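(* For every $\rho\in(0,1)$ there exist two distinct normalized positive-mass $\omega_{\mathrm{FS}}$-model potentials $\phi,\psi\in\mathrm{PSH}(\mathbb{CP}^1,\omega_{\mathrm{FS}})$ and a closed Fubini--Study disk $C\subset\mathbb{CP}^1$ such that $$\langle\omega_{\mathrm{FS}}+dd^c\phi\rangle=\langle\omega_{\mathrm{FS}}+dd^c\psi\rangle=\mathbf{1}_C\,\omega_{\mathrm{FS}}$$ as Borel measures, with total mass $1-\rho>0$; equivalently, $$\mathbf{1}_{\{\phi=0\}}=\mathbf{1}_{\{\psi=0\}}=\mathbf{1}_C\qquad \omega_{\mathrm{FS}}\text{-almost everywhere}.$$ Moreover, $$\nu(\phi,x)=\nu(\psi,x)=0\qquad\text{for every }x\in\mathbb{CP}^1,$$ and $$\mathcal{I}(c\phi)=\mathcal{O}_{\mathbb{CP}^1}=\mathcal{I}(c\psi)\qquad\text{for every real }c>0.$$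
   Context: On the affine chart $\mathbb{C}\subset\mathbb{CP}^1$ with coordinate $w$, $\omega_{\mathrm{FS}}=dd^c\left(\tfrac12\log(1+|w|^2)\right)$, where $dd^c$ is normalized so that $dd^c\log|w-p|=\delta_p$; thus $\int_{\mathbb{CP}^1}\omega_{\mathrm{FS}}=1$. $\mathrm{PSH}(X,\omega)$ is the set of $\omega$-plurisubharmonic functions on $X$ (not identically $-\infty$). A closed Fubini--Study disk is a closed geodesic ball for the Fubini--Study metric. Model potentials: let $(X,\omega)$ be a compact Kähler manifold. For an upper-semicontinuous $f$ set $P_\omega(f)=\left(\sup\{v\in\mathrm{PSH}(X,\omega): v\le f\}\right)^*$, where $^*$ denotes upper-semicontinuous regularization. For $\phi\in\mathrm{PSH}(X,\omega)$ with $\sup_X\phi=0$ (such $\phi$ is called normalized) set $P_\omega[\phi]=\left(\lim_{C\to\infty}P_\omega(\min\{\phi+C,0\})\right)^*$. The function $\phi$ is an $\omega$-model potential if $P_\omega[\phi]=\phi$. It has positive mass if its non-pluripolar Monge--Ampère measure has strictly positive total mass. In complex dimension one the non-pluripolar Monge--Ampère measure is $\langle\omega+dd^cu\rangle=\mathbf{1}_{\{u>-\infty\}}(\omega+dd^cu)$. With this normalization, in complex dimension one the Lelong number $\nu(u,x)$ is the mass of the atom of the measure $\omega+dd^cu$ at $x$. The multiplier ideal sheaf $\mathcal{I}(cu)$ is the sheaf of germs of holomorphic functions $f$ such that $|f|^2e^{-cu}$ is locally integrable; $\mathcal{O}_{\mathbb{CP}^1}$ is the structure sheaf. *)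

theory Defs
  imports "HOL-Analysis.Analysis"
begin

section \<open>The complex projective line\<close>

text \<open>
  \<open>Aff w\<close> is the point \<open>[1 : w]\<close> of the affine chart and \<open>Infty\<close> is \<open>[0 : 1]\<close>. The complex
  structure is given by the two charts with coordinates \<open>w\<close> and \<open>z = 1/w\<close>; each chart is
  represented by its parametrisation \<open>\<complex> \<Rightarrow> cp1\<close>, with coordinate map \<open>inv chart\<close> on \<open>range chart\<close>.
\<close>

datatype cp1 = Aff complex | Infty

definition chart0 :: "complex \<Rightarrow> cp1" where
  "chart0 w = Aff w"

definition chart1 :: "complex \<Rightarrow> cp1" where
  "chart1 z = (if z = 0 then Infty else Aff (1 / z))"

definition charts :: "(complex \<Rightarrow> cp1) set" where
  "charts = {chart0, chart1}"

instantiation cp1 :: topological_space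
begin

definition open_cp1 :: "cp1 set \<Rightarrow> bool" where
  "open_cp1 U \<longleftrightarrow> (\<forall>chart\<in>charts. open (chart -` U))"

instance
proof
  fix S T :: "cp1 set" and K :: "cp1 set set"
  show "open (UNIV :: cp1 set)"
    by (simp add: open_cp1_def)
  show "open S \<Longrightarrow> open T \<Longrightarrow> open (S \<inter> T)"
    by (simp add: open_cp1_def open_Int)
  show "\<forall>S\<in>K. open S \<Longrightarrow> open (\<Union>K)"
    by (simp add: open_cp1_def vimage_Union open_UN)
qed

end

lemma inj_chart: "chart \<in> charts \<Longrightarrow> inj chart"
  by (auto simp: charts_def chart0_def chart1_def inj_on_def split: if_splits)

lemma continuous_on_chart: "chart \<in> charts \<Longrightarrow> continuous_on UNIV chart"
  by (simp add: continuous_on_open_vimage open_cp1_def)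

lemma range_chart0: "range chart0 = - {Infty}"
  using cp1.exhaust by (auto simp: chart0_def image_iff)

lemma range_chart1: "range chart1 = - {Aff 0}"
proof -
  have "x \<in> range chart1" if "x \<noteq> Aff 0" for x
  proof (cases x)
    case (Aff w)
    then have "x = chart1 (1 / w)" using that by (auto simp: chart1_def)
    then show ?thesis by blast
  next
    case Infty
    then have "x = chart1 0" by (simp add: chart1_def)
    then show ?thesis by blast
  qed
  then show ?thesis by (auto simp: chart1_def)
qed

lemma open_range_chart: "chart \<in> charts \<Longrightarrow> open (range chart)"
proof -
  have 1: "chart0 -` (- {Infty}) = UNIV" "chart1 -` (- {Infty}) = - {0}"
          "chart0 -` (- {Aff 0}) = - {0}" "chart1 -` (- {Aff 0}) = UNIV"
    by (auto simp: chart0_def chart1_def split: if_splits)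
  assume "chart \<in> charts"
  then consider "range chart = - {Infty}" | "range chart = - {Aff 0}"
    using range_chart0 range_chart1 by (auto simp: charts_def)
  then show ?thesis
    by cases (simp_all only: open_cp1_def charts_def ball_simps 1 open_UNIV simp_thms,
              simp_all add: open_Compl)
qed


section \<open>The operator $dd^c$ on the complex plane\<close>

text \<open>
  Normalised by $dd^c \log|w-p| = \delta_p$, the operator is $dd^c = \frac{1}{2\pi}\Delta$, where
  $(1,1)$-forms and currents are identified with densities and distributions with respect to
  Lebesgue measure.
\<close>

definition pderiv_dir :: "complex \<Rightarrow> (complex \<Rightarrow> real) \<Rightarrow> complex \<Rightarrow> real" where
  "pderiv_dir v f z = frechet_derivative f (at z) v"

definition laplacian :: "(complex \<Rightarrow> real) \<Rightarrow> complex \<Rightarrow> real" where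
  "laplacian f z = pderiv_dir 1 (pderiv_dir 1 f) z + pderiv_dir \<i> (pderiv_dir \<i> f) z"

primrec C_k :: "nat \<Rightarrow> (complex \<Rightarrow> real) \<Rightarrow> bool" where
  "C_k 0 f \<longleftrightarrow> continuous_on UNIV f"
| "C_k (Suc k) f \<longleftrightarrow>
     (\<forall>z. f differentiable (at z)) \<and> C_k k (pderiv_dir 1 f) \<and> C_k k (pderiv_dir \<i> f)"

definition test_function :: "(complex \<Rightarrow> real) \<Rightarrow> bool" where
  "test_function g \<longleftrightarrow> (\<forall>k. C_k k g) \<and> bounded {z. g z \<noteq> 0}"

text \<open>
  \<open>is_ddc v \<nu>\<close>: the distribution $dd^c v$ is the Radon measure \<open>\<nu>\<close>. It is applied to locally
  integrable \<open>v\<close>, whose poles form a null set, so that their value under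
  \<^const>\<open>real_of_ereal\<close> is irrelevant.
\<close>

definition is_ddc :: "(complex \<Rightarrow> ereal) \<Rightarrow> complex measure \<Rightarrow> bool" where
  "is_ddc v \<nu> \<longleftrightarrow>
     sets \<nu> = sets borel \<and>
     (\<forall>K. compact K \<longrightarrow> emeasure \<nu> K < \<infinity>) \<and>
     (\<forall>g. test_function g \<longrightarrow>
        (\<integral>w. g w \<partial>\<nu>) = (\<integral>w. real_of_ereal (v w) * (laplacian g w / (2 * pi)) \<partial>lborel))"


section \<open>The Fubini--Study form, metric and disks\<close>

text \<open>The local potential has the same expression in both charts.\<close>

definition fs_potential :: "complex \<Rightarrow> real" where
  "fs_potential w = ln (1 + (cmod w)\<^sup>2) / 2"

definition fs_density :: "complex \<Rightarrow> real" where
  "fs_density w = laplacian fs_potential w / (2 * pi)"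

lemma fs_density_eq: "fs_density w = 1 / (pi * (1 + (cmod w)\<^sup>2)\<^sup>2)"
proof -
  have pos: "1 + z \<bullet> z \<noteq> 0" "1 + z \<bullet> z > 0" for z :: complex
    using inner_ge_zero[of z] by linarith+
  have d1: "(fs_potential has_derivative (\<lambda>h. (z \<bullet> h) / (1 + z \<bullet> z))) (at z)" for z
    unfolding fs_potential_def power2_norm_eq_inner
    using pos[of z]
    by (auto intro!: derivative_eq_intros simp: inner_commute field_simps)
  have p1: "pderiv_dir v fs_potential = (\<lambda>z. (z \<bullet> v) / (1 + z \<bullet> z))" for v
    using frechet_derivative_at[OF d1] by (auto simp: pderiv_dir_def fun_eq_iff)
  have d2: "((\<lambda>z. (z \<bullet> v) / (1 + z \<bullet> z)) has_derivative
      (\<lambda>h. ((h \<bullet> v) * (1 + z \<bullet> z) - (z \<bullet> v) * (2 * (z \<bullet> h))) / (1 + z \<bullet> z)\<^sup>2)) (at z)"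
    for v z :: complex
    using pos[of z]
    by (auto intro!: derivative_eq_intros ext
        simp: inner_commute field_simps power2_eq_square)
  have p2: "pderiv_dir v (pderiv_dir v fs_potential) z =
      ((v \<bullet> v) * (1 + z \<bullet> z) - 2 * (z \<bullet> v)\<^sup>2) / (1 + z \<bullet> z)\<^sup>2" for v z
    unfolding p1 unfolding pderiv_dir_def frechet_derivative_at[OF d2, symmetric]
    by (simp add: power2_eq_square)
  have "laplacian fs_potential w = 2 / (1 + w \<bullet> w)\<^sup>2"
    unfolding laplacian_def p2 add_divide_distrib[symmetric]
    by (simp add: inner_complex_def power2_eq_square)
  then show ?thesis
    by (simp add: fs_density_def power2_norm_eq_inner)
qed

definition omega_FS :: "cp1 measure" where
  "omega_FS = distr (density lborel (\<lambda>w. ennreal (fs_density w))) borel chart0"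

text \<open>
  The Riemannian metric of the Kaehler form $h\,dx \wedge dy$ is $h\,|dw|^2$. The charts
  agree on their overlap, so the second one is only needed for the speed at \<open>Infty\<close>.
\<close>

definition fs_speed :: "(real \<Rightarrow> cp1) \<Rightarrow> real \<Rightarrow> real" where
  "fs_speed \<gamma> t =
     (let chart = (if \<gamma> t \<in> range chart0 then chart0 else chart1)
      in sqrt (fs_density (inv chart (\<gamma> t))) * cmod (vector_derivative (inv chart \<circ> \<gamma>) (at t)))"

definition piecewise_C1_curve :: "(real \<Rightarrow> cp1) \<Rightarrow> bool" where
  "piecewise_C1_curve \<gamma> \<longleftrightarrow>
     continuous_on {0..1} \<gamma> \<and>
     (\<exists>S. finite S \<and> (\<forall>chart\<in>charts.
        (inv chart \<circ> \<gamma>) C1_differentiable_on {t \<in> {0..1} - S. \<gamma> t \<in> range chart}))"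

definition fs_length :: "(real \<Rightarrow> cp1) \<Rightarrow> ennreal" where
  "fs_length \<gamma> = (\<integral>\<^sup>+t\<in>{0..1}. ennreal (fs_speed \<gamma> t) \<partial>lborel)"

definition fs_dist :: "cp1 \<Rightarrow> cp1 \<Rightarrow> ennreal" where
  "fs_dist p q = (INF \<gamma>\<in>{\<gamma>. piecewise_C1_curve \<gamma> \<and> \<gamma> 0 = p \<and> \<gamma> 1 = q}. fs_length \<gamma>)"

definition closed_fs_disk :: "cp1 set \<Rightarrow> bool" where
  "closed_fs_disk C \<longleftrightarrow> (\<exists>p r::real. r > 0 \<and> C = {q. fs_dist p q \<le> ennreal r})"


section \<open>Quasi-plurisubharmonic functions\<close>

text \<open>
  The difference below is meaningful as soon as one of the two parts is finite; this holds in
  \<open>subharmonic\<close>, where the integrand is bounded above.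
\<close>

definition ereal_integral :: "'a measure \<Rightarrow> ('a \<Rightarrow> ereal) \<Rightarrow> ereal" where
  "ereal_integral M f =
     enn2ereal (\<integral>\<^sup>+x. e2ennreal (f x) \<partial>M) - enn2ereal (\<integral>\<^sup>+x. e2ennreal (- f x) \<partial>M)"

definition usc :: "('a::topological_space \<Rightarrow> ereal) \<Rightarrow> bool" where
  "usc f \<longleftrightarrow> (\<forall>a. open {x. f x < a})"

definition subharmonic :: "(complex \<Rightarrow> ereal) \<Rightarrow> bool" where
  "subharmonic v \<longleftrightarrow>
     usc v \<and> (\<forall>z. v z \<noteq> \<infinity>) \<and>
     (\<forall>z. \<forall>r>0. v z \<le>
        ereal_integral (restrict_space lborel {0..2 * pi}) (\<lambda>\<theta>. v (z + complex_of_real r * cis \<theta>))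
          / ereal (2 * pi))"

text \<open>In complex dimension one, plurisubharmonic means subharmonic.\<close>

definition PSH_FS :: "(cp1 \<Rightarrow> ereal) set" where
  "PSH_FS = {u. (\<exists>x. u x \<noteq> -\<infinity>) \<and>
     (\<forall>chart\<in>charts. subharmonic (\<lambda>w. u (chart w) + ereal (fs_potential w)))}"

definition pullback :: "(complex \<Rightarrow> cp1) \<Rightarrow> cp1 measure \<Rightarrow> complex measure" where
  "pullback chart \<mu> = distr (restrict_space \<mu> (range chart)) borel (inv chart)"

definition ma_measure :: "(cp1 \<Rightarrow> ereal) \<Rightarrow> cp1 measure" where
  \<comment> \<open>$\omega_{FS} + dd^c u$\<close>
  "ma_measure u = (THE \<mu>. sets \<mu> = sets borel \<and>
     (\<forall>chart\<in>charts. is_ddc (\<lambda>w. u (chart w) + ereal (fs_potential w)) (pullback chart \<mu>)))"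

definition np_ma_measure :: "(cp1 \<Rightarrow> ereal) \<Rightarrow> cp1 measure" where
  \<comment> \<open>$\langle\omega_{FS} + dd^c u\rangle$\<close>
  "np_ma_measure u = density (ma_measure u) (indicator {x. u x \<noteq> -\<infinity>})"

definition positive_mass :: "(cp1 \<Rightarrow> ereal) \<Rightarrow> bool" where
  "positive_mass u \<longleftrightarrow> emeasure (np_ma_measure u) UNIV > 0"

definition lelong :: "(cp1 \<Rightarrow> ereal) \<Rightarrow> cp1 \<Rightarrow> ennreal" where
  "lelong u x = emeasure (ma_measure u) {x}"


section \<open>Model potentials\<close>

text \<open>As \<open>nhds x\<close> does not delete \<open>x\<close>, this is the least upper-semicontinuous majorant.\<close>

definition usc_reg :: "(cp1 \<Rightarrow> ereal) \<Rightarrow> cp1 \<Rightarrow> ereal" where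
  "usc_reg f x = Limsup (nhds x) f"

definition P_env :: "(cp1 \<Rightarrow> ereal) \<Rightarrow> cp1 \<Rightarrow> ereal" where
  "P_env f = usc_reg (\<lambda>x. SUP v\<in>{v \<in> PSH_FS. \<forall>y. v y \<le> f y}. v x)"

definition P_model :: "(cp1 \<Rightarrow> ereal) \<Rightarrow> cp1 \<Rightarrow> ereal" where
  "P_model \<phi> = usc_reg (\<lambda>x. Lim at_top (\<lambda>C::real. P_env (\<lambda>y. min (\<phi> y + ereal C) 0) x))"

definition normalized :: "(cp1 \<Rightarrow> ereal) \<Rightarrow> bool" where
  "normalized \<phi> \<longleftrightarrow> (SUP x. \<phi> x) = 0"

definition model_potential :: "(cp1 \<Rightarrow> ereal) \<Rightarrow> bool" where
  "model_potential \<phi> \<longleftrightarrow> \<phi> \<in> PSH_FS \<and> normalized \<phi> \<and> P_model \<phi> = \<phi>"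


section \<open>Multiplier ideal sheaves\<close>

text \<open>
  Sheaves of functions are given by their sections over open sets; sections over \<open>U\<close> are made
  \<open>extensional\<close> so that they are determined by their values on \<open>U\<close>.
\<close>

definition structure_sheaf :: "cp1 set \<Rightarrow> (cp1 \<Rightarrow> complex) set" where
  "structure_sheaf U =
     {f \<in> extensional U. \<forall>chart\<in>charts. (f \<circ> chart) holomorphic_on (chart -` U)}"

definition exp_ereal :: "ereal \<Rightarrow> ennreal" where
  "exp_ereal x =
     (if x = \<infinity> then \<infinity> else if x = -\<infinity> then 0 else ennreal (exp (real_of_ereal x)))"

text \<open>
  Local integrability is with respect to Lebesgue measure in a chart or, equivalently, any
  smooth positive volume form, such as \<open>omega_FS\<close>.
\<close>

definition multiplier_ideal :: "(cp1 \<Rightarrow> ereal) \<Rightarrow> cp1 set \<Rightarrow> (cp1 \<Rightarrow> complex) set" where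
  \<comment> \<open>sections over \<open>U\<close> of $\mathcal{I}(h)$, with weight $e^{-h}$\<close>
  "multiplier_ideal h U = {f \<in> structure_sheaf U.
     \<forall>x\<in>U. \<exists>V. open V \<and> x \<in> V \<and> V \<subseteq> U \<and>
       (\<integral>\<^sup>+y\<in>V. ennreal ((cmod (f y))\<^sup>2) * exp_ereal (- h y) \<partial>omega_FS) < \<infinity>}"

end

theory Submission
  imports Defs "HOL-Probability.Probability" "HOL-Complex_Analysis.Complex_Analysis"
begin

text \<open>
  Let \<open>\<mu>\<close> be a probability measure on the disc \<open>|w| \<le> s\<close> that has no atoms, has the same logarithmic
  potential as the unit mass at \<open>0\<close> outside that disc, and is carried by countably many compact sets
  on each of which its potential is infinite. Let \<open>\<phi>\<close> be the potential of \<open>1\<^sub>C \<omega> + \<rho> \<mu>\<close>, where \<open>C\<close> is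
  the disk \<open>|w| \<ge> R\<close> around \<open>\<infinity>\<close>, of mass \<open>1 - \<rho>\<close>. Outside \<open>|w| \<le> s\<close> it is the explicit radial function
  that belongs to a point mass at \<open>0\<close>, so with the right constant it vanishes on \<open>C\<close> and is negative
  elsewhere if \<open>s\<close> is small. As \<open>\<phi> = -\<infinity>\<close> holds \<open>\<mu>\<close>-almost everywhere, \<open>\<mu>\<close> disappears from the
  non-pluripolar measure; and if \<open>v\<close> is quasi-subharmonic with \<open>v \<le> min (\<phi> + A) 0\<close>, then a maximum
  principle on \<open>|w| < R\<close> gives \<open>v \<le> \<phi>\<close>, whence \<open>\<phi>\<close> is a model potential. The absence of atoms
  gives the Lelong numbers and, through Jensen's inequality, the integrability of \<open>exp (- a \<phi>)\<close>.
  Two measures \<open>\<mu>\<close> that give different mass to some disc yield different potentials.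

  Such a \<open>\<mu>\<close> is the law of a random point: pack the unit disc up to a null set by countably many discs,
  choose one with probability equal to its relative area, contract it strongly towards its centre,
  and repeat inside it. The mean value property preserves the outer potential in each step, and the
  contraction makes the potential infinite.
\<close>

section \<open>Polar coordinates and circle means\<close>

text \<open>The mass missing from the non-pluripolar measure must sit on a polar set. A point mass
  would do, but it shows in the Lelong number; a uniform mass on a circle has no atoms and the right
  outer potential, but a circle is not polar. Both demands are met by replacing rotation symmetry
  with the mean value property: seen from outside, a disc may be traded for its centre or for a
  packing by smaller discs, and this at every scale.

  Dropping the constant \<open>A\<close> from \<open>v \<le> \<phi> + A\<close> needs a barrier. The
  potential of \<mu> restricted to a compact piece is infinite at every point of the piece, like an
  Evans potential, and harmonic elsewhere, so the classical maximum principle applies to its sum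
  with \<open>v\<close>. The whole potential is only lower semicontinuous, hence the exhaustion by
  compact pieces.

  Potentials are formed with a nonnegative kernel, minus the logarithm of a normalised distance.
  Most integrals then take values in \<open>ennreal\<close>, where Tonelli and Fatou apply freely,
  and identities are written as equalities of sums so that infinities are never subtracted.\<close>

lemma nn_integral_radial:
  fixes f :: "real \<Rightarrow> ennreal"
  assumes [measurable]: "f \<in> borel_measurable borel"
  shows "(\<integral>\<^sup>+w. f ((cmod w)\<^sup>2) \<partial>lborel) = (\<integral>\<^sup>+t. ennreal pi * f t * indicator {0..} t \<partial>lborel)"
proof -
  \<comment> \<open>The disc of squared radius \<open>a\<close> has area pi a, so the squared radius
    has constant density pi on the half-line. This is why radial integrals are always taken in
    |w|^2.\<close>
  define M where "M = distr lborel borel (\<lambda>w::complex. (cmod w)\<^sup>2)"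
  define N where "N = density lborel (\<lambda>t::real. ennreal pi * indicator {0..} t)"
  have eq: "emeasure M {..a} = emeasure N {..a}" for a
  proof -
    have "emeasure M {..a} = emeasure lborel {w::complex. (cmod w)\<^sup>2 \<le> a}"
      unfolding M_def by (subst emeasure_distr) (auto intro!: arg_cong[where f="emeasure lborel"])
    also have "\<dots> = ennreal pi * ennreal (max a 0)"
    proof (cases "a < 0")
      case True
      then have "{w::complex. (cmod w)\<^sup>2 \<le> a} = {}"
        by (auto simp: not_le) (meson order_less_le_trans zero_le_power2)
      with True show ?thesis by (simp add: max_def)
    next
      case False
      then have "{w::complex. (cmod w)\<^sup>2 \<le> a} = cball 0 (sqrt a)"
        by (auto simp: real_le_rsqrt sqrt_ge_absD)
      with False show ?thesis
        by (simp add: emeasure_cball unit_ball_vol_2 ennreal_mult' max_def)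
    qed
    also have "\<dots> = emeasure N {..a}"
    proof -
      have "emeasure N {..a} = (\<integral>\<^sup>+t. ennreal pi * indicator {0..a} t \<partial>lborel)"
        unfolding N_def by (subst emeasure_density) (auto intro!: nn_integral_cong split: split_indicator)
      also have "\<dots> = ennreal pi * ennreal (max a 0)"
        by (subst nn_integral_cmult) (auto simp: max_def emeasure_lborel_Icc_eq)
      finally show ?thesis ..
    qed
    finally show ?thesis .
  qed
  have "M = N"
  proof (rule measure_eqI_generator_eq[where E="range (\<lambda>a. {..a::real})" and \<Omega>=UNIV and A="\<lambda>n. {..real n}"])
    show "Int_stable (range (\<lambda>a. {..a::real}))"
      by (auto simp: Int_stable_def)
    show "sets M = sigma_sets UNIV (range (\<lambda>a. {..a}))" "sets N = sigma_sets UNIV (range (\<lambda>a. {..a}))"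
      by (simp_all add: M_def N_def borel_eq_atMost)
    show "(\<Union>i. {..real i}) = UNIV"
      by (auto intro: real_arch_simple)
    fix i :: nat
    have "emeasure M {..real i} = emeasure lborel {w::complex. (cmod w)\<^sup>2 \<le> real i}"
      unfolding M_def by (subst emeasure_distr) (auto intro!: arg_cong[where f="emeasure lborel"])
    also have "\<dots> \<le> emeasure lborel (cball (0::complex) (sqrt (real i)))"
      by (intro emeasure_mono) (auto simp: real_le_rsqrt)
    also have "\<dots> < \<infinity>" by (simp add: emeasure_cball)
    finally show "emeasure M {..real i} \<noteq> \<infinity>" by simp
  qed (use eq in auto)
  then have "(\<integral>\<^sup>+t. f t \<partial>M) = (\<integral>\<^sup>+t. f t \<partial>N)" by simp
  then show ?thesis
    unfolding M_def N_def by (simp add: nn_integral_distr nn_integral_density mult_ac)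
qed

text \<open>A Vitali packing exhausts \<open>U\<close> up to a null set by disjoint discs, and a
  rotation turns a disc into a disc of the same radius. The packing of the preimage need not be
  known to exhaust it, so only an inequality comes out; the inverse rotation supplies the other
  one.\<close>

lemma emeasure_open_le_rotate:
  fixes U :: "complex set"
  assumes "open U" "cmod c = 1"
  shows "emeasure lborel U \<le> emeasure lborel ((\<lambda>w. c * w) -` U)"
proof -
  define K where "K = {(a, r). 0 < r \<and> ball a r \<subseteq> U}"
  have "\<exists>i. i \<in> K \<and> x \<in> ball (fst i) (snd i) \<and> snd i < d" if xU: "x \<in> U" and d: "0 < d" for x d
  proof -
    obtain e where "e > 0" "ball x e \<subseteq> U" using \<open>open U\<close> xU by (rule openE)
    then show ?thesis using xU d
      by (intro exI[of _ "(x, min e (d/2))"]) (auto simp: K_def)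
  qed
  then obtain I where I: "countable I" "I \<subseteq> K"
     "pairwise (\<lambda>i j. disjnt (ball (fst i) (snd i)) (ball (fst j) (snd j))) I"
     "negligible (U - (\<Union>i\<in>I. ball (fst i) (snd i)))"
    using Vitali_covering_theorem_balls[of U K fst snd] by blast
  define B where "B i = ball (fst i) (snd i)" for i :: "complex \<times> real"
  have measB: "B i \<in> sets lborel" for i by (simp add: B_def)
  have disj: "disjoint_family_on B I"
    using I(3) by (auto simp: disjoint_family_on_def pairwise_def disjnt_def B_def)
  have BU: "(\<Union>i\<in>I. B i) \<subseteq> U" using I(2) unfolding K_def B_def by fastforce
  have oB: "open (\<Union>i\<in>I. B i)" by (auto simp: B_def)
  have null: "U - (\<Union>i\<in>I. B i) \<in> null_sets lborel"
  proof -
    have "U - (\<Union>i\<in>I. B i) \<in> sets borel" using \<open>open U\<close> oB by auto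
    then show ?thesis
      using I(4) by (auto simp: B_def negligible_iff_null_sets null_sets_completion_iff)
  qed
  have cne: "c \<noteq> 0" using assms by auto
  have vim: "(\<lambda>w. c * w) -` B i = ball (fst i / c) (snd i)" for i
  proof -
    have "dist (fst i / c) w = dist (fst i) (c * w)" for w
    proof -
      have "dist (fst i) (c * w) = cmod (c * (fst i / c - w))"
        using cne by (simp add: dist_norm right_diff_distrib)
      also have "\<dots> = dist (fst i / c) w" using assms by (simp add: norm_mult dist_norm)
      finally show ?thesis ..
    qed
    then show ?thesis by (auto simp: B_def)
  qed
  have "emeasure lborel U = emeasure lborel ((\<Union>i\<in>I. B i) \<union> (U - (\<Union>i\<in>I. B i)))"
    using BU by (intro arg_cong[where f="emeasure lborel"]) auto
  also have "\<dots> = emeasure lborel (\<Union>i\<in>I. B i)"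
    using null oB by (intro emeasure_Un_null_set) auto
  also have "\<dots> = (\<integral>\<^sup>+i. emeasure lborel (B i) \<partial>count_space I)"
    using disj I(1) measB by (intro emeasure_UN_countable) auto
  also have "\<dots> = (\<integral>\<^sup>+i. emeasure lborel ((\<lambda>w. c * w) -` B i) \<partial>count_space I)"
    using I(2) by (intro nn_integral_cong, subst vim)
      (auto simp: B_def emeasure_ball K_def)
  also have "\<dots> = emeasure lborel (\<Union>i\<in>I. (\<lambda>w. c * w) -` B i)"
  proof (rule emeasure_UN_countable[symmetric])
    show "disjoint_family_on (\<lambda>i. (\<lambda>w. c * w) -` B i) I"
      unfolding disjoint_family_on_def
    proof (intro ballI impI)
      fix m n assume "m \<in> I" "n \<in> I" "m \<noteq> n"
      then have "B m \<inter> B n = {}" using disj by (auto simp: disjoint_family_on_def)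
      then show "(\<lambda>w. c * w) -` B m \<inter> (\<lambda>w. c * w) -` B n = {}" by blast
    qed
  qed (use I(1) in \<open>auto simp: vim\<close>)
  also have "\<dots> \<le> emeasure lborel ((\<lambda>w. c * w) -` U)"
  proof (rule emeasure_mono)
    show "(\<lambda>w. c * w) -` U \<in> sets lborel"
      using measurable_sets[of "\<lambda>w. c * w" borel borel U] \<open>open U\<close> by auto
  qed (use BU in auto)
  finally show ?thesis .
qed

lemma lborel_distr_rotate:
  assumes "cmod c = 1"
  shows "distr lborel borel (\<lambda>w. c * w) = (lborel :: complex measure)"
proof (rule lborel_eqI[symmetric])
  have op: "emeasure (distr lborel borel (\<lambda>w. c * w)) U = emeasure lborel U"
    if "open U" for U :: "complex set"
  proof -
    have cne: "c \<noteq> 0" using assms by auto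
    let ?V = "(\<lambda>w. c * w) -` U"
    have "open ?V" using \<open>open U\<close> by (intro open_vimage continuous_intros)
    then have "emeasure lborel ?V \<le> emeasure lborel ((\<lambda>w. (1/c) * w) -` ?V)"
      using assms by (intro emeasure_open_le_rotate) (auto simp: norm_divide)
    also have "(\<lambda>w. (1/c) * w) -` ?V = U" using cne by auto
    finally have "emeasure lborel ?V = emeasure lborel U"
      using emeasure_open_le_rotate[OF \<open>open U\<close> assms] by simp
    then show ?thesis using \<open>open U\<close> by (subst emeasure_distr) auto
  qed
  show "emeasure (distr lborel borel (\<lambda>w. c * w)) (box l u) = (\<Prod>b\<in>Basis. (u - l) \<bullet> b)"
    if "\<And>b. b \<in> Basis \<Longrightarrow> l \<bullet> b \<le> u \<bullet> b" for l u :: complex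
    using that by (subst op) (auto simp: open_box)
qed simp

section \<open>Means over circles and discs\<close>

abbreviation circ :: "real measure" where
  "circ \<equiv> restrict_space lborel {0..2 * pi}"

lemma space_circ: "space circ = {0..2*pi}"
  by (simp add: space_restrict_space)

lemma emeasure_circ: "emeasure circ (space circ) = ennreal (2 * pi)"
  by (simp add: space_circ emeasure_restrict_space)

lemma finite_measure_circ: "finite_measure circ"
  by (rule finite_measureI) (simp only: emeasure_circ, simp)

lemma borel_measurable_circ: "f \<in> borel_measurable borel \<Longrightarrow> f \<in> borel_measurable circ"
  by (simp add: measurable_restrict_space1)

lemma cis_measurable [measurable]: "cis \<in> borel_measurable borel"
  by (intro borel_measurable_continuous_onI continuous_intros)

text \<open>Rotation invariance makes the planar integral independent of the angle, so Tonelli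
  allows averaging over the angle at the cost of a factor 2 pi. Together with
  \<open>nn_integral_radial\<close> this serves as integration in polar coordinates.\<close>

lemma nn_integral_rotate_mean:
  fixes f :: "complex \<Rightarrow> ennreal"
  assumes [measurable]: "f \<in> borel_measurable borel"
  shows "ennreal (2 * pi) * (\<integral>\<^sup>+w. f w \<partial>lborel) = (\<integral>\<^sup>+w. (\<integral>\<^sup>+\<theta>. f (cis \<theta> * w) \<partial>circ) \<partial>lborel)"
proof -
  interpret C: finite_measure circ by (rule finite_measure_circ)
  interpret P: pair_sigma_finite lborel circ ..
  have rot: "(\<integral>\<^sup>+w. f (cis \<theta> * w) \<partial>lborel) = (\<integral>\<^sup>+w. f w \<partial>lborel)" for \<theta>
  proof -
    have "(\<integral>\<^sup>+w. f w \<partial>lborel) = (\<integral>\<^sup>+w. f w \<partial>distr lborel borel (\<lambda>w. cis \<theta> * w))"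
      by (simp add: lborel_distr_rotate)
    also have "\<dots> = (\<integral>\<^sup>+w. f (cis \<theta> * w) \<partial>lborel)" by (simp add: nn_integral_distr)
    finally show ?thesis ..
  qed
  have m1 [measurable]: "fst \<in> borel_measurable (lborel \<Otimes>\<^sub>M circ)"
    using measurable_fst[of "lborel :: complex measure" circ] by (simp cong: measurable_cong_sets)
  have m2 [measurable]: "snd \<in> borel_measurable (lborel \<Otimes>\<^sub>M circ)"
    by (rule measurable_compose[OF measurable_snd]) (intro borel_measurable_circ, simp)
  have [measurable]: "(\<lambda>p. f (cis (snd p) * fst p)) \<in> borel_measurable (lborel \<Otimes>\<^sub>M circ)"
    by measurable
  have "(\<integral>\<^sup>+w. (\<integral>\<^sup>+\<theta>. f (cis \<theta> * w) \<partial>circ) \<partial>lborel) = (\<integral>\<^sup>+\<theta>. (\<integral>\<^sup>+w. f (cis \<theta> * w) \<partial>lborel) \<partial>circ)"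
    by (rule P.Fubini'[symmetric]) (simp add: case_prod_beta)
  also have "\<dots> = (\<integral>\<^sup>+w. f w \<partial>lborel) * ennreal (2 * pi)"
    unfolding rot by (simp add: emeasure_restrict_space)
  finally show ?thesis by (simp add: mult.commute)
qed

lemma nn_integral_disc:
  fixes f :: "complex \<Rightarrow> ennreal"
  assumes [measurable]: "f \<in> borel_measurable borel"
  shows "ennreal (2 * pi) * (\<integral>\<^sup>+w. f w * indicator (ball c r) w \<partial>lborel) =
    (\<integral>\<^sup>+w. (\<integral>\<^sup>+\<theta>. f (c + cis \<theta> * w) \<partial>circ) * indicator (ball 0 r) w \<partial>lborel)"
proof -
  interpret C: finite_measure circ by (rule finite_measure_circ)
  have [measurable]: "ball a r \<in> sets borel" for a :: complex
    by simp
  have [measurable]: "(+) c \<in> borel_measurable borel"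
    by (intro borel_measurable_continuous_onI continuous_intros)
  have "(\<integral>\<^sup>+w. f w * indicator (ball c r) w \<partial>lborel) =
     (\<integral>\<^sup>+w. f w * indicator (ball c r) w \<partial>distr lborel borel ((+) c))"
    by (simp add: lborel_distr_plus)
  also have "\<dots> = (\<integral>\<^sup>+w. f (c + w) * indicator (ball 0 r) w \<partial>lborel)"
    by (simp add: nn_integral_distr, intro nn_integral_cong) (auto split: split_indicator simp: dist_norm)
  also have "ennreal (2 * pi) * \<dots> = (\<integral>\<^sup>+w. (\<integral>\<^sup>+\<theta>. f (c + cis \<theta> * w) * indicator (ball 0 r) (cis \<theta> * w) \<partial>circ) \<partial>lborel)"
    by (rule nn_integral_rotate_mean) measurable
  also have "\<dots> = (\<integral>\<^sup>+w. (\<integral>\<^sup>+\<theta>. f (c + cis \<theta> * w) * indicator (ball 0 r) w \<partial>circ) \<partial>lborel)"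
    by (intro nn_integral_cong) (auto split: split_indicator simp: norm_mult)
  also have "\<dots> = (\<integral>\<^sup>+w. (\<integral>\<^sup>+\<theta>. f (c + cis \<theta> * w) \<partial>circ) * indicator (ball 0 r) w \<partial>lborel)"
    by (intro nn_integral_cong nn_integral_multc borel_measurable_circ) measurable
  finally show ?thesis .
qed

section \<open>Circle means of the logarithm of a linear factor\<close>

lemma circ_integral_continuous:
  fixes g :: "real \<Rightarrow> real"
  assumes "continuous_on UNIV g"
  shows "integrable circ g" "integral\<^sup>L circ g = integral {0..2*pi} g"
proof -
  have "set_integrable lborel {0..2*pi} g"
    unfolding set_integrable_def
    by (intro borel_integrable_compact continuous_on_subset[OF assms]) auto
  then show "integrable circ g"
    by (simp add: integrable_restrict_space set_integrable_def)
  show "integral\<^sup>L circ g = integral {0..2*pi} g"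
    using set_borel_integral_eq_integral(2)[OF \<open>set_integrable lborel {0..2*pi} g\<close>]
    by (simp add: integral_restrict_space set_lebesgue_integral_def)
qed

text \<open>As |b| < 1, the values 1 - b w for |w| \<le> 1 stay in the right half-plane, where
  \<open>Ln\<close> is holomorphic. Cauchy's formula at the centre gives the mean
  \<open>Ln 1 = 0\<close>, and the real part is the claim.\<close>

lemma circ_mean_ln_unit:
  fixes b :: complex
  assumes b: "cmod b < 1"
  shows "integrable circ (\<lambda>\<theta>. ln (cmod (1 - b * cis \<theta>)))"
    and "integral\<^sup>L circ (\<lambda>\<theta>. ln (cmod (1 - b * cis \<theta>))) = 0"
proof -
  have pos: "Re (1 - b * w) > 0" if "cmod w \<le> 1" for w
  proof -
    have "Re (b * w) \<le> cmod (b * w)" by (rule complex_Re_le_cmod)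
    also have "\<dots> \<le> cmod b * 1" unfolding norm_mult using that by (intro mult_left_mono) auto
    finally show ?thesis using b by simp
  qed
  have nz: "1 - b * w \<noteq> 0" if "cmod w \<le> 1" for w
    using pos[OF that] by (metis less_irrefl zero_complex.simps(1))
  have nR: "1 - b * w \<notin> \<real>\<^sub>\<le>\<^sub>0" if "cmod w \<le> 1" for w
    using pos[OF that] by (auto simp: complex_nonpos_Reals_iff)
  have cont: "continuous_on UNIV (\<lambda>\<theta>. ln (cmod (1 - b * cis \<theta>)))"
    using nz by (intro continuous_intros) auto
  show "integrable circ (\<lambda>\<theta>. ln (cmod (1 - b * cis \<theta>)))"
    by (rule circ_integral_continuous(1)[OF cont])
  have hol: "(\<lambda>w. Ln (1 - b * w)) holomorphic_on cball 0 1"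
    using nR by (intro holomorphic_intros) auto
  have "((\<lambda>u. Ln (1 - b * u) / (u - 0)) has_contour_integral (2 * of_real pi * \<i> * Ln (1 - b * 0))) (circlepath 0 1)"
    by (rule Cauchy_integral_circlepath_simple[OF hol]) auto
  then have "((\<lambda>u. Ln (1 - b * u) / (u - 0)) has_contour_integral 0) (circlepath 0 1)"
    by simp
  then have "((\<lambda>x. Ln (1 - b * exp (2 * of_real pi * \<i> * of_real x)) * (2 * of_real pi * \<i>)) has_integral 0) {0..1::real}"
    unfolding has_contour_integral_def
    by (rule has_integral_eq[rotated]) (subst vector_derivative_circlepath01, auto simp: circlepath)
  then have "((\<lambda>x. 1 / (2 * of_real pi * \<i>) * (Ln (1 - b * exp (2 * of_real pi * \<i> * of_real x)) * (2 * of_real pi * \<i>))) has_integral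
      1 / (2 * of_real pi * \<i>) * 0) {0..1::real}"
    by (rule has_integral_mult_right)
  then have "((\<lambda>x. Ln (1 - b * exp (2 * of_real pi * \<i> * of_real x))) has_integral 0) {0..1::real}"
    by simp
  then have "((\<lambda>x. Re (Ln (1 - b * exp (2 * of_real pi * \<i> * of_real x)))) has_integral 0) {0..1::real}"
    by (drule_tac has_integral_Re) simp
  then have "((\<lambda>x. ln (cmod (1 - b * cis (2 * pi * x)))) has_integral 0) {0..1::real}"
  proof (rule has_integral_eq[rotated])
    fix x :: real
    have "exp (2 * of_real pi * \<i> * of_real x) = cis (2 * pi * x)"
      by (simp add: cis_conv_exp mult_ac)
    then show "Re (Ln (1 - b * exp (2 * of_real pi * \<i> * of_real x))) = ln (cmod (1 - b * cis (2 * pi * x)))"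
      using nz[of "cis (2 * pi * x)"] by (simp add: Re_Ln)
  qed
  have im: "((\<lambda>x. (1 / (1/(2*pi))) *\<^sub>R x + -((1 / (1/(2*pi))) *\<^sub>R 0)) ` cbox 0 (1::real)) = {0..2*pi}"
    by (auto simp: image_iff intro!: bexI[of _ "x / (2*pi)" for x])
  have "((\<lambda>x. ln (cmod (1 - b * cis x))) has_integral 0) {0..2*pi}"
    using has_integral_affinity[OF \<open>((\<lambda>x. ln (cmod (1 - b * cis (2 * pi * x)))) has_integral 0) {0..1::real}\<close>[unfolded cbox_interval[symmetric]], of "1/(2*pi)" 0]
    unfolding im by simp
  then show "integral\<^sup>L circ (\<lambda>\<theta>. ln (cmod (1 - b * cis \<theta>))) = 0"
    unfolding circ_integral_continuous(2)[OF cont] by (rule integral_unique)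
qed

lemma circ_mean_ln_outside:
  assumes "cmod B < cmod A"
  shows "integrable circ (\<lambda>\<theta>. ln (cmod (A - B * cis \<theta>)))"
    and "integral\<^sup>L circ (\<lambda>\<theta>. ln (cmod (A - B * cis \<theta>))) = 2 * pi * ln (cmod A)"
proof -
  interpret C: finite_measure circ by (rule finite_measure_circ)
  have A: "A \<noteq> 0" using assms by auto
  have b: "cmod (B / A) < 1" using assms A by (simp add: norm_divide)
  have eq: "ln (cmod (A - B * cis \<theta>)) = ln (cmod A) + ln (cmod (1 - B / A * cis \<theta>))" for \<theta>
  proof -
    have "1 - B / A * cis \<theta> \<noteq> 0"
      using b by (metis eq_iff_diff_eq_0 less_irrefl mult.right_neutral norm_cis norm_mult norm_one)
    moreover have "A - B * cis \<theta> = A * (1 - B / A * cis \<theta>)"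
      using A by (simp add: right_diff_distrib)
    ultimately show ?thesis using A by (simp add: norm_mult ln_mult)
  qed
  show "integrable circ (\<lambda>\<theta>. ln (cmod (A - B * cis \<theta>)))"
    unfolding eq using circ_mean_ln_unit(1)[OF b] by simp
  show "integral\<^sup>L circ (\<lambda>\<theta>. ln (cmod (A - B * cis \<theta>))) = 2 * pi * ln (cmod A)"
    unfolding eq using circ_mean_ln_unit[OF b] emeasure_circ
    by (subst Bochner_Integration.integral_add) (auto simp: measure_def)
qed

text \<open>Reflection in the unit circle: conjugating \<open>A - B * cis \<theta>\<close> and
  multiplying by the unimodular \<open>- cis \<theta>\<close> exchanges the roles of
  \<open>A\<close> and \<open>B\<close>, which reduces this to the case of a pole outside the
  circle.\<close>

lemma circ_mean_ln_inside:
  assumes "cmod A < cmod B"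
  shows "integrable circ (\<lambda>\<theta>. ln (cmod (A - B * cis \<theta>)))"
    and "integral\<^sup>L circ (\<lambda>\<theta>. ln (cmod (A - B * cis \<theta>))) = 2 * pi * ln (cmod B)"
proof -
  have "cmod (A - B * cis \<theta>) = cmod (cnj B - cnj A * cis \<theta>)" for \<theta>
  proof -
    have "cnj B - cnj A * cis \<theta> = - cis \<theta> * cnj (A - B * cis \<theta>)"
      by (simp add: algebra_simps cis_cnj cis_mult)
    then have "cmod (cnj B - cnj A * cis \<theta>) = cmod (- cis \<theta>) * cmod (cnj (A - B * cis \<theta>))"
      by (simp only: norm_mult)
    then show ?thesis
      by (simp only: complex_mod_cnj norm_minus_cancel norm_cis mult_1)
  qed
  then show "integrable circ (\<lambda>\<theta>. ln (cmod (A - B * cis \<theta>)))"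
    "integral\<^sup>L circ (\<lambda>\<theta>. ln (cmod (A - B * cis \<theta>))) = 2 * pi * ln (cmod B)"
    using circ_mean_ln_outside[of "cnj A" "cnj B"] assms by auto
qed

text \<open>The value at nonpositive arguments extends -log continuously over its pole. Arguments
  above 1 are cut off to 0 by \<open>ennreal\<close>; hence the normalising divisors
  \<open>T\<close> below, which keep distances at most 1 wherever exact values matter.\<close>

definition neglog :: "real \<Rightarrow> ennreal" where
  "neglog t = (if t \<le> 0 then \<infinity> else ennreal (- ln t))"

lemma continuous_neglog: "continuous_on UNIV neglog"
proof -
  have "(neglog \<longlongrightarrow> neglog t) (at t)" for t
  proof (cases "t = 0")
    case False
    show ?thesis
    proof (cases "t > 0")
      case True
      have "((\<lambda>t. ennreal (- ln t)) \<longlongrightarrow> ennreal (- ln t)) (at t)"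
        using True by (intro tendsto_intros) auto
      then have "(neglog \<longlongrightarrow> ennreal (- ln t)) (at t)"
        by (rule tendsto_cong[THEN iffD1, rotated])
           (use True in \<open>auto simp: neglog_def intro!: eventually_at_in_open'[of "{0<..}", THEN eventually_mono]\<close>)
      then show ?thesis using True by (simp add: neglog_def)
    next
      case neg: False
      have "((\<lambda>_. \<infinity>) \<longlongrightarrow> (\<infinity>::ennreal)) (at t)" by simp
      then have "(neglog \<longlongrightarrow> \<infinity>) (at t)"
        by (rule tendsto_cong[THEN iffD1, rotated])
           (use neg False in \<open>auto simp: neglog_def intro!: eventually_at_in_open'[of "{..<0}", THEN eventually_mono]\<close>)
      then show ?thesis using neg by (simp add: neglog_def)
    qed
  next
    case True
    have "(neglog \<longlongrightarrow> \<infinity>) (at 0)"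
      unfolding infinity_ennreal_def
    proof (rule tendsto_top_iff_ennreal[THEN iffD2], intro allI impI)
      fix l :: real assume "0 \<le> l"
      have "\<forall>\<^sub>F x in at 0. x \<in> {..<exp (-l-1)}"
        by (intro eventually_at_in_open') auto
      then show "\<forall>\<^sub>F x in at 0. ennreal l < neglog x"
      proof eventually_elim
        case (elim x)
        show ?case
        proof (cases "x \<le> 0")
          case False
          then have "ln x < -l-1" using elim by (metis exp_less_cancel_iff exp_ln_iff lessThan_iff linorder_not_le)
          then show ?thesis using False \<open>0 \<le> l\<close> by (auto simp: neglog_def ennreal_less_iff)
        qed (simp add: neglog_def)
      qed
    qed
    with True show ?thesis by (simp add: neglog_def)
  qed
  then show ?thesis by (simp add: continuous_on_eq_continuous_at isCont_def)
qed

lemma measurable_neglog [measurable]: "neglog \<in> borel_measurable borel"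
  by (rule borel_measurable_continuous_onI[OF continuous_neglog])

lemma antimono_neglog: "s \<le> t \<Longrightarrow> neglog t \<le> neglog s"
  by (auto simp: neglog_def intro!: ennreal_leI)

text \<open>Superharmonicity of minus the logarithm of the distance. The mean is known exactly when
  the circle misses the pole. If |A| = |B| it runs through the pole; slightly smaller circles and
  Fatou's lemma then give the inequality, which is all that a submean property requires.\<close>

lemma circ_neglog_mean:
  assumes T: "cmod A + cmod B \<le> T" and A: "A \<noteq> 0"
  shows "(\<integral>\<^sup>+\<theta>. neglog (cmod (A - B * cis \<theta>) / T) \<partial>circ) \<le> ennreal (2 * pi * (- ln (cmod A / T)))"
proof -
  interpret C: finite_measure circ by (rule finite_measure_circ)
  have T0: "T > 0" using T A by (smt (verit) norm_ge_zero zero_less_norm_iff)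
  have le: "cmod (A - B' * cis \<theta>) \<le> T" if "cmod B' \<le> cmod B" for B' \<theta>
    using T that norm_triangle_ineq4[of A "B' * cis \<theta>"] by (simp add: norm_mult)
  have mean: "(\<integral>\<^sup>+\<theta>. neglog (cmod (A - B' * cis \<theta>) / T) \<partial>circ) = ennreal (2 * pi * ln T - I)"
    if B': "cmod B' \<le> cmod B" "cmod B' \<noteq> cmod A" and
      I: "integrable circ (\<lambda>\<theta>. ln (cmod (A - B' * cis \<theta>)))" "integral\<^sup>L circ (\<lambda>\<theta>. ln (cmod (A - B' * cis \<theta>))) = I"
    for B' I
  proof -
    have nz: "A - B' * cis \<theta> \<noteq> 0" for \<theta>
      using B'(2) by (metis eq_iff_diff_eq_0 mult.right_neutral norm_cis norm_mult)
    have "(\<integral>\<^sup>+\<theta>. neglog (cmod (A - B' * cis \<theta>) / T) \<partial>circ) = (\<integral>\<^sup>+\<theta>. ennreal (ln T - ln (cmod (A - B' * cis \<theta>))) \<partial>circ)"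
      using nz T0 by (intro nn_integral_cong) (auto simp: neglog_def ln_div not_le divide_le_0_iff)
    also have "\<dots> = ennreal (\<integral>\<theta>. ln T - ln (cmod (A - B' * cis \<theta>)) \<partial>circ)"
      using I(1) le[OF B'(1)] nz T0
      by (intro nn_integral_eq_integral) (auto intro!: AE_I2 simp: ln_le_cancel_iff)
    also have "\<dots> = ennreal (2 * pi * ln T - I)"
      using I emeasure_circ by (subst Bochner_Integration.integral_diff) (auto simp: measure_def)
    finally show ?thesis .
  qed
  have lnA: "- ln (cmod A / T) = ln T - ln (cmod A)"
    using A T0 by (simp add: ln_div)
  consider "cmod B < cmod A" | "cmod A < cmod B" | "cmod A = cmod B" by linarith
  then show ?thesis
  proof cases
    case 1
    show ?thesis
      using mean[of B "2 * pi * ln (cmod A)"] circ_mean_ln_outside[OF 1] 1 unfolding lnA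
      by (simp add: algebra_simps)
  next
    case 2
    then have "ln (cmod A) \<le> ln (cmod B)" using A by (intro ln_mono) auto
    then show ?thesis
      using mean[of B "2 * pi * ln (cmod B)"] circ_mean_ln_inside[OF 2] 2 unfolding lnA
      by (auto simp: algebra_simps intro!: ennreal_leI)
  next
    case 3
    define t where "t n = 1 - 1 / real (n + 2)" for n
    have t: "0 \<le> t n" "t n < 1" for n by (auto simp: t_def)
    have tl: "t \<longlonglongrightarrow> 1"
      unfolding t_def by real_asymp
    have I: "(\<integral>\<^sup>+\<theta>. neglog (cmod (A - (t n * B) * cis \<theta>) / T) \<partial>circ) = ennreal (2 * pi * (- ln (cmod A / T)))" for n
    proof -
      have lt: "cmod (t n * B) < cmod A" using t[of n] 3 A mult_strict_right_mono[of "t n" 1 "cmod B"] zero_less_norm_iff[of A]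
        by (simp add: norm_mult del: zero_less_norm_iff)
      show ?thesis
        using mean[of "t n * B" "2 * pi * ln (cmod A)"] circ_mean_ln_outside[OF lt] lt 3 unfolding lnA
        by (simp add: algebra_simps)
    qed
    have "(\<integral>\<^sup>+\<theta>. neglog (cmod (A - B * cis \<theta>) / T) \<partial>circ) =
       (\<integral>\<^sup>+\<theta>. liminf (\<lambda>n. neglog (cmod (A - (t n * B) * cis \<theta>) / T)) \<partial>circ)"
    proof (rule nn_integral_cong)
      fix \<theta>
      have "(\<lambda>n. cmod (A - (t n * B) * cis \<theta>) / T) \<longlonglongrightarrow> cmod (A - (1 * B) * cis \<theta>) / T"
        by (intro tendsto_intros tendsto_divide tendsto_of_real[OF tl, unfolded of_real_1]) (use T0 in auto)
      then have "(\<lambda>n. neglog (cmod (A - (t n * B) * cis \<theta>) / T)) \<longlonglongrightarrow> neglog (cmod (A - B * cis \<theta>) / T)"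
        using continuous_neglog by (auto intro: continuous_on_tendsto_compose)
      then show "neglog (cmod (A - B * cis \<theta>) / T) = liminf (\<lambda>n. neglog (cmod (A - (t n * B) * cis \<theta>) / T))"
        by (intro lim_imp_Liminf[symmetric]) auto
    qed
    also have "\<dots> \<le> liminf (\<lambda>n. \<integral>\<^sup>+\<theta>. neglog (cmod (A - (t n * B) * cis \<theta>) / T) \<partial>circ)"
    proof (rule nn_integral_liminf)
      show "(\<lambda>\<theta>. neglog (cmod (A - (t n * B) * cis \<theta>) / T)) \<in> borel_measurable circ" for n
        by (intro borel_measurable_circ) measurable
    qed
    also have "\<dots> = ennreal (2 * pi * (- ln (cmod A / T)))"
      unfolding I by (simp add: Liminf_const)
    finally show ?thesis .
  qed
qed

section \<open>Test functions\<close>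

lemma pderiv_dirI: "(f has_derivative f') (at z) \<Longrightarrow> pderiv_dir v f z = f' v"
  unfolding pderiv_dir_def using frechet_derivative_at by metis

lemma has_derivative_pderiv:
  "f differentiable (at z) \<Longrightarrow> (f has_derivative (\<lambda>v. pderiv_dir v f z)) (at z)"
  unfolding pderiv_dir_def by (simp add: frechet_derivative_works[symmetric])

lemma C_k_SucD: "C_k (Suc k) f \<Longrightarrow> C_k k f"
proof (induction k arbitrary: f)
  case 0
  then show ?case
    by (auto intro!: continuous_at_imp_continuous_on differentiable_imp_continuous_within)
next
  case (Suc k)
  from Suc.prems have "C_k k (pderiv_dir 1 f)" "C_k k (pderiv_dir \<i> f)" "\<forall>z. f differentiable (at z)"
    using Suc.IH by (auto simp del: C_k.simps(2) simp: C_k.simps(2)[of "Suc k"])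
  then show ?case by simp
qed

lemma C_k_const: "C_k k (\<lambda>_. c)"
proof (induction k arbitrary: c)
  case (Suc k)
  have "pderiv_dir v (\<lambda>_. c) = (\<lambda>_. 0)" for v
    by (rule ext, subst pderiv_dirI[where f'="\<lambda>_. 0"]) auto
  with Suc show ?case by simp
qed (auto intro: continuous_intros)

lemma C_k_add:
  assumes "C_k k f" "C_k k g" shows "C_k k (\<lambda>z. f z + g z)"
  using assms
proof (induction k arbitrary: f g)
  case (Suc k)
  have "pderiv_dir v (\<lambda>z. f z + g z) = (\<lambda>z. pderiv_dir v f z + pderiv_dir v g z)" for v
    using Suc.prems by (intro ext pderiv_dirI has_derivative_add has_derivative_pderiv) auto
  with Suc show ?case by auto
qed (auto intro: continuous_intros)

lemma pderiv_dir_mult: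
  assumes "f differentiable (at z)" "g differentiable (at z)"
  shows "pderiv_dir v (\<lambda>z. f z * g z) z = f z * pderiv_dir v g z + pderiv_dir v f z * g z"
  by (rule pderiv_dirI, rule has_derivative_mult; rule has_derivative_pderiv; fact)

lemma C_k_mult:
  assumes "C_k k f" "C_k k g" shows "C_k k (\<lambda>z. f z * g z)"
  using assms
proof (induction k arbitrary: f g)
  case (Suc k)
  have p: "pderiv_dir v (\<lambda>z. f z * g z) = (\<lambda>z. f z * pderiv_dir v g z + pderiv_dir v f z * g z)" for v
    using Suc.prems by (intro ext pderiv_dir_mult) auto
  have "C_k k f" "C_k k g" using Suc.prems C_k_SucD by blast+
  with Suc show ?case unfolding C_k.simps p by (auto intro!: C_k_add)
qed (auto intro: continuous_intros)

lemma C_k_power: "C_k k f \<Longrightarrow> C_k k (\<lambda>z. f z ^ n)"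
  by (induction n) (auto intro: C_k_const C_k_mult)

lemma C_k_affine:
  assumes "\<And>z. (f has_derivative f') (at z)"
  shows "C_k k f"
proof -
  have p: "pderiv_dir v f = (\<lambda>_. f' v)" for v
    using assms by (auto intro: pderiv_dirI)
  have "continuous_on UNIV f"
    using assms by (meson continuous_at_imp_continuous_on has_derivative_continuous)
  moreover have "\<forall>z. f differentiable (at z)" using assms by (auto simp: differentiable_def)
  ultimately show ?thesis by (cases k) (auto simp: p C_k_const)
qed

text \<open>The functions exp(-1/t)/t^j form a family that differentiation maps into its own linear
  span. Smoothness of the classical case \<open>j = 0\<close> is therefore proved for all
  \<open>j\<close> at once.\<close>

definition flat_fun :: "nat \<Rightarrow> real \<Rightarrow> real" where
  "flat_fun j t = (if t \<le> 0 then 0 else exp (- (1 / t)) / t ^ j)"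

lemma flat_fun_tendsto_0: "((\<lambda>t. exp (- (1 / t)) / t ^ j) \<longlongrightarrow> 0) (at_right (0::real))"
proof -
  have "((\<lambda>x. x ^ j / exp x) \<longlongrightarrow> 0) (at_top :: real filter)"
    by (rule tendsto_power_div_exp_0)
  then have "((\<lambda>t. (inverse t) ^ j / exp (inverse t)) \<longlongrightarrow> 0) (at_right (0::real))"
    by (rule filterlim_compose) (rule filterlim_inverse_at_top_right)
  then show ?thesis
    by (simp add: exp_minus field_simps)
qed

lemma flat_fun_deriv:
  "((flat_fun j) has_real_derivative (- real j * flat_fun (j + 1) t + flat_fun (j + 2) t)) (at t)"
proof -
  consider "t < 0" | "t > 0" | "t = 0" by linarith
  then show ?thesis
  proof cases
    case 1
    have "((\<lambda>_. 0) has_real_derivative 0) (at t)" by simp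
    then have "(flat_fun j has_real_derivative 0) (at t)"
      by (rule has_field_derivative_transform_within_open[where S="{..<0}"])
         (use 1 in \<open>auto simp: flat_fun_def\<close>)
    then show ?thesis using 1 by (simp add: flat_fun_def)
  next
    case 2
    have "((\<lambda>t. exp (- (1 / t)) / t ^ j) has_real_derivative
        (- real j * (exp (- (1 / t)) / t ^ (j+1)) + exp (- (1 / t)) / t ^ (j+2))) (at t)"
      using 2 by (cases j) (auto intro!: derivative_eq_intros simp: field_simps power2_eq_square, metis One_nat_def power_eq_if)
    then have "(flat_fun j has_real_derivative
        (- real j * (exp (- (1 / t)) / t ^ (j+1)) + exp (- (1 / t)) / t ^ (j+2))) (at t)"
      by (rule has_field_derivative_transform_within_open[where S="{0<..}"])
         (use 2 in \<open>auto simp: flat_fun_def\<close>)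
    then show ?thesis using 2 by (simp add: flat_fun_def)
  next
    case 3
    have "((\<lambda>h. flat_fun j h / h) \<longlongrightarrow> 0) (at 0)"
    proof (rule filterlim_split_at)
      have "((\<lambda>_. 0) \<longlongrightarrow> (0::real)) (at_left (0::real))" by simp
      then show "((\<lambda>h. flat_fun j h / h) \<longlongrightarrow> 0) (at_left 0)"
        by (rule tendsto_cong[THEN iffD1, rotated])
           (auto simp: flat_fun_def eventually_at_filter)
      \<comment> \<open>For h > 0 the difference quotient at 0 is the next member of the family,
        with exponent \<open>j + 1\<close>.\<close>
      show "((\<lambda>h. flat_fun j h / h) \<longlongrightarrow> 0) (at_right 0)"
        by (rule tendsto_cong[THEN iffD1, rotated, OF flat_fun_tendsto_0[of "Suc j"]],
            rule eventually_mono[OF eventually_at_right_less[of 0]]) (simp add: flat_fun_def field_simps)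
    qed
    then show ?thesis using 3
      by (simp add: DERIV_def flat_fun_def)
  qed
qed

lemma C_k_flat_fun:
  assumes f: "\<And>k. C_k k f"
  shows "C_k k (\<lambda>z. flat_fun j (f z))"
proof (induction k arbitrary: j)
  case 0
  have "continuous_on UNIV (flat_fun j)"
    using flat_fun_deriv by (meson DERIV_isCont continuous_at_imp_continuous_on)
  moreover have "continuous_on UNIV f" using f[of 0] by simp
  ultimately show ?case
    by (auto intro: continuous_on_compose2)
next
  case (Suc k)
  have d: "f differentiable (at z)" for z using f[of "Suc 0"] by simp
  have h: "((\<lambda>z. flat_fun j (f z)) has_derivative
      (\<lambda>v. (- real j * flat_fun (j + 1) (f z) + flat_fun (j + 2) (f z)) * pderiv_dir v f z)) (at z)" for z
    using has_derivative_compose[OF has_derivative_pderiv[OF d] flat_fun_deriv[unfolded has_field_derivative_def]] .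
  have p: "pderiv_dir v (\<lambda>z. flat_fun j (f z)) =
     (\<lambda>z. (- real j * flat_fun (j + 1) (f z) + flat_fun (j + 2) (f z)) * pderiv_dir v f z)" for v
    by (intro ext pderiv_dirI h)
  have "C_k k (pderiv_dir 1 f)" "C_k k (pderiv_dir \<i> f)" using f[of "Suc k"] by auto
  moreover have "C_k k (pderiv_dir v (\<lambda>z. flat_fun j (f z)))" if "C_k k (pderiv_dir v f)" for v
    unfolding p by (intro C_k_mult C_k_add C_k_const Suc that)
  ultimately have "C_k k (pderiv_dir 1 (\<lambda>z. flat_fun j (f z)))" "C_k k (pderiv_dir \<i> (\<lambda>z. flat_fun j (f z)))"
    by blast+
  then show ?case using h by (auto simp: differentiable_def)
qed

section \<open>Smooth approximation of boxes\<close>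

definition box_bump :: "complex \<Rightarrow> complex \<Rightarrow> complex \<Rightarrow> real" where
  "box_bump a b w = flat_fun 0 (Re w - Re a) * flat_fun 0 (Re b - Re w) *
     (flat_fun 0 (Im w - Im a) * flat_fun 0 (Im b - Im w))"

lemma box_bump_range: "0 \<le> box_bump a b w" "box_bump a b w \<le> 1"
  by (auto simp: box_bump_def flat_fun_def intro!: mult_nonneg_nonneg mult_le_one)

lemma box_bump_pos: "0 < box_bump a b w \<longleftrightarrow> w \<in> box a b"
  by (auto simp: box_bump_def flat_fun_def in_box_complex_iff)

lemma C_k_box_bump: "C_k k (box_bump a b)"
proof -
  have d: "((\<lambda>z. Re z - c) has_derivative Re) (at z)" "((\<lambda>z. c - Re z) has_derivative (\<lambda>v. - Re v)) (at z)"
    "((\<lambda>z. Im z - c) has_derivative Im) (at z)" "((\<lambda>z. c - Im z) has_derivative (\<lambda>v. - Im v)) (at z)" for c z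
    by (auto intro!: derivative_eq_intros bounded_linear.has_derivative[OF bounded_linear_Re]
        bounded_linear.has_derivative[OF bounded_linear_Im])
  have "C_k k (\<lambda>z. Re z - c)" "C_k k (\<lambda>z. c - Re z)" "C_k k (\<lambda>z. Im z - c)" "C_k k (\<lambda>z. c - Im z)" for c k
    using C_k_affine[OF d(1)] C_k_affine[OF d(2)] C_k_affine[OF d(3)] C_k_affine[OF d(4)] by auto
  then show ?thesis unfolding box_bump_def
    by (intro C_k_mult C_k_flat_fun)
qed

lemma test_function_box_bump: "test_function (\<lambda>w. 1 - (1 - box_bump a b w) ^ n)"
proof -
  have "C_k k (\<lambda>w. 1 + (-1) * (1 + (-1) * box_bump a b w) ^ n)" for k
    by (intro C_k_add C_k_mult C_k_power C_k_const C_k_box_bump)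
  moreover have "{w. 1 - (1 - box_bump a b w) ^ n \<noteq> 0} \<subseteq> box a b"
    using box_bump_pos box_bump_range(1) by (auto, metis diff_zero order_le_less power_one)
  ultimately show ?thesis
    unfolding test_function_def using bounded_subset[OF bounded_box] by (simp add: algebra_simps)
qed

text \<open>With \<open>b\<close> the bump of a box, 0 < b \<le> 1 on the box and b = 0 elsewhere,
  so the test functions 1 - (1 - b)^n tend to the indicator of the open box, dominated by that
  indicator. Open boxes are stable under intersection and generate the Borel sets.\<close>

lemma test_function_separates:
  fixes \<mu> \<nu> :: "complex measure"
  assumes sets: "sets \<mu> = sets borel" "sets \<nu> = sets borel"
    and fin: "\<And>K. compact K \<Longrightarrow> emeasure \<mu> K < \<infinity>" "\<And>K. compact K \<Longrightarrow> emeasure \<nu> K < \<infinity>"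
    and eq: "\<And>g. test_function g \<Longrightarrow> (\<integral>w. g w \<partial>\<mu>) = (\<integral>w. g w \<partial>\<nu>)"
  shows "\<mu> = \<nu>"
proof -
  have fb: "emeasure M (cbox a b) < \<infinity>" "emeasure M (box a b) < \<infinity>" if "M \<in> {\<mu>, \<nu>}" for M a b
  proof -
    show "emeasure M (cbox a b) < \<infinity>" using fin that by auto
    moreover have "emeasure M (box a b) \<le> emeasure M (cbox a b)"
      using that sets by (intro emeasure_mono box_subset_cbox) auto
    ultimately show "emeasure M (box a b) < \<infinity>" by (rule le_less_trans[rotated])
  qed
  have lim: "(\<lambda>n. \<integral>w. 1 - (1 - box_bump a b w) ^ n \<partial>M) \<longlonglongrightarrow> measure M (box a b)" if M: "M \<in> {\<mu>, \<nu>}" for M a b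
  proof -
    have sM: "sets M = sets borel" using M sets by auto
    have cont: "continuous_on UNIV (box_bump a b)" using C_k_box_bump[of 0] by simp
    have meas [measurable]: "box_bump a b \<in> borel_measurable M"
      using borel_measurable_continuous_onI[OF cont] sM by (simp cong: measurable_cong_sets)
    have z: "box_bump a b w = 0" if "w \<notin> box a b" for w
      using box_bump_pos box_bump_range(1) that by (metis order_le_less)
    have "(\<lambda>n. \<integral>w. 1 - (1 - box_bump a b w) ^ n \<partial>M) \<longlonglongrightarrow> (\<integral>w. indicator (box a b) w \<partial>M)"
    proof (rule integral_dominated_convergence[where w="indicator (box a b)"])
      show "integrable M (indicator (box a b) :: complex \<Rightarrow> real)"
        using fb(2)[OF M] sM by (auto simp: integrable_indicator_iff)
      show "indicator (box a b) \<in> borel_measurable M" using sM by simp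
      show "AE w in M. (\<lambda>n. 1 - (1 - box_bump a b w) ^ n) \<longlonglongrightarrow> indicator (box a b) w"
      proof (intro AE_I2)
        fix w
        show "(\<lambda>n. 1 - (1 - box_bump a b w) ^ n) \<longlonglongrightarrow> indicator (box a b) w"
        proof (cases "w \<in> box a b")
          case True
          then have "(\<lambda>n. 1 - (1 - box_bump a b w) ^ n) \<longlonglongrightarrow> 1 - 0"
            using box_bump_pos[of a b w] box_bump_range[of a b w]
            by (intro tendsto_diff tendsto_const LIMSEQ_realpow_zero) auto
          then show ?thesis using True by simp
        qed (simp add: z)
      qed
      show "AE w in M. norm (1 - (1 - box_bump a b w) ^ n) \<le> indicator (box a b) w" for n
      proof (intro AE_I2)
        fix w
        have "0 \<le> (1 - box_bump a b w) ^ n" "(1 - box_bump a b w) ^ n \<le> 1"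
          using box_bump_range[of a b w] by (auto intro!: power_le_one)
        then show "norm (1 - (1 - box_bump a b w) ^ n) \<le> indicator (box a b) w"
          using z[of w] by (auto split: split_indicator)
      qed
    qed measurable
    then show ?thesis using sM by (simp add: sets_eq_imp_space_eq[OF sM])
  qed
  have box: "emeasure \<mu> (box a b) = emeasure \<nu> (box a b)" for a b
  proof -
    have "measure \<mu> (box a b) = measure \<nu> (box a b)"
      using lim[of \<mu> a b] lim[of \<nu> a b] eq[OF test_function_box_bump]
      by (auto intro: LIMSEQ_unique)
    then show ?thesis
      using fb(2)[of \<mu> a b] fb(2)[of \<nu> a b] by (simp add: emeasure_eq_ennreal_measure top.not_eq_extremum)
  qed
  show ?thesis
  proof (rule measure_eqI_generator_eq[where E="range (\<lambda>(a,b). box a b :: complex set)" and \<Omega>=UNIV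
        and A="\<lambda>n. box (- real n *\<^sub>R (1 + \<i>)) (real n *\<^sub>R (1 + \<i>))"])
    show "Int_stable (range (\<lambda>(a,b). box a b :: complex set))"
      by (auto simp: Int_stable_def box_Int_box)
    show "sets \<mu> = sigma_sets UNIV (range (\<lambda>(a,b). box a b))" "sets \<nu> = sigma_sets UNIV (range (\<lambda>(a,b). box a b))"
      using sets by (simp_all add: borel_eq_box)
    show "(\<Union>i. box (- real i *\<^sub>R (1 + \<i>)) (real i *\<^sub>R (1 + \<i>))) = UNIV"
    proof safe
      fix w :: complex
      obtain n where n: "cmod w < real n" using reals_Archimedean2 by blast
      then have "w \<in> box (- real n *\<^sub>R (1 + \<i>)) (real n *\<^sub>R (1 + \<i>))"
        using abs_Re_le_cmod[of w] abs_Im_le_cmod[of w] by (auto simp: in_box_complex_iff)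
      then show "w \<in> (\<Union>i. box (- real i *\<^sub>R (1 + \<i>)) (real i *\<^sub>R (1 + \<i>)))" by blast
    qed auto
  qed (use box fb in \<open>auto simp: top.not_eq_extremum\<close>)
qed

section \<open>The Laplacian of the logarithm\<close>

lemma pderiv_dir_zero_outside:
  assumes "\<And>w. cmod w > T \<Longrightarrow> F w = 0" "cmod z > T"
  shows "pderiv_dir v F z = 0"
proof -
  have "((\<lambda>_. 0) has_derivative (\<lambda>_. 0)) (at z)" by simp
  then have "(F has_derivative (\<lambda>_. 0)) (at z)"
    by (rule has_derivative_transform_within_open[where s="{w. T < cmod w}"])
       (use assms in \<open>auto intro!: open_Collect_less continuous_intros\<close>)
  then show ?thesis by (rule pderiv_dirI)
qed

lemma bounded_support_bound:
  fixes f :: "complex \<Rightarrow> real"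
  assumes "continuous_on UNIV f" "\<And>w. cmod w > T \<Longrightarrow> f w = 0"
  obtains M where "M \<ge> 0" "\<And>w. \<bar>f w\<bar> \<le> M"
proof -
  have "compact (f ` cball 0 T)"
    using assms(1) by (intro compact_continuous_image continuous_on_subset[OF assms(1)]) auto
  then obtain B where "\<forall>x\<in>f ` cball 0 T. norm x \<le> B"
    using compact_imp_bounded bounded_iff by metis
  then have B: "\<bar>f w\<bar> \<le> B" if "w \<in> cball 0 T" for w
    using that by auto
  have "\<bar>f w\<bar> \<le> max B 0" for w
    using B[of w] assms(2)[of w] by (cases "cmod w \<le> T") (auto simp: max_def)
  then show thesis using that[of "max B 0"] by auto
qed

lemma integrable_bounded_support:
  fixes f :: "complex \<Rightarrow> real"
  assumes "continuous_on UNIV f" "\<And>w. cmod w > T \<Longrightarrow> f w = 0"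
  shows "integrable lborel f"
proof -
  have "integrable lborel (\<lambda>w. indicator (cball 0 T) w *\<^sub>R f w)"
    by (intro borel_integrable_compact continuous_on_subset[OF assms(1)]) auto
  also have "(\<lambda>w. indicator (cball 0 T) w *\<^sub>R f w) = f"
    using assms(2) by (auto simp: indicator_def fun_eq_iff not_le)
  finally show ?thesis .
qed

section \<open>Integration by parts in the plane\<close>

lemma has_real_derivative_line:
  assumes "F differentiable (at (w + t *\<^sub>R v))"
  shows "((\<lambda>t. F (w + t *\<^sub>R v)) has_real_derivative pderiv_dir v F (w + t *\<^sub>R v)) (at t)"
proof -
  let ?z = "w + t *\<^sub>R v"
  have lin: "linear (\<lambda>v. pderiv_dir v F ?z)"
    using has_derivative_pderiv[OF assms] by (rule has_derivative_linear)
  have "((\<lambda>t. w + t *\<^sub>R v) has_derivative (\<lambda>h. h *\<^sub>R v)) (at t)"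
    by (auto intro!: derivative_eq_intros)
  from has_derivative_compose[OF this has_derivative_pderiv[OF assms]]
  show ?thesis
    by (simp add: has_field_derivative_def linear_scale[OF lin] mult.commute[of _ "pderiv_dir v F ?z"] fun_eq_iff
        mult_commute_abs)
qed

text \<open>Translation invariance makes the integral of every difference quotient vanish. The mean
  value theorem bounds the quotients by the supremum of the derivative on a fixed disc, so dominated
  convergence carries this over to the derivative.\<close>

lemma integral_pderiv_dir_eq_0:
  fixes F :: "complex \<Rightarrow> real"
  assumes diff: "\<And>z. F differentiable (at z)" and cont: "continuous_on UNIV (pderiv_dir v F)"
    and supp: "\<And>w. cmod w > T \<Longrightarrow> F w = 0"
  shows "(\<integral>w. pderiv_dir v F w \<partial>lborel) = 0"
proof -
  have contF: "continuous_on UNIV F"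
    using diff by (auto intro!: continuous_at_imp_continuous_on differentiable_imp_continuous_within)
  have [measurable]: "F \<in> borel_measurable borel" "pderiv_dir v F \<in> borel_measurable borel"
    using contF cont by (auto intro: borel_measurable_continuous_onI)
  have intF: "integrable lborel F" by (rule integrable_bounded_support[OF contF supp])
  obtain M where M: "M \<ge> 0" "\<And>w. \<bar>pderiv_dir v F w\<bar> \<le> M"
    using bounded_support_bound[OF cont, of T] pderiv_dir_zero_outside[of T F, OF supp] by blast
  define q where "q n w = real (Suc n) * (F (w + (1 / real (Suc n)) *\<^sub>R v) - F w)" for n w
  have shift: "integrable lborel (\<lambda>w. F (w + c))" "(\<integral>w. F (w + c) \<partial>lborel) = (\<integral>w. F w \<partial>lborel)" for c
  proof -
    have [measurable]: "(+) c \<in> borel_measurable borel"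
      by (intro borel_measurable_continuous_onI continuous_intros)
    have "integrable (distr lborel borel ((+) c)) F" using intF by (simp add: lborel_distr_plus)
    then show "integrable lborel (\<lambda>w. F (w + c))"
      by (subst (asm) integrable_distr_eq) (simp_all add: add.commute)
    have "(\<integral>w. F w \<partial>distr lborel borel ((+) c)) = (\<integral>w. F (c + w) \<partial>lborel)"
      by (rule integral_distr) simp_all
    then show "(\<integral>w. F (w + c) \<partial>lborel) = (\<integral>w. F w \<partial>lborel)"
      by (simp add: lborel_distr_plus add.commute)
  qed
  have q0: "(\<integral>w. q n w \<partial>lborel) = 0" for n
    unfolding q_def using shift intF by simp
  have "(\<lambda>n. \<integral>w. q n w \<partial>lborel) \<longlonglongrightarrow> (\<integral>w. pderiv_dir v F w \<partial>lborel)"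
  proof (rule integral_dominated_convergence[where w="\<lambda>w. M * indicator (cball 0 (T + cmod v)) w"])
    show "integrable lborel (\<lambda>w. M * indicator (cball 0 (T + cmod v)) w :: real)"
      by (intro integrable_mult_right integrable_real_indicator) (simp_all add: emeasure_bounded_finite[unfolded infinity_ennreal_def])
    show "AE w in lborel. (\<lambda>n. q n w) \<longlonglongrightarrow> pderiv_dir v F w"
    proof (intro AE_I2)
      fix w
      have "((\<lambda>t. F (w + t *\<^sub>R v)) has_real_derivative pderiv_dir v F w) (at 0)"
        using has_real_derivative_line[of F w 0 v] diff by simp
      then have "((\<lambda>h. (F (w + h *\<^sub>R v) - F w) / h) \<longlongrightarrow> pderiv_dir v F w) (at 0)"
        by (simp add: DERIV_def)
      moreover have "filterlim (\<lambda>n. 1 / real (Suc n)) (at 0) sequentially"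
        unfolding filterlim_at
        using LIMSEQ_inverse_real_of_nat by (auto simp: inverse_eq_divide)
      ultimately have "(\<lambda>n. (F (w + (1 / real (Suc n)) *\<^sub>R v) - F w) / (1 / real (Suc n))) \<longlonglongrightarrow> pderiv_dir v F w"
        by (rule filterlim_compose)
      then show "(\<lambda>n. q n w) \<longlonglongrightarrow> pderiv_dir v F w"
        by (simp add: q_def mult.commute)
    qed
    show "AE w in lborel. norm (q n w) \<le> M * indicator (cball 0 (T + cmod v)) w" for n
    proof (intro AE_I2)
      fix w
      let ?e = "1 / real (Suc n)"
      have e: "?e > 0" "?e \<le> 1" by auto
      show "norm (q n w) \<le> M * indicator (cball 0 (T + cmod v)) w"
      proof (cases "cmod w \<le> T + cmod v")
        case True
        obtain z where z: "F (w + ?e *\<^sub>R v) - F (w + 0 *\<^sub>R v) = (?e - 0) * pderiv_dir v F (w + z *\<^sub>R v)"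
          using MVT2[OF e(1), of "\<lambda>t. F (w + t *\<^sub>R v)" "\<lambda>t. pderiv_dir v F (w + t *\<^sub>R v)"]
            has_real_derivative_line[OF diff] by blast
        then have "q n w = pderiv_dir v F (w + z *\<^sub>R v)" by (simp add: q_def del: of_nat_Suc)
        then show ?thesis using True M(2) by simp
      next
        case False
        have "cmod (?e *\<^sub>R v) \<le> 1 * cmod v" unfolding norm_scaleR using e by (intro mult_right_mono) auto
        then have "cmod (w + ?e *\<^sub>R v) > T" using False norm_diff_ineq[of w "?e *\<^sub>R v"] by linarith
        moreover have "cmod w > T" using False norm_ge_zero[of v] by linarith
        ultimately show ?thesis using False supp by (simp add: q_def)
      qed
    qed
  qed (simp_all add: q_def)
  then show ?thesis unfolding q0 by (simp add: LIMSEQ_const_iff)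
qed

lemma green_identity_dir:
  assumes h: "\<And>z. h differentiable (at z)" "\<And>z. pderiv_dir v h differentiable (at z)"
      "continuous_on UNIV (pderiv_dir v (pderiv_dir v h))"
    and g: "\<And>z. g differentiable (at z)" "\<And>z. pderiv_dir v g differentiable (at z)"
      "continuous_on UNIV (pderiv_dir v (pderiv_dir v g))"
    and supp: "\<And>w. cmod w > T \<Longrightarrow> g w = 0"
  shows "(\<integral>w. h w * pderiv_dir v (pderiv_dir v g) w \<partial>lborel) =
     (\<integral>w. pderiv_dir v (pderiv_dir v h) w * g w \<partial>lborel)"
proof -
  \<comment> \<open>In the derivative of this Wronskian the products of first derivatives cancel,
    and what remains is the difference of the two integrands.\<close>
  define F where "F w = h w * pderiv_dir v g w - pderiv_dir v h w * g w" for w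
  have F: "(F has_derivative (\<lambda>u. (h z * pderiv_dir u (pderiv_dir v g) z + pderiv_dir u h z * pderiv_dir v g z)
      - (pderiv_dir v h z * pderiv_dir u g z + pderiv_dir u (pderiv_dir v h) z * g z))) (at z)" for z
    unfolding F_def
    by (intro has_derivative_diff has_derivative_mult has_derivative_pderiv h g)
  have pF: "pderiv_dir v F = (\<lambda>z. h z * pderiv_dir v (pderiv_dir v g) z - pderiv_dir v (pderiv_dir v h) z * g z)"
    by (rule ext, subst pderiv_dirI[OF F]) simp
  have ch: "continuous_on UNIV h" and cg: "continuous_on UNIV g"
    using h(1) g(1) by (auto intro!: continuous_at_imp_continuous_on differentiable_imp_continuous_within)
  have s1: "cmod w > T \<Longrightarrow> pderiv_dir v g w = 0" for w using pderiv_dir_zero_outside[of T g w v] supp by blast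
  have s2: "cmod w > T \<Longrightarrow> pderiv_dir v (pderiv_dir v g) w = 0" for w using pderiv_dir_zero_outside[of T "pderiv_dir v g" w v] s1 by blast
  have "(\<integral>w. pderiv_dir v F w \<partial>lborel) = 0"
  proof (rule integral_pderiv_dir_eq_0)
    show "F differentiable (at z)" for z using F by (auto simp: differentiable_def)
    show "continuous_on UNIV (pderiv_dir v F)"
      unfolding pF using h(3) g(3) ch cg by (intro continuous_intros)
    show "F w = 0" if "cmod w > T" for w using supp[OF that] s1[OF that] by (simp add: F_def)
  qed
  moreover have "(\<integral>w. pderiv_dir v F w \<partial>lborel) = (\<integral>w. h w * pderiv_dir v (pderiv_dir v g) w \<partial>lborel) -
     (\<integral>w. pderiv_dir v (pderiv_dir v h) w * g w \<partial>lborel)"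
    unfolding pF
  proof (rule Bochner_Integration.integral_diff)
    show "integrable lborel (\<lambda>x. h x * pderiv_dir v (pderiv_dir v g) x)"
      using s2 by (intro integrable_bounded_support[of _ T] continuous_intros ch g(3)) auto
    show "integrable lborel (\<lambda>x. pderiv_dir v (pderiv_dir v h) x * g x)"
      using supp by (intro integrable_bounded_support[of _ T] continuous_intros cg h(3)) auto
  qed
  ultimately show ?thesis by simp
qed

text \<open>A smooth regularisation of log |w - a|. For \<open>d = 1\<close> and
  \<open>a = 0\<close> it is \<open>fs_potential\<close>; its Laplacian is a rescaled Fubini--Study
  density and concentrates at \<open>a\<close> as \<open>d\<close> tends to 0.\<close>

definition log_smooth :: "real \<Rightarrow> complex \<Rightarrow> complex \<Rightarrow> real" where
  "log_smooth d a w = ln (d + (cmod (w - a))\<^sup>2) / 2"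

lemma log_smooth_derivs:
  assumes d: "d > 0"
  shows "log_smooth d a differentiable (at z)" "pderiv_dir v (log_smooth d a) differentiable (at z)"
    "pderiv_dir v (pderiv_dir v (log_smooth d a)) z =
      ((v \<bullet> v) * (d + (z - a) \<bullet> (z - a)) - 2 * ((z - a) \<bullet> v)\<^sup>2) / (d + (z - a) \<bullet> (z - a))\<^sup>2"
proof -
  have pos: "d + z \<bullet> z \<noteq> 0" "d + z \<bullet> z > 0" for z :: complex
    using inner_ge_zero[of z] d by linarith+
  have d1: "(log_smooth d a has_derivative (\<lambda>h. ((z - a) \<bullet> h) / (d + (z - a) \<bullet> (z - a)))) (at z)" for z
    unfolding log_smooth_def power2_norm_eq_inner
    using pos[of "z - a"]
    by (auto intro!: derivative_eq_intros simp: inner_commute field_simps)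
  have p1: "pderiv_dir v (log_smooth d a) = (\<lambda>z. ((z - a) \<bullet> v) / (d + (z - a) \<bullet> (z - a)))" for v
    by (rule ext, rule pderiv_dirI[OF d1])
  have d2: "((\<lambda>z. ((z - a) \<bullet> v) / (d + (z - a) \<bullet> (z - a))) has_derivative
      (\<lambda>h. ((h \<bullet> v) * (d + (z - a) \<bullet> (z - a)) - ((z - a) \<bullet> v) * (2 * ((z - a) \<bullet> h))) / (d + (z - a) \<bullet> (z - a))\<^sup>2)) (at z)"
    for v z :: complex
    using pos[of "z - a"]
    by (auto intro!: derivative_eq_intros ext
        simp: inner_commute field_simps power2_eq_square)
  show "log_smooth d a differentiable (at z)" using d1 by (auto simp: differentiable_def)
  show "pderiv_dir v (log_smooth d a) differentiable (at z)"
    unfolding p1 using d2 by (auto simp: differentiable_def)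
  show "pderiv_dir v (pderiv_dir v (log_smooth d a)) z =
      ((v \<bullet> v) * (d + (z - a) \<bullet> (z - a)) - 2 * ((z - a) \<bullet> v)\<^sup>2) / (d + (z - a) \<bullet> (z - a))\<^sup>2"
    unfolding p1 by (subst pderiv_dirI[OF d2]) (simp add: power2_eq_square)
qed

lemma laplacian_log_smooth:
  assumes "d > 0"
  shows "laplacian (log_smooth d a) w = 2 * d / (d + (cmod (w - a))\<^sup>2)\<^sup>2"
  unfolding laplacian_def log_smooth_derivs(3)[OF assms] add_divide_distrib[symmetric]
    power2_norm_eq_inner
  by (simp add: inner_complex_def power2_eq_square algebra_simps)

lemma test_functionD:
  assumes "test_function g"
  shows "g differentiable (at z)" "pderiv_dir 1 g differentiable (at z)" "pderiv_dir \<i> g differentiable (at z)"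
    "continuous_on UNIV g" "continuous_on UNIV (pderiv_dir 1 (pderiv_dir 1 g))"
    "continuous_on UNIV (pderiv_dir \<i> (pderiv_dir \<i> g))" "continuous_on UNIV (laplacian g)"
    and "\<exists>T. T \<ge> 0 \<and> (\<forall>w. cmod w > T \<longrightarrow> g w = 0 \<and> laplacian g w = 0)"
proof -
  have c: "C_k k g" for k using assms by (simp add: test_function_def)
  show "continuous_on UNIV g" using c[of 0] by simp
  show "g differentiable (at z)" "pderiv_dir 1 g differentiable (at z)" "pderiv_dir \<i> g differentiable (at z)"
    using c[of "Suc (Suc 0)"] by auto
  show c2: "continuous_on UNIV (pderiv_dir 1 (pderiv_dir 1 g))" "continuous_on UNIV (pderiv_dir \<i> (pderiv_dir \<i> g))"
    using c[of "Suc (Suc 0)"] by auto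
  then show "continuous_on UNIV (laplacian g)"
    unfolding laplacian_def[abs_def] by (intro continuous_intros)
  obtain T where T: "\<And>w. g w \<noteq> 0 \<Longrightarrow> cmod w \<le> T"
    using assms by (auto simp: test_function_def bounded_iff)
  have s0: "cmod w > max T 0 \<Longrightarrow> g w = 0" for w using T[of w] by fastforce
  have s1: "cmod w > max T 0 \<Longrightarrow> pderiv_dir v g w = 0" for v w
    using pderiv_dir_zero_outside[of "max T 0" g w] s0 by blast
  have s2: "cmod w > max T 0 \<Longrightarrow> pderiv_dir v (pderiv_dir v g) w = 0" for v w
    using pderiv_dir_zero_outside[of "max T 0" "pderiv_dir v g" w] s1 by blast
  show "\<exists>T. T \<ge> 0 \<and> (\<forall>w. cmod w > T \<longrightarrow> g w = 0 \<and> laplacian g w = 0)"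
    using s0 s2 by (intro exI[of _ "max T 0"]) (auto simp: laplacian_def)
qed

lemma green_identity_log_smooth:
  assumes d: "d > 0" and g: "test_function g"
  shows "(\<integral>w. log_smooth d a w * laplacian g w \<partial>lborel) = (\<integral>w. 2 * d / (d + (cmod (w - a))\<^sup>2)\<^sup>2 * g w \<partial>lborel)"
proof -
  obtain T where T: "\<And>w. cmod w > T \<Longrightarrow> g w = 0" using test_functionD(8)[OF g] by blast
  note gd = test_functionD[OF g]
  have pos: "d + z \<bullet> z \<noteq> 0" for z :: complex
    using inner_ge_zero[of z] d by linarith
  have c: "continuous_on UNIV (pderiv_dir v (pderiv_dir v (log_smooth d a)))" for v
    unfolding log_smooth_derivs(3)[OF d, abs_def] using pos by (intro continuous_intros) auto
  have cl: "continuous_on UNIV (log_smooth d a)"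
    using log_smooth_derivs(1)[OF d] by (auto intro!: continuous_at_imp_continuous_on differentiable_imp_continuous_within)
  have s1: "cmod w > T \<Longrightarrow> pderiv_dir v g w = 0" for v w
    using pderiv_dir_zero_outside[of T g w v] T by blast
  have s: "cmod w > T \<Longrightarrow> pderiv_dir v (pderiv_dir v g) w = 0" for v w
    using pderiv_dir_zero_outside[of T "pderiv_dir v g" w v] s1 by blast
  have "(\<integral>w. log_smooth d a w * laplacian g w \<partial>lborel) =
     (\<integral>w. log_smooth d a w * pderiv_dir 1 (pderiv_dir 1 g) w + log_smooth d a w * pderiv_dir \<i> (pderiv_dir \<i> g) w \<partial>lborel)"
    by (simp add: laplacian_def distrib_left)
  also have "\<dots> = (\<integral>w. log_smooth d a w * pderiv_dir 1 (pderiv_dir 1 g) w \<partial>lborel) + (\<integral>w. log_smooth d a w * pderiv_dir \<i> (pderiv_dir \<i> g) w \<partial>lborel)"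
    using s by (intro Bochner_Integration.integral_add integrable_bounded_support[of _ T] continuous_intros cl gd) auto
  also have "\<dots> = (\<integral>w. pderiv_dir 1 (pderiv_dir 1 (log_smooth d a)) w * g w \<partial>lborel) + (\<integral>w. pderiv_dir \<i> (pderiv_dir \<i> (log_smooth d a)) w * g w \<partial>lborel)"
    using T by (intro arg_cong2[where f="(+)"] green_identity_dir[of _ _ _ T] log_smooth_derivs c gd d)
  also have "\<dots> = (\<integral>w. pderiv_dir 1 (pderiv_dir 1 (log_smooth d a)) w * g w + pderiv_dir \<i> (pderiv_dir \<i> (log_smooth d a)) w * g w \<partial>lborel)"
    using T by (intro Bochner_Integration.integral_add[symmetric] integrable_bounded_support[of _ T] continuous_intros c gd) auto
  also have "\<dots> = (\<integral>w. laplacian (log_smooth d a) w * g w \<partial>lborel)"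
    by (simp add: laplacian_def distrib_right)
  finally show ?thesis unfolding laplacian_log_smooth[OF d] .
qed

lemma integral_laplacian_eq_0:
  assumes g: "test_function g"
  shows "(\<integral>w. laplacian g w \<partial>lborel) = 0"
proof -
  obtain T where T: "\<And>w. cmod w > T \<Longrightarrow> g w = 0" using test_functionD(8)[OF g] by blast
  note gd = test_functionD[OF g]
  have s1: "cmod w > T \<Longrightarrow> pderiv_dir v g w = 0" for v w
    using pderiv_dir_zero_outside[of T g w v] T by blast
  have s: "cmod w > T \<Longrightarrow> pderiv_dir v (pderiv_dir v g) w = 0" for v w
    using pderiv_dir_zero_outside[of T "pderiv_dir v g" w v] s1 by blast
  have "(\<integral>w. laplacian g w \<partial>lborel) = (\<integral>w. pderiv_dir 1 (pderiv_dir 1 g) w \<partial>lborel) + (\<integral>w. pderiv_dir \<i> (pderiv_dir \<i> g) w \<partial>lborel)"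
    unfolding laplacian_def
    using s by (intro Bochner_Integration.integral_add integrable_bounded_support[of _ T] gd) auto
  also have "\<dots> = 0"
    using integral_pderiv_dir_eq_0[OF gd(2) gd(5) s1] integral_pderiv_dir_eq_0[OF gd(3) gd(6) s1] by simp
  finally show ?thesis .
qed

section \<open>Integrability of the logarithm\<close>

lemma ball_cball_borel [measurable]: "ball (a::complex) r \<in> sets borel" "cball (a::complex) r \<in> sets borel"
  by auto

text \<open>In the squared radius \<open>t\<close> the integrand is pi t^(-1/2), integrable at 0.
  The pole 1/|w - a| dominates the logarithm here and is also what exponential integrability comes
  down to later, where a bound uniform in \<open>a\<close> matters.\<close>

lemma nn_integral_inverse_dist:
  fixes a :: complex
  assumes "r \<ge> 0"
  shows "(\<integral>\<^sup>+w. ennreal (1 / cmod (w - a)) * indicator (cball a r) w \<partial>lborel) = ennreal (2 * pi * r)"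
proof -
  have [measurable]: "(+) a \<in> borel_measurable borel"
    by (intro borel_measurable_continuous_onI continuous_intros)
  have "(\<integral>\<^sup>+w. ennreal (1 / cmod (w - a)) * indicator (cball a r) w \<partial>lborel) =
      (\<integral>\<^sup>+w. ennreal (1 / cmod (w - a)) * indicator (cball a r) w \<partial>distr lborel borel ((+) a))"
    by (simp add: lborel_distr_plus)
  also have "\<dots> = (\<integral>\<^sup>+w. ennreal (1 / cmod w) * indicator (cball 0 r) w \<partial>lborel)"
    by (simp add: nn_integral_distr, intro nn_integral_cong) (auto split: split_indicator simp: dist_norm)
  also have "\<dots> = (\<integral>\<^sup>+w. (\<lambda>t. ennreal (t powr (-1/2)) * indicator {..r\<^sup>2} t) ((cmod w)\<^sup>2) \<partial>lborel)"
  proof (intro nn_integral_cong)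
    fix w :: complex
    have "((cmod w)\<^sup>2) powr (-1/2) = 1 / cmod w"
    proof (cases "w = 0")
      case False
      then have "((cmod w)\<^sup>2) powr (-1/2) = inverse (sqrt ((cmod w)\<^sup>2))"
        by (simp add: powr_minus powr_half_sqrt[symmetric])
      then show ?thesis by (simp add: inverse_eq_divide)
    qed simp
    moreover have "(cmod w)\<^sup>2 \<le> r\<^sup>2 \<longleftrightarrow> cmod w \<le> r"
      using assms by (simp add: power2_le_iff_abs_le)
    ultimately show "ennreal (1 / cmod w) * indicator (cball 0 r) w = (\<lambda>t. ennreal (t powr (-1/2)) * indicator {..r\<^sup>2} t) ((cmod w)\<^sup>2)"
      by (auto split: split_indicator)
  qed
  also have "\<dots> = (\<integral>\<^sup>+t. ennreal pi * (ennreal (t powr (-1/2)) * indicator {..r\<^sup>2} t) * indicator {0..} t \<partial>lborel)"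
    by (rule nn_integral_radial) measurable
  also have "\<dots> = (\<integral>\<^sup>+t. ennreal pi * ennreal (t powr (-1/2) * indicator {0..r\<^sup>2} t) \<partial>lborel)"
    by (intro nn_integral_cong) (auto split: split_indicator)
  also have "\<dots> = ennreal pi * (\<integral>\<^sup>+t. ennreal (t powr (-1/2) * indicator {0..r\<^sup>2} t) \<partial>lborel)"
    by (intro nn_integral_cmult) measurable
  also have "(\<integral>\<^sup>+t. ennreal (t powr (-1/2) * indicator {0..r\<^sup>2} t) \<partial>lborel) = ennreal (2 * r)"
  proof -
    have "((\<lambda>t::real. t powr (-1/2)) has_integral ((r\<^sup>2) powr (-1/2+1) / (-1/2+1))) {0..r\<^sup>2}"
      by (rule has_integral_powr_from_0) auto
    also have "(r\<^sup>2) powr (-1/2+1) / (-1/2+1) = 2 * r"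
      using assms by (simp add: powr_half_sqrt)
    finally show ?thesis
      by (subst nn_integral_has_integral_lebesgue[symmetric]) (auto simp: mult.commute)
  qed
  also have "ennreal pi * ennreal (2 * r) = ennreal (2 * pi * r)"
    using assms by (subst ennreal_mult[symmetric]) (auto simp: mult_ac)
  finally show ?thesis .
qed

text \<open>Crude, but 1/s has an integrable singularity in the plane, which is enough for a
  majorant.\<close>

lemma abs_ln_le: "0 \<le> (s::real) \<Longrightarrow> \<bar>ln s\<bar> \<le> 1 / s + s"
proof (cases "s = 0")
  case False
  assume "0 \<le> s"
  with False have s: "s > 0" by simp
  have "ln s \<le> s - 1" using s by (rule ln_le_minus_one)
  moreover have "ln (1 / s) \<le> 1 / s - 1" using s by (intro ln_le_minus_one) simp
  moreover have "ln (1 / s) = - ln s" using s by (simp add: ln_div)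
  ultimately show ?thesis using s by (auto simp: abs_if) (smt (verit) divide_pos_pos)
qed simp

lemma integrable_inverse_dist:
  "integrable lborel (\<lambda>w. 1 / cmod (w - a) * indicator (cball a r) w)"
proof (cases "r \<ge> 0")
  case True
  have "(\<integral>\<^sup>+w. ennreal (norm (1 / cmod (w - a) * indicator (cball a r) w)) \<partial>lborel) =
     (\<integral>\<^sup>+w. ennreal (1 / cmod (w - a)) * indicator (cball a r) w \<partial>lborel)"
    by (intro nn_integral_cong) (auto split: split_indicator)
  then show ?thesis
    by (intro integrableI_bounded) (measurable, simp only: nn_integral_inverse_dist[OF True] ennreal_less_top infinity_ennreal_def)
qed (simp add: not_le)

text \<open>The first form, with an added constant, is the majorant for the regularised logarithms;
  the second is their limit.\<close>

lemma integrable_ln_dist: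
  fixes f :: "complex \<Rightarrow> real"
  assumes f: "f \<in> borel_measurable borel" "\<And>w. \<bar>f w\<bar> \<le> M" "\<And>w. cmod w > T \<Longrightarrow> f w = 0"
  shows "integrable lborel (\<lambda>w. (\<bar>ln (cmod (w - a))\<bar> + c) * f w)"
    and "integrable lborel (\<lambda>w. ln (cmod (w - a)) * f w)"
proof -
  note [measurable] = f(1)
  define R where "R = max T 0 + cmod a"
  have M: "M \<ge> 0" using f(2)[of 0] by linarith
  have dom: "integrable lborel (\<lambda>w. (1 / cmod (w - a) * indicator (cball a R) w) * M + (R + \<bar>c\<bar>) * M * indicator (cball a R) w)"
    by (intro Bochner_Integration.integrable_add integrable_mult_left integrable_inverse_dist integrable_mult_right integrable_real_indicator)
       (simp_all add: emeasure_bounded_finite[unfolded infinity_ennreal_def])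
  have le: "(\<bar>ln (cmod (w - a))\<bar> + \<bar>c\<bar>) * \<bar>f w\<bar> \<le> (1 / cmod (w - a) * indicator (cball a R) w) * M + (R + \<bar>c\<bar>) * M * indicator (cball a R) w" for w
  proof (cases "cmod w \<le> T")
    case True
    then have d: "cmod (w - a) \<le> R" unfolding R_def using norm_triangle_ineq4[of w a] by linarith
    have "(\<bar>ln (cmod (w - a))\<bar> + \<bar>c\<bar>) * \<bar>f w\<bar> \<le> (1 / cmod (w - a) + R + \<bar>c\<bar>) * M"
      using abs_ln_le[of "cmod (w - a)"] d f(2)[of w] M by (intro mult_mono) auto
    then show ?thesis using d by (simp add: dist_norm norm_minus_commute algebra_simps)
  next
    case False
    have "0 \<le> R" by (simp add: R_def)
    then show ?thesis using f(3)[of w] False M by (auto split: split_indicator)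
  qed
  have R0: "R \<ge> 0" by (simp add: R_def)
  show "integrable lborel (\<lambda>w. (\<bar>ln (cmod (w - a))\<bar> + c) * f w)"
  proof (rule Bochner_Integration.integrable_bound[OF dom])
    show "AE w in lborel. norm ((\<bar>ln (cmod (w - a))\<bar> + c) * f w) \<le> norm ((1 / cmod (w - a) * indicator (cball a R) w) * M + (R + \<bar>c\<bar>) * M * indicator (cball a R) w)"
    proof (intro AE_I2)
      fix w
      have "norm ((\<bar>ln (cmod (w - a))\<bar> + c) * f w) \<le> (\<bar>ln (cmod (w - a))\<bar> + \<bar>c\<bar>) * \<bar>f w\<bar>"
        by (simp add: abs_mult mult_right_mono)
      also note le
      finally show "norm ((\<bar>ln (cmod (w - a))\<bar> + c) * f w) \<le> norm ((1 / cmod (w - a) * indicator (cball a R) w) * M + (R + \<bar>c\<bar>) * M * indicator (cball a R) w)"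
        by simp
    qed
  qed measurable
  show "integrable lborel (\<lambda>w. ln (cmod (w - a)) * f w)"
  proof (rule Bochner_Integration.integrable_bound[OF dom])
    show "AE w in lborel. norm (ln (cmod (w - a)) * f w) \<le> norm ((1 / cmod (w - a) * indicator (cball a R) w) * M + (R + \<bar>c\<bar>) * M * indicator (cball a R) w)"
    proof (intro AE_I2)
      fix w
      have "norm (ln (cmod (w - a)) * f w) \<le> (\<bar>ln (cmod (w - a))\<bar> + \<bar>c\<bar>) * \<bar>f w\<bar>"
        by (simp add: abs_mult mult_right_mono)
      also note le
      finally show "norm (ln (cmod (w - a)) * f w) \<le> norm ((1 / cmod (w - a) * indicator (cball a R) w) * M + (R + \<bar>c\<bar>) * M * indicator (cball a R) w)"
        by simp
    qed
  qed measurable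
qed

lemma nn_integral_kernel_radial:
  assumes "0 \<le> a"
  shows "(\<integral>\<^sup>+w. ennreal (1 / (1 + (cmod w)\<^sup>2)\<^sup>2) * indicator {w. a \<le> (cmod w)\<^sup>2} w \<partial>lborel) = ennreal (pi / (1 + a))"
proof -
  have "(\<integral>\<^sup>+w. ennreal (1 / (1 + (cmod w)\<^sup>2)\<^sup>2) * indicator {w. a \<le> (cmod w)\<^sup>2} w \<partial>lborel) =
     (\<integral>\<^sup>+w. (\<lambda>t. ennreal (1 / (1 + t)\<^sup>2) * indicator {a..} t) ((cmod w)\<^sup>2) \<partial>lborel)"
    by (intro nn_integral_cong) (auto split: split_indicator)
  also have "\<dots> = (\<integral>\<^sup>+t. ennreal pi * (ennreal (1 / (1 + t)\<^sup>2) * indicator {a..} t) * indicator {0..} t \<partial>lborel)"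
    by (rule nn_integral_radial) measurable
  also have "\<dots> = (\<integral>\<^sup>+t. ennreal pi * (ennreal (1 / (1 + t)\<^sup>2) * indicator {a..} t) \<partial>lborel)"
    using assms by (intro nn_integral_cong) (auto split: split_indicator)
  also have "\<dots> = ennreal pi * (\<integral>\<^sup>+t. ennreal (1 / (1 + t)\<^sup>2) * indicator {a..} t \<partial>lborel)"
    by (intro nn_integral_cmult) measurable
  also have "(\<integral>\<^sup>+t. ennreal (1 / (1 + t)\<^sup>2) * indicator {a..} t \<partial>lborel) = ennreal (0 - (- 1 / (1 + a)))"
  proof (rule nn_integral_FTC_atLeast)
    show "((\<lambda>t. - 1 / (1 + t)) has_real_derivative 1 / (1 + t)\<^sup>2) (at t)" if "a \<le> t" for t
      using that assms by (auto intro!: derivative_eq_intros simp: power2_eq_square)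
    show "((\<lambda>t::real. - 1 / (1 + t)) \<longlongrightarrow> 0) at_top" by real_asymp
  qed auto
  also have "ennreal pi * ennreal (0 - (- 1 / (1 + a))) = ennreal (pi / (1 + a))"
    using assms by (subst ennreal_mult[symmetric]) (auto simp: field_simps)
  finally show ?thesis .
qed

lemma has_bochner_integral_kernel:
  "integrable lborel (\<lambda>w::complex. 2 / (1 + (cmod w)\<^sup>2)\<^sup>2)" "(\<integral>w. 2 / (1 + (cmod w)\<^sup>2)\<^sup>2 \<partial>lborel) = 2 * pi"
proof -
  have "(\<integral>\<^sup>+w. ennreal (2 / (1 + (cmod w)\<^sup>2)\<^sup>2) \<partial>lborel) =
     (\<integral>\<^sup>+w. ennreal 2 * (ennreal (1 / (1 + (cmod w)\<^sup>2)\<^sup>2) * indicator {w. 0 \<le> (cmod w)\<^sup>2} w) \<partial>lborel)"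
    by (intro nn_integral_cong) (auto simp: ennreal_mult[symmetric] simp del: ennreal_numeral)
  also have "\<dots> = ennreal 2 * (\<integral>\<^sup>+w. (ennreal (1 / (1 + (cmod w)\<^sup>2)\<^sup>2) * indicator {w. 0 \<le> (cmod w)\<^sup>2} w) \<partial>lborel)"
    by (intro nn_integral_cmult) measurable
  also have "\<dots> = ennreal (2 * pi)"
    by (subst nn_integral_kernel_radial) (auto simp: ennreal_mult)
  finally have "has_bochner_integral lborel (\<lambda>w::complex. 2 / (1 + (cmod w)\<^sup>2)\<^sup>2) (2 * pi)"
    by (intro has_bochner_integral_nn_integral) auto
  then show "integrable lborel (\<lambda>w::complex. 2 / (1 + (cmod w)\<^sup>2)\<^sup>2)" "(\<integral>w. 2 / (1 + (cmod w)\<^sup>2)\<^sup>2 \<partial>lborel) = 2 * pi"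
    by (auto simp: has_bochner_integral_iff)
qed

lemma test_function_bounds:
  assumes g: "test_function g"
  obtains T M where "T \<ge> 0" "\<forall>w. cmod w > T \<longrightarrow> g w = 0 \<and> laplacian g w = 0"
    "\<forall>w. \<bar>g w\<bar> \<le> M" "\<forall>w. \<bar>laplacian g w\<bar> \<le> M"
proof -
  obtain T where T: "T \<ge> 0 \<and> (\<forall>w. cmod w > T \<longrightarrow> g w = 0 \<and> laplacian g w = 0)"
    using test_functionD(8)[OF g] by (rule exE)
  have b: "\<exists>M. \<forall>w. \<bar>f w\<bar> \<le> M" if "continuous_on UNIV f" "\<forall>w. cmod w > T \<longrightarrow> f w = 0" for f :: "complex \<Rightarrow> real"
    by (rule bounded_support_bound[of f T]) (use that in auto)
  obtain M1 where M1: "\<forall>w. \<bar>g w\<bar> \<le> M1" using b[OF test_functionD(4)[OF g]] T by auto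
  obtain M2 where M2: "\<forall>w. \<bar>laplacian g w\<bar> \<le> M2" using b[OF test_functionD(7)[OF g]] T by auto
  have "\<forall>w. \<bar>g w\<bar> \<le> max M1 M2" "\<forall>w. \<bar>laplacian g w\<bar> \<le> max M1 M2"
    using M1 M2 by (meson max.coboundedI1, meson max.coboundedI2)
  with T show thesis by (intro that[of T "max M1 M2"]) auto
qed

section \<open>The fundamental solution\<close>

lemma integrable_ln_laplacian:
  assumes g: "test_function g"
  shows "integrable lborel (\<lambda>w. ln (cmod (w - a)) * laplacian g w)"
proof -
  obtain T M where T: "T \<ge> 0" "\<forall>w. cmod w > T \<longrightarrow> g w = 0 \<and> laplacian g w = 0"
    "\<forall>w. \<bar>g w\<bar> \<le> M" "\<forall>w. \<bar>laplacian g w\<bar> \<le> M"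
    by (rule test_function_bounds[OF g])
  then show ?thesis
    by (intro integrable_ln_dist(2)[where T=T and M=M] borel_measurable_continuous_onI test_functionD(7)[OF g]) auto
qed

text \<open>This is the normalisation of dd^c. Green's identity moves the Laplacian onto
  \<open>log_smooth\<close> with parameter \<delta>^2; the substitution w = a + \<delta> x turns it
  into the fixed kernel 2/(1 + |x|^2)^2 of mass 2 pi, while \<open>g\<close> is evaluated at points
  tending to \<open>a\<close>.\<close>

lemma integral_ln_laplacian:
  assumes g: "test_function g"
  shows "(\<integral>w. ln (cmod (w - a)) * laplacian g w \<partial>lborel) = 2 * pi * g a"
proof -
  obtain T M where T: "T \<ge> 0" "\<forall>w. cmod w > T \<longrightarrow> g w = 0 \<and> laplacian g w = 0"
    and Mg: "\<forall>w. \<bar>g w\<bar> \<le> M" and M: "\<forall>w. \<bar>laplacian g w\<bar> \<le> M"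
    by (rule test_function_bounds[OF g])
  note cg = test_functionD(4)[OF g] and cl = test_functionD(7)[OF g]
  have [measurable]: "g \<in> borel_measurable borel" "laplacian g \<in> borel_measurable borel"
    using cg cl by (auto intro: borel_measurable_continuous_onI)
  define \<delta> where "\<delta> n = 1 / real (Suc n)" for n
  have \<delta>: "\<delta> n > 0" "\<delta> n \<le> 1" for n by (auto simp: \<delta>_def)
  have \<delta>l: "\<delta> \<longlonglongrightarrow> 0" unfolding \<delta>_def using LIMSEQ_inverse_real_of_nat by (simp add: inverse_eq_divide)
  \<comment> \<open>An upper bound for all the regularised logarithms on the support of
    \<open>g\<close>, as \<delta> \<le> 1 and |w - a| \<le> T + |a| there. From below they are
    bounded by log |w - a| itself.\<close>
  define c where "c = ln (1 + (T + cmod a)\<^sup>2) / 2"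
  have [measurable]: "log_smooth d a \<in> borel_measurable borel" for d
    unfolding log_smooth_def by measurable
  have lim1: "(\<lambda>n. \<integral>w. log_smooth ((\<delta> n)\<^sup>2) a w * laplacian g w \<partial>lborel) \<longlonglongrightarrow> (\<integral>w. ln (cmod (w - a)) * laplacian g w \<partial>lborel)"
  proof (rule integral_dominated_convergence[where w="\<lambda>w. (\<bar>ln (cmod (w - a))\<bar> + c) * \<bar>laplacian g w\<bar>"])
    show "integrable lborel (\<lambda>w. (\<bar>ln (cmod (w - a))\<bar> + c) * \<bar>laplacian g w\<bar>)"
      using T M by (intro integrable_ln_dist(1)[where T=T and M=M]) auto
    show "AE w in lborel. (\<lambda>n. log_smooth ((\<delta> n)\<^sup>2) a w * laplacian g w) \<longlonglongrightarrow> ln (cmod (w - a)) * laplacian g w"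
      using AE_lborel_singleton[of a]
    proof eventually_elim
      case (elim w)
      have "(\<lambda>n. ln ((\<delta> n)\<^sup>2 + (cmod (w - a))\<^sup>2) / 2 * laplacian g w) \<longlonglongrightarrow> ln (0\<^sup>2 + (cmod (w - a))\<^sup>2) / 2 * laplacian g w"
        using elim by (intro tendsto_intros \<delta>l) auto
      also have "ln (0\<^sup>2 + (cmod (w - a))\<^sup>2) / 2 = ln (cmod (w - a))"
        using elim by (simp add: ln_realpow)
      finally show ?case by (simp add: log_smooth_def)
    qed
    show "AE w in lborel. norm (log_smooth ((\<delta> n)\<^sup>2) a w * laplacian g w) \<le> (\<bar>ln (cmod (w - a))\<bar> + c) * \<bar>laplacian g w\<bar>" for n
      using AE_lborel_singleton[of a]
    proof eventually_elim
      case (elim w)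
      show ?case
      proof (cases "cmod w \<le> T")
        case True
        let ?s = "cmod (w - a)"
        have s: "?s > 0" "?s \<le> T + cmod a" using elim True norm_triangle_ineq4[of w a] by auto
        have "ln ?s = ln (?s\<^sup>2) / 2" using s by (simp add: ln_realpow)
        also have "\<dots> \<le> log_smooth ((\<delta> n)\<^sup>2) a w"
          using s unfolding log_smooth_def by (intro divide_right_mono ln_mono) auto
        finally have 1: "ln ?s \<le> log_smooth ((\<delta> n)\<^sup>2) a w" .
        have "(\<delta> n)\<^sup>2 \<le> 1" using \<delta>[of n] by (simp add: power_le_one)
        moreover have "?s\<^sup>2 \<le> (T + cmod a)\<^sup>2" using s by (intro power_mono) auto
        ultimately have sum: "(\<delta> n)\<^sup>2 + ?s\<^sup>2 \<le> 1 + (T + cmod a)\<^sup>2" by (rule add_mono)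
        have 2: "log_smooth ((\<delta> n)\<^sup>2) a w \<le> c"
          unfolding log_smooth_def c_def
          by (intro divide_right_mono ln_mono sum) (use elim in \<open>auto intro: add_nonneg_pos\<close>)
        have "c \<ge> 0" by (simp add: c_def)
        then have "\<bar>log_smooth ((\<delta> n)\<^sup>2) a w\<bar> \<le> \<bar>ln ?s\<bar> + c" using 1 2 by linarith
        then show ?thesis by (simp add: abs_mult mult_right_mono)
      qed (simp add: T)
    qed
  qed simp_all
  have eq: "(\<integral>w. log_smooth ((\<delta> n)\<^sup>2) a w * laplacian g w \<partial>lborel) = (\<integral>x. 2 / (1 + (cmod x)\<^sup>2)\<^sup>2 * g (a + \<delta> n *\<^sub>R x) \<partial>lborel)" for n
  proof -
    let ?f = "\<lambda>w. 2 * (\<delta> n)\<^sup>2 / ((\<delta> n)\<^sup>2 + (cmod (w - a))\<^sup>2)\<^sup>2 * g w"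
    have [measurable]: "(\<lambda>x. a + \<delta> n *\<^sub>R x) \<in> borel_measurable borel" by measurable
    have "(\<integral>w. log_smooth ((\<delta> n)\<^sup>2) a w * laplacian g w \<partial>lborel) = (\<integral>w. ?f w \<partial>lborel)"
      using \<delta>[of n] by (intro green_identity_log_smooth g) simp
    also have "\<dots> = (\<integral>w. ?f w \<partial>density (distr lborel borel (\<lambda>x. a + \<delta> n *\<^sub>R x)) (\<lambda>_. \<bar>\<delta> n\<bar> ^ DIM(complex)))"
      using \<delta>[of n] by (subst lborel_affine[of "\<delta> n" a]) auto
    also have "\<dots> = (\<integral>w. (\<delta> n)\<^sup>2 * ?f w \<partial>distr lborel borel (\<lambda>x. a + \<delta> n *\<^sub>R x))"
      using \<delta>[of n] by (subst integral_density) auto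
    also have "\<dots> = (\<integral>x. (\<delta> n)\<^sup>2 * ?f (a + \<delta> n *\<^sub>R x) \<partial>lborel)"
      by (rule integral_distr) auto
    also have "\<dots> = (\<integral>x. 2 / (1 + (cmod x)\<^sup>2)\<^sup>2 * g (a + \<delta> n *\<^sub>R x) \<partial>lborel)"
    proof (intro Bochner_Integration.integral_cong refl)
      fix x :: complex
      have e: "\<delta> n \<noteq> 0" using \<delta>(1)[of n] by simp
      have "(\<delta> n)\<^sup>2 + (cmod (\<delta> n *\<^sub>R x))\<^sup>2 = (\<delta> n)\<^sup>2 * (1 + (cmod x)\<^sup>2)"
        by (simp add: algebra_simps power_mult_distrib)
      then have "?f (a + \<delta> n *\<^sub>R x) = 2 * (\<delta> n)\<^sup>2 / ((\<delta> n)\<^sup>2 * (1 + (cmod x)\<^sup>2))\<^sup>2 * g (a + \<delta> n *\<^sub>R x)"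
        by simp
      also have "\<dots> = (1 / (\<delta> n)\<^sup>2) * (2 / (1 + (cmod x)\<^sup>2)\<^sup>2 * g (a + \<delta> n *\<^sub>R x))"
        using e by (simp add: power_mult_distrib power2_eq_square)
      finally show "(\<delta> n)\<^sup>2 * ?f (a + \<delta> n *\<^sub>R x) = 2 / (1 + (cmod x)\<^sup>2)\<^sup>2 * g (a + \<delta> n *\<^sub>R x)"
        using e by simp
    qed
    finally show ?thesis .
  qed
  have lim2: "(\<lambda>n. \<integral>x. 2 / (1 + (cmod x)\<^sup>2)\<^sup>2 * g (a + \<delta> n *\<^sub>R x) \<partial>lborel) \<longlonglongrightarrow> (\<integral>x. 2 / (1 + (cmod x)\<^sup>2)\<^sup>2 * g a \<partial>lborel)"
  proof (rule integral_dominated_convergence[where w="\<lambda>x. 2 / (1 + (cmod x)\<^sup>2)\<^sup>2 * M"])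
    show "integrable lborel (\<lambda>x::complex. 2 / (1 + (cmod x)\<^sup>2)\<^sup>2 * M)"
      by (intro integrable_mult_left has_bochner_integral_kernel)
    show "AE x in lborel. (\<lambda>n. 2 / (1 + (cmod x)\<^sup>2)\<^sup>2 * g (a + \<delta> n *\<^sub>R x)) \<longlonglongrightarrow> 2 / (1 + (cmod x)\<^sup>2)\<^sup>2 * g a"
    proof (intro AE_I2 tendsto_mult tendsto_const)
      fix x :: complex
      have "(\<lambda>n. a + \<delta> n *\<^sub>R x) \<longlonglongrightarrow> a + 0 *\<^sub>R x" by (intro tendsto_intros \<delta>l)
      then show "(\<lambda>n. g (a + \<delta> n *\<^sub>R x)) \<longlonglongrightarrow> g a"
        using cg by (auto intro: continuous_on_tendsto_compose)
    qed
    show "AE x in lborel. norm (2 / (1 + (cmod x)\<^sup>2)\<^sup>2 * g (a + \<delta> n *\<^sub>R x)) \<le> 2 / (1 + (cmod x)\<^sup>2)\<^sup>2 * M" for n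
      using Mg by (intro AE_I2) (auto simp: abs_mult intro!: divide_right_mono)
  qed measurable
  have "(\<integral>x. 2 / (1 + (cmod x)\<^sup>2)\<^sup>2 * g a \<partial>lborel) = 2 * pi * g a"
    using has_bochner_integral_kernel by (subst Bochner_Integration.integral_mult_left) auto
  then show ?thesis using LIMSEQ_unique[OF lim1[unfolded eq] lim2] by simp
qed

section \<open>Logarithmic potentials on the projective line\<close>

text \<open>\<open>ereal_integral\<close> is defined by positive and negative parts, which do not
  behave additively. Subharmonic functions occur in the form of an integrable function minus a
  nonnegative one whose integral may be infinite, and for these the expected formula holds.\<close>

lemma ereal_integral_diff:
  fixes w :: "'a \<Rightarrow> real" and h :: "'a \<Rightarrow> ennreal"
  assumes w: "integrable M w" and [measurable]: "h \<in> borel_measurable M"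
    and f: "\<And>x. x \<in> space M \<Longrightarrow> f x = ereal (w x) - enn2ereal (h x)"
  shows "ereal_integral M f = ereal (\<integral>x. w x \<partial>M) - enn2ereal (\<integral>\<^sup>+x. h x \<partial>M)"
proof -
  have [measurable]: "w \<in> borel_measurable M" using w by auto
  \<comment> \<open>\<open>P\<close> and \<open>N\<close> are the positive and negative parts of
    \<open>w - h\<close>. As \<open>ennreal\<close> cuts off negative values of \<open>w\<close>,
    the last summand of \<open>N\<close> puts them back.\<close>
  define P where "P x = ennreal (w x) - h x" for x
  define N where "N x = h x - ennreal (w x) + (if w x \<le> 0 then ennreal (- w x) else 0)" for x
  have [measurable]: "P \<in> borel_measurable M" "N \<in> borel_measurable M"
    unfolding P_def N_def by measurable
  have pt: "e2ennreal (f x) = P x \<and> e2ennreal (- f x) = N x \<and> P x + h x + ennreal (- w x) = N x + ennreal (w x)"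
    if x: "x \<in> space M" for x
  proof (cases "h x")
    case (real r)
    have 1: "f x = ereal (w x - r)" using real f[OF x] by (simp add: enn2ereal_ennreal)
    show ?thesis
    proof (cases "w x \<le> 0")
      case True
      then have "P x = 0" "N x = ennreal (r - w x)" using real
        by (auto simp: P_def N_def ennreal_neg ennreal_plus[symmetric] simp del: ennreal_plus)
      then show ?thesis using True real unfolding 1
        by (auto simp: e2ennreal_ereal ennreal_neg ennreal_plus[symmetric] simp del: ennreal_plus)
    next
      case False
      then have "P x = ennreal (w x - r)" "N x = ennreal (r - w x)" using real
        by (auto simp: P_def N_def ennreal_minus)
      then show ?thesis using False real unfolding 1
        by (cases "r \<le> w x") (auto simp: e2ennreal_ereal ennreal_neg ennreal_plus[symmetric] simp del: ennreal_plus)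
    qed
  next
    case top
    then have "f x = - \<infinity>" using f[OF x] by simp
    moreover have "P x = 0" "N x = top" using top by (auto simp: P_def N_def ennreal_minus_top)
    ultimately show ?thesis using top by (auto simp: e2ennreal_neg)
  qed
  have fin: "(\<integral>\<^sup>+x. ennreal (w x) \<partial>M) < \<infinity>" "(\<integral>\<^sup>+x. ennreal (- w x) \<partial>M) < \<infinity>"
    using w by (auto simp: real_integrable_def less_top)
  obtain a b where ab: "(\<integral>\<^sup>+x. ennreal (w x) \<partial>M) = ennreal a" "a \<ge> 0" "(\<integral>\<^sup>+x. ennreal (- w x) \<partial>M) = ennreal b" "b \<ge> 0"
    using fin by (intro that[of "enn2real (\<integral>\<^sup>+x. ennreal (w x) \<partial>M)" "enn2real (\<integral>\<^sup>+x. ennreal (- w x) \<partial>M)"]) auto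
  have Iw: "(\<integral>x. w x \<partial>M) = a - b"
    using real_lebesgue_integral_def[OF w] ab by simp
  \<comment> \<open>The pointwise identity between the parts, in the additive form that survives
    infinite values of \<open>h\<close>.\<close>
  have sum: "(\<integral>\<^sup>+x. P x \<partial>M) + (\<integral>\<^sup>+x. h x \<partial>M) + ennreal b = (\<integral>\<^sup>+x. N x \<partial>M) + ennreal a"
  proof -
    have "(\<integral>\<^sup>+x. P x + h x + ennreal (- w x) \<partial>M) = (\<integral>\<^sup>+x. N x + ennreal (w x) \<partial>M)"
      using pt by (intro nn_integral_cong) auto
    then show ?thesis unfolding ab(1,3)[symmetric]
      by (simp add: nn_integral_add)
  qed
  have "(\<integral>\<^sup>+x. P x \<partial>M) \<le> (\<integral>\<^sup>+x. ennreal (w x) \<partial>M)"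
    by (intro nn_integral_mono) (simp add: P_def diff_le_self_ennreal)
  then obtain p where p: "(\<integral>\<^sup>+x. P x \<partial>M) = ennreal p" "p \<ge> 0"
    unfolding ab(1) by (intro that[of "enn2real (\<integral>\<^sup>+x. P x \<partial>M)"]) (auto simp: le_less_trans)
  have I: "ereal_integral M f = enn2ereal (\<integral>\<^sup>+x. P x \<partial>M) - enn2ereal (\<integral>\<^sup>+x. N x \<partial>M)"
    unfolding ereal_integral_def using pt by (simp cong: nn_integral_cong)
  show ?thesis
  proof (cases "\<integral>\<^sup>+x. h x \<partial>M")
    case (real r)
    have "(\<integral>\<^sup>+x. N x \<partial>M) \<noteq> \<infinity>"
    proof
      assume "(\<integral>\<^sup>+x. N x \<partial>M) = \<infinity>"
      with sum real p ab show False by (simp add: ennreal_plus[symmetric] del: ennreal_plus)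
    qed
    then obtain n where n: "(\<integral>\<^sup>+x. N x \<partial>M) = ennreal n" "n \<ge> 0"
      by (intro that[of "enn2real (\<integral>\<^sup>+x. N x \<partial>M)"]) (auto simp: less_top)
    have "p + r + b = n + a"
      using sum p n real ab by (simp add: ennreal_plus[symmetric] del: ennreal_plus)
    then show ?thesis unfolding I Iw p(1) n(1) real(2) using p n real
      by (simp add: enn2ereal_ennreal)
  next
    case top
    have "(\<integral>\<^sup>+x. N x \<partial>M) = top"
    proof (rule ccontr)
      assume "(\<integral>\<^sup>+x. N x \<partial>M) \<noteq> top"
      then have "(\<integral>\<^sup>+x. N x \<partial>M) + ennreal a < top" by (simp add: less_top)
      with sum top show False by simp
    qed
    then show ?thesis unfolding I p(1) top by (simp add: enn2ereal_ennreal p(2))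
  qed
qed

text \<open>
  With \<open>\<alpha> / \<beta>\<close> read as a point of the projective line, this is minus the logarithm of its chordal
  distance to \<open>z\<close>, hence nonnegative; homogeneous coordinates allow the same formula in both charts.
\<close>

definition log_kernel :: "complex \<Rightarrow> complex \<Rightarrow> complex \<Rightarrow> ennreal" where
  "log_kernel \<alpha> \<beta> z = neglog (cmod (\<alpha> - \<beta> * z) / (sqrt ((cmod \<alpha>)\<^sup>2 + (cmod \<beta>)\<^sup>2) * sqrt (1 + (cmod z)\<^sup>2)))"

lemma cauchy_schwarz_linear_form:
  "cmod (\<alpha> - \<beta> * z) \<le> sqrt ((cmod \<alpha>)\<^sup>2 + (cmod \<beta>)\<^sup>2) * sqrt (1 + (cmod z)\<^sup>2)"
proof -
  have "cmod (\<alpha> - \<beta> * z) \<le> cmod \<alpha> * 1 + cmod \<beta> * cmod z"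
    using norm_triangle_ineq4[of \<alpha> "\<beta> * z"] by (simp add: norm_mult)
  also have "\<dots> \<le> sqrt (((cmod \<alpha>)\<^sup>2 + (cmod \<beta>)\<^sup>2) * (1\<^sup>2 + (cmod z)\<^sup>2))"
  proof (rule real_le_rsqrt)
    have "0 \<le> (cmod \<alpha> * cmod z - cmod \<beta>)\<^sup>2" by simp
    then show "(cmod \<alpha> * 1 + cmod \<beta> * cmod z)\<^sup>2 \<le> ((cmod \<alpha>)\<^sup>2 + (cmod \<beta>)\<^sup>2) * (1\<^sup>2 + (cmod z)\<^sup>2)"
      by (simp add: power2_eq_square algebra_simps)
  qed
  finally show ?thesis by (simp add: real_sqrt_mult)
qed

lemma fs_potential_nonneg: "0 \<le> fs_potential z"
  by (simp add: fs_potential_def)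

lemma continuous_fs_potential: "continuous_on S fs_potential"
  unfolding fs_potential_def[abs_def]
  by (intro continuous_intros) (auto simp: add_pos_nonneg less_imp_neq[symmetric])

lemma log_kernel_eq:
  assumes "\<alpha> - \<beta> * z \<noteq> 0"
  defines "l \<equiv> ln ((cmod \<alpha>)\<^sup>2 + (cmod \<beta>)\<^sup>2) / 2 + fs_potential z - ln (cmod (\<alpha> - \<beta> * z))"
  shows "log_kernel \<alpha> \<beta> z = ennreal l" "0 \<le> l"
proof -
  have n: "(cmod \<alpha>)\<^sup>2 + (cmod \<beta>)\<^sup>2 > 0"
  proof (rule ccontr)
    assume "\<not> ?thesis"
    then have "\<alpha> = 0 \<and> \<beta> = 0" by (simp add: sum_power2_gt_zero_iff)
    with assms show False by simp
  qed
  have z: "1 + (cmod z)\<^sup>2 > 0" by (simp add: add_pos_nonneg)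
  define D where "D = sqrt ((cmod \<alpha>)\<^sup>2 + (cmod \<beta>)\<^sup>2) * sqrt (1 + (cmod z)\<^sup>2)"
  have D: "D > 0" unfolding D_def by (intro mult_pos_pos real_sqrt_gt_zero n z)
  have lD: "ln D = ln ((cmod \<alpha>)\<^sup>2 + (cmod \<beta>)\<^sup>2) / 2 + fs_potential z"
  proof -
    have "ln D = ln (sqrt ((cmod \<alpha>)\<^sup>2 + (cmod \<beta>)\<^sup>2)) + ln (sqrt (1 + (cmod z)\<^sup>2))"
      unfolding D_def by (intro ln_mult_pos real_sqrt_gt_zero n z)
    then show ?thesis using n z by (simp add: fs_potential_def ln_sqrt)
  qed
  have l: "l = - ln (cmod (\<alpha> - \<beta> * z) / D)"
    using D assms by (simp add: lD ln_div)
  then show "log_kernel \<alpha> \<beta> z = ennreal l"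
    using D assms unfolding log_kernel_def D_def[symmetric] by (simp add: neglog_def not_le divide_le_0_iff)
  have "ln (cmod (\<alpha> - \<beta> * z)) \<le> ln D"
    using assms cauchy_schwarz_linear_form[of \<alpha> \<beta> z] by (intro ln_mono) (auto simp: D_def)
  then show "0 \<le> l" using lD by (simp add: l_def)
qed

lemma log_kernel_eq_top: "\<alpha> - \<beta> * z = 0 \<Longrightarrow> log_kernel \<alpha> \<beta> z = \<infinity>"
  by (simp add: log_kernel_def neglog_def)

lemma continuous_log_kernel:
  assumes "(cmod \<alpha>)\<^sup>2 + (cmod \<beta>)\<^sup>2 > 0"
  shows "continuous_on UNIV (log_kernel \<alpha> \<beta>)"
proof -
  have nz: "sqrt ((cmod \<alpha>)\<^sup>2 + (cmod \<beta>)\<^sup>2) * sqrt (1 + (cmod z)\<^sup>2) \<noteq> 0" for z :: complex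
    using assms by (auto simp: add_pos_nonneg less_imp_neq[symmetric])
  show ?thesis unfolding log_kernel_def[abs_def]
    by (rule continuous_on_compose2[OF continuous_neglog]) (use nz in \<open>auto intro!: continuous_intros\<close>)
qed

lemma measurable_log_kernel [measurable (raw)]:
  assumes [measurable]: "a \<in> borel_measurable M" "b \<in> borel_measurable M" "c \<in> borel_measurable M"
  shows "(\<lambda>x. log_kernel (a x) (b x) (c x)) \<in> borel_measurable M"
  unfolding log_kernel_def by measurable

lemma circ_fs_potential: "integrable circ (\<lambda>\<theta>. fs_potential (z + cis \<theta> * r))"
  by (rule circ_integral_continuous(1)) (intro continuous_on_compose2[OF continuous_fs_potential] continuous_intros; auto)

text \<open>The submean property of a single kernel, with the two \<open>fs_potential\<close> terms
  on the sides where they are nonnegative. The lower bound on the norm of (\<alpha>, \<beta>) keeps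
  its logarithm nonnegative, so that it passes through \<open>ennreal\<close> unharmed.\<close>

lemma circ_log_kernel_mean:
  assumes \<tau>: "(cmod \<alpha>)\<^sup>2 + (cmod \<beta>)\<^sup>2 \<ge> 1"
  shows "(\<integral>\<^sup>+\<theta>. log_kernel \<alpha> \<beta> (z + cis \<theta> * r) \<partial>circ) + ennreal (2 * pi * fs_potential z) \<le>
     ennreal (2 * pi) * log_kernel \<alpha> \<beta> z + ennreal (\<integral>\<theta>. fs_potential (z + cis \<theta> * r) \<partial>circ)"
proof (cases "\<alpha> - \<beta> * z = 0")
  case True
  then show ?thesis by (simp add: log_kernel_eq_top ennreal_mult_top)
next
  case False
  interpret C: finite_measure circ by (rule finite_measure_circ)
  define A where "A = \<alpha> - \<beta> * z"
  define B where "B = \<beta> * r"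
  \<comment> \<open>\<open>T\<close> dominates |A - B cis \<theta>| on the whole circle, so
    \<open>neglog\<close> is exact there, and is at least 1 so that \<open>ln T\<close> is
    nonnegative.\<close>
  define T where "T = max 1 (cmod A + cmod B)"
  define lt where "lt = ln ((cmod \<alpha>)\<^sup>2 + (cmod \<beta>)\<^sup>2) / 2"
  define Ifs where "Ifs = (\<integral>\<theta>. fs_potential (z + cis \<theta> * r) \<partial>circ)"
  have A: "A \<noteq> 0" using False by (simp add: A_def)
  have T: "T \<ge> 1" "cmod A + cmod B \<le> T" by (auto simp: T_def)
  have lt: "lt \<ge> 0" using \<tau> by (simp add: lt_def)
  have AB: "\<alpha> - \<beta> * (z + cis \<theta> * r) = A - B * cis \<theta>" for \<theta>
    by (simp add: A_def B_def algebra_simps)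
  have pt: "log_kernel \<alpha> \<beta> (z + cis \<theta> * r) + ennreal (ln T) =
      neglog (cmod (A - B * cis \<theta>) / T) + ennreal (lt + fs_potential (z + cis \<theta> * r))" for \<theta>
  proof (cases "A - B * cis \<theta> = 0")
    case True
    then show ?thesis using log_kernel_eq_top[of \<alpha> \<beta> "z + cis \<theta> * r"] by (simp add: AB neglog_def)
  next
    case False
    have le: "cmod (A - B * cis \<theta>) \<le> T"
      using T(2) norm_triangle_ineq4[of A "B * cis \<theta>"] by (simp add: norm_mult)
    have l0: "ln (cmod (A - B * cis \<theta>)) \<le> ln T" using le False by (intro ln_mono) auto
    have n: "neglog (cmod (A - B * cis \<theta>) / T) = ennreal (ln T - ln (cmod (A - B * cis \<theta>)))"
      using False T by (simp add: neglog_def ln_div not_le divide_le_0_iff)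
    note k = log_kernel_eq[of \<alpha> \<beta> "z + cis \<theta> * r", unfolded AB, OF False, folded lt_def]
    show ?thesis
      unfolding n k(1) using k(2) l0 lt T fs_potential_nonneg[of "z + cis \<theta> * r"]
      by (simp add: ennreal_plus[symmetric] del: ennreal_plus)
  qed
  have [measurable]: "(\<lambda>\<theta>. log_kernel \<alpha> \<beta> (z + cis \<theta> * r)) \<in> borel_measurable circ"
    "(\<lambda>\<theta>. neglog (cmod (A - B * cis \<theta>) / T)) \<in> borel_measurable circ"
    by (intro borel_measurable_circ; measurable)+
  have Ifs: "(\<integral>\<^sup>+\<theta>. ennreal (lt + fs_potential (z + cis \<theta> * r)) \<partial>circ) = ennreal (2 * pi * lt + Ifs)"
  proof -
    have "(\<integral>\<^sup>+\<theta>. ennreal (lt + fs_potential (z + cis \<theta> * r)) \<partial>circ) = ennreal (\<integral>\<theta>. lt + fs_potential (z + cis \<theta> * r) \<partial>circ)"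
      using lt by (intro nn_integral_eq_integral Bochner_Integration.integrable_add circ_fs_potential) (auto simp: fs_potential_nonneg)
    also have "(\<integral>\<theta>. lt + fs_potential (z + cis \<theta> * r) \<partial>circ) = 2 * pi * lt + Ifs"
      using emeasure_circ by (subst Bochner_Integration.integral_add) (auto simp: circ_fs_potential Ifs_def measure_def)
    finally show ?thesis .
  qed
  have Ifs0: "Ifs \<ge> 0" unfolding Ifs_def by (simp add: fs_potential_nonneg)
  have lA: "ln (cmod A) \<le> ln T" 
  proof (rule ln_mono)
    show "cmod A \<le> T" using T norm_ge_zero[of B] by linarith
  qed (use A in auto)
  have "(\<integral>\<^sup>+\<theta>. log_kernel \<alpha> \<beta> (z + cis \<theta> * r) \<partial>circ) + ennreal (2 * pi * ln T) =
     (\<integral>\<^sup>+\<theta>. log_kernel \<alpha> \<beta> (z + cis \<theta> * r) + ennreal (ln T) \<partial>circ)"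
  proof -
    have "(\<integral>\<^sup>+\<theta>. ennreal (ln T) \<partial>circ) = ennreal (2 * pi * ln T)"
      unfolding nn_integral_const emeasure_circ using T
      by (subst ennreal_mult'[symmetric]) (auto simp: mult_ac)
    then show ?thesis by (subst nn_integral_add) auto
  qed
  also have "\<dots> = (\<integral>\<^sup>+\<theta>. neglog (cmod (A - B * cis \<theta>) / T) \<partial>circ) + ennreal (2 * pi * lt + Ifs)"
    unfolding pt Ifs[symmetric] using circ_fs_potential[THEN borel_measurable_integrable] by (intro nn_integral_add) auto
  also have "\<dots> \<le> ennreal (2 * pi * (- ln (cmod A / T))) + ennreal (2 * pi * lt + Ifs)"
    by (intro add_right_mono circ_neglog_mean T A)
  also have "- ln (cmod A / T) = ln T - ln (cmod A)" using A T by (simp add: ln_div)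
  finally have le: "(\<integral>\<^sup>+\<theta>. log_kernel \<alpha> \<beta> (z + cis \<theta> * r) \<partial>circ) + ennreal (2 * pi * ln T) \<le>
     ennreal (2 * pi * (ln T - ln (cmod A)) + (2 * pi * lt + Ifs))"
    using lA lt Ifs0 by (simp add: ennreal_plus[symmetric] del: ennreal_plus)
  then have "(\<integral>\<^sup>+\<theta>. log_kernel \<alpha> \<beta> (z + cis \<theta> * r) \<partial>circ) \<noteq> top"
    by (auto simp: top_unique)
  then obtain k where k: "(\<integral>\<^sup>+\<theta>. log_kernel \<alpha> \<beta> (z + cis \<theta> * r) \<partial>circ) = ennreal k" "k \<ge> 0"
    by (intro that[of "enn2real (\<integral>\<^sup>+\<theta>. log_kernel \<alpha> \<beta> (z + cis \<theta> * r) \<partial>circ)"]) (auto simp: less_top)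
  have "k + 2 * pi * ln T \<le> 2 * pi * (ln T - ln (cmod A)) + (2 * pi * lt + Ifs)"
    using le k T lA lt Ifs0 by (simp add: ennreal_plus[symmetric] del: ennreal_plus)
  then have real: "k + 2 * pi * fs_potential z \<le> 2 * pi * (lt + fs_potential z - ln (cmod A)) + Ifs"
    by (simp add: algebra_simps)
  note lk = log_kernel_eq[of \<alpha> \<beta> z, folded A_def lt_def, OF A]
  show ?thesis unfolding k(1) lk(1) Ifs_def[symmetric]
    using real lk(2) k(2) Ifs0 fs_potential_nonneg[of z]
    by (simp add: ennreal_plus[symmetric] ennreal_mult[symmetric] del: ennreal_plus)
qed

text \<open>A random point of the projective line in homogeneous coordinates. One locale thus serves
  the affine chart, with coordinates (x, 1), and the chart at infinity, with (1, x); a zero of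
  \<beta> is a point that the chart does not see.\<close>

locale log_potential = prob_space M for M :: "'a measure" +
  fixes \<alpha> \<beta> :: "'a \<Rightarrow> complex" and c :: real
  assumes meas [measurable]: "\<alpha> \<in> borel_measurable M" "\<beta> \<in> borel_measurable M"
    and norm_ge: "\<And>x. (cmod (\<alpha> x))\<^sup>2 + (cmod (\<beta> x))\<^sup>2 \<ge> 1"
begin

definition pot :: "complex \<Rightarrow> ennreal" where
  "pot z = (\<integral>\<^sup>+x. log_kernel (\<alpha> x) (\<beta> x) z \<partial>M)"

definition v :: "complex \<Rightarrow> ereal" where
  "v z = ereal (c + fs_potential z) - enn2ereal (pot z)"

lemma pot_measurable [measurable]: "pot \<in> borel_measurable borel"
  unfolding pot_def[abs_def] by measurable

lemma pot_lsc:
  assumes "X \<longlonglongrightarrow> z"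
  shows "pot z \<le> liminf (\<lambda>n. pot (X n))"
proof -
  have "pot z = (\<integral>\<^sup>+x. liminf (\<lambda>n. log_kernel (\<alpha> x) (\<beta> x) (X n)) \<partial>M)"
    unfolding pot_def
  proof (rule nn_integral_cong)
    fix x
    have "(cmod (\<alpha> x))\<^sup>2 + (cmod (\<beta> x))\<^sup>2 > 0" using norm_ge[of x] by linarith
    then have "(\<lambda>n. log_kernel (\<alpha> x) (\<beta> x) (X n)) \<longlonglongrightarrow> log_kernel (\<alpha> x) (\<beta> x) z"
      using assms by (intro continuous_on_tendsto_compose[OF continuous_log_kernel]) auto
    then show "log_kernel (\<alpha> x) (\<beta> x) z = liminf (\<lambda>n. log_kernel (\<alpha> x) (\<beta> x) (X n))"
      by (intro lim_imp_Liminf[symmetric]) auto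
  qed
  also have "\<dots> \<le> liminf (\<lambda>n. pot (X n))"
    unfolding pot_def by (rule nn_integral_liminf) measurable
  finally show ?thesis .
qed

lemma usc_minus_pot:
  assumes g: "continuous_on UNIV g"
  shows "usc (\<lambda>z. ereal (g z) - enn2ereal (pot z))"
  unfolding usc_def
proof (intro allI)
  fix a :: ereal
  let ?v = "\<lambda>z. ereal (g z) - enn2ereal (pot z)"
  have "closed {z. a \<le> ?v z}"
    unfolding closed_sequential_limits
  proof (intro allI impI, elim conjE)
    fix X z assume X: "\<forall>n. X n \<in> {z. a \<le> ?v z}" "X \<longlonglongrightarrow> z"
    have fs: "(\<lambda>n. ereal (g (X n))) \<longlonglongrightarrow> ereal (g z)"
      using X(2) by (intro tendsto_ereal continuous_on_tendsto_compose[OF g]) auto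
    show "z \<in> {z. a \<le> ?v z}"
    proof (rule ccontr)
      assume "z \<notin> {z. a \<le> ?v z}"
      then have "?v z < a" by simp
      then obtain b where b: "?v z < b" "b < a" using dense by blast
      \<comment> \<open>The strict inequality is split by \<open>b\<close> and then
        \<open>d\<close>, one bounding the continuous part and one the potential, so that the two
        limits are never combined at infinite values. A negative \<open>d\<close> needs no limit
        because the potential is nonnegative.\<close>
      have "ereal (g z) - b < enn2ereal (pot z)"
        using b(1) by (cases "enn2ereal (pot z)"; cases b) auto
      then obtain d where d: "ereal (g z) - b < d" "d < enn2ereal (pot z)"
        using dense by blast
      have d0: "e2ennreal d < pot z \<or> d < 0"
        using d(2) by (metis e2ennreal_enn2ereal e2ennreal_mono enn2ereal_e2ennreal less_le not_le)
      have "\<forall>\<^sub>F n in sequentially. d < enn2ereal (pot (X n))"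
      proof (cases "d < 0")
        case True
        then show ?thesis using enn2ereal_nonneg less_le_trans by (intro always_eventually) blast
      next
        case False
        with d0 have "e2ennreal d < liminf (\<lambda>n. pot (X n))"
          using pot_lsc[OF X(2)] by (auto intro: less_le_trans)
        then have "\<forall>\<^sub>F n in sequentially. e2ennreal d < pot (X n)"
          by (rule less_LiminfD)
        then show ?thesis
        proof eventually_elim
          case (elim n)
          then have "enn2ereal (e2ennreal d) < enn2ereal (pot (X n))" by (simp add: less_ennreal.rep_eq)
          then show ?case using False by (simp add: enn2ereal_e2ennreal)
        qed
      qed
      moreover have "\<forall>\<^sub>F n in sequentially. ereal (g (X n)) - b < d"
      proof (cases b)
        case (real r)
        have "(\<lambda>n. ereal (g (X n)) - ereal r) \<longlonglongrightarrow> ereal (g z) - ereal r"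
          using fs by (auto intro: tendsto_diff)
        then show ?thesis using d(1) unfolding real by (rule order_tendstoD(2))
      qed (use b d in auto)
      ultimately have "\<forall>\<^sub>F n in sequentially. False"
      proof eventually_elim
        case (elim n)
        have "ereal (g (X n)) - b < enn2ereal (pot (X n))"
          using elim by (rule less_trans[rotated])
        then have "?v (X n) < a" using b(2)
          by (cases "enn2ereal (pot (X n))"; cases b; cases a) auto
        with X(1) show False by (meson mem_Collect_eq not_le)
      qed
      then show False by simp
    qed
  qed
  then have "open (- {z. a \<le> ?v z})" by (rule open_Compl)
  also have "- {z. a \<le> ?v z} = {z. ?v z < a}" by auto
  finally show "open {z. ?v z < a}" .
qed

lemma usc_v: "usc v"
  unfolding v_def[abs_def] by (intro usc_minus_pot continuous_intros continuous_fs_potential)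

lemma circ_pot_mean:
  "(\<integral>\<^sup>+\<theta>. pot (z + cis \<theta> * r) \<partial>circ) + ennreal (2 * pi * fs_potential z) \<le>
     ennreal (2 * pi) * pot z + ennreal (\<integral>\<theta>. fs_potential (z + cis \<theta> * r) \<partial>circ)"
proof -
  interpret C: finite_measure circ by (rule finite_measure_circ)
  interpret P: pair_sigma_finite M circ ..
  have m2 [measurable]: "snd \<in> borel_measurable (M \<Otimes>\<^sub>M circ)"
    by (rule measurable_compose[OF measurable_snd]) (intro borel_measurable_circ, simp)
  have [measurable]: "(\<lambda>p. log_kernel (\<alpha> (fst p)) (\<beta> (fst p)) (z + cis (snd p) * r)) \<in> borel_measurable (M \<Otimes>\<^sub>M circ)"
    by measurable
  have "(\<integral>\<^sup>+\<theta>. pot (z + cis \<theta> * r) \<partial>circ) = (\<integral>\<^sup>+x. (\<integral>\<^sup>+\<theta>. log_kernel (\<alpha> x) (\<beta> x) (z + cis \<theta> * r) \<partial>circ) \<partial>M)"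
    unfolding pot_def by (rule P.Fubini') (simp add: case_prod_beta)
  moreover have "(\<lambda>x. \<integral>\<^sup>+\<theta>. log_kernel (\<alpha> x) (\<beta> x) (z + cis \<theta> * r) \<partial>circ) \<in> borel_measurable M"
    by (rule C.borel_measurable_nn_integral) (simp add: case_prod_beta)
  ultimately have "(\<integral>\<^sup>+\<theta>. pot (z + cis \<theta> * r) \<partial>circ) + ennreal (2 * pi * fs_potential z) =
     (\<integral>\<^sup>+x. (\<integral>\<^sup>+\<theta>. log_kernel (\<alpha> x) (\<beta> x) (z + cis \<theta> * r) \<partial>circ) + ennreal (2 * pi * fs_potential z) \<partial>M)"
    by (subst nn_integral_add) (auto simp: emeasure_space_1)
  also have "\<dots> \<le> (\<integral>\<^sup>+x. ennreal (2 * pi) * log_kernel (\<alpha> x) (\<beta> x) z + ennreal (\<integral>\<theta>. fs_potential (z + cis \<theta> * r) \<partial>circ) \<partial>M)"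
    by (intro nn_integral_mono circ_log_kernel_mean norm_ge)
  also have "\<dots> = ennreal (2 * pi) * pot z + ennreal (\<integral>\<theta>. fs_potential (z + cis \<theta> * r) \<partial>circ)"
    by (subst nn_integral_add) (auto simp: emeasure_space_1 pot_def nn_integral_cmult)
  finally show ?thesis .
qed

lemma subharmonic_v: "subharmonic v"
  unfolding subharmonic_def
proof (intro conjI allI impI usc_v)
  show "v z \<noteq> \<infinity>" for z
    using enn2ereal_nonneg[of "pot z"] unfolding v_def by (cases "enn2ereal (pot z)") auto
next
  fix z :: complex and r :: real
  assume "r > 0"
  interpret C: finite_measure circ by (rule finite_measure_circ)
  define I where "I = (\<integral>\<theta>. fs_potential (z + cis \<theta> * r) \<partial>circ)"
  define J where "J = (\<integral>\<^sup>+\<theta>. pot (z + cis \<theta> * r) \<partial>circ)"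
  have I0: "I \<ge> 0" unfolding I_def by (simp add: fs_potential_nonneg)
  have "ereal_integral circ (\<lambda>\<theta>. v (z + complex_of_real r * cis \<theta>)) =
     ereal (\<integral>\<theta>. c + fs_potential (z + cis \<theta> * r) \<partial>circ) - enn2ereal J"
    unfolding J_def
  proof (rule ereal_integral_diff)
    show "(\<lambda>\<theta>. pot (z + cis \<theta> * r)) \<in> borel_measurable circ"
      by (intro borel_measurable_circ) measurable
  qed (auto simp: v_def mult.commute[of "complex_of_real r"] intro!: Bochner_Integration.integrable_add circ_fs_potential)
  also have "(\<integral>\<theta>. c + fs_potential (z + cis \<theta> * r) \<partial>circ) = 2 * pi * c + I"
    using emeasure_circ by (subst Bochner_Integration.integral_add) (auto simp: circ_fs_potential I_def measure_def)
  finally have eq: "ereal_integral circ (\<lambda>\<theta>. v (z + complex_of_real r * cis \<theta>)) = ereal (2 * pi * c + I) - enn2ereal J" .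
  have le: "J + ennreal (2 * pi * fs_potential z) \<le> ennreal (2 * pi) * pot z + ennreal I"
    unfolding I_def J_def by (rule circ_pot_mean)
  show "v z \<le> ereal_integral circ (\<lambda>\<theta>. v (z + complex_of_real r * cis \<theta>)) / ereal (2 * pi)"
  proof (cases "pot z")
    case top
    then show ?thesis by (simp add: v_def)
  next
    case (real p)
    then have "J \<noteq> top" using le
      by (auto simp: top_unique ennreal_mult[symmetric] ennreal_plus[symmetric] simp del: ennreal_plus)
    then obtain j where j: "J = ennreal j" "j \<ge> 0"
      by (intro that[of "enn2real J"]) (auto simp: less_top)
    have "j + 2 * pi * fs_potential z \<le> 2 * pi * p + I"
      using le j real I0 fs_potential_nonneg[of z]
      by (simp add: ennreal_mult[symmetric] ennreal_plus[symmetric] del: ennreal_plus)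
    then have "c + fs_potential z - p \<le> (2 * pi * c + I - j) / (2 * pi)"
      by (simp add: field_simps)
    then show ?thesis unfolding eq unfolding v_def real(2) j(1) using real(1) j(2)
      by (simp add: enn2ereal_ennreal)
  qed
qed

lemma fs_potential_bound: "cmod (z + cis \<theta> * w) \<le> R \<Longrightarrow> fs_potential (z + cis \<theta> * w) \<le> ln (1 + R\<^sup>2) / 2"
  unfolding fs_potential_def
  by (intro divide_right_mono ln_mono) (auto intro!: power_mono simp: add_pos_nonneg)

text \<open>The submean inequality at a single point \<open>z0\<close> of finite potential bounds
  all circle means of the potential centred there, up to a local bound on
  \<open>fs_potential\<close>; integration over the radii does the rest.\<close>

lemma pot_locally_integrable:
  assumes z0: "pot z0 < \<infinity>"
  shows "(\<integral>\<^sup>+w. pot w * indicator (ball z0 r) w \<partial>lborel) < \<infinity>"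
proof -
  interpret C: finite_measure circ by (rule finite_measure_circ)
  define R where "R = cmod z0 + \<bar>r\<bar>"
  define B where "B = 2 * pi * (ln (1 + R\<^sup>2) / 2)"
  have "ennreal (2 * pi) * (\<integral>\<^sup>+w. pot w * indicator (ball z0 r) w \<partial>lborel) =
     (\<integral>\<^sup>+w. (\<integral>\<^sup>+\<theta>. pot (z0 + cis \<theta> * w) \<partial>circ) * indicator (ball 0 r) w \<partial>lborel)"
    by (rule nn_integral_disc) measurable
  also have "\<dots> \<le> (\<integral>\<^sup>+w. (ennreal (2 * pi) * pot z0 + ennreal B) * indicator (ball (0::complex) r) w \<partial>lborel)"
  proof (rule nn_integral_mono)
    fix w :: complex
    show "(\<integral>\<^sup>+\<theta>. pot (z0 + cis \<theta> * w) \<partial>circ) * indicator (ball 0 r) w \<le> (ennreal (2 * pi) * pot z0 + ennreal B) * indicator (ball 0 r) w"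
    proof (cases "w \<in> ball 0 r")
      case True
      have "(\<integral>\<theta>. fs_potential (z0 + cis \<theta> * w) \<partial>circ) \<le> (\<integral>\<theta>. ln (1 + R\<^sup>2) / 2 \<partial>circ)"
      proof (intro integral_mono circ_fs_potential fs_potential_bound)
        fix \<theta>
        show "cmod (z0 + cis \<theta> * w) \<le> R"
          using True norm_triangle_ineq[of z0 "cis \<theta> * w"] by (simp add: R_def norm_mult)
      qed simp
      also have "\<dots> = B" using emeasure_circ by (simp add: B_def measure_def)
      finally have "ennreal (\<integral>\<theta>. fs_potential (z0 + cis \<theta> * w) \<partial>circ) \<le> ennreal B" by (rule ennreal_leI)
      then have "ennreal (2 * pi) * pot z0 + ennreal (\<integral>\<theta>. fs_potential (z0 + cis \<theta> * w) \<partial>circ) \<le> ennreal (2 * pi) * pot z0 + ennreal B"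
        by (rule add_left_mono)
      moreover have "(\<integral>\<^sup>+\<theta>. pot (z0 + cis \<theta> * w) \<partial>circ) \<le> (\<integral>\<^sup>+\<theta>. pot (z0 + cis \<theta> * w) \<partial>circ) + ennreal (2 * pi * fs_potential z0)"
        by simp
      ultimately have "(\<integral>\<^sup>+\<theta>. pot (z0 + cis \<theta> * w) \<partial>circ) \<le> ennreal (2 * pi) * pot z0 + ennreal B"
        using circ_pot_mean[of z0 w] by (blast intro: order_trans)
      then show ?thesis by (intro mult_right_mono) auto
    qed simp
  qed
  also have "\<dots> = (ennreal (2 * pi) * pot z0 + ennreal B) * emeasure lborel (ball (0::complex) r)"
    by (subst nn_integral_cmult) auto
  also have "\<dots> < \<infinity>"
    using z0 emeasure_bounded_finite[OF bounded_ball, of "0::complex" r]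
    by (auto simp: ennreal_mult_less_top)
  finally show ?thesis
    by (auto simp: ennreal_mult_less_top)
qed

text \<open>The law of the point \<open>\<alpha> / \<beta>\<close>, restricted to the event that it lies in the chart.\<close>

definition mass :: "complex measure" where
  "mass = distr (restrict_space M {x \<in> space M. \<beta> x \<noteq> 0}) borel (\<lambda>x. \<alpha> x / \<beta> x)"

lemma integral_mass:
  fixes g :: "complex \<Rightarrow> real"
  assumes [measurable]: "g \<in> borel_measurable borel"
  shows "(\<integral>w. g w \<partial>mass) = (\<integral>x. (if \<beta> x \<noteq> 0 then g (\<alpha> x / \<beta> x) else 0) \<partial>M)"
proof -
  have "(\<lambda>x. \<alpha> x / \<beta> x) \<in> borel_measurable M" by measurable
  then have [measurable]: "(\<lambda>x. \<alpha> x / \<beta> x) \<in> borel_measurable (restrict_space M {x \<in> space M. \<beta> x \<noteq> 0})"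
    by (rule measurable_restrict_space1)
  have "{x \<in> space M. \<beta> x \<noteq> 0} \<in> sets M" by measurable
  then show ?thesis unfolding mass_def
    by (subst integral_distr; simp add: integral_restrict_space Int_absorb2)
       (intro Bochner_Integration.integral_cong, auto simp: indicator_def)
qed

lemma finite_mass: "emeasure mass A \<le> 1"
proof -
  have "(\<lambda>x. \<alpha> x / \<beta> x) \<in> borel_measurable M" by measurable
  then have [measurable]: "(\<lambda>x. \<alpha> x / \<beta> x) \<in> borel_measurable (restrict_space M {x \<in> space M. \<beta> x \<noteq> 0})"
    by (rule measurable_restrict_space1)
  have s: "{x \<in> space M. \<beta> x \<noteq> 0} \<in> sets M" by measurable
  have "emeasure mass A \<le> emeasure mass (space mass)" by (rule emeasure_space)
  also have "\<dots> = emeasure (restrict_space M {x \<in> space M. \<beta> x \<noteq> 0}) (space (restrict_space M {x \<in> space M. \<beta> x \<noteq> 0}))"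
    unfolding mass_def by (subst emeasure_distr) auto
  also have "\<dots> \<le> 1"
    using s by (subst emeasure_restrict_space) (auto simp: space_restrict_space intro: emeasure_le_1)
  finally show ?thesis .
qed

text \<open>Up to a constant the kernel is \<open>fs_potential\<close> minus log |w - a| with a =
  \<alpha>/\<beta>, and the constant dies because the Laplacian of a test function has integral 0.
  For \<beta> = 0 the point lies at infinity, the logarithm is itself constant, and no Dirac mass
  appears.\<close>

lemma kernel_integral:
  assumes g: "test_function g"
  shows "(\<integral>w. enn2real (log_kernel (\<alpha> x) (\<beta> x) w) * (laplacian g w / (2 * pi)) \<partial>lborel) =
     (\<integral>w. fs_potential w * (laplacian g w / (2 * pi)) \<partial>lborel) - (if \<beta> x \<noteq> 0 then g (\<alpha> x / \<beta> x) else 0)"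
proof -
  obtain T B where T: "T \<ge> 0" "\<forall>w. cmod w > T \<longrightarrow> g w = 0 \<and> laplacian g w = 0"
    "\<forall>w. \<bar>g w\<bar> \<le> B" "\<forall>w. \<bar>laplacian g w\<bar> \<le> B"
    by (rule test_function_bounds[OF g])
  note cl = test_functionD(7)[OF g]
  define L where "L w = laplacian g w / (2 * pi)" for w
  have cL: "continuous_on UNIV L" unfolding L_def by (intro continuous_intros cl) auto
  have L0: "cmod w > T \<Longrightarrow> L w = 0" for w using T by (simp add: L_def)
  have iL: "integrable lborel L" by (rule integrable_bounded_support[OF cL L0])
  have IL: "(\<integral>w. L w \<partial>lborel) = 0" unfolding L_def using integral_laplacian_eq_0[OF g] by simp
  have ifs: "integrable lborel (\<lambda>w. fs_potential w * L w)"
    by (rule integrable_bounded_support[of _ T]) (auto intro!: continuous_intros cL continuous_fs_potential simp: L0)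
  have iln: "integrable lborel (\<lambda>w. ln (cmod (w - a)) * L w)" for a
    using integrable_ln_laplacian[OF g, of a] unfolding L_def by simp
  have Iln: "(\<integral>w. ln (cmod (w - a)) * L w \<partial>lborel) = g a" for a
    using integral_ln_laplacian[OF g, of a] unfolding L_def by simp
  define t where "t = ln ((cmod (\<alpha> x))\<^sup>2 + (cmod (\<beta> x))\<^sup>2) / 2"
  have [measurable]: "L \<in> borel_measurable borel" by (rule borel_measurable_continuous_onI[OF cL])
  have [measurable]: "fs_potential \<in> borel_measurable borel"
    by (rule borel_measurable_continuous_onI[OF continuous_fs_potential])
  have mK: "(\<lambda>w. enn2real (log_kernel (\<alpha> x) (\<beta> x) w) * L w) \<in> borel_measurable lborel" by measurable
  show ?thesis
  proof (cases "\<beta> x = 0")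
    case True
    then have a: "\<alpha> x \<noteq> 0" using norm_ge[of x] by auto
    have K: "enn2real (log_kernel (\<alpha> x) (\<beta> x) w) = fs_potential w + (t - ln (cmod (\<alpha> x)))" for w
      using log_kernel_eq[of "\<alpha> x" "\<beta> x" w] a True by (simp add: t_def)
    have "(\<integral>w. enn2real (log_kernel (\<alpha> x) (\<beta> x) w) * L w \<partial>lborel) = (\<integral>w. fs_potential w * L w + (t - ln (cmod (\<alpha> x))) * L w \<partial>lborel)"
      unfolding K by (simp add: distrib_right)
    also have "\<dots> = (\<integral>w. fs_potential w * L w \<partial>lborel)"
      using iL ifs IL by simp
    finally show ?thesis using True by (simp add: L_def)
  next
    case False
    define a where "a = \<alpha> x / \<beta> x"
    have "(\<integral>w. enn2real (log_kernel (\<alpha> x) (\<beta> x) w) * L w \<partial>lborel) =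
      (\<integral>w. (fs_potential w * L w + (t - ln (cmod (\<beta> x))) * L w) - ln (cmod (w - a)) * L w \<partial>lborel)"
    proof (rule integral_cong_AE[OF mK])
      show "AE w in lborel. enn2real (log_kernel (\<alpha> x) (\<beta> x) w) * L w = (fs_potential w * L w + (t - ln (cmod (\<beta> x))) * L w) - ln (cmod (w - a)) * L w"
        using AE_lborel_singleton[of a]
      proof eventually_elim
        case (elim w)
        have e: "\<alpha> x - \<beta> x * w = - \<beta> x * (w - a)" using False by (simp add: a_def right_diff_distrib)
        then have nz: "\<alpha> x - \<beta> x * w \<noteq> 0" using elim False by simp
        have "ln (cmod (\<alpha> x - \<beta> x * w)) = ln (cmod (\<beta> x)) + ln (cmod (w - a))"
          unfolding e using False elim by (simp add: norm_mult ln_mult)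
        then have k: "enn2real (log_kernel (\<alpha> x) (\<beta> x) w) = fs_potential w + (t - ln (cmod (\<beta> x))) - ln (cmod (w - a))"
          using log_kernel_eq[OF nz] by (simp add: t_def)
        show ?case unfolding k by (simp add: algebra_simps)
      qed
    qed measurable
    also have "\<dots> = (\<integral>w. fs_potential w * L w \<partial>lborel) - g a"
      using iL ifs IL iln Iln by simp
    finally show ?thesis using False by (simp add: L_def a_def)
  qed
qed

text \<open>Fubini reduces the claim to \<open>kernel_integral\<close>: the two integrals of
  \<open>fs_potential\<close> cancel and the law of the point is left. A single finite value of the
  potential gives the absolute integrability on the support of the test function that Fubini
  demands.\<close>

lemma is_ddc_v:
  assumes z0: "pot z0 < \<infinity>"
  shows "is_ddc v mass"
  unfolding is_ddc_def
proof (intro conjI allI impI)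
  show "sets mass = sets borel" by (simp add: mass_def)
  show "emeasure mass K < \<infinity>" for K using finite_mass[of K] by (auto simp: less_top[symmetric] top_unique)
next
  fix g assume g: "test_function g"
  obtain T B where T: "T \<ge> 0" "\<forall>w. cmod w > T \<longrightarrow> g w = 0 \<and> laplacian g w = 0"
    and B: "\<forall>w. \<bar>g w\<bar> \<le> B" "\<forall>w. \<bar>laplacian g w\<bar> \<le> B"
    by (rule test_function_bounds[OF g])
  define L where "L w = laplacian g w / (2 * pi)" for w
  have cL: "continuous_on UNIV L" unfolding L_def by (intro continuous_intros test_functionD(7)[OF g]) auto
  have L0: "cmod w > T \<Longrightarrow> L w = 0" for w using T by (simp add: L_def)
  have IL: "(\<integral>w. L w \<partial>lborel) = 0" unfolding L_def using integral_laplacian_eq_0[OF g] by simp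
  define B' where "B' = B / (2 * pi)"
  have LB: "\<bar>L w\<bar> \<le> B'" for w using B(2) by (auto simp: L_def B'_def abs_div intro!: divide_right_mono)
  have B'0: "B' \<ge> 0" using LB[of 0] by linarith
  have [measurable]: "L \<in> borel_measurable borel" by (rule borel_measurable_continuous_onI[OF cL])
  have [measurable]: "fs_potential \<in> borel_measurable borel"
    by (rule borel_measurable_continuous_onI[OF continuous_fs_potential])
  have [measurable]: "g \<in> borel_measurable borel" by (rule borel_measurable_continuous_onI[OF test_functionD(4)[OF g]])
  \<comment> \<open>Local integrability is available on discs around \<open>z0\<close>; this one
    contains the support of the test function.\<close>
  define r where "r = T + cmod z0 + 1"
  have supp: "L w = 0" if "w \<notin> ball z0 r" for w
  proof (rule L0)
    show "T < cmod w" using that norm_triangle_ineq4[of z0 w] by (simp add: r_def dist_norm)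
  qed
  interpret P: pair_sigma_finite M lborel ..
  define K where "K x w = log_kernel (\<alpha> x) (\<beta> x) w" for x w
  have mK [measurable]: "(\<lambda>p. K (fst p) (snd p)) \<in> borel_measurable (M \<Otimes>\<^sub>M lborel)"
    unfolding K_def by measurable
  have finpot: "AE w in lborel. w \<in> ball z0 r \<longrightarrow> pot w < \<infinity>"
  proof -
    have "AE w in lborel. pot w * indicator (ball z0 r) w \<noteq> \<infinity>"
      using pot_locally_integrable[OF z0, of r] by (intro nn_integral_PInf_AE) auto
    then show ?thesis by eventually_elim (auto simp: less_top)
  qed
  have int: "integrable (M \<Otimes>\<^sub>M lborel) (\<lambda>(x, w). enn2real (K x w) * L w)"
  proof (rule integrableI_bounded)
    show "(\<lambda>(x, w). enn2real (K x w) * L w) \<in> borel_measurable (M \<Otimes>\<^sub>M lborel)"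
      unfolding case_prod_beta by measurable
    have "(\<integral>\<^sup>+p. ennreal (norm (case p of (x, w) \<Rightarrow> enn2real (K x w) * L w)) \<partial>(M \<Otimes>\<^sub>M lborel)) \<le>
      (\<integral>\<^sup>+p. ennreal B' * (K (fst p) (snd p) * indicator (ball z0 r) (snd p)) \<partial>(M \<Otimes>\<^sub>M lborel))"
    proof (rule nn_integral_mono)
      fix p :: "'a \<times> complex"
      obtain x w where p: "p = (x, w)" by fastforce
      have "ennreal (norm (enn2real (K x w) * L w)) \<le> ennreal B' * (K x w * indicator (ball z0 r) w)"
      proof (cases "w \<in> ball z0 r \<and> K x w \<noteq> top")
        case True
        then have "ennreal (norm (enn2real (K x w) * L w)) = ennreal \<bar>L w\<bar> * K x w"
          by (simp add: abs_mult ennreal_mult' mult.commute less_top)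
        also have "\<dots> \<le> ennreal B' * K x w" using LB by (intro mult_right_mono ennreal_leI) auto
        finally show ?thesis using True by simp
      qed (auto simp: supp)
      then show "ennreal (norm (case p of (x, w) \<Rightarrow> enn2real (K x w) * L w)) \<le> ennreal B' * (K (fst p) (snd p) * indicator (ball z0 r) (snd p))"
        by (simp add: p)
    qed
    also have "\<dots> = (\<integral>\<^sup>+w. \<integral>\<^sup>+x. ennreal B' * (K x w * indicator (ball z0 r) w) \<partial>M \<partial>lborel)"
      by (subst P.nn_integral_snd[symmetric]) auto
    also have "\<dots> = (\<integral>\<^sup>+w. ennreal B' * (pot w * indicator (ball z0 r) w) \<partial>lborel)"
      unfolding pot_def K_def by (intro nn_integral_cong, subst nn_integral_cmult, measurable, subst nn_integral_multc, measurable)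
    also have "\<dots> = ennreal B' * (\<integral>\<^sup>+w. pot w * indicator (ball z0 r) w \<partial>lborel)"
      by (rule nn_integral_cmult) measurable
    also have "\<dots> < \<infinity>"
      using pot_locally_integrable[OF z0, of r] by (auto simp: ennreal_mult_less_top)
    finally show "(\<integral>\<^sup>+p. ennreal (norm (case p of (x, w) \<Rightarrow> enn2real (K x w) * L w)) \<partial>(M \<Otimes>\<^sub>M lborel)) < \<infinity>" .
  qed
  have intw: "integrable lborel (\<lambda>w. \<integral>x. enn2real (K x w) * L w \<partial>M)"
    by (rule P.integrable_snd[OF int])
  have i1: "integrable lborel (\<lambda>w. (c + fs_potential w) * L w)"
    by (rule integrable_bounded_support[of _ T]) (auto intro!: continuous_intros cL continuous_fs_potential simp: L0)
  have i2: "integrable lborel (\<lambda>w. fs_potential w * L w)"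
    by (rule integrable_bounded_support[of _ T]) (auto intro!: continuous_intros cL continuous_fs_potential simp: L0)
  have i3: "integrable lborel L" by (rule integrable_bounded_support[OF cL L0])
  have iG: "integrable M (\<lambda>x. if \<beta> x \<noteq> 0 then g (\<alpha> x / \<beta> x) else 0)"
    by (rule integrable_const_bound[of _ B]) (use B(1) order_trans[OF abs_ge_zero] in \<open>auto intro!: AE_I2\<close>)
  have "(\<integral>w. real_of_ereal (v w) * L w \<partial>lborel) = (\<integral>w. (c + fs_potential w) * L w - (\<integral>x. enn2real (K x w) * L w \<partial>M) \<partial>lborel)"
  proof (rule integral_cong_AE)
    show "(\<lambda>w. real_of_ereal (v w) * L w) \<in> borel_measurable lborel"
      unfolding v_def by measurable
    show "(\<lambda>w. (c + fs_potential w) * L w - (\<integral>x. enn2real (K x w) * L w \<partial>M)) \<in> borel_measurable lborel"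
      using intw by measurable
    show "AE w in lborel. real_of_ereal (v w) * L w = (c + fs_potential w) * L w - (\<integral>x. enn2real (K x w) * L w \<partial>M)"
      using finpot
    proof eventually_elim
      case (elim w)
      show ?case
      proof (cases "w \<in> ball z0 r")
        case True
        then have f: "pot w < \<infinity>" using elim by simp
        have "(\<integral>x. enn2real (K x w) \<partial>M) = enn2real (pot w)"
        proof -
          have ne: "AE x in M. K x w \<noteq> \<infinity>"
            using f unfolding pot_def K_def by (intro nn_integral_PInf_AE) auto
          have "(\<integral>x. enn2real (K x w) \<partial>M) = enn2real (\<integral>\<^sup>+x. ennreal (enn2real (K x w)) \<partial>M)"
            by (rule integral_eq_nn_integral) (auto simp: K_def)
          also have "(\<integral>\<^sup>+x. ennreal (enn2real (K x w)) \<partial>M) = pot w"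
            unfolding pot_def using ne by (intro nn_integral_cong_AE) (auto simp: K_def less_top)
          finally show ?thesis .
        qed
        moreover have "real_of_ereal (v w) = c + fs_potential w - enn2real (pot w)"
          using f by (cases "pot w") (auto simp: v_def enn2ereal_ennreal)
        ultimately show ?thesis by (simp add: left_diff_distrib)
      qed (simp add: supp)
    qed
  qed
  also have "\<dots> = (\<integral>w. (c + fs_potential w) * L w \<partial>lborel) - (\<integral>w. (\<integral>x. enn2real (K x w) * L w \<partial>M) \<partial>lborel)"
    by (rule Bochner_Integration.integral_diff[OF i1 intw])
  also have "(\<integral>w. (\<integral>x. enn2real (K x w) * L w \<partial>M) \<partial>lborel) = (\<integral>x. (\<integral>w. enn2real (K x w) * L w \<partial>lborel) \<partial>M)"
    by (rule P.Fubini_integral[OF int])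
  also have "\<dots> = (\<integral>x. (\<integral>w. fs_potential w * L w \<partial>lborel) - (if \<beta> x \<noteq> 0 then g (\<alpha> x / \<beta> x) else 0) \<partial>M)"
    unfolding K_def L_def kernel_integral[OF g] ..
  also have "\<dots> = (\<integral>w. fs_potential w * L w \<partial>lborel) - (\<integral>w. g w \<partial>mass)"
    using iG by (simp add: integral_mass prob_space)
  also have "(\<integral>w. (c + fs_potential w) * L w \<partial>lborel) = (\<integral>w. fs_potential w * L w \<partial>lborel)"
    using i2 i3 IL by (simp add: distrib_right)
  finally show "(\<integral>w. g w \<partial>mass) = (\<integral>w. real_of_ereal (v w) * (laplacian g w / (2 * pi)) \<partial>lborel)"
    by (simp add: L_def)
qed

end

section \<open>Measures carried by polar sets\<close>

lemma circ_neglog_outside: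
  assumes w: "cmod B < cmod A" and T: "cmod A + cmod B \<le> T"
  shows "(\<integral>\<^sup>+\<theta>. neglog (cmod (A - B * cis \<theta>) / T) \<partial>circ) = ennreal (2 * pi) * neglog (cmod A / T)"
proof -
  interpret C: finite_measure circ by (rule finite_measure_circ)
  have T0: "T > 0" using w T norm_ge_zero[of B] by linarith
  have A: "A \<noteq> 0" using w by auto
  have nz: "A - B * cis \<theta> \<noteq> 0" for \<theta>
    using w by (metis eq_iff_diff_eq_0 less_irrefl mult.right_neutral norm_cis norm_mult)
  have le: "cmod (A - B * cis \<theta>) \<le> T" for \<theta>
    using T norm_triangle_ineq4[of A "B * cis \<theta>"] by (simp add: norm_mult)
  have lnle: "ln (cmod (A - B * cis \<theta>)) \<le> ln T" for \<theta>
    using nz le by (intro ln_mono) auto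
  have "(\<integral>\<^sup>+\<theta>. neglog (cmod (A - B * cis \<theta>) / T) \<partial>circ) = (\<integral>\<^sup>+\<theta>. ennreal (ln T - ln (cmod (A - B * cis \<theta>))) \<partial>circ)"
    using nz T0 by (intro nn_integral_cong) (simp add: neglog_def ln_div not_le divide_le_0_iff)
  also have "\<dots> = ennreal (\<integral>\<theta>. ln T - ln (cmod (A - B * cis \<theta>)) \<partial>circ)"
    using circ_mean_ln_outside(1)[OF w] lnle by (intro nn_integral_eq_integral) auto
  also have "(\<integral>\<theta>. ln T - ln (cmod (A - B * cis \<theta>)) \<partial>circ) = 2 * pi * (ln T - ln (cmod A))"
    using circ_mean_ln_outside[OF w] emeasure_circ
    by (subst Bochner_Integration.integral_diff) (auto simp: measure_def right_diff_distrib)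
  also have "ennreal \<dots> = ennreal (2 * pi) * neglog (cmod A / T)"
    using A T0 by (simp add: neglog_def ln_div not_le divide_le_0_iff ennreal_mult' del: ennreal_mult'')
  finally show ?thesis .
qed

text \<open>Newton's theorem in the plane. As the disc is open, the point \<open>z\<close> may lie
  on its boundary: every circle inside still has the pole strictly outside.\<close>

lemma disc_mean_neglog:
  assumes r: "0 \<le> r" "r \<le> cmod (z - p)" and T: "cmod (z - p) + r \<le> T"
  shows "(\<integral>\<^sup>+w. neglog (cmod (z - w) / T) * indicator (ball p r) w \<partial>lborel) = ennreal (pi * r\<^sup>2) * neglog (cmod (z - p) / T)"
proof (cases "r = 0")
  case False
  let ?f = "\<lambda>w. neglog (cmod (z - w) / T)"
  have "ennreal (2 * pi) * (\<integral>\<^sup>+w. ?f w * indicator (ball p r) w \<partial>lborel) =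
     (\<integral>\<^sup>+w. (\<integral>\<^sup>+\<theta>. ?f (p + cis \<theta> * w) \<partial>circ) * indicator (ball 0 r) w \<partial>lborel)"
    by (rule nn_integral_disc) measurable
  also have "\<dots> = (\<integral>\<^sup>+w. ennreal (2 * pi) * neglog (cmod (z - p) / T) * indicator (ball (0::complex) r) w \<partial>lborel)"
  proof (rule nn_integral_cong)
    fix w :: complex
    show "(\<integral>\<^sup>+\<theta>. ?f (p + cis \<theta> * w) \<partial>circ) * indicator (ball 0 r) w = ennreal (2 * pi) * neglog (cmod (z - p) / T) * indicator (ball 0 r) w"
    proof (cases "w \<in> ball 0 r")
      case True
      have e: "z - (p + cis \<theta> * w) = (z - p) - w * cis \<theta>" for \<theta> by (simp add: algebra_simps)
      show ?thesis
        unfolding e using True r T by (subst circ_neglog_outside) auto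
    qed simp
  qed
  also have "\<dots> = ennreal (2 * pi) * neglog (cmod (z - p) / T) * emeasure lborel (ball (0::complex) r)"
    by (rule nn_integral_cmult_indicator) simp
  also have "emeasure lborel (ball (0::complex) r) = ennreal (pi * r\<^sup>2)"
    using r by (simp add: emeasure_ball unit_ball_vol_2)
  finally have "ennreal (2 * pi) * (\<integral>\<^sup>+w. ?f w * indicator (ball p r) w \<partial>lborel) =
     ennreal (2 * pi) * (ennreal (pi * r\<^sup>2) * neglog (cmod (z - p) / T))"
    by (simp add: mult_ac)
  then show ?thesis
    by (subst (asm) ennreal_mult_cancel_left) auto
qed simp

text \<open>
  The number \<open>T\<close> only serves to make the logarithmic kernel nonnegative: the assumption \<open>mean\<close>
  says that the discretised area measure has the potential of a point mass at \<open>0\<close> outside the disc.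
\<close>

locale disc_packing =
  fixes p :: "nat \<Rightarrow> complex" and r :: "nat \<Rightarrow> real" and D :: "nat pmf"
  assumes radius: "\<And>j. j \<in> set_pmf D \<Longrightarrow> 0 < r j \<and> r j < 1/2"
    and inside: "\<And>j. j \<in> set_pmf D \<Longrightarrow> cmod (p j) + r j \<le> 1"
    and weight: "\<And>j. j \<in> set_pmf D \<Longrightarrow> pmf D j = (r j)\<^sup>2"
    and disjoint: "\<And>i j. i \<in> set_pmf D \<Longrightarrow> j \<in> set_pmf D \<Longrightarrow> i \<noteq> j \<Longrightarrow> ball (p i) (r i) \<inter> ball (p j) (r j) = {}"
    and mean: "\<And>z T. cmod z \<ge> 1 \<Longrightarrow> T \<ge> cmod z + 1 \<Longrightarrow>
      (\<integral>\<^sup>+j. neglog (cmod (z - p j) / T) \<partial>measure_pmf D) = neglog (cmod z / T)"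

text \<open>Seen from outside the unit disc, its area measure, those of the packing discs, and the
  masses at their centres all have the logarithmic potentials that Newton's theorem gives. Null sets
  being invisible to area, the countable sum reproduces the mass at 0.\<close>

lemma disc_packing_exists: "\<exists>p r D. disc_packing p r D"
proof -
  \<comment> \<open>Radii below 1/2 give every disc a relative area below 1/4. This drives the
    convergence of the random points, the absence of atoms and the decay of the cell masses.\<close>
  define K where "K = {(a :: complex, s :: real). 0 < s \<and> s < 1/2 \<and> ball a s \<subseteq> ball 0 1}"
  have "\<exists>i. i \<in> K \<and> x \<in> ball (fst i) (snd i) \<and> snd i < d" if x: "x \<in> ball 0 1" and d: "0 < d" for x d
  proof -
    obtain e where "e > 0" "ball x e \<subseteq> ball 0 1" using open_ball x by (rule openE)
    then show ?thesis using d
      by (intro exI[of _ "(x, min e (min (d/2) (1/4)))"]) (auto simp: K_def)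
  qed
  then obtain I where I: "countable I" "I \<subseteq> K"
     "pairwise (\<lambda>i j. disjnt (ball (fst i) (snd i)) (ball (fst j) (snd j))) I"
     "negligible (ball 0 1 - (\<Union>i\<in>I. ball (fst i) (snd i)))"
    using Vitali_covering_theorem_balls[of "ball 0 1" K fst snd] by blast
  \<comment> \<open>The packing discs are numbered, so that a sequence of choices is a stream of
    natural numbers.\<close>
  define J where "J = to_nat_on I ` I"
  define p where "p j = fst (from_nat_into I j)" for j
  define r where "r j = snd (from_nat_into I j)" for j
  have inI: "from_nat_into I j \<in> I" if "j \<in> J" for j
    using that I(1) by (auto simp: J_def)
  have inj: "inj_on (from_nat_into I) J"
    using I(1) by (auto simp: J_def inj_on_def)
  define B where "B j = ball (p j) (r j)" for j
  have UB: "(\<Union>j\<in>J. B j) = (\<Union>i\<in>I. ball (fst i) (snd i))"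
    using I(1) by (auto simp: J_def B_def p_def r_def)
  have r: "0 < r j" "r j < 1/2" "B j \<subseteq> ball 0 1" if "j \<in> J" for j
    using subsetD[OF I(2) inI[OF that]] by (simp_all add: K_def r_def p_def B_def case_prod_beta)
  have disj: "B i \<inter> B j = {}" if "i \<in> J" "j \<in> J" "i \<noteq> j" for i j
  proof -
    have "from_nat_into I i \<noteq> from_nat_into I j" using inj that by (auto simp: inj_on_def)
    then show ?thesis using I(3) inI that by (auto simp: pairwise_def disjnt_def B_def p_def r_def)
  qed
  have null: "ball 0 1 - (\<Union>j\<in>J. B j) \<in> null_sets lborel"
  proof -
    have "ball 0 1 - (\<Union>j\<in>J. B j) \<in> sets borel" by (intro sets.Diff borel_open) (auto simp: B_def)
    then show ?thesis
      using I(4) by (auto simp: UB negligible_iff_null_sets null_sets_completion_iff)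
  qed
  have decomp: "(\<integral>\<^sup>+w. f w * indicator (ball 0 1) w \<partial>lborel) = (\<integral>\<^sup>+j. (\<integral>\<^sup>+w. f w * indicator (B j) w \<partial>lborel) \<partial>count_space J)"
    if [measurable]: "f \<in> borel_measurable borel" for f :: "complex \<Rightarrow> ennreal"
  proof -
    have "(\<integral>\<^sup>+w. f w * indicator (ball 0 1) w \<partial>lborel) = (\<integral>\<^sup>+w. f w * indicator (\<Union>j\<in>J. B j) w \<partial>lborel)"
    proof (rule nn_integral_cong_AE)
      show "AE w in lborel. f w * indicator (ball 0 1) w = f w * indicator (\<Union>j\<in>J. B j) w"
        using AE_not_in[OF null]
      proof eventually_elim
        case (elim w)
        have "w \<in> (\<Union>j\<in>J. B j) \<longleftrightarrow> w \<in> ball 0 1" using elim r(3) by blast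
        then show ?case by (simp add: indicator_def)
      qed
    qed
    also have "\<dots> = (\<integral>\<^sup>+w. (\<integral>\<^sup>+j. f w * indicator (B j) w \<partial>count_space J) \<partial>lborel)"
    proof (rule nn_integral_cong)
      fix w
      have "indicator (\<Union>j\<in>J. B j) w = (\<integral>\<^sup>+j. indicator (B j) w \<partial>count_space J)"
      proof -
        have "(\<integral>\<^sup>+j. indicator (B j) w \<partial>count_space J) = (\<integral>\<^sup>+j. indicator {j \<in> J. w \<in> B j} j \<partial>count_space J)"
          by (intro nn_integral_cong) (auto simp: indicator_def)
        also have "\<dots> = emeasure (count_space J) {j \<in> J. w \<in> B j}"
          by (rule nn_integral_indicator) auto
        also have "\<dots> = indicator (\<Union>j\<in>J. B j) w"
        proof (cases "w \<in> (\<Union>j\<in>J. B j)")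
          case True
          then obtain j where j: "j \<in> J" "w \<in> B j" by blast
          then have "{j \<in> J. w \<in> B j} = {j}" using disj by blast
          then show ?thesis using True j by simp
        next
          case False
          then have "{j \<in> J. w \<in> B j} = {}" by blast
          then show ?thesis using False by (simp only: emeasure_empty) simp
        qed
        finally show ?thesis ..
      qed
      then show "f w * indicator (\<Union>j\<in>J. B j) w = (\<integral>\<^sup>+j. f w * indicator (B j) w \<partial>count_space J)"
        by (simp add: nn_integral_cmult)
    qed
    also have "\<dots> = (\<integral>\<^sup>+j. (\<integral>\<^sup>+w. f w * indicator (B j) w \<partial>lborel) \<partial>count_space J)"
      by (rule nn_integral_count_space_nn_integral) (auto simp: B_def J_def I(1))
    finally show ?thesis .
  qed
  have areaB: "emeasure lborel (B j) = ennreal (pi * (r j)\<^sup>2)" if "j \<in> J" for j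
    using r[OF that] by (simp add: B_def emeasure_ball unit_ball_vol_2)
  have "ennreal pi * 1 = ennreal pi * (\<integral>\<^sup>+j. ennreal ((r j)\<^sup>2) \<partial>count_space J)"
  proof -
    have "ennreal pi = (\<integral>\<^sup>+w. 1 * indicator (ball (0::complex) 1) w \<partial>lborel)"
      by (simp add: emeasure_ball unit_ball_vol_2)
    also have "\<dots> = (\<integral>\<^sup>+j. (\<integral>\<^sup>+w. 1 * indicator (B j) w \<partial>lborel) \<partial>count_space J)"
      by (rule decomp) simp
    also have "\<dots> = (\<integral>\<^sup>+j. ennreal pi * ennreal ((r j)\<^sup>2) \<partial>count_space J)"
    proof (rule nn_integral_cong)
      fix j assume "j \<in> space (count_space J)"
      then have "(\<integral>\<^sup>+w. 1 * indicator (B j) w \<partial>lborel) = emeasure lborel (B j)" by (simp add: B_def)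
      also have "\<dots> = ennreal pi * ennreal ((r j)\<^sup>2)" using areaB \<open>j \<in> _\<close> by (simp add: ennreal_mult')
      finally show "(\<integral>\<^sup>+w. 1 * indicator (B j) w \<partial>lborel) = ennreal pi * ennreal ((r j)\<^sup>2)" .
    qed
    also have "\<dots> = ennreal pi * (\<integral>\<^sup>+j. ennreal ((r j)\<^sup>2) \<partial>count_space J)"
      by (rule nn_integral_cmult) simp
    finally show ?thesis by simp
  qed
  then have sum1: "(\<integral>\<^sup>+j. ennreal ((r j)\<^sup>2) \<partial>count_space J) = 1"
    by (subst (asm) ennreal_mult_cancel_left) auto
  \<comment> \<open>The area of a packing disc relative to the unit disc is the square of its
    radius.\<close>
  define q where "q j = (if j \<in> J then (r j)\<^sup>2 else 0)" for j
  have q1: "(\<integral>\<^sup>+j. ennreal (q j) \<partial>count_space UNIV) = 1"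
    unfolding sum1[symmetric] by (subst nn_integral_count_space_indicator)
      (auto simp: q_def indicator_def intro!: nn_integral_cong)
  define D where "D = embed_pmf q"
  have pmfD: "pmf D j = q j" for j
    unfolding D_def by (rule pmf_embed_pmf) (auto simp: q_def q1[unfolded q_def])
  have setD: "set_pmf D = J"
    using r(1) by (force simp: set_pmf_eq pmfD q_def)
  have nnD: "(\<integral>\<^sup>+j. f j \<partial>measure_pmf D) = (\<integral>\<^sup>+j. ennreal ((r j)\<^sup>2) * f j \<partial>count_space J)" for f
    unfolding nn_integral_measure_pmf
    by (subst (2) nn_integral_count_space_indicator)
       (auto simp: pmfD q_def indicator_def intro!: nn_integral_cong)
  have "disc_packing p r D"
  proof
    show "0 < r j \<and> r j < 1/2" if "j \<in> set_pmf D" for j using r that setD by auto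
    show in1: "cmod (p j) + r j \<le> 1" if "j \<in> set_pmf D" for j
    proof -
      have j: "j \<in> J" using that setD by simp
      have "cball (p j) (r j) \<subseteq> cball 0 1"
        using r[OF j] closure_mono[of "B j" "ball 0 1"] by (simp add: B_def)
      then show ?thesis using r[OF j] by (simp add: cball_subset_cball_iff)
    qed
    show "pmf D j = (r j)\<^sup>2" if "j \<in> set_pmf D" for j using that setD by (simp add: pmfD q_def)
    show "ball (p i) (r i) \<inter> ball (p j) (r j) = {}" if "i \<in> set_pmf D" "j \<in> set_pmf D" "i \<noteq> j" for i j
      using disj[of i j] that setD by (simp add: B_def)
    fix z :: complex and T :: real
    assume z: "cmod z \<ge> 1" and T: "T \<ge> cmod z + 1"
    have T0: "T > 0" using z T by linarith
    have "ennreal pi * neglog (cmod z / T) = (\<integral>\<^sup>+w. neglog (cmod (z - w) / T) * indicator (ball 0 1) w \<partial>lborel)"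
      using disc_mean_neglog[of 1 z 0 T] z T by simp
    also have "\<dots> = (\<integral>\<^sup>+j. (\<integral>\<^sup>+w. neglog (cmod (z - w) / T) * indicator (B j) w \<partial>lborel) \<partial>count_space J)"
      by (rule decomp) measurable
    also have "\<dots> = (\<integral>\<^sup>+j. ennreal pi * (ennreal ((r j)\<^sup>2) * neglog (cmod (z - p j) / T)) \<partial>count_space J)"
    proof (rule nn_integral_cong)
      fix j assume "j \<in> space (count_space J)"
      then have j: "j \<in> J" by simp
      have i: "cmod (p j) + r j \<le> 1" using in1 j setD by simp
      have "cmod z \<le> cmod (z - p j) + cmod (p j)" by (metis diff_add_cancel norm_triangle_ineq)
      then have a: "r j \<le> cmod (z - p j)" using i z by linarith
      have b: "cmod (z - p j) + r j \<le> T" using i T norm_triangle_ineq4[of z "p j"] by linarith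
      have "(\<integral>\<^sup>+w. neglog (cmod (z - w) / T) * indicator (B j) w \<partial>lborel) = ennreal (pi * (r j)\<^sup>2) * neglog (cmod (z - p j) / T)"
        unfolding B_def using r[OF j] by (intro disc_mean_neglog a b) simp
      then show "(\<integral>\<^sup>+w. neglog (cmod (z - w) / T) * indicator (B j) w \<partial>lborel) = ennreal pi * (ennreal ((r j)\<^sup>2) * neglog (cmod (z - p j) / T))"
        by (simp add: ennreal_mult' mult_ac)
    qed
    also have "\<dots> = ennreal pi * (\<integral>\<^sup>+j. neglog (cmod (z - p j) / T) \<partial>measure_pmf D)"
      unfolding nnD by (rule nn_integral_cmult) simp
    finally show "(\<integral>\<^sup>+j. neglog (cmod (z - p j) / T) \<partial>measure_pmf D) = neglog (cmod z / T)"
      by (subst (asm) ennreal_mult_cancel_left) auto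
  qed
  then show ?thesis by blast
qed

text \<open>
  A cell of mass \<open>m\<close> is contracted by this factor: its diameter \<open>d\<close> then satisfies
  \<open>m * ln (1 / d) \<ge> 1 / m\<close>, which is unbounded along nested cells.
\<close>

definition shrink :: "real \<Rightarrow> real" where
  "shrink m = exp (- (1 / m\<^sup>2))"

lemma shrink_bounds: "0 < shrink m" "shrink m \<le> 1" "m \<noteq> 0 \<Longrightarrow> shrink m < 1"
  by (auto simp: shrink_def)

section \<open>The random point and its approximations\<close>

context disc_packing
begin

abbreviation S :: "nat stream measure" where
  "S \<equiv> stream_space (measure_pmf D)"

definition good :: "nat stream \<Rightarrow> bool" where
  "good s \<longleftrightarrow> (\<forall>n. s !! n \<in> set_pmf D)"

lemma good_SCons [simp]: "good (i ## s) \<longleftrightarrow> i \<in> set_pmf D \<and> good s"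
  unfolding good_def by (auto, metis snth.simps(1) stream.sel(1), metis snth.simps(2) stream.sel(2),
      metis not0_implies_Suc snth.simps stream.sel)

lemma prob_space_S: "prob_space S"
  by (rule prob_space.prob_space_stream_space[OF measure_pmf.prob_space_axioms])

lemma space_S [simp]: "space S = UNIV"
  by (simp add: space_stream_space)

lemma measurable_snth_count [measurable]: "(\<lambda>s. s !! n) \<in> S \<rightarrow>\<^sub>M count_space UNIV"
  using measurable_snth[of n "measure_pmf D"] by (simp cong: measurable_cong_sets)

lemma nn_integral_S:
  assumes [measurable]: "f \<in> borel_measurable S"
  shows "(\<integral>\<^sup>+s. f s \<partial>S) = (\<integral>\<^sup>+i. (\<integral>\<^sup>+s. f (i ## s) \<partial>S) \<partial>measure_pmf D)"
  by (rule prob_space.nn_integral_stream_space[OF measure_pmf.prob_space_axioms]) measurable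

lemma AE_good: "AE s in S. good s"
proof -
  have "AE s in S. stream_all (\<lambda>i. i \<in> set_pmf D) s"
    by (rule prob_space.AE_stream_all[OF measure_pmf.prob_space_axioms]) (auto intro: AE_pmfI)
  then show ?thesis by (simp add: good_def sset_range)
qed

lemma measurable_good [measurable]: "Measurable.pred S good"
  unfolding good_def[abs_def] by measurable

text \<open>The parameter \<open>m\<close> is the mass of the current cell. Entering a subcell
  multiplies it by the relative area, and the contraction there depends on the new mass, so the
  recursion cannot be run with a fixed similarity factor.\<close>

primrec X :: "nat \<Rightarrow> real \<Rightarrow> nat stream \<Rightarrow> complex" where
  "X 0 m s = 0"
| "X (Suc k) m s = p (shd s) + complex_of_real (r (shd s) * shrink (m * (r (shd s))\<^sup>2)) * X k (m * (r (shd s))\<^sup>2) (stl s)"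

lemma measurable_X [measurable]: "X k m \<in> borel_measurable S"
proof (induction k arbitrary: m)
  case 0
  then show ?case by simp
next
  case (Suc k)
  note [measurable] = Suc
  have "(\<lambda>s. (\<lambda>i s. p i + complex_of_real (r i * shrink (m * (r i)\<^sup>2)) * X k (m * (r i)\<^sup>2) (stl s)) (shd s) s) \<in> borel_measurable S"
    by (rule measurable_compose_countable) measurable
  then show ?case by simp
qed

lemma scale_bounds:
  assumes "i \<in> set_pmf D"
  shows "0 < r i * shrink m" "r i * shrink m \<le> r i" "r i * shrink m \<le> 1/2"
proof -
  show "0 < r i * shrink m" using radius[OF assms] shrink_bounds(1) by simp
  show "r i * shrink m \<le> r i" using radius[OF assms] shrink_bounds[of m] by (simp add: mult_left_le)
  then show "r i * shrink m \<le> 1/2" using radius[OF assms] by linarith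
qed

lemma norm_scale:
  assumes "i \<in> set_pmf D"
  shows "cmod (complex_of_real (r i * shrink m) * x) = (r i * shrink m) * cmod x"
  using scale_bounds(1)[OF assms, of m] by (simp only: norm_mult norm_of_real abs_of_pos)

lemma affine_in_disc:
  assumes "i \<in> set_pmf D" "cmod x \<le> 1"
  shows "cmod (p i + complex_of_real (r i * shrink m) * x) \<le> 1"
proof -
  have "cmod (p i + complex_of_real (r i * shrink m) * x) \<le> cmod (p i) + (r i * shrink m) * cmod x"
    using norm_triangle_ineq[of "p i" "complex_of_real (r i * shrink m) * x"]
    unfolding norm_scale[OF assms(1)] .
  also have "(r i * shrink m) * cmod x \<le> r i * 1"
    using scale_bounds[OF assms(1), of m] assms(2) radius[OF assms(1)] by (intro mult_mono) auto
  finally show ?thesis using inside[OF assms(1)] by linarith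
qed

lemma good_shd_stl: "good s \<Longrightarrow> shd s \<in> set_pmf D \<and> good (stl s)"
  using good_SCons[of "shd s" "stl s"] by simp

lemma X_norm: "good s \<Longrightarrow> cmod (X k m s) \<le> 1"
proof (induction k arbitrary: m s)
  case (Suc k)
  then show ?case using good_shd_stl[OF Suc.prems] by (auto intro!: affine_in_disc simp del: of_real_mult)
qed simp

text \<open>Every letter contracts by a factor at most 1/2, because radii are below 1/2 and
  \<open>shrink\<close> is at most 1. The approximations are therefore Cauchy sequences on good
  streams.\<close>

lemma X_step: "good s \<Longrightarrow> cmod (X (Suc k) m s - X k m s) \<le> (1/2) ^ k"
proof (induction k arbitrary: m s)
  case 0
  have "cmod (p (shd s)) \<le> 1"
    using inside[of "shd s"] radius[of "shd s"] good_shd_stl[OF 0] by force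
  then show ?case by simp
next
  case (Suc k)
  define i where "i = shd s"
  define m' where "m' = m * (r i)\<^sup>2"
  have i: "i \<in> set_pmf D" "good (stl s)" using good_shd_stl[OF Suc.prems] by (auto simp: i_def)
  have "X (Suc (Suc k)) m s - X (Suc k) m s = complex_of_real (r i * shrink m') * (X (Suc k) m' (stl s) - X k m' (stl s))"
    by (simp add: i_def m'_def algebra_simps del: of_real_mult)
  then have "cmod (X (Suc (Suc k)) m s - X (Suc k) m s) = (r i * shrink m') * cmod (X (Suc k) m' (stl s) - X k m' (stl s))"
    by (simp only: norm_scale[OF i(1)])
  also have "\<dots> \<le> 1/2 * (1/2) ^ k"
    using scale_bounds[OF i(1), of m'] Suc.IH[OF i(2), of m'] by (intro mult_mono) auto
  finally show ?case by simp
qed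

definition Xlim :: "real \<Rightarrow> nat stream \<Rightarrow> complex" where
  "Xlim m s = lim (\<lambda>k. X k m s)"

lemma measurable_Xlim [measurable]: "Xlim m \<in> borel_measurable S"
  unfolding Xlim_def[abs_def] by measurable

lemma X_tendsto: "good s \<Longrightarrow> (\<lambda>k. X k m s) \<longlonglongrightarrow> Xlim m s"
proof -
  assume g: "good s"
  have "summable (\<lambda>k. X (Suc k) m s - X k m s)"
    by (rule summable_comparison_test'[where g="\<lambda>k. (1/2) ^ k" and N=0])
       (use X_step[OF g] in \<open>auto intro: summable_geometric simp del: X.simps\<close>)
  then have "(\<lambda>k. \<Sum>j<k. X (Suc j) m s - X j m s) \<longlonglongrightarrow> (\<Sum>k. X (Suc k) m s - X k m s)"
    by (rule summable_LIMSEQ)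
  then have "(\<lambda>k. X k m s - X 0 m s) \<longlonglongrightarrow> (\<Sum>k. X (Suc k) m s - X k m s)"
    by (simp only: sum_lessThan_telescope[of "\<lambda>k. X k m s"])
  then have "convergent (\<lambda>k. X k m s)" by (auto simp: convergent_def)
  then show ?thesis unfolding Xlim_def by (simp add: convergent_LIMSEQ_iff)
qed

lemma Xlim_norm: "good s \<Longrightarrow> cmod (Xlim m s) \<le> 1"
  using X_norm by (intro LIMSEQ_le_const2[OF tendsto_norm[OF X_tendsto]]) auto

lemma Xlim_SCons:
  assumes "i \<in> set_pmf D" "good s"
  shows "Xlim m (i ## s) = p i + complex_of_real (r i * shrink (m * (r i)\<^sup>2)) * Xlim (m * (r i)\<^sup>2) s"
proof -
  have "(\<lambda>k. X (Suc k) m (i ## s)) \<longlonglongrightarrow> Xlim m (i ## s)"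
    using X_tendsto[of "i ## s" m] assms by (intro LIMSEQ_Suc) auto
  moreover have "(\<lambda>k. X (Suc k) m (i ## s)) \<longlonglongrightarrow> p i + complex_of_real (r i * shrink (m * (r i)\<^sup>2)) * Xlim (m * (r i)\<^sup>2) s"
    by (simp del: of_real_mult) (intro tendsto_intros X_tendsto assms)
  ultimately show ?thesis by (rule LIMSEQ_unique)
qed

text \<open>Given the first letter, the rest is a copy scaled by \<open>b\<close> around
  \<open>p i\<close>. Since b \<le> r i and \<open>z\<close> lies outside the packing disc, the
  rescaled point (z - p i)/b again has modulus at least 1, so by induction the copy acts as a mass
  at \<open>p i\<close>. The contraction thus leaves the outer potential alone, and
  \<open>mean\<close> replaces the centres by the origin.\<close>

lemma X_mean:
  assumes "cmod z \<ge> 1" "T \<ge> cmod z + 1"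
  shows "(\<integral>\<^sup>+s. neglog (cmod (z - X k m s) / T) \<partial>S) = neglog (cmod z / T)"
  using assms
proof (induction k arbitrary: m z T)
  case 0
  interpret prob_space S by (rule prob_space_S)
  show ?case using emeasure_space_1 by simp
next
  case (Suc k)
  have "(\<integral>\<^sup>+s. neglog (cmod (z - X (Suc k) m s) / T) \<partial>S) =
      (\<integral>\<^sup>+i. (\<integral>\<^sup>+s. neglog (cmod (z - X (Suc k) m (i ## s)) / T) \<partial>S) \<partial>measure_pmf D)"
    by (rule nn_integral_S) measurable
  also have "\<dots> = (\<integral>\<^sup>+i. neglog (cmod (z - p i) / T) \<partial>measure_pmf D)"
  proof (rule nn_integral_cong_AE, rule AE_pmfI)
    fix i assume i: "i \<in> set_pmf D"
    define m' where "m' = m * (r i)\<^sup>2"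
    define b where "b = r i * shrink m'"
    have b: "0 < b" "b \<le> r i" using scale_bounds[OF i] by (auto simp: b_def)
    have pz: "cmod z \<le> cmod (z - p i) + cmod (p i)" by (metis diff_add_cancel norm_triangle_ineq)
    have a: "r i \<le> cmod (z - p i)" using inside[OF i] Suc.prems pz by linarith
    have t: "cmod (z - p i) + b \<le> T"
      using inside[OF i] Suc.prems norm_triangle_ineq4[of z "p i"] b by linarith
    have bz: "cmod ((z - p i) / complex_of_real b) = cmod (z - p i) / b"
      using b by (simp add: norm_divide)
    have "(\<integral>\<^sup>+s. neglog (cmod (z - X (Suc k) m (i ## s)) / T) \<partial>S) =
       (\<integral>\<^sup>+s. neglog (cmod ((z - p i) / complex_of_real b - X k m' s) / (T / b)) \<partial>S)"
    proof (rule nn_integral_cong)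
      fix s
      have "z - X (Suc k) m (i ## s) = complex_of_real b * ((z - p i) / complex_of_real b - X k m' s)"
        using b by (simp add: b_def[symmetric] m'_def[symmetric] right_diff_distrib diff_divide_distrib del: of_real_mult)
      then have "cmod (z - X (Suc k) m (i ## s)) / T = cmod ((z - p i) / complex_of_real b - X k m' s) / (T / b)"
        using b by (simp add: norm_mult)
      then show "neglog (cmod (z - X (Suc k) m (i ## s)) / T) = neglog (cmod ((z - p i) / complex_of_real b - X k m' s) / (T / b))"
        by (rule arg_cong[where f=neglog])
    qed
    also have "\<dots> = neglog (cmod ((z - p i) / complex_of_real b) / (T / b))"
    proof (rule Suc.IH)
      show "1 \<le> cmod ((z - p i) / complex_of_real b)" unfolding bz using a b by simp
      show "cmod ((z - p i) / complex_of_real b) + 1 \<le> T / b" unfolding bz using divide_right_mono[OF t, of b] b by (simp add: add_divide_distrib)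
    qed
    also have "cmod ((z - p i) / complex_of_real b) / (T / b) = cmod (z - p i) / T"
      unfolding bz using b by simp
    finally show "(\<integral>\<^sup>+s. neglog (cmod (z - X (Suc k) m (i ## s)) / T) \<partial>S) = neglog (cmod (z - p i) / T)" .
  qed
  also have "\<dots> = neglog (cmod z / T)" by (rule mean[OF Suc.prems])
  finally show ?case .
qed

text \<open>Unlike for the approximations, |z| > 1 is strict here: the gap |z| - 1 bounds the
  distance to all approximations from below and provides the majorant for the passage to the
  limit.\<close>

lemma Xlim_mean:
  assumes z: "cmod z > 1" and T: "T \<ge> cmod z + 1"
  shows "(\<integral>\<^sup>+s. neglog (cmod (z - Xlim m s) / T) \<partial>S) = neglog (cmod z / T)"
proof -
  interpret prob_space S by (rule prob_space_S)
  have T0: "T > 0" using z T by linarith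
  have "(\<lambda>k. \<integral>\<^sup>+s. neglog (cmod (z - X k m s) / T) \<partial>S) \<longlonglongrightarrow> (\<integral>\<^sup>+s. neglog (cmod (z - Xlim m s) / T) \<partial>S)"
  proof (rule nn_integral_dominated_convergence[where w="\<lambda>_. neglog ((cmod z - 1) / T)"])
    show "(\<integral>\<^sup>+s. neglog ((cmod z - 1) / T) \<partial>S) < \<infinity>"
      using z T0 emeasure_space_1 by (simp add: neglog_def not_le divide_le_0_iff)
    show "AE s in S. neglog (cmod (z - X k m s) / T) \<le> neglog ((cmod z - 1) / T)" for k
      using AE_good
    proof eventually_elim
      case (elim s)
      have "cmod z - 1 \<le> cmod (z - X k m s)"
        using X_norm[OF elim, of k m] norm_triangle_ineq2[of z "X k m s"] by linarith
      then show ?case using T0 by (intro antimono_neglog divide_right_mono) auto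
    qed
    show "AE s in S. (\<lambda>k. neglog (cmod (z - X k m s) / T)) \<longlonglongrightarrow> neglog (cmod (z - Xlim m s) / T)"
      using AE_good
    proof eventually_elim
      case (elim s)
      have "(\<lambda>k. cmod (z - X k m s) / T) \<longlonglongrightarrow> cmod (z - Xlim m s) / T"
        using T0 by (intro tendsto_intros X_tendsto elim) auto
      then show ?case by (intro continuous_on_tendsto_compose[OF continuous_neglog]) auto
    qed
  qed measurable
  moreover have "(\<integral>\<^sup>+s. neglog (cmod (z - X k m s) / T) \<partial>S) = neglog (cmod z / T)" for k
    using z T by (intro X_mean) auto
  ultimately show ?thesis by (simp add: LIMSEQ_const_iff)
qed

text \<open>A point belongs to at most one open packing disc, which is chosen with probability at
  most 1/4. Since \<open>m > 0\<close> the contraction is strict, so the limit stays inside the open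
  disc that was chosen and cannot be reached from a neighbour along the boundary. Each level gains a
  factor 1/4.\<close>

lemma Xlim_no_atom_aux:
  assumes "m > 0"
  shows "(\<integral>\<^sup>+s. indicator {x} (Xlim m s) \<partial>S) \<le> ennreal ((1/4) ^ n)"
  using assms
proof (induction n arbitrary: m x)
  case 0
  interpret prob_space S by (rule prob_space_S)
  have "(\<integral>\<^sup>+s. indicator {x} (Xlim m s) \<partial>S) \<le> (\<integral>\<^sup>+s. 1 \<partial>S)"
    by (intro nn_integral_mono) (auto simp: indicator_def)
  then show ?case using emeasure_space_1 by simp
next
  case (Suc n)
  define g where "g i = (\<integral>\<^sup>+s. indicator {x} (Xlim m (i ## s)) \<partial>S :: ennreal)" for i
  have g1: "g i \<le> ennreal ((1/4) ^ n) \<and> (x \<notin> ball (p i) (r i) \<longrightarrow> g i = 0)" if i: "i \<in> set_pmf D" for i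
  proof -
    define m' where "m' = m * (r i)\<^sup>2"
    define b where "b = r i * shrink m'"
    have m': "m' > 0" using Suc.prems radius[OF i] by (simp add: m'_def)
    have b: "0 < b" "b < r i" using scale_bounds(1)[OF i] shrink_bounds(3)[of m'] m' radius[OF i] by (auto simp: b_def)
    have eq: "AE s in S. (indicator {x} (Xlim m (i ## s)) :: ennreal) = indicator {(x - p i) / complex_of_real b} (Xlim m' s)"
      using AE_good
    proof eventually_elim
      case (elim s)
      have "Xlim m (i ## s) = p i + complex_of_real b * Xlim m' s"
        using Xlim_SCons[OF i elim, of m] by (simp add: b_def m'_def)
      then have "Xlim m (i ## s) = x \<longleftrightarrow> Xlim m' s = (x - p i) / complex_of_real b"
        using b by (auto simp: field_simps)
      then show ?case by (auto simp: indicator_def)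
    qed
    have geq: "g i = (\<integral>\<^sup>+s. indicator {(x - p i) / complex_of_real b} (Xlim m' s) \<partial>S)"
      unfolding g_def by (rule nn_integral_cong_AE[OF eq])
    have "g i = 0" if "x \<notin> ball (p i) (r i)"
    proof -
      have "AE s in S. (indicator {(x - p i) / complex_of_real b} (Xlim m' s) :: ennreal) = 0"
        using AE_good
      proof eventually_elim
        case (elim s)
        have "cmod ((x - p i) / complex_of_real b) > 1"
          using that b by (simp add: norm_divide dist_norm norm_minus_commute)
        then have "Xlim m' s \<noteq> (x - p i) / complex_of_real b" using Xlim_norm[OF elim, of m'] by auto
        then show ?case by simp
      qed
      then show ?thesis unfolding geq by (subst nn_integral_0_iff_AE) auto
    qed
    then show ?thesis using Suc.IH[OF m', of "(x - p i) / complex_of_real b"] by (auto simp: geq)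
  qed
  have "(\<integral>\<^sup>+s. indicator {x} (Xlim m s) \<partial>S) = (\<integral>\<^sup>+i. g i \<partial>measure_pmf D)"
    unfolding g_def by (rule nn_integral_S) measurable
  also have "\<dots> \<le> ennreal ((1/4) ^ Suc n)"
  proof (cases "\<exists>i\<in>set_pmf D. x \<in> ball (p i) (r i)")
    case True
    then obtain i where i: "i \<in> set_pmf D" "x \<in> ball (p i) (r i)" by blast
    have "(\<integral>\<^sup>+i. g i \<partial>measure_pmf D) \<le> (\<integral>\<^sup>+j. ennreal ((1/4) ^ n) * indicator {i} j \<partial>measure_pmf D)"
    proof (rule nn_integral_mono_AE, rule AE_pmfI)
      fix j assume j: "j \<in> set_pmf D"
      show "g j \<le> ennreal ((1/4) ^ n) * indicator {i} j"
        using g1[OF j] disjoint[OF i(1) j] i(2) by (cases "i = j") auto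
    qed
    also have "\<dots> = ennreal ((1/4) ^ n) * ennreal (pmf D i)"
      by (subst nn_integral_cmult_indicator) (auto simp: emeasure_pmf_single)
    also have "\<dots> \<le> ennreal ((1/4) ^ n) * ennreal (1/4)"
    proof (intro mult_left_mono ennreal_leI)
      have "(r i)\<^sup>2 \<le> (1/2)\<^sup>2" using radius[OF i(1)] by (intro power_mono) auto
      then show "pmf D i \<le> 1/4" using weight[OF i(1)] by (simp add: power2_eq_square)
    qed simp
    also have "\<dots> = ennreal ((1/4) ^ Suc n)" by (simp add: ennreal_mult'[symmetric] mult.commute del: ennreal_power)
    finally show ?thesis .
  next
    case False
    then have "(\<integral>\<^sup>+i. g i \<partial>measure_pmf D) = (\<integral>\<^sup>+i. 0 \<partial>measure_pmf D)"
      using g1 by (intro nn_integral_cong_AE AE_pmfI) auto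
    then show ?thesis by simp
  qed
  finally show ?case .
qed

lemma Xlim_no_atom:
  assumes "m > 0"
  shows "(\<integral>\<^sup>+s. indicator {x} (Xlim m s) \<partial>S) = 0"
proof -
  have "(\<lambda>n. ennreal ((1/4) ^ n)) \<longlonglongrightarrow> ennreal 0"
    by (intro tendsto_ennrealI LIMSEQ_realpow_zero) auto
  then have "(\<integral>\<^sup>+s. indicator {x} (Xlim m s) \<partial>S) \<le> ennreal 0"
    by (rule LIMSEQ_le_const) (use Xlim_no_atom_aux[OF assms] in auto)
  then show ?thesis by simp
qed

end

text \<open>\<open>K_polar\<close> asks for the potential of the restriction to \<open>K k\<close>
  to be infinite at every point of \<open>K k\<close>, not just almost everywhere; only then does it
  block maxima from approaching \<open>K k\<close>. The bound on \<open>T\<close> reflects that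
  points of the disc of radius \<open>s\<close> have mutual distance at most 2 s.\<close>

locale polar_measure = prob_space \<mu> for \<mu> :: "complex measure" +
  fixes K :: "nat \<Rightarrow> complex set" and s :: real
  assumes radius_pos: "s > 0"
    and sets_mu [measurable_cong, simp]: "sets \<mu> = sets borel"
    and supp: "emeasure \<mu> (- cball 0 s) = 0"
    and mean_mu: "\<And>z T. cmod z > s \<Longrightarrow> T \<ge> cmod z + s \<Longrightarrow>
      (\<integral>\<^sup>+x. neglog (cmod (z - x) / T) \<partial>\<mu>) = neglog (cmod z / T)"
    and atomless: "\<And>x. emeasure \<mu> {x} = 0"
    and compact_K: "\<And>k. compact (K k)"
    and incseq_K: "incseq K"
    and K_tendsto: "(\<lambda>k. emeasure \<mu> (K k)) \<longlonglongrightarrow> 1"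
    and K_polar: "\<And>k z T. z \<in> K k \<Longrightarrow> T \<ge> 2 * s \<Longrightarrow> (\<integral>\<^sup>+x. indicator (K k) x * neglog (cmod (z - x) / T) \<partial>\<mu>) = \<infinity>"

section \<open>Cells indexed by finite words, and the compact polar sets\<close>

context disc_packing
begin

primrec wmass :: "real \<Rightarrow> nat list \<Rightarrow> real" where
  "wmass m [] = m"
| "wmass m (i # w) = wmass (m * (r i)\<^sup>2) w"

primrec wsize :: "real \<Rightarrow> nat list \<Rightarrow> real" where
  "wsize m [] = 1"
| "wsize m (i # w) = (r i * shrink (m * (r i)\<^sup>2)) * wsize (m * (r i)\<^sup>2) w"

primrec wcentre :: "real \<Rightarrow> nat list \<Rightarrow> complex" where
  "wcentre m [] = 0"
| "wcentre m (i # w) = p i + complex_of_real (r i * shrink (m * (r i)\<^sup>2)) * wcentre (m * (r i)\<^sup>2) w"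

lemma good_shift: "set w \<subseteq> set_pmf D \<Longrightarrow> good s \<Longrightarrow> good (w @- s)"
  by (induction w) auto

text \<open>Self-similarity: behind a prefix \<open>w\<close> the construction starts afresh, only
  with the mass of the cell of \<open>w\<close>. This is why the initial mass is a
  parameter.\<close>

lemma Xlim_shift:
  assumes "set w \<subseteq> set_pmf D" "good s"
  shows "Xlim m (w @- s) = wcentre m w + complex_of_real (wsize m w) * Xlim (wmass m w) s"
  using assms
proof (induction w arbitrary: m)
  case (Cons i w)
  then have "Xlim m ((i # w) @- s) = p i + complex_of_real (r i * shrink (m * (r i)\<^sup>2)) * Xlim (m * (r i)\<^sup>2) (w @- s)"
    by (simp add: Xlim_SCons good_shift del: of_real_mult)
  with Cons show ?case by (simp add: algebra_simps)
qed simp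

lemma wmass_bounds:
  assumes "set w \<subseteq> set_pmf D" "m > 0"
  shows "0 < wmass m w \<and> wmass m w \<le> m * (1/4) ^ length w"
  using assms
proof (induction w arbitrary: m)
  case (Cons i w)
  have r: "0 < r i" "r i < 1/2" using Cons.prems radius by auto
  have "(r i)\<^sup>2 \<le> (1/2)\<^sup>2" using r by (intro power_mono) auto
  then have r2: "m * (r i)\<^sup>2 \<le> m * (1/4)" using Cons.prems by (simp add: power2_eq_square)
  have "wmass (m * (r i)\<^sup>2) w \<le> (m * (r i)\<^sup>2) * (1/4) ^ length w" "0 < wmass (m * (r i)\<^sup>2) w"
    using Cons.IH[of "m * (r i)\<^sup>2"] Cons.prems r by auto
  moreover have "(m * (r i)\<^sup>2) * (1/4) ^ length w \<le> (m * (1/4)) * (1/4) ^ length w"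
    using r2 by (intro mult_right_mono) auto
  ultimately show ?case by simp
qed simp

text \<open>The last letter contributes \<open>shrink\<close> of the mass of the cell itself, and
  all other factors are at most 1. The empty word has no such factor.\<close>

lemma wsize_bounds:
  assumes "set w \<subseteq> set_pmf D" "m > 0"
  shows "0 < wsize m w \<and> wsize m w \<le> 1 \<and> (w \<noteq> [] \<longrightarrow> wsize m w \<le> shrink (wmass m w))"
  using assms
proof (induction w arbitrary: m)
  case (Cons i w)
  define m' where "m' = m * (r i)\<^sup>2"
  define b where "b = r i * shrink m'"
  have i: "i \<in> set_pmf D" using Cons.prems by auto
  have m': "m' > 0" using radius[OF i] Cons.prems by (simp add: m'_def)
  have b: "0 < b" "b \<le> 1" using scale_bounds[OF i, of m'] by (auto simp: b_def)
  have bs: "b \<le> shrink m'" using radius[OF i] shrink_bounds[of m'] by (simp add: b_def mult_left_le_one_le)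
  have IH: "0 < wsize m' w" "wsize m' w \<le> 1" "w \<noteq> [] \<longrightarrow> wsize m' w \<le> shrink (wmass m' w)"
    using Cons.IH[OF _ m'] Cons.prems by auto
  have e: "wsize m (i # w) = b * wsize m' w" "wmass m (i # w) = wmass m' w" by (simp_all add: b_def m'_def)
  have "b * wsize m' w \<le> shrink (wmass m' w)"
  proof (cases "w = []")
    case True
    then show ?thesis using bs by simp
  next
    case False
    have "b * wsize m' w \<le> wsize m' w" using b IH by (simp add: mult_left_le_one_le)
    then show ?thesis using IH(3) False by linarith
  qed
  moreover have "b * wsize m' w \<le> 1" using b IH by (simp add: mult_le_one)
  ultimately show ?case unfolding e using b IH by simp
qed simp

text \<open>The prefix \<open>w\<close> has probability \<open>wmass m w / m\<close>; the left side
  is the part of the integral that comes from the streams beginning with it.\<close>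

lemma nn_integral_shift_le:
  assumes "set w \<subseteq> set_pmf D" "m \<ge> 0" "f \<in> borel_measurable S"
  shows "ennreal (wmass m w) * (\<integral>\<^sup>+s. f (w @- s) \<partial>S) \<le> ennreal m * (\<integral>\<^sup>+s. f s \<partial>S)"
  using assms
proof (induction w arbitrary: m f)
  case (Cons i w)
  note [measurable] = Cons.prems(3)
  have i: "i \<in> set_pmf D" using Cons.prems by auto
  have "ennreal (wmass m (i # w)) * (\<integral>\<^sup>+s. f ((i # w) @- s) \<partial>S) \<le> ennreal (m * (r i)\<^sup>2) * (\<integral>\<^sup>+s. f (i ## s) \<partial>S)"
    using Cons.IH[of "m * (r i)\<^sup>2" "\<lambda>s. f (i ## s)"] Cons.prems by simp
  also have "\<dots> = ennreal m * ((\<integral>\<^sup>+s. f (i ## s) \<partial>S) * ennreal (pmf D i))"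
    using weight[OF i] Cons.prems by (simp add: ennreal_mult' mult_ac)
  also have "(\<integral>\<^sup>+s. f (i ## s) \<partial>S) * ennreal (pmf D i) = (\<integral>\<^sup>+j. (\<integral>\<^sup>+s. f (i ## s) \<partial>S) * indicator {i} j \<partial>measure_pmf D)"
    by (subst nn_integral_cmult_indicator) (auto simp: emeasure_pmf_single)
  also have "\<dots> \<le> (\<integral>\<^sup>+j. (\<integral>\<^sup>+s. f (j ## s) \<partial>S) \<partial>measure_pmf D)"
    by (intro nn_integral_mono) (auto simp: indicator_def)
  also have "\<dots> = (\<integral>\<^sup>+s. f s \<partial>S)" by (rule nn_integral_S[symmetric]) measurable
  finally show ?case by (simp add: mult_left_mono)
qed simp

lemma nn_integral_snth: "(\<integral>\<^sup>+s. h (s !! n) \<partial>S) = (\<integral>\<^sup>+i. h i \<partial>measure_pmf D)"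
proof (induction n)
  case 0
  interpret prob_space S by (rule prob_space_S)
  have "(\<integral>\<^sup>+s. h (s !! 0) \<partial>S) = (\<integral>\<^sup>+i. (\<integral>\<^sup>+s. h ((i ## s) !! 0) \<partial>S) \<partial>measure_pmf D)"
    by (rule nn_integral_S) (rule measurable_compose[OF measurable_snth_count], simp)
  then show ?case using emeasure_space_1 by simp
next
  case (Suc n)
  have "(\<integral>\<^sup>+s. h (s !! Suc n) \<partial>S) = (\<integral>\<^sup>+i. (\<integral>\<^sup>+s. h ((i ## s) !! Suc n) \<partial>S) \<partial>measure_pmf D)"
    by (rule nn_integral_S) (rule measurable_compose[OF measurable_snth_count], simp)
  then show ?case using Suc by simp
qed

text \<open>Infinitely many cells on one level would not form a closed set. Finite alphabets repair
  this, and the geometric bounds on what they omit are summable over the positions of a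
  stream.\<close>

lemma truncation_exists:
  obtains F :: "nat \<Rightarrow> nat set" where "\<And>n. finite (F n)" "\<And>n. F n \<subseteq> set_pmf D"
    "\<And>m n. m \<le> n \<Longrightarrow> F m \<subseteq> F n" "\<And>n. emeasure (measure_pmf D) (- F n) \<le> ennreal ((1/2) ^ (n + 2))"
proof -
  have "\<exists>N. emeasure (measure_pmf D) {N..} \<le> ennreal ((1/2) ^ (n + 2))" for n :: nat
  proof -
    have "(\<lambda>N. emeasure (measure_pmf D) {N..}) \<longlonglongrightarrow> emeasure (measure_pmf D) (\<Inter>N. {N..})"
      by (rule Lim_emeasure_decseq) (auto simp: decseq_def)
    moreover have "(\<Inter>N::nat. {N..}) = {}"
    proof -
      have "x \<notin> {Suc x..}" for x :: nat by simp
      then show ?thesis by blast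
    qed
    ultimately have "(\<lambda>N. emeasure (measure_pmf D) {N..}) \<longlonglongrightarrow> 0" by simp
    then have "\<forall>\<^sub>F N in sequentially. emeasure (measure_pmf D) {N..} < ennreal ((1/2) ^ (n + 2))"
      by (rule order_tendstoD(2)) (simp del: ennreal_power)
    then obtain N where "\<forall>n'\<ge>N. emeasure (measure_pmf D) {n'..} < ennreal ((1/2) ^ (n + 2))"
      unfolding eventually_sequentially by blast
    then have "emeasure (measure_pmf D) {N..} < ennreal ((1/2) ^ (n + 2))" by blast
    then show ?thesis by (intro exI[of _ N]) (rule less_imp_le)
  qed
  then have "\<forall>n. \<exists>N. emeasure (measure_pmf D) {N..} \<le> ennreal ((1/2) ^ (n + 2))" by (rule allI)
  then have "\<exists>N. \<forall>n. emeasure (measure_pmf D) {N n..} \<le> ennreal ((1/2) ^ (n + 2))" by (rule choice)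
  then obtain N where N: "\<forall>n. emeasure (measure_pmf D) {N n..} \<le> ennreal ((1/2) ^ (n + 2))" by (rule exE)
  \<comment> \<open>Partial sums of the thresholds make the alphabets increasing in
    \<open>n\<close>.\<close>
  define F where "F n = set_pmf D \<inter> {..<(\<Sum>j\<le>n. N j)}" for n
  show thesis
  proof (rule that[of F])
    fix n
    have "N n \<le> (\<Sum>j\<le>n. N j)" by (rule member_le_sum) auto
    then have "emeasure (measure_pmf D) (- F n) \<le> emeasure (measure_pmf D) ({N n..} \<union> - set_pmf D)"
      by (intro emeasure_mono) (auto simp: F_def)
    also have "\<dots> = emeasure (measure_pmf D) {N n..}"
    proof (rule emeasure_Un_null_set)
      have "emeasure (measure_pmf D) {x \<in> space (measure_pmf D). x \<notin> set_pmf D} = 0"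
        by (rule emeasure_eq_0_AE, rule AE_pmfI) simp
      then show "- set_pmf D \<in> null_sets (measure_pmf D)"
        by (simp add: null_sets_def Compl_eq)
    qed simp
    finally show "emeasure (measure_pmf D) (- F n) \<le> ennreal ((1/2) ^ (n + 2))"
      by (rule order_trans) (use N in blast)
    show "finite (F n)" "F n \<subseteq> set_pmf D" by (auto simp: F_def)
  next
    fix m n :: nat assume "m \<le> n"
    then have "(\<Sum>j\<le>m. N j) \<le> (\<Sum>j\<le>n. N j)" by (intro sum_mono2) auto
    then show "F m \<subseteq> F n" by (auto simp: F_def)
  qed
qed

text \<open>The potential is infinite at a point of \<open>K k\<close> because the point lies in, or
  on the boundary of, a cell of every level. The cell of a word has mass \<open>a\<close>, diameter
  at most twice \<open>shrink a\<close>, and keeps at least half of its mass after the truncation,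
  so it alone contributes a multiple of 1/a.\<close>

lemma polar_measure_exists: "\<exists>\<mu> K. polar_measure \<mu> K 1"
proof -
  interpret SP: prob_space S by (rule prob_space_S)
  obtain F :: "nat \<Rightarrow> nat set" where F: "\<And>n. finite (F n)" "\<And>n. F n \<subseteq> set_pmf D"
    "\<And>m n. m \<le> n \<Longrightarrow> F m \<subseteq> F n" "\<And>n. emeasure (measure_pmf D) (- F n) \<le> ennreal ((1/2) ^ (n + 2))"
    by (rule truncation_exists) (rule that)
  \<comment> \<open>The alphabets are shifted by \<open>k\<close>: enlarging \<open>k\<close> loses
    less mass, and a word of length \<open>n\<close> allowed for \<open>k\<close>, followed by a
    stream of \<open>A (k + n)\<close>, lies again in \<open>A k\<close>, since position 0 of the
    tail becomes position \<open>n\<close>.\<close>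
  define A where "A k = {s. \<forall>i. s !! i \<in> F (i + k)}" for k
  have [measurable]: "A k \<in> sets S" for k
  proof -
    have "Measurable.pred S (\<lambda>s. \<forall>i. s !! i \<in> F (i + k))" by measurable
    then show ?thesis by (simp add: A_def pred_def)
  qed
  have Agood: "s \<in> A k \<Longrightarrow> good s" for s k using F(2) by (auto simp: A_def good_def)
  have Acomp: "emeasure S (- A k) \<le> ennreal ((1/2) ^ (k + 1))" for k
  proof -
    have m: "{s. s !! i \<notin> F (i + k)} \<in> sets S" for i
    proof -
      have "Measurable.pred S (\<lambda>s. s !! i \<notin> F (i + k))" by measurable
      then show ?thesis by (simp add: pred_def)
    qed
    have "emeasure S (- A k) = emeasure S (\<Union>i. {s. s !! i \<notin> F (i + k)})"
      by (rule arg_cong[where f="emeasure S"]) (auto simp: A_def)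
    also have "\<dots> \<le> (\<Sum>i. emeasure S {s. s !! i \<notin> F (i + k)})"
      by (rule emeasure_subadditive_countably) (use m in auto)
    also have "\<dots> \<le> (\<Sum>i. ennreal ((1/2) ^ (k + 2) * (1/2) ^ i))"
    proof (rule suminf_le)
      fix i
      have "emeasure S {s. s !! i \<notin> F (i + k)} = (\<integral>\<^sup>+s. indicator {s. s !! i \<notin> F (i + k)} s \<partial>S)"
        using m[of i] by (rule nn_integral_indicator[symmetric])
      also have "\<dots> = (\<integral>\<^sup>+s. indicator (- F (i + k)) (s !! i) \<partial>S)"
        by (intro nn_integral_cong) (simp add: indicator_def)
      also have "\<dots> = emeasure (measure_pmf D) (- F (i + k))"
        by (subst nn_integral_snth) simp
      finally show "emeasure S {s. s !! i \<notin> F (i + k)} \<le> ennreal ((1/2) ^ (k + 2) * (1/2) ^ i)"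
        using F(4)[of "i + k"] by (simp add: power_add mult_ac del: ennreal_power)
    qed auto
    also have "\<dots> = ennreal (\<Sum>i. (1/2) ^ (k + 2) * (1/2) ^ i)"
      by (rule suminf_ennreal2) (auto intro!: summable_mult summable_geometric)
    also have "(\<Sum>i. (1/2::real) ^ (k + 2) * (1/2) ^ i) = (1/2) ^ (k + 1)"
      by (subst suminf_mult) (auto simp: suminf_geometric summable_geometric)
    finally show ?thesis .
  qed
  have Aprob: "emeasure S (A k) \<ge> ennreal (1 - (1/2) ^ (k + 1))" for k
  proof -
    have "1 = emeasure S (A k \<union> - A k)" using SP.emeasure_space_1 by simp
    also have "\<dots> \<le> emeasure S (A k) + emeasure S (- A k)"
      using sets.compl_sets[of "A k" S] by (intro emeasure_subadditive) (auto simp: Compl_eq_Diff_UNIV)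
    also have "\<dots> \<le> emeasure S (A k) + ennreal ((1/2) ^ (k + 1))" by (intro add_left_mono Acomp)
    finally have "1 \<le> ennreal (SP.prob (A k) + (1/2) ^ (k + 1))"
      by (simp add: SP.emeasure_eq_measure ennreal_plus[symmetric] del: ennreal_plus ennreal_power)
    then have "1 - (1/2) ^ (k + 1) \<le> SP.prob (A k)" by (simp add: del: ennreal_plus)
    then show ?thesis by (simp add: SP.emeasure_eq_measure ennreal_leI)
  qed
  define W where "W k n = {w. length w = n \<and> (\<forall>j<n. w ! j \<in> F (j + k))}" for k n
  have finW: "finite (W k n)" for k n
  proof (rule finite_subset)
    show "W k n \<subseteq> {w. set w \<subseteq> F (n + k) \<and> length w = n}"
    proof safe
      fix w x assume w: "w \<in> W k n" "x \<in> set w"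
      then obtain j where j: "j < n" "x = w ! j" by (auto simp: W_def in_set_conv_nth)
      then show "x \<in> F (n + k)" using w F(3)[of "j + k" "n + k"] by (auto simp: W_def)
    qed (auto simp: W_def)
    show "finite {w. set w \<subseteq> F (n + k) \<and> length w = n}" using F(1) by (rule finite_lists_length_eq)
  qed
  have Wset: "w \<in> W k n \<Longrightarrow> set w \<subseteq> set_pmf D" for w k n
    using F(2) by (fastforce simp: W_def in_set_conv_nth)
  define K where "K k = (\<Inter>n. \<Union>w\<in>W k n. cball (wcentre 1 w) (wsize 1 w))" for k
  have Kclosed: "closed (K k)" for k
    unfolding K_def using finW by (intro closed_INT ballI closed_UN) auto
  have K1: "K k \<subseteq> cball 0 1" for k
  proof -
    have "K k \<subseteq> (\<Union>w\<in>W k 0. cball (wcentre 1 w) (wsize 1 w))" unfolding K_def by blast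
    also have "W k 0 = {[]}" by (auto simp: W_def)
    finally show ?thesis by simp
  qed
  have Kcomp: "compact (K k)" for k
    using Kclosed K1 bounded_subset[OF bounded_cball] compact_eq_bounded_closed by blast
  have XK: "Xlim 1 s \<in> K k" if s: "s \<in> A k" for s k
    unfolding K_def
  proof (intro INT_I UN_I)
    fix n
    show w: "stake n s \<in> W k n" using s by (auto simp: W_def A_def)
    have g: "good (sdrop n s)" using Agood[OF s] by (auto simp: good_def sdrop_snth)
    have e: "Xlim 1 s = wcentre 1 (stake n s) + complex_of_real (wsize 1 (stake n s)) * Xlim (wmass 1 (stake n s)) (sdrop n s)"
      using Xlim_shift[OF Wset[OF w] g, of 1] by (simp add: stake_sdrop)
    have "cmod (complex_of_real (wsize 1 (stake n s)) * Xlim (wmass 1 (stake n s)) (sdrop n s)) \<le> wsize 1 (stake n s) * 1"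
      using wsize_bounds[OF Wset[OF w], of 1] Xlim_norm[OF g]
      by (simp only: norm_mult norm_of_real) (intro mult_mono, auto)
    then show "Xlim 1 s \<in> cball (wcentre 1 (stake n s)) (wsize 1 (stake n s))"
      unfolding e by (simp add: dist_norm)
  qed
  have polar: "(\<integral>\<^sup>+s. indicator (A k) s * neglog (cmod (z - Xlim 1 s) / T) \<partial>S) = \<infinity>"
    if z: "z \<in> K k" and T: "T \<ge> 2" for z k T
  proof -
    \<comment> \<open>With \<open>a\<close> the mass of the level-n cell near \<open>z\<close>, the
      kernel is at least 1/a^2 on its limit points, as 2 \<sigma> \<le> T * shrink a. The streams of
      \<open>A (k + n)\<close> behind the word have probability at least 1/2, and a * (1/a^2) *
      (1/2) \<ge> 4^n / 2 because a \<le> 4^(-n). The bound on the size of a cell requires a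
      nonempty word, hence n > 0.\<close>
    have lb: "ennreal (4 ^ n / 2) \<le> (\<integral>\<^sup>+s. indicator (A k) s * neglog (cmod (z - Xlim 1 s) / T) \<partial>S)" if n: "n > 0" for n
    proof -
      have "z \<in> (\<Union>w\<in>W k n. cball (wcentre 1 w) (wsize 1 w))" using z unfolding K_def by blast
      then obtain w where w: "w \<in> W k n" "cmod (z - wcentre 1 w) \<le> wsize 1 w"
        by (auto simp: dist_norm norm_minus_commute)
      note ws = Wset[OF w(1)]
      have len: "length w = n" using w by (simp add: W_def)
      define a where "a = wmass 1 w"
      define \<sigma> where "\<sigma> = wsize 1 w"
      have a: "0 < a" "a \<le> (1/4) ^ n" using wmass_bounds[OF ws, of 1] len by (auto simp: a_def)
      have \<sigma>: "0 < \<sigma>" "\<sigma> \<le> shrink a" using wsize_bounds[OF ws, of 1] len n by (auto simp: \<sigma>_def a_def)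
      let ?f = "\<lambda>s. indicator (A k) s * neglog (cmod (z - Xlim 1 s) / T)"
      have "ennreal (4 ^ n / 2) \<le> ennreal (a * ((1 / a\<^sup>2) * (1/2)))"
      proof (rule ennreal_leI)
        have "4 ^ n \<le> 1 / a" using a by (simp add: field_simps)
        then show "4 ^ n / 2 \<le> a * ((1 / a\<^sup>2) * (1/2))" using a by (simp add: power2_eq_square)
      qed
      also have "\<dots> = ennreal a * (ennreal (1 / a\<^sup>2) * ennreal (1/2))"
        using a by (subst ennreal_mult[symmetric], simp, simp, subst ennreal_mult[symmetric]) auto
      also have "\<dots> \<le> ennreal a * (ennreal (1 / a\<^sup>2) * emeasure S (A (k + n)))"
      proof (intro mult_left_mono)
        have "(1/2::real) ^ (k + n) \<le> 1" by (intro power_le_one) auto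
        then have "ennreal (1/2) \<le> ennreal (1 - (1/2) ^ (k + n + 1))" by (intro ennreal_leI) simp
        then show "ennreal (1/2) \<le> emeasure S (A (k + n))" using Aprob[of "k + n"] by (rule order_trans)
      qed auto
      also have "ennreal (1 / a\<^sup>2) * emeasure S (A (k + n)) = (\<integral>\<^sup>+s. ennreal (1 / a\<^sup>2) * indicator (A (k + n)) s \<partial>S)"
        by (subst nn_integral_cmult_indicator) auto
      also have "\<dots> \<le> (\<integral>\<^sup>+s. ?f (w @- s) \<partial>S)"
      proof (rule nn_integral_mono)
        fix s
        show "ennreal (1 / a\<^sup>2) * indicator (A (k + n)) s \<le> ?f (w @- s)"
        proof (cases "s \<in> A (k + n)")
          case True
          have inA: "w @- s \<in> A k" unfolding A_def
          proof (intro CollectI allI)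
            fix i
            show "(w @- s) !! i \<in> F (i + k)"
            proof (cases "i < n")
              case True
              then show ?thesis using w(1) len by (simp add: W_def shift_snth_less)
            next
              case False
              have "s !! (i - n) \<in> F (i - n + (k + n))" using \<open>s \<in> A (k + n)\<close> by (auto simp: A_def)
              then show ?thesis using False len by (simp add: shift_snth_ge)
            qed
          qed
          have g: "good s" using Agood[OF True] .
          have "cmod (z - Xlim 1 (w @- s)) \<le> 2 * \<sigma>"
          proof -
            have "z - Xlim 1 (w @- s) = (z - wcentre 1 w) - complex_of_real \<sigma> * Xlim a s"
              using Xlim_shift[OF ws g, of 1] by (simp add: \<sigma>_def a_def)
            then have "cmod (z - Xlim 1 (w @- s)) \<le> cmod (z - wcentre 1 w) + cmod (complex_of_real \<sigma> * Xlim a s)"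
              using norm_triangle_ineq4 by metis
            also have "cmod (complex_of_real \<sigma> * Xlim a s) \<le> \<sigma> * 1"
              using \<sigma> Xlim_norm[OF g, of a] by (simp only: norm_mult norm_of_real) (intro mult_mono, auto)
            finally show ?thesis using w(2) by (simp add: \<sigma>_def)
          qed
          also have "2 * \<sigma> \<le> T * shrink a" using T \<sigma> by (intro mult_mono) auto
          finally have "cmod (z - Xlim 1 (w @- s)) / T \<le> shrink a" using T by (simp add: field_simps)
          then have "neglog (shrink a) \<le> neglog (cmod (z - Xlim 1 (w @- s)) / T)" by (rule antimono_neglog)
          moreover have "neglog (shrink a) = ennreal (1 / a\<^sup>2)" by (simp add: neglog_def shrink_def not_le)
          ultimately show ?thesis using True inA by simp
        qed simp
      qed
      also have "ennreal a * (\<integral>\<^sup>+s. ?f (w @- s) \<partial>S) \<le> ennreal 1 * (\<integral>\<^sup>+s. ?f s \<partial>S)"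
        unfolding a_def by (rule nn_integral_shift_le[OF ws]) auto
      finally show ?thesis by (simp add: mult_left_mono)
    qed
    show ?thesis
    proof (rule ccontr)
      assume "\<not> ?thesis"
      then obtain c where c: "(\<integral>\<^sup>+s. indicator (A k) s * neglog (cmod (z - Xlim 1 s) / T) \<partial>S) = ennreal c" "c \<ge> 0"
        by (intro that[of "enn2real (\<integral>\<^sup>+s. indicator (A k) s * neglog (cmod (z - Xlim 1 s) / T) \<partial>S)"]) (auto simp: less_top)
      obtain n :: nat where n: "2 * c < 4 ^ n" using real_arch_pow[of 4 "2 * c"] by auto
      have "(0::real) < 4 ^ n" by simp
      then have "c < 4 ^ Suc n / 2" using n unfolding power_Suc by linarith
      moreover have "4 ^ Suc n / 2 \<le> c"
        using lb[of "Suc n"] c by (simp del: power_Suc)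
      ultimately show False by linarith
    qed
  qed
  \<comment> \<open>On the null set of streams that are not good, \<open>lim\<close> has no
    controlled value; it is replaced by 0 so that all values lie in the unit disc.\<close>
  define Y where "Y s = (if good s then Xlim 1 s else 0)" for s
  have [measurable]: "Y \<in> borel_measurable S" unfolding Y_def[abs_def] by measurable
  have Y1: "cmod (Y s) \<le> 1" for s using Xlim_norm by (auto simp: Y_def)
  have AEY: "AE s in S. Y s = Xlim 1 s" using AE_good by eventually_elim (simp add: Y_def)
  define \<mu> where "\<mu> = distr S borel Y"
  have [measurable]: "K k \<in> sets borel" for k using Kclosed by simp
  have nnmu: "(\<integral>\<^sup>+x. h x \<partial>\<mu>) = (\<integral>\<^sup>+s. h (Y s) \<partial>S)" if [measurable]: "h \<in> borel_measurable borel" for h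
    unfolding \<mu>_def by (rule nn_integral_distr) measurable
  have "polar_measure \<mu> K 1"
  proof (intro polar_measure.intro polar_measure_axioms.intro)
    show "prob_space \<mu>" unfolding \<mu>_def by (rule SP.prob_space_distr) measurable
    then interpret M: prob_space \<mu> .
    show "sets \<mu> = sets borel" by (simp add: \<mu>_def)
    have "emeasure \<mu> (- cball 0 1) = emeasure S (Y -` (- cball 0 1) \<inter> space S)"
      unfolding \<mu>_def by (rule emeasure_distr) auto
    also have "Y -` (- cball 0 1) = {}" using Y1 by (auto simp: not_le)
    finally show "emeasure \<mu> (- cball 0 1) = 0" by simp
    show "(\<integral>\<^sup>+x. neglog (cmod (z - x) / T) \<partial>\<mu>) = neglog (cmod z / T)" if "cmod z > 1" "T \<ge> cmod z + 1" for z T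
    proof -
      have "(\<integral>\<^sup>+x. neglog (cmod (z - x) / T) \<partial>\<mu>) = (\<integral>\<^sup>+s. neglog (cmod (z - Y s) / T) \<partial>S)"
        by (rule nnmu) measurable
      also have "\<dots> = (\<integral>\<^sup>+s. neglog (cmod (z - Xlim 1 s) / T) \<partial>S)"
        by (rule nn_integral_cong_AE) (use AEY in eventually_elim, simp)
      finally show ?thesis using Xlim_mean[OF that, of 1] by simp
    qed
    show "emeasure \<mu> {x} = 0" for x
    proof -
      have "emeasure \<mu> {x} = (\<integral>\<^sup>+y. indicator {x} y \<partial>\<mu>)" by (simp add: \<mu>_def)
      also have "\<dots> = (\<integral>\<^sup>+s. indicator {x} (Y s) \<partial>S)" by (rule nnmu) simp
      also have "\<dots> = (\<integral>\<^sup>+s. indicator {x} (Xlim 1 s) \<partial>S)"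
        by (rule nn_integral_cong_AE) (use AEY in eventually_elim, simp)
      finally show ?thesis using Xlim_no_atom[of 1] by simp
    qed
    show "compact (K k)" for k by (rule Kcomp)
    show "incseq K"
    proof (rule incseq_SucI)
      fix k
      have "W k n \<subseteq> W (Suc k) n" for n
        using F(3)[of "j + k" "j + Suc k" for j] by (auto simp: W_def)
      then show "K k \<subseteq> K (Suc k)" unfolding K_def by blast
    qed
    show "(\<lambda>k. emeasure \<mu> (K k)) \<longlonglongrightarrow> 1"
    proof (rule tendsto_sandwich)
      show "\<forall>\<^sub>F k in sequentially. ennreal (1 - (1/2) ^ (k + 1)) \<le> emeasure \<mu> (K k)"
      proof (intro always_eventually allI)
        fix k
        have "emeasure S (A k) \<le> emeasure S (Y -` K k \<inter> space S)"
        proof (rule emeasure_mono)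
          show "A k \<subseteq> Y -` K k \<inter> space S" using XK Agood by (auto simp: Y_def)
        qed (rule measurable_sets[of Y S borel]; measurable)
        also have "\<dots> = emeasure \<mu> (K k)" unfolding \<mu>_def by (rule emeasure_distr[symmetric]) measurable
        finally show "ennreal (1 - (1/2) ^ (k + 1)) \<le> emeasure \<mu> (K k)" using Aprob[of k] by (rule order_trans[rotated])
      qed
      have "(\<lambda>k. (1/2::real) ^ (k + 1)) \<longlonglongrightarrow> 0"
        by (intro LIMSEQ_ignore_initial_segment LIMSEQ_realpow_zero) auto
      then have "(\<lambda>k. ennreal (1 - (1/2) ^ (k + 1))) \<longlonglongrightarrow> ennreal (1 - 0)"
        by (intro tendsto_ennrealI tendsto_diff tendsto_const)
      then show "(\<lambda>k. ennreal (1 - (1/2) ^ (k + 1))) \<longlonglongrightarrow> 1" by simp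
    qed (auto intro!: always_eventually M.emeasure_le_1)
    show "(\<integral>\<^sup>+x. indicator (K k) x * neglog (cmod (z - x) / T) \<partial>\<mu>) = \<infinity>" if "z \<in> K k" "T \<ge> 2 * 1" for k z T
    proof -
      have "\<infinity> = (\<integral>\<^sup>+s. indicator (A k) s * neglog (cmod (z - Xlim 1 s) / T) \<partial>S)" using polar[of z k T] that by simp
      also have "\<dots> \<le> (\<integral>\<^sup>+s. indicator (K k) (Y s) * neglog (cmod (z - Y s) / T) \<partial>S)"
        using XK Agood by (intro nn_integral_mono) (auto simp: indicator_def Y_def)
      also have "\<dots> = (\<integral>\<^sup>+x. indicator (K k) x * neglog (cmod (z - x) / T) \<partial>\<mu>)"
        by (rule nnmu[symmetric]) measurable
      finally show ?thesis by (simp add: top_unique)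
    qed
  qed simp
  then show ?thesis by blast
qed

end

text \<open>The carrier must be small compared with \<open>R\<close> for the potential to be
  negative near it, and two different sizes will provide two different potentials. Dividing both the
  point and \<open>T\<close> by \<open>s\<close> leaves the kernel unchanged.\<close>

lemma polar_measure_scale:
  assumes "polar_measure \<mu> K 1" and s: "s > 0"
  shows "polar_measure (distr \<mu> borel (\<lambda>x. complex_of_real s * x)) (\<lambda>k. (\<lambda>x. complex_of_real s * x) ` K k) s"
proof -
  interpret polar_measure \<mu> K 1 by fact
  define h where "h x = complex_of_real s * x" for x :: complex
  have [measurable]: "h \<in> borel_measurable borel" unfolding h_def by measurable
  then have hm [measurable]: "h \<in> borel_measurable \<mu>" by (simp cong: measurable_cong_sets)
  have inj: "h x = h y \<longleftrightarrow> x = y" for x y using s by (simp add: h_def)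
  have him: "h x \<in> h ` A \<longleftrightarrow> x \<in> A" for x A using inj by (auto simp: image_iff)
  have em: "emeasure (distr \<mu> borel h) (h ` A) = emeasure \<mu> A" if "h ` A \<in> sets borel" for A
  proof -
    have "h -` (h ` A) \<inter> space \<mu> = A" using him by (auto simp: sets_eq_imp_space_eq[OF sets_mu])
    then show ?thesis using emeasure_distr[OF hm that] by simp
  qed
  have nl: "neglog (cmod (z - h x) / T) = neglog (cmod (z / complex_of_real s - x) / (T / s))" for z x T
  proof -
    have "z - h x = complex_of_real s * (z / complex_of_real s - x)" using s by (simp add: h_def right_diff_distrib)
    then have "cmod (z - h x) = s * cmod (z / complex_of_real s - x)" using s by (simp only: norm_mult norm_of_real abs_of_pos)
    then have "cmod (z - h x) / T = cmod (z / complex_of_real s - x) / (T / s)" using s by simp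
    then show ?thesis by (rule arg_cong)
  qed
  have cz: "cmod (z / complex_of_real s) = cmod z / s" for z using s by (simp add: norm_divide)
  have Kb: "h ` K k \<in> sets borel" for k
  proof -
    have "compact (h ` K k)" unfolding h_def by (intro compact_continuous_image continuous_intros compact_K)
    then show ?thesis by (simp add: compact_imp_closed)
  qed
  have "polar_measure (distr \<mu> borel h) (\<lambda>k. h ` K k) s"
  proof (intro polar_measure.intro polar_measure_axioms.intro)
    show "prob_space (distr \<mu> borel h)" by (rule prob_space_distr) measurable
    show "emeasure (distr \<mu> borel h) (- cball 0 s) = 0"
    proof -
      have "emeasure (distr \<mu> borel h) (- cball 0 s) = emeasure \<mu> (h -` (- cball 0 s) \<inter> space \<mu>)"
        by (rule emeasure_distr) auto
      also have "h -` (- cball 0 s) \<inter> space \<mu> = - cball 0 1"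
        using s by (auto simp: sets_eq_imp_space_eq[OF sets_mu] h_def norm_mult)
      finally show ?thesis using supp by simp
    qed
    show "(\<integral>\<^sup>+x. neglog (cmod (z - x) / T) \<partial>distr \<mu> borel h) = neglog (cmod z / T)" if "cmod z > s" "T \<ge> cmod z + s" for z T
    proof -
      have "(\<integral>\<^sup>+x. neglog (cmod (z - x) / T) \<partial>distr \<mu> borel h) = (\<integral>\<^sup>+x. neglog (cmod (z - h x) / T) \<partial>\<mu>)"
        by (rule nn_integral_distr) measurable
      also have "\<dots> = neglog (cmod (z / complex_of_real s) / (T / s))"
        unfolding nl
      proof (rule mean_mu)
        show "1 < cmod (z / complex_of_real s)" unfolding cz using that s by simp
        show "cmod (z / complex_of_real s) + 1 \<le> T / s"
          unfolding cz using divide_right_mono[OF that(2), of s] s by (simp add: add_divide_distrib)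
      qed
      also have "cmod (z / complex_of_real s) / (T / s) = cmod z / T" unfolding cz using s by simp
      finally show ?thesis .
    qed
    show "emeasure (distr \<mu> borel h) {x} = 0" for x
    proof -
      have "h ` {x / complex_of_real s} = {x}" using s by (simp add: h_def)
      then show ?thesis using em[of "{x / complex_of_real s}"] atomless by simp
    qed
    show "compact (h ` K k)" for k unfolding h_def by (intro compact_continuous_image continuous_intros compact_K)
    show "incseq (\<lambda>k. h ` K k)" using incseq_K by (auto simp: incseq_def)
    show "(\<lambda>k. emeasure (distr \<mu> borel h) (h ` K k)) \<longlonglongrightarrow> 1"
      using K_tendsto by (simp add: em[OF Kb])
    show "(\<integral>\<^sup>+x. indicator (h ` K k) x * neglog (cmod (z - x) / T) \<partial>distr \<mu> borel h) = \<infinity>" if zK: "z \<in> h ` K k" and T2: "T \<ge> 2 * s" for k z T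
    proof -
      note [measurable] = Kb
      obtain y where y: "y \<in> K k" "z = h y" using zK by blast
      have zs: "z / complex_of_real s = y" using y s by (simp add: h_def)
      have "(\<integral>\<^sup>+x. indicator (h ` K k) x * neglog (cmod (z - x) / T) \<partial>distr \<mu> borel h) = (\<integral>\<^sup>+x. indicator (h ` K k) (h x) * neglog (cmod (z - h x) / T) \<partial>\<mu>)"
        by (rule nn_integral_distr) measurable
      also have "\<dots> = (\<integral>\<^sup>+x. indicator (K k) x * neglog (cmod (y - x) / (T / s)) \<partial>\<mu>)"
        unfolding nl zs by (intro nn_integral_cong) (simp add: indicator_def him)
      also have "\<dots> = \<infinity>" using T2 s by (intro K_polar y) (simp add: field_simps)
      finally show ?thesis .
    qed
  qed (simp_all add: s)
  then show ?thesis unfolding h_def[abs_def] .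
qed

lemma polar_measure_ex: "s > 0 \<Longrightarrow> \<exists>\<mu> K. polar_measure \<mu> K s"
  using disc_packing_exists disc_packing.polar_measure_exists polar_measure_scale by metis

section \<open>Measures on the projective line\<close>

lemma inv_chart0 [simp]: "inv chart0 (Aff w) = w"
  using inv_f_f[OF inj_chart[of chart0], of w] by (simp add: charts_def chart0_def)

lemma inv_chart [simp]: "chart \<in> charts \<Longrightarrow> inv chart (chart w) = w"
  by (rule inv_f_f[OF inj_chart])

section \<open>Topology and Borel sets through the charts\<close>

lemma open_inverse_vimage:
  fixes B :: "complex set"
  assumes "open B"
  shows "open {z. z \<noteq> 0 \<and> 1 / z \<in> B}"
proof -
  have "open ((- {0}) \<inter> (\<lambda>z. 1 / z) -` B)"
    using assms by (intro continuous_open_preimage continuous_intros) auto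
  also have "(- {0}) \<inter> (\<lambda>z. 1 / z) -` B = {z. z \<noteq> 0 \<and> 1 / z \<in> B}" by auto
  finally show ?thesis .
qed

lemma vimage_charts:
  "chart0 -` (chart0 ` B) = B" "chart1 -` (chart1 ` B) = B"
  "chart1 -` (chart0 ` B) = {z. z \<noteq> 0 \<and> 1 / z \<in> B}" "chart0 -` (chart1 ` B) = {z. z \<noteq> 0 \<and> 1 / z \<in> B}"
proof -
  show "chart0 -` (chart0 ` B) = B" "chart1 -` (chart1 ` B) = B"
    using inj_chart by (auto simp: charts_def inj_vimage_image_eq)
  show "chart1 -` (chart0 ` B) = {z. z \<noteq> 0 \<and> 1 / z \<in> B}"
    by (auto simp: chart0_def chart1_def split: if_splits)
  show "chart0 -` (chart1 ` B) = {z. z \<noteq> 0 \<and> 1 / z \<in> B}"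
  proof (intro set_eqI iffI)
    fix w assume "w \<in> {z. z \<noteq> 0 \<and> 1 / z \<in> B}"
    then have "1 / w \<in> B" "chart0 w = chart1 (1 / w)" by (auto simp: chart0_def chart1_def)
    then show "w \<in> chart0 -` (chart1 ` B)" by blast
  qed (auto simp: chart0_def chart1_def split: if_splits)
qed

lemma open_chart_image: "chart \<in> charts \<Longrightarrow> open B \<Longrightarrow> open (chart ` B)"
  using open_inverse_vimage[of B] by (auto simp: open_cp1_def charts_def vimage_charts)

lemma continuous_on_inv_chart:
  assumes "chart \<in> charts"
  shows "continuous_on (range chart) (inv chart)"
proof -
  have "inv chart -` B \<inter> range chart = chart ` B" for B
    using assms by auto
  then show ?thesis
    using open_chart_image[OF assms] by (simp add: continuous_on_open_vimage[OF open_range_chart[OF assms]])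
qed

lemma chart_measurable [measurable]: "chart0 \<in> borel_measurable borel" "chart1 \<in> borel_measurable borel"
  using continuous_on_chart by (auto intro!: borel_measurable_continuous_onI simp: charts_def)

lemma inv_chart_measurable:
  assumes "chart \<in> charts" "sets \<mu> = sets borel"
  shows "inv chart \<in> borel_measurable (restrict_space \<mu> (range chart))"
proof -
  have "inv chart \<in> borel_measurable (restrict_space borel (range chart))"
    by (rule borel_measurable_continuous_on_restrict[OF continuous_on_inv_chart[OF assms(1)]])
  moreover have "sets (restrict_space \<mu> (range chart)) = sets (restrict_space borel (range chart))"
    using assms(2) by (rule sets_restrict_space_cong)
  ultimately show ?thesis by (simp cong: measurable_cong_sets)
qed

lemma chart_image_borel:
  assumes "chart \<in> charts" "A \<in> sets borel"
  shows "chart ` A \<in> sets borel"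
proof -
  have "inv chart -` A \<inter> space (restrict_space borel (range chart)) \<in> sets (restrict_space borel (range chart))"
    by (rule measurable_sets[OF inv_chart_measurable[OF assms(1) refl] assms(2)])
  also have "inv chart -` A \<inter> space (restrict_space borel (range chart)) = chart ` A"
    using assms by (auto simp: space_restrict_space)
  finally show ?thesis
    using open_range_chart[OF assms(1)] by (auto simp: sets_restrict_space_iff)
qed

lemma emeasure_pullback:
  assumes "chart \<in> charts" "sets \<mu> = sets borel" "A \<in> sets borel"
  shows "emeasure (pullback chart \<mu>) A = emeasure \<mu> (chart ` A)"
proof -
  have sp: "space \<mu> = UNIV" using sets_eq_imp_space_eq[OF assms(2)] by simp
  have "emeasure (pullback chart \<mu>) A = emeasure (restrict_space \<mu> (range chart)) (inv chart -` A \<inter> space (restrict_space \<mu> (range chart)))"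
    unfolding pullback_def by (rule emeasure_distr[OF inv_chart_measurable[OF assms(1,2)] assms(3)])
  also have "inv chart -` A \<inter> space (restrict_space \<mu> (range chart)) = chart ` A"
    using assms(1) by (auto simp: space_restrict_space sp)
  also have "emeasure (restrict_space \<mu> (range chart)) (chart ` A) = emeasure \<mu> (chart ` A)"
    using open_range_chart[OF assms(1)] assms(2) by (intro emeasure_restrict_space) (auto simp: sp)
  finally show ?thesis .
qed

lemma sets_pullback [simp]: "sets (pullback chart \<mu>) = sets borel"
  by (simp add: pullback_def)

text \<open>A Borel set splits into its part in the affine chart and at most the point at infinity,
  which is the origin of the other chart.\<close>

lemma cp1_measure_eqI:
  assumes "sets \<mu> = sets borel" "sets \<nu> = sets borel"
    and "\<And>chart. chart \<in> charts \<Longrightarrow> pullback chart \<mu> = pullback chart \<nu>"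
  shows "\<mu> = \<nu>"
proof (rule measure_eqI)
  fix A assume "A \<in> sets \<mu>"
  then have A: "A \<in> sets borel" using assms by simp
  have c: "chart0 \<in> charts" "chart1 \<in> charts" by (auto simp: charts_def)
  have 0: "chart0 -` A \<in> sets borel" "chart1 -` A \<inter> {0} \<in> sets borel"
    using measurable_sets[OF chart_measurable(1) A] measurable_sets[OF chart_measurable(2) A] by auto
  have e: "A = chart0 ` (chart0 -` A) \<union> chart1 ` (chart1 -` A \<inter> {0})"
  proof safe
    fix x assume "x \<in> A" "x \<notin> chart1 ` (chart1 -` A \<inter> {0})"
    then show "x \<in> chart0 ` (chart0 -` A)"
      by (cases x) (auto simp: chart0_def chart1_def image_iff)
  qed
  have d: "chart0 ` (chart0 -` A) \<inter> chart1 ` (chart1 -` A \<inter> {0}) = {}"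
    by (auto simp: chart0_def chart1_def)
  have "emeasure M A = emeasure (pullback chart0 M) (chart0 -` A) + emeasure (pullback chart1 M) (chart1 -` A \<inter> {0})"
    if M: "sets M = sets borel" for M
  proof -
    have "emeasure M A = emeasure M (chart0 ` (chart0 -` A) \<union> chart1 ` (chart1 -` A \<inter> {0}))"
      by (rule arg_cong[OF e])
    also have "\<dots> = emeasure M (chart0 ` (chart0 -` A)) + emeasure M (chart1 ` (chart1 -` A \<inter> {0}))"
      using chart_image_borel[OF c(1) 0(1)] chart_image_borel[OF c(2) 0(2)] M d
      by (intro plus_emeasure[symmetric]) auto
    finally show ?thesis using emeasure_pullback[OF c(1) M 0(1)] emeasure_pullback[OF c(2) M 0(2)] by simp
  qed
  then show "emeasure \<mu> A = emeasure \<nu> A" using assms c by simp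
qed (use assms in simp)

section \<open>Uniqueness of the Monge--Ampere measure\<close>

lemma is_ddc_unique: "is_ddc v \<mu> \<Longrightarrow> is_ddc v \<nu> \<Longrightarrow> \<mu> = \<nu>"
  unfolding is_ddc_def by (rule test_function_separates) auto

lemma ma_measure_eqI:
  assumes "sets \<mu> = sets borel"
    and "\<And>chart. chart \<in> charts \<Longrightarrow> is_ddc (\<lambda>w. u (chart w) + ereal (fs_potential w)) (pullback chart \<mu>)"
  shows "ma_measure u = \<mu>"
  unfolding ma_measure_def
proof (rule the_equality)
  show "sets \<mu> = sets borel \<and> (\<forall>chart\<in>charts. is_ddc (\<lambda>w. u (chart w) + ereal (fs_potential w)) (pullback chart \<mu>))"
    using assms by blast
  fix \<nu> assume \<nu>: "sets \<nu> = sets borel \<and> (\<forall>chart\<in>charts. is_ddc (\<lambda>w. u (chart w) + ereal (fs_potential w)) (pullback chart \<nu>))"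
  show "\<nu> = \<mu>"
    using \<nu> assms by (intro cp1_measure_eqI) (auto intro: is_ddc_unique)
qed

lemma pullback_distr_chart0:
  assumes M: "sets M = sets borel"
  shows "pullback chart0 (distr M borel chart0) = M"
    and "pullback chart1 (distr M borel chart0) = distr (restrict_space M {z \<in> space M. z \<noteq> 0}) borel (\<lambda>z. 1 / z)"
proof -
  have c: "chart0 \<in> charts" "chart1 \<in> charts" by (auto simp: charts_def)
  have sp: "space M = UNIV" using sets_eq_imp_space_eq[OF M] by simp
  have m0: "chart0 \<in> borel_measurable M" using chart_measurable(1) M by (simp cong: measurable_cong_sets)
  have e: "emeasure (distr M borel chart0) A = emeasure M (chart0 -` A)" if "A \<in> sets borel" for A
    using emeasure_distr[OF m0 that] by (simp add: sp)
  show "pullback chart0 (distr M borel chart0) = M"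
  proof (rule measure_eqI)
    fix A assume "A \<in> sets (pullback chart0 (distr M borel chart0))"
    then have A: "A \<in> sets borel" by simp
    show "emeasure (pullback chart0 (distr M borel chart0)) A = emeasure M A"
      using emeasure_pullback[OF c(1) _ A, of "distr M borel chart0"] e[OF chart_image_borel[OF c(1) A]]
      by (simp add: vimage_charts)
  qed (simp add: M)
  show "pullback chart1 (distr M borel chart0) = distr (restrict_space M {z \<in> space M. z \<noteq> 0}) borel (\<lambda>z. 1 / z)"
  proof (rule measure_eqI)
    fix A assume "A \<in> sets (pullback chart1 (distr M borel chart0))"
    then have A: "A \<in> sets borel" by simp
    have s: "{z \<in> space M. z \<noteq> 0} \<in> sets M" by (simp add: sp M)
    have "(\<lambda>z::complex. 1 / z) \<in> borel_measurable M" using M by (simp cong: measurable_cong_sets)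
    then have mi: "(\<lambda>z. 1 / z) \<in> borel_measurable (restrict_space M {z \<in> space M. z \<noteq> 0})"
      by (rule measurable_restrict_space1)
    have "emeasure (distr (restrict_space M {z \<in> space M. z \<noteq> 0}) borel (\<lambda>z. 1 / z)) A =
        emeasure (restrict_space M {z \<in> space M. z \<noteq> 0}) ((\<lambda>z. 1 / z) -` A \<inter> space (restrict_space M {z \<in> space M. z \<noteq> 0}))"
      by (rule emeasure_distr[OF mi A])
    also have "\<dots> = emeasure M ((\<lambda>z. 1 / z) -` A \<inter> space (restrict_space M {z \<in> space M. z \<noteq> 0}))"
      using s by (intro emeasure_restrict_space) (auto simp: space_restrict_space)
    also have "(\<lambda>z. 1 / z) -` A \<inter> space (restrict_space M {z \<in> space M. z \<noteq> 0}) = {z. z \<noteq> 0 \<and> 1 / z \<in> A}"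
      by (auto simp: space_restrict_space sp)
    finally show "emeasure (pullback chart1 (distr M borel chart0)) A =
        emeasure (distr (restrict_space M {z \<in> space M. z \<noteq> 0}) borel (\<lambda>z. 1 / z)) A"
      using emeasure_pullback[OF c(2) _ A, of "distr M borel chart0"] e[OF chart_image_borel[OF c(2) A]]
      by (simp add: vimage_charts)
  qed simp
qed

section \<open>Fubini--Study disks\<close>

lemma sqrt_fs_density: "sqrt (fs_density w) = 1 / (sqrt pi * (1 + (cmod w)\<^sup>2))"
  unfolding fs_density_eq by (simp add: real_sqrt_divide real_sqrt_mult abs_of_nonneg)

lemma fs_speed_Aff:
  assumes "\<gamma> t = Aff w"
  shows "fs_speed \<gamma> t = cmod (vector_derivative (inv chart0 \<circ> \<gamma>) (at t)) / (sqrt pi * (1 + (cmod w)\<^sup>2))"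
proof -
  have "\<gamma> t \<in> range chart0" using assms by (auto simp: chart0_def)
  then show ?thesis using assms by (simp add: fs_speed_def sqrt_fs_density Let_def)
qed

text \<open>The competitor is the ray t \<zeta> in the coordinate at infinity. Its speed is
  |\<zeta>| / (1 + t^2 |\<zeta>|^2), whose integral is an arctangent; the factor 1/sqrt pi comes
  from normalising the total area to 1.\<close>

lemma fs_dist_Infty_le: "fs_dist Infty (chart1 \<zeta>) \<le> ennreal (arctan (cmod \<zeta>) / sqrt pi)"
proof -
  define \<gamma> where "\<gamma> t = chart1 (complex_of_real t * \<zeta>)" for t :: real
  have c1: "chart1 \<in> charts" by (simp add: charts_def)
  have i1: "inv chart1 \<circ> \<gamma> = (\<lambda>t. complex_of_real t * \<zeta>)"
    using c1 by (auto simp: \<gamma>_def)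
  have v1: "((\<lambda>t. complex_of_real t * \<zeta>) has_vector_derivative \<zeta>) (at t)" for t
    by (auto intro!: derivative_eq_intros simp: has_vector_derivative_def scaleR_conv_of_real)
  have v0: "((inv chart0 \<circ> \<gamma>) has_vector_derivative - 1 / (complex_of_real (t\<^sup>2) * \<zeta>)) (at t)" if t: "0 < t" and z: "\<zeta> \<noteq> 0" for t
  proof (rule has_vector_derivative_transform_within_open)
    have "((\<lambda>w. 1 / (w * \<zeta>)) has_field_derivative - 1 / (complex_of_real (t\<^sup>2) * \<zeta>)) (at (complex_of_real t))"
      using t z by (auto intro!: derivative_eq_intros simp: power2_eq_square)
    then show "((\<lambda>t. 1 / (complex_of_real t * \<zeta>)) has_vector_derivative - 1 / (complex_of_real (t\<^sup>2) * \<zeta>)) (at t)"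
      by (rule has_vector_derivative_real_field)
    show "open {0::real<..}" "t \<in> {0<..}" using t by auto
    show "1 / (complex_of_real x * \<zeta>) = (inv chart0 \<circ> \<gamma>) x" if "x \<in> {0<..}" for x
      using that z by (simp add: \<gamma>_def chart1_def)
  qed
  have "piecewise_C1_curve \<gamma>" unfolding piecewise_C1_curve_def
  proof (intro conjI exI[of _ "{0,1}"] ballI)
    show "continuous_on {0..1} \<gamma>" unfolding \<gamma>_def
      by (rule continuous_on_compose2[OF continuous_on_chart[OF c1]]) (auto intro!: continuous_intros)
    fix chart assume "chart \<in> charts"
    then consider "chart = chart0" | "chart = chart1" by (auto simp: charts_def)
    then show "(inv chart \<circ> \<gamma>) C1_differentiable_on {t \<in> {0..1} - {0, 1}. \<gamma> t \<in> range chart}"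
    proof cases
      case 1
      show ?thesis
      proof (cases "\<zeta> = 0")
        case True
        then have "\<gamma> t = Infty" for t by (simp add: \<gamma>_def chart1_def)
        then have "{t \<in> {0..1} - {0, 1}. \<gamma> t \<in> range chart} = {}" by (auto simp: 1 range_chart0)
        then show ?thesis by (simp only: C1_differentiable_on_def) auto
      next
        case False
        then show ?thesis unfolding C1_differentiable_on_def 1
          by (intro exI[of _ "\<lambda>t. - 1 / (complex_of_real (t\<^sup>2) * \<zeta>)"] conjI ballI v0 continuous_intros) auto
      qed
    next
      case 2
      show ?thesis unfolding C1_differentiable_on_def 2 i1
        using v1 by (intro exI[of _ "\<lambda>t. \<zeta>"] conjI ballI continuous_intros) auto
    qed
  qed simp
  then have "fs_dist Infty (chart1 \<zeta>) \<le> fs_length \<gamma>"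
    unfolding fs_dist_def by (intro INF_lower) (simp add: \<gamma>_def chart1_def)
  also have "fs_length \<gamma> = (\<integral>\<^sup>+t. ennreal (cmod \<zeta> / (sqrt pi * (1 + t\<^sup>2 * (cmod \<zeta>)\<^sup>2))) * indicator {0..1} t \<partial>lborel)"
    unfolding fs_length_def
  proof (rule nn_integral_cong_AE)
    \<comment> \<open>At t = 0 the curve sits at infinity, outside the affine chart in which the
      speed is measured elsewhere; a single parameter does not affect the length.\<close>
    show "AE t in lborel. ennreal (fs_speed \<gamma> t) * indicator {0..1} t = ennreal (cmod \<zeta> / (sqrt pi * (1 + t\<^sup>2 * (cmod \<zeta>)\<^sup>2))) * indicator {0..1} t"
      using AE_lborel_singleton[of 0]
    proof eventually_elim
      case (elim t)
      show ?case
      proof (cases "t \<in> {0..1}")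
        case True
        then have t: "t > 0" using elim by auto
        have "fs_speed \<gamma> t = cmod \<zeta> / (sqrt pi * (1 + t\<^sup>2 * (cmod \<zeta>)\<^sup>2))"
        proof (cases "\<zeta> = 0")
          case z: True
          then have "\<gamma> t = Infty" by (simp add: \<gamma>_def chart1_def)
          then have "\<gamma> t \<notin> range chart0" by (simp add: range_chart0)
          then have "fs_speed \<gamma> t = sqrt (fs_density (inv chart1 (\<gamma> t))) * cmod (vector_derivative (inv chart1 \<circ> \<gamma>) (at t))"
            by (simp add: fs_speed_def)
          then show ?thesis using vector_derivative_at[OF v1, of t] z by (simp add: i1)
        next
          case False
          have "\<gamma> t = Aff (1 / (complex_of_real t * \<zeta>))" using t False by (simp add: \<gamma>_def chart1_def)
          then have "fs_speed \<gamma> t = cmod (- 1 / (complex_of_real (t\<^sup>2) * \<zeta>)) / (sqrt pi * (1 + (cmod (1 / (complex_of_real t * \<zeta>)))\<^sup>2))"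
            using fs_speed_Aff vector_derivative_at[OF v0[OF t False]] by metis
          also have "\<dots> = 1 / (t\<^sup>2 * cmod \<zeta>) / (sqrt pi * (1 + 1 / (t\<^sup>2 * (cmod \<zeta>)\<^sup>2)))"
            using t by (simp add: norm_divide norm_mult power_divide power_mult_distrib norm_power)
          also have "\<dots> = cmod \<zeta> / (sqrt pi * (1 + t\<^sup>2 * (cmod \<zeta>)\<^sup>2))"
          proof -
            have "t\<^sup>2 * (cmod \<zeta>)\<^sup>2 > 0" using t False by simp
            then have "1 + 1 / (t\<^sup>2 * (cmod \<zeta>)\<^sup>2) = (1 + t\<^sup>2 * (cmod \<zeta>)\<^sup>2) / (t\<^sup>2 * (cmod \<zeta>)\<^sup>2)"
              by (metis add.commute add_divide_distrib divide_self less_irrefl)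
            then show ?thesis using t False by (simp add: power2_eq_square)
          qed
          finally show ?thesis .
        qed
        then show ?thesis by simp
      qed simp
    qed
  qed
  also have "\<dots> = ennreal (arctan (1 * cmod \<zeta>) / sqrt pi - arctan (0 * cmod \<zeta>) / sqrt pi)"
  proof (rule nn_integral_FTC_Icc)
    fix x :: real
    have "((\<lambda>t. arctan (t * cmod \<zeta>)) has_real_derivative cmod \<zeta> / (1 + (x * cmod \<zeta>)\<^sup>2)) (at x)"
      by (auto intro!: derivative_eq_intros simp: divide_inverse)
    then have "((\<lambda>t. arctan (t * cmod \<zeta>) / sqrt pi) has_real_derivative cmod \<zeta> / (1 + (x * cmod \<zeta>)\<^sup>2) / sqrt pi) (at x)"
      by (rule DERIV_cdivide)
    then show "((\<lambda>t. arctan (t * cmod \<zeta>) / sqrt pi) has_real_derivative cmod \<zeta> / (sqrt pi * (1 + x\<^sup>2 * (cmod \<zeta>)\<^sup>2))) (at x)"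
      by (rule DERIV_cong) (simp add: power_mult_distrib mult.commute)
  qed (auto intro!: divide_nonneg_nonneg)
  finally show ?thesis by simp
qed

section \<open>Lower bound for the distance from infinity\<close>

lemma compact_avoiding:
  fixes \<gamma> :: "real \<Rightarrow> cp1"
  assumes "continuous_on S \<gamma>" "compact S" "open U"
  shows "compact {t \<in> S. \<gamma> t \<notin> U}"
proof -
  obtain A where A: "open A" "A \<inter> S = \<gamma> -` U \<inter> S"
    using assms(1,3) unfolding continuous_on_open_invariant by blast
  have "{t \<in> S. \<gamma> t \<notin> U} = S - A" using A by blast
  then show ?thesis using assms(2) A(1) by (simp add: compact_diff)
qed

text \<open>By Cauchy--Schwarz the derivative of arctan |f| is at most |f'| / (1 + |f|^2) in
  absolute value, the length density up to a constant. \<open>f\<close> must not vanish for |f| to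
  be differentiable. Integrability of the density is not assumed but follows from the length
  bound.\<close>

lemma arctan_length_bound:
  fixes f :: "real \<Rightarrow> complex"
  assumes ab: "a \<le> b" and S: "finite S"
    and cont: "continuous_on {a..b} f"
    and deriv: "\<And>t. t \<in> {a<..<b} - S \<Longrightarrow> (f has_vector_derivative D t) (at t)"
    and contD: "continuous_on ({a<..<b} - S) D"
    and nz: "\<And>t. t \<in> {a..b} \<Longrightarrow> f t \<noteq> 0"
    and len: "(\<integral>\<^sup>+t. ennreal (cmod (D t) / (1 + (cmod (f t))\<^sup>2)) * indicator ({a<..<b} - S) t \<partial>lborel) \<le> ennreal L" "L \<ge> 0"
  shows "arctan (cmod (f a)) - arctan (cmod (f b)) \<le> L"
proof -
  define E where "E = {a<..<b} - S"
  have E: "E \<in> sets borel" using S unfolding E_def by (intro sets.Diff) (auto intro: borel_closed finite_imp_closed)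
  have pos: "1 + (cmod z)\<^sup>2 > 0" for z by (simp add: add_pos_nonneg)
  define G where "G t = indicator E t *\<^sub>R (cmod (D t) / (1 + (cmod (f t))\<^sup>2))" for t
  have [measurable]: "G \<in> borel_measurable borel"
  proof -
    have "continuous_on E (\<lambda>t. cmod (D t) / (1 + (cmod (f t))\<^sup>2))"
      using contD unfolding E_def
      by (intro continuous_intros continuous_on_subset[OF cont]) (use less_imp_neq[OF pos, symmetric] in auto)
    then show ?thesis unfolding G_def[abs_def] by (rule borel_measurable_continuous_on_indicator[OF E])
  qed
  have G0: "0 \<le> G t" for t by (auto simp: G_def indicator_def intro!: divide_nonneg_nonneg)
  have nnG: "(\<integral>\<^sup>+t. ennreal (G t) \<partial>lborel) \<le> ennreal L"
  proof -
    have "(\<integral>\<^sup>+t. ennreal (G t) \<partial>lborel) = (\<integral>\<^sup>+t. ennreal (cmod (D t) / (1 + (cmod (f t))\<^sup>2)) * indicator E t \<partial>lborel)"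
      by (intro nn_integral_cong) (auto simp: G_def indicator_def)
    then show ?thesis using len(1) by (simp add: E_def)
  qed
  have intG: "integrable lborel G"
  proof (rule integrableI_bounded)
    have "(\<integral>\<^sup>+t. ennreal (norm (G t)) \<partial>lborel) = (\<integral>\<^sup>+t. ennreal (G t) \<partial>lborel)"
      using G0 by (intro nn_integral_cong) simp
    also have "\<dots> < \<infinity>" using nnG by (auto simp: le_less_trans)
    finally show "(\<integral>\<^sup>+t. ennreal (norm (G t)) \<partial>lborel) < \<infinity>" .
  qed measurable
  have IL: "integral\<^sup>L lborel G \<le> L"
  proof -
    have "ennreal (integral\<^sup>L lborel G) = (\<integral>\<^sup>+t. ennreal (G t) \<partial>lborel)"
      using G0 intG by (intro nn_integral_eq_integral[symmetric]) auto
    then have "ennreal (integral\<^sup>L lborel G) \<le> ennreal L" using nnG by (simp only:)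
    then show ?thesis using len(2) ennreal_le_iff by blast
  qed
  have G_UNIV: "(G has_integral integral\<^sup>L lborel G) UNIV" by (rule has_integral_integral_lborel[OF intG])
  have "(\<lambda>t. if t \<in> {a..b} then G t else 0) = G" by (rule ext) (auto simp: G_def E_def indicator_def)
  then have G_int: "(G has_integral integral\<^sup>L lborel G) {a..b}"
    using G_UNIV has_integral_restrict_UNIV[of "{a..b}" G "integral\<^sup>L lborel G"] by simp
  define A where "A t = arctan (cmod (f t))" for t
  define A' where "A' t = (f t \<bullet> D t) / cmod (f t) / (1 + (cmod (f t))\<^sup>2)" for t
  have dA: "(A has_vector_derivative A' t) (at t)" if t: "t \<in> {a<..<b} - S" for t
  proof -
    have ft: "f t \<bullet> f t > 0" using nz[of t] t by simp
    have n: "cmod (f t) = sqrt (f t \<bullet> f t)" by (rule norm_eq_sqrt_inner)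
    have "((\<lambda>t. f t \<bullet> f t) has_derivative (\<lambda>h. f t \<bullet> (h *\<^sub>R D t) + (h *\<^sub>R D t) \<bullet> f t)) (at t)"
      using deriv[OF t] by (intro has_derivative_inner) (auto simp: has_vector_derivative_def)
    then have u: "((\<lambda>t. f t \<bullet> f t) has_real_derivative 2 * (f t \<bullet> D t)) (at t)"
      unfolding has_field_derivative_def by (rule has_derivative_eq_rhs) (auto simp: inner_commute)
    have "((\<lambda>t. arctan (sqrt (f t \<bullet> f t))) has_real_derivative A' t) (at t)"
      using ft inner_ge_zero[of "f t", THEN leD] by (auto intro!: derivative_eq_intros u simp: A'_def n divide_simps)
    then show ?thesis unfolding has_real_derivative_iff_has_vector_derivative A_def[abs_def] norm_eq_sqrt_inner .
  qed
  have cA: "continuous_on {a..b} A" unfolding A_def by (intro continuous_intros cont)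
  have A_int: "(A' has_integral A b - A a) {a..b}"
    by (rule fundamental_theorem_of_calculus_interior_strong[OF S ab]) (use dA cA in auto)
  then have "((\<lambda>t. - A' t) has_integral - (A b - A a)) {a..b}" by (rule has_integral_neg)
  then have A_int': "((\<lambda>t. if t \<in> E then - A' t else 0) has_integral - (A b - A a)) {a..b}"
    by (rule has_integral_spike_finite[of "S \<union> {a, b}", rotated 2]) (use S in \<open>auto simp: E_def\<close>)
  have "- (A b - A a) \<le> integral\<^sup>L lborel G"
  proof (rule has_integral_le[OF A_int' G_int])
    fix t
    show "(if t \<in> E then - A' t else 0) \<le> G t"
    proof (cases "t \<in> E")
      case True
      then have f0: "cmod (f t) > 0" using nz[of t] by (auto simp: E_def)
      have "- (f t \<bullet> D t) \<le> cmod (f t) * cmod (D t)"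
        using Cauchy_Schwarz_ineq2[of "f t" "D t"] by linarith
      then have "- (f t \<bullet> D t) / cmod (f t) \<le> cmod (D t)"
        using f0 by (subst pos_divide_le_eq) (auto simp: mult.commute)
      then have "- (f t \<bullet> D t) / cmod (f t) / (1 + (cmod (f t))\<^sup>2) \<le> cmod (D t) / (1 + (cmod (f t))\<^sup>2)"
        using pos[of "f t"] by (intro divide_right_mono) auto
      then show ?thesis using True by (simp add: A'_def G_def)
    qed (simp add: G0)
  qed
  then show ?thesis using IL by (simp add: A_def)
qed

text \<open>Every curve from infinity to \<open>z\<close> crosses the annulus R0 < |w| < N, and
  during the crossing the affine coordinate is available and nonzero. The finite outer radius
  \<open>N\<close> cuts away the start, where the affine coordinate has a pole; it is sent to
  infinity afterwards.\<close>

lemma fs_dist_Infty_ge: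
  assumes R0: "0 < R0" "cmod z \<le> R0" and N: "R0 < N"
  shows "ennreal ((arctan N - arctan R0) / sqrt pi) \<le> fs_dist Infty (Aff z)"
  unfolding fs_dist_def
proof (rule INF_greatest)
  fix \<gamma> assume "\<gamma> \<in> {\<gamma>. piecewise_C1_curve \<gamma> \<and> \<gamma> 0 = Infty \<and> \<gamma> 1 = Aff z}"
  then have \<gamma>: "piecewise_C1_curve \<gamma>" "\<gamma> 0 = Infty" "\<gamma> 1 = Aff z" by auto
  have c: "chart0 \<in> charts" "chart1 \<in> charts" by (auto simp: charts_def)
  obtain S where cont: "continuous_on {0..1} \<gamma>" and S: "finite S"
    and C1: "(inv chart0 \<circ> \<gamma>) C1_differentiable_on {t \<in> {0..1} - S. \<gamma> t \<in> range chart0}"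
    using \<gamma>(1) c unfolding piecewise_C1_curve_def by blast
  define U0 where "U0 = chart0 ` ball 0 N"
  define U1 where "U1 = chart1 ` ball 0 (1 / R0)"
  have oU: "open U0" "open U1" "open (chart1 ` ball 0 (1 / N))"
    unfolding U0_def U1_def using open_chart_image c by auto
  have in0: "Aff w \<in> U0 \<longleftrightarrow> cmod w < N" for w by (auto simp: U0_def chart0_def)
  have inf0: "Infty \<notin> U0" by (auto simp: U0_def chart0_def)
  have in1: "Aff w \<in> chart1 ` ball 0 (1 / r) \<longleftrightarrow> cmod w > r" if "r > 0" for w r
  proof
    assume "Aff w \<in> chart1 ` ball 0 (1 / r)"
    then obtain y where y: "y \<noteq> 0" "w = 1 / y" "cmod y < 1 / r"
      by (auto simp: chart1_def split: if_splits)
    then have "r * cmod y < 1" using that by (simp add: pos_less_divide_eq mult.commute)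
    then show "cmod w > r" using y(1) unfolding y(2) by (simp add: norm_divide pos_less_divide_eq)
  next
    assume "cmod w > r"
    then have "w \<noteq> 0" using that by auto
    moreover have wr: "0 < cmod w * r" using \<open>cmod w > r\<close> that by (intro mult_pos_pos) linarith+
    moreover have "cmod (1 / w) < 1 / r" unfolding norm_divide norm_one
      by (rule divide_strict_left_mono) (use \<open>cmod w > r\<close> wr in auto)
    ultimately have w: "w \<noteq> 0" "cmod (1 / w) < 1 / r" by auto
    then have "Aff w = chart1 (1 / w)" by (simp add: chart1_def)
    then show "Aff w \<in> chart1 ` ball 0 (1 / r)" using w by (auto intro!: image_eqI)
  qed
  have inf1: "Infty \<in> chart1 ` ball 0 (1 / r)" if "r > 0" for r
    using that by (intro image_eqI[of _ _ 0]) (auto simp: chart1_def)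
  \<comment> \<open>The last time outside |w| < N is where the crossing starts.\<close>
  define A where "A = {t \<in> {0..1}. \<gamma> t \<notin> U0}"
  have "compact A" unfolding A_def by (rule compact_avoiding[OF cont _ oU(1)]) simp
  moreover have "0 \<in> A" using \<gamma> inf0 by (simp add: A_def)
  ultimately obtain t1 where t1: "t1 \<in> A" "\<And>t. t \<in> A \<Longrightarrow> t \<le> t1"
    using compact_attains_sup[of A] by auto
  have t1': "0 \<le> t1" "t1 \<le> 1" "\<gamma> t1 \<notin> U0" using t1(1) by (auto simp: A_def)
  \<comment> \<open>The first later time inside |w| \<le> R0 is where the crossing ends.\<close>
  define B where "B = {t \<in> {t1..1}. \<gamma> t \<notin> U1}"
  have "compact B" unfolding B_def
    by (rule compact_avoiding[OF continuous_on_subset[OF cont] _ oU(2)]) (use t1' in auto)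
  moreover have "1 \<in> B" using \<gamma>(3) in1[OF R0(1), of z] R0 t1' by (simp add: B_def U1_def)
  ultimately obtain t2 where t2: "t2 \<in> B" "\<And>t. t \<in> B \<Longrightarrow> t2 \<le> t"
    using compact_attains_inf[of B] by auto
  have t2': "t1 \<le> t2" "t2 \<le> 1" "\<gamma> t2 \<notin> U1" using t2(1) by (auto simp: B_def)
  obtain w2 where w2: "\<gamma> t2 = Aff w2" "cmod w2 \<le> R0"
    using t2'(3) inf1[OF R0(1)] in1[OF R0(1)] by (cases "\<gamma> t2") (auto simp: U1_def not_less)
  have "t1 \<noteq> t2" using t1'(3) w2 N in0[of w2] by auto
  then have t12: "t1 < t2" using t2'(1) by simp
  have mid: "\<exists>w. \<gamma> t = Aff w \<and> R0 < cmod w \<and> cmod w < N" if t: "t1 < t" "t < t2" for t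
  proof -
    have "t \<notin> A" using t1(2)[of t] t by auto
    then have "\<gamma> t \<in> U0" using t t1' t2' by (auto simp: A_def)
    then obtain w where w: "\<gamma> t = Aff w" by (auto simp: U0_def chart0_def)
    have "t \<notin> B" using t2(2)[of t] t by auto
    then have "\<gamma> t \<in> U1" using t t2' by (auto simp: B_def)
    then show ?thesis using w \<open>\<gamma> t \<in> U0\<close> in0 in1[OF R0(1)] by (auto simp: U1_def)
  qed
  \<comment> \<open>By continuity the curve is still near its endpoint values during the crossing.
    As it stays in the annulus then, it cannot be at infinity at \<open>t1\<close> or at 0 at
    \<open>t2\<close>.\<close>
  have nb: "\<exists>t. t1 < t \<and> t < t2 \<and> \<gamma> t \<in> U" if U: "open U" "\<gamma> t0 \<in> U" "t0 = t1 \<or> t0 = t2" for U t0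
  proof -
    obtain V where V: "open V" "V \<inter> {0..1} = \<gamma> -` U \<inter> {0..1}"
      using cont U(1) unfolding continuous_on_open_invariant by blast
    have t0: "t0 \<in> {0..1}" using U(3) t1' t2' by auto
    then have "t0 \<in> V" using V(2) U(2) by blast
    then obtain e where e: "e > 0" "ball t0 e \<subseteq> V" using V(1) openE by blast
    define d where "d = min (e/2) ((t2 - t1)/2)"
    have d: "d > 0" "d < e" "d < t2 - t1" using e t12 by (auto simp: d_def min_def)
    define t where "t = (if t0 = t1 then t1 + d else t2 - d)"
    have "t \<in> V" using e d U(3) by (intro subsetD[OF e(2)]) (auto simp: t_def dist_real_def)
    moreover have "t1 < t" "t < t2" using d by (auto simp: t_def)
    ultimately have "\<gamma> t \<in> U" using V(2) t1' t2' by auto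
    with \<open>t1 < t\<close> \<open>t < t2\<close> show ?thesis by blast
  qed
  have N0: "N > 0" using R0 N by linarith
  obtain w1 where w1: "\<gamma> t1 = Aff w1" "N \<le> cmod w1"
  proof (cases "\<gamma> t1")
    case (Aff w)
    then show ?thesis using that t1'(3) in0[of w] by auto
  next
    case Infty
    obtain t where t: "t1 < t" "t < t2" "\<gamma> t \<in> chart1 ` ball 0 (1 / N)"
      using nb[OF oU(3), of t1] inf1[OF N0] Infty by auto
    obtain w where w: "\<gamma> t = Aff w" "cmod w < N" using mid[OF t(1,2)] by auto
    have "N < cmod w" using t(3) in1[OF N0, of w] unfolding w(1) by blast
    with w show ?thesis by simp
  qed
  have w2': "w2 \<noteq> 0"
  proof
    assume "w2 = 0"
    have "open (chart0 ` ball 0 R0)" using open_chart_image c by auto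
    moreover have "\<gamma> t2 \<in> chart0 ` ball 0 R0" using w2 \<open>w2 = 0\<close> R0 by (auto simp: chart0_def)
    ultimately obtain t where t: "t1 < t" "t < t2" "\<gamma> t \<in> chart0 ` ball 0 R0" using nb[of "chart0 ` ball 0 R0" t2] by blast
    then show False using mid[OF t(1,2)] by (auto simp: chart0_def)
  qed
  have Aff: "\<exists>w. \<gamma> t = Aff w \<and> w \<noteq> 0" if "t \<in> {t1..t2}" for t
    using that mid[of t] w1 w2 w2' N0 R0 by (cases "t = t1 \<or> t = t2") fastforce+
  define f where "f t = inv chart0 (\<gamma> t)" for t
  have f_eq: "\<gamma> t = Aff (f t) \<and> f t \<noteq> 0" if "t \<in> {t1..t2}" for t
    using Aff[OF that] by (auto simp: f_def)
  have cf: "continuous_on {t1..t2} f" unfolding f_def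
    by (rule continuous_on_compose2[OF continuous_on_inv_chart[OF c(1)] continuous_on_subset[OF cont]])
       (use f_eq t1' t2' in \<open>auto simp: range_chart0\<close>)
  obtain D where D: "\<And>t. t \<in> {t \<in> {0..1} - S. \<gamma> t \<in> range chart0} \<Longrightarrow> ((inv chart0 \<circ> \<gamma>) has_vector_derivative D t) (at t)"
    "continuous_on {t \<in> {0..1} - S. \<gamma> t \<in> range chart0} D"
    using C1 unfolding C1_differentiable_on_def by blast
  have sub: "{t1<..<t2} - S \<subseteq> {t \<in> {0..1} - S. \<gamma> t \<in> range chart0}"
    using f_eq t1' t2' by (auto simp: range_chart0)
  have fo: "inv chart0 \<circ> \<gamma> = f" by (auto simp: f_def)
  show "ennreal ((arctan N - arctan R0) / sqrt pi) \<le> fs_length \<gamma>"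
  proof (cases "fs_length \<gamma>")
    case (real l)
    have "arctan (cmod (f t1)) - arctan (cmod (f t2)) \<le> sqrt pi * l"
    proof (rule arctan_length_bound[of t1 t2 S f D])
      show "(f has_vector_derivative D t) (at t)" if "t \<in> {t1<..<t2} - S" for t
        using D(1)[OF subsetD[OF sub that]] by (simp add: fo)
      have "(\<integral>\<^sup>+t. ennreal (cmod (D t) / (1 + (cmod (f t))\<^sup>2)) * indicator ({t1<..<t2} - S) t \<partial>lborel) \<le> ennreal (sqrt pi) * fs_length \<gamma>"
        (is "?I \<le> _")
      proof -
        have "?I \<le> (\<integral>\<^sup>+t. ennreal (sqrt pi) * (ennreal (fs_speed \<gamma> t * indicator ({t1<..<t2} - S) t)) \<partial>lborel)"
        proof (rule nn_integral_mono)
          fix t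
          show "ennreal (cmod (D t) / (1 + (cmod (f t))\<^sup>2)) * indicator ({t1<..<t2} - S) t \<le> ennreal (sqrt pi) * (ennreal (fs_speed \<gamma> t * indicator ({t1<..<t2} - S) t))"
          proof (cases "t \<in> {t1<..<t2} - S")
            case True
            then have "t \<in> {t1..t2}" by auto
            then have "\<gamma> t = Aff (f t)" using f_eq by blast
            moreover have "vector_derivative (inv chart0 \<circ> \<gamma>) (at t) = D t"
              using D(1)[OF subsetD[OF sub True]] by (rule vector_derivative_at)
            ultimately have "fs_speed \<gamma> t = cmod (D t) / (sqrt pi * (1 + (cmod (f t))\<^sup>2))"
              using fs_speed_Aff by metis
            then show ?thesis using True by (simp add: ennreal_mult'[symmetric])
          qed simp
        qed
        also have "\<dots> = ennreal (sqrt pi) * (\<integral>\<^sup>+t. ennreal (fs_speed \<gamma> t * indicator ({t1<..<t2} - S) t) \<partial>lborel)"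
        proof (rule nn_integral_cmult)
          have E: "{t1<..<t2} - S \<in> sets borel" using S by (intro sets.Diff) (auto intro: borel_closed finite_imp_closed)
          have "continuous_on ({t1<..<t2} - S) (\<lambda>t. cmod (D t) / (sqrt pi * (1 + (cmod (f t))\<^sup>2)))"
            by (intro continuous_intros continuous_on_subset[OF D(2) sub] continuous_on_subset[OF cf])
               (auto simp: add_nonneg_eq_0_iff)
          then have "(\<lambda>t. indicator ({t1<..<t2} - S) t *\<^sub>R (cmod (D t) / (sqrt pi * (1 + (cmod (f t))\<^sup>2)))) \<in> borel_measurable borel"
            by (rule borel_measurable_continuous_on_indicator[OF E])
          also have "(\<lambda>t. indicator ({t1<..<t2} - S) t *\<^sub>R (cmod (D t) / (sqrt pi * (1 + (cmod (f t))\<^sup>2)))) = (\<lambda>t. fs_speed \<gamma> t * indicator ({t1<..<t2} - S) t)"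
          proof
            fix t
            show "indicator ({t1<..<t2} - S) t *\<^sub>R (cmod (D t) / (sqrt pi * (1 + (cmod (f t))\<^sup>2))) = fs_speed \<gamma> t * indicator ({t1<..<t2} - S) t"
            proof (cases "t \<in> {t1<..<t2} - S")
              case True
              then have "t \<in> {t1..t2}" by auto
              then have "\<gamma> t = Aff (f t)" using f_eq by blast
              moreover have "vector_derivative (inv chart0 \<circ> \<gamma>) (at t) = D t"
                using D(1)[OF subsetD[OF sub True]] by (rule vector_derivative_at)
              ultimately have "fs_speed \<gamma> t = cmod (D t) / (sqrt pi * (1 + (cmod (f t))\<^sup>2))"
                using fs_speed_Aff by metis
              then show ?thesis using True by simp
            qed simp
          qed
          finally show "(\<lambda>t. ennreal (fs_speed \<gamma> t * indicator ({t1<..<t2} - S) t)) \<in> borel_measurable lborel" by simp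
        qed
        also have "(\<integral>\<^sup>+t. ennreal (fs_speed \<gamma> t * indicator ({t1<..<t2} - S) t) \<partial>lborel) \<le> fs_length \<gamma>"
          unfolding fs_length_def using t1' t2'
          by (intro nn_integral_mono) (auto simp: indicator_def)
        finally show "?I \<le> ennreal (sqrt pi) * fs_length \<gamma>" by (simp add: mult_left_mono)
      qed
      then show "?I \<le> ennreal (sqrt pi * l)"
        using real by (simp add: ennreal_mult')
    qed (use t12 S cf f_eq D(2) sub real in \<open>auto intro: continuous_on_subset\<close>)
    moreover have "f t1 = w1" "f t2 = w2" using w1 w2 by (auto simp: f_def)
    moreover have "arctan N \<le> arctan (cmod w1)" "arctan (cmod w2) \<le> arctan R0"
      using w1 w2 by (auto intro: arctan_monotone')
    ultimately have "arctan N - arctan R0 \<le> sqrt pi * l" by (smt (verit))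
    then show ?thesis using real by (simp add: ennreal_leI divide_le_eq mult.commute)
  qed simp
qed

lemma closed_fs_disk_Infty:
  assumes R: "R > 0"
  shows "closed_fs_disk (insert Infty (Aff ` {w. R \<le> cmod w}))"
  unfolding closed_fs_disk_def
proof (intro exI conjI)
  \<comment> \<open>The Fubini--Study distance from infinity to the circle |w| = R.\<close>
  define r where "r = arctan (1 / R) / sqrt pi"
  show "r > 0" using R by (simp add: r_def)
  have r_eq: "r = (pi / 2 - arctan R) / sqrt pi"
    using arctan_inverse[OF R] by (simp add: r_def inverse_eq_divide)
  show "insert Infty (Aff ` {w. R \<le> cmod w}) = {q. fs_dist Infty q \<le> ennreal r}"
  proof (intro set_eqI iffI)
    fix q assume q: "q \<in> insert Infty (Aff ` {w. R \<le> cmod w})"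
    have "\<exists>\<zeta>. q = chart1 \<zeta> \<and> cmod \<zeta> \<le> 1 / R"
    proof (cases q)
      case (Aff w)
      then have w: "R \<le> cmod w" using q by auto
      then have "w \<noteq> 0" using R by auto
      then have "q = chart1 (1 / w)" using Aff by (simp add: chart1_def)
      moreover have "cmod (1 / w) \<le> 1 / R" using w R by (simp add: norm_divide frac_le)
      ultimately show ?thesis by blast
    next
      case Infty
      then show ?thesis using R by (intro exI[of _ 0]) (auto simp: chart1_def)
    qed
    then obtain \<zeta> where \<zeta>: "q = chart1 \<zeta>" "cmod \<zeta> \<le> 1 / R" by blast
    have "fs_dist Infty q \<le> ennreal (arctan (cmod \<zeta>) / sqrt pi)" unfolding \<zeta>(1) by (rule fs_dist_Infty_le)
    also have "\<dots> \<le> ennreal r" unfolding r_def using \<zeta>(2) by (intro ennreal_leI divide_right_mono arctan_monotone') auto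
    finally show "q \<in> {q. fs_dist Infty q \<le> ennreal r}" by simp
  next
    fix q assume "q \<in> {q. fs_dist Infty q \<le> ennreal r}"
    then have q: "fs_dist Infty q \<le> ennreal r" by simp
    show "q \<in> insert Infty (Aff ` {w. R \<le> cmod w})"
    proof (rule ccontr)
      assume "q \<notin> insert Infty (Aff ` {w. R \<le> cmod w})"
      then obtain w where w: "q = Aff w" "cmod w < R" by (cases q) (auto simp: image_iff not_le)
      \<comment> \<open>A radius strictly between |w| and \<open>R\<close>: the lower bound for the
        distance then exceeds \<open>r\<close> strictly in the limit, hence already for some finite
        \<open>N\<close>.\<close>
      define R0 where "R0 = (cmod w + R) / 2"
      have R0: "0 < R0" "cmod w \<le> R0" "R0 < R" using w R norm_ge_zero[of w] by (auto simp: R0_def simp del: norm_ge_zero) 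
      have lt: "(pi / 2 - arctan R) / sqrt pi < (pi / 2 - arctan R0) / sqrt pi"
        using R0 by (intro divide_strict_right_mono diff_strict_left_mono arctan_monotone) auto
      have "((\<lambda>N. (arctan N - arctan R0) / sqrt pi) \<longlongrightarrow> (pi / 2 - arctan R0) / sqrt pi) at_top"
        by (intro tendsto_intros tendsto_arctan_at_top) auto
      then have "\<forall>\<^sub>F N in at_top. (pi / 2 - arctan R) / sqrt pi < (arctan N - arctan R0) / sqrt pi"
        using lt by (rule order_tendstoD(1))
      then have "\<forall>\<^sub>F N in at_top. R0 < N \<and> (pi / 2 - arctan R) / sqrt pi < (arctan N - arctan R0) / sqrt pi"
        using eventually_gt_at_top[of R0] by eventually_elim simp
      then obtain N where N: "R0 < N" "r < (arctan N - arctan R0) / sqrt pi"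
        unfolding r_eq using eventually_happens by (metis (no_types, lifting) trivial_limit_at_top_linorder)
      have "ennreal r < ennreal ((arctan N - arctan R0) / sqrt pi)"
        using N \<open>r > 0\<close> by (intro ennreal_lessI) auto
      also have "\<dots> \<le> fs_dist Infty q" unfolding w(1) by (rule fs_dist_Infty_ge[OF R0(1,2) N(1)])
      finally show False using q by simp
    qed
  qed
qed

section \<open>A domination principle\<close>

context polar_measure
begin

lemma space_mu [simp]: "space \<mu> = UNIV"
  using sets_eq_imp_space_eq[OF sets_mu] by simp

lemma K_borel [measurable]: "K k \<in> sets borel"
  using compact_K by (simp add: compact_imp_closed)

lemma AE_supp: "AE x in \<mu>. cmod x \<le> s"
proof -
  have "AE x in \<mu>. x \<notin> - cball 0 s"
    using supp by (intro AE_not_in) (auto simp: null_sets_def)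
  then show ?thesis by eventually_elim simp
qed

text \<open>The potential of the restriction of \<mu> to \<open>K k\<close>. In contrast to
  \<open>full\<close> it is continuous and harmonic off a compact set.\<close>

definition part :: "nat \<Rightarrow> real \<Rightarrow> complex \<Rightarrow> ennreal" where
  "part k T z = (\<integral>\<^sup>+x. indicator (K k) x * neglog (cmod (z - x) / T) \<partial>\<mu>)"

definition full :: "real \<Rightarrow> complex \<Rightarrow> ennreal" where
  "full T z = (\<integral>\<^sup>+x. neglog (cmod (z - x) / T) \<partial>\<mu>)"

lemma part_measurable [measurable]: "part k T \<in> borel_measurable borel"
  unfolding part_def[abs_def] by measurable

lemma part_le_full: "part k T z \<le> full T z"
  unfolding part_def full_def by (intro nn_integral_mono) (auto simp: indicator_def)

lemma AE_union_K: "AE x in \<mu>. \<exists>k. x \<in> K k"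
proof -
  have "(\<lambda>k. emeasure \<mu> (K k)) \<longlonglongrightarrow> emeasure \<mu> (\<Union>k. K k)"
    by (rule Lim_emeasure_incseq) (auto simp: incseq_K)
  then have "emeasure \<mu> (\<Union>k. K k) = 1" using K_tendsto by (rule LIMSEQ_unique)
  then have "AE x in \<mu>. x \<in> (\<Union>k. K k)"
    using AE_in_set_eq_1[of "\<Union>k. K k"] by (simp add: emeasure_eq_measure)
  then show ?thesis by eventually_elim auto
qed

lemma part_tendsto_full: "(\<lambda>k. part k T z) \<longlonglongrightarrow> full T z"
proof -
  have mono: "incseq (\<lambda>k x. indicator (K k) x * neglog (cmod (z - x) / T))"
    using incseq_K by (auto simp: incseq_def le_fun_def indicator_def intro!: mult_right_mono)
  have "(\<lambda>k. part k T z) \<longlonglongrightarrow> (SUP k. part k T z)"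
    unfolding part_def using mono
    by (intro LIMSEQ_SUP) (auto simp: incseq_def le_fun_def intro!: nn_integral_mono)
  also have "(SUP k. part k T z) = (\<integral>\<^sup>+x. (SUP k. indicator (K k) x * neglog (cmod (z - x) / T)) \<partial>\<mu>)"
    unfolding part_def by (rule nn_integral_monotone_convergence_SUP[symmetric, OF mono]) measurable
  also have "\<dots> = full T z" unfolding full_def
  proof (rule nn_integral_cong_AE)
    show "AE x in \<mu>. (SUP k. indicator (K k) x * neglog (cmod (z - x) / T)) = neglog (cmod (z - x) / T)"
      using AE_union_K
    proof eventually_elim
      case (elim x)
      then obtain k where k: "x \<in> K k" by blast
      show ?case
      proof (rule antisym)
        show "(SUP k. indicator (K k) x * neglog (cmod (z - x) / T)) \<le> neglog (cmod (z - x) / T)"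
          by (rule SUP_least) (auto simp: indicator_def)
        show "neglog (cmod (z - x) / T) \<le> (SUP k. indicator (K k) x * neglog (cmod (z - x) / T))"
          by (rule SUP_upper2[of k]) (use k in auto)
      qed
    qed
  qed
  finally show ?thesis .
qed

lemma part_bound:
  assumes "\<And>x. x \<in> K k \<Longrightarrow> d \<le> cmod (z - x)" "T > 0"
  shows "part k T z \<le> neglog (d / T)"
proof -
  have "part k T z \<le> (\<integral>\<^sup>+x. neglog (d / T) \<partial>\<mu>)"
    unfolding part_def using assms
    by (intro nn_integral_mono) (auto simp: indicator_def intro!: antimono_neglog divide_right_mono)
  then show ?thesis by (simp add: emeasure_space_1[simplified])
qed

lemma part_continuous:
  assumes z: "z \<notin> K k" and X: "X \<longlonglongrightarrow> z" and T: "T > 0"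
  shows "(\<lambda>n. part k T (X n)) \<longlonglongrightarrow> part k T z"
proof -
  have "open (- K k)" using compact_K[of k] by (simp add: compact_imp_closed open_Compl)
  then obtain e where e: "e > 0" "ball z e \<subseteq> - K k" using z by (meson ComplI openE)
  have far: "e \<le> cmod (z - x)" if "x \<in> K k" for x
    using e(2) that by (auto simp: dist_norm subset_eq not_less[symmetric])
  have "\<forall>\<^sub>F n in sequentially. dist (X n) z < e / 2"
    using X e(1) by (intro tendstoD) auto
  then obtain n0 where n0: "\<And>n. n \<ge> n0 \<Longrightarrow> cmod (X n - z) < e / 2"
    by (auto simp: eventually_sequentially dist_norm)
  have "(\<lambda>n. part k T (X (n + n0))) \<longlonglongrightarrow> part k T z"
    unfolding part_def
  proof (rule nn_integral_dominated_convergence[where w="\<lambda>_. neglog (e / 2 / T)"])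
    show "(\<integral>\<^sup>+x. neglog (e / 2 / T) \<partial>\<mu>) < \<infinity>"
      using e T by (simp add: emeasure_space_1[simplified] neglog_def not_le divide_le_0_iff)
    show "AE x in \<mu>. indicator (K k) x * neglog (cmod (X (n + n0) - x) / T) \<le> neglog (e / 2 / T)" for n
    proof (intro AE_I2)
      fix x
      show "indicator (K k) x * neglog (cmod (X (n + n0) - x) / T) \<le> neglog (e / 2 / T)"
      proof (cases "x \<in> K k")
        case True
        have "cmod (z - x) \<le> cmod (X (n + n0) - x) + cmod (X (n + n0) - z)"
          using norm_triangle_ineq4[of "X (n + n0) - x" "X (n + n0) - z"] by simp
        then have "e / 2 \<le> cmod (X (n + n0) - x)" using far[OF True] n0[of "n + n0"] by simp
        then have "e / 2 / T \<le> cmod (X (n + n0) - x) / T" by (rule divide_right_mono) (use T in simp)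
        then have "neglog (cmod (X (n + n0) - x) / T) \<le> neglog (e / 2 / T)" by (rule antimono_neglog)
        then show ?thesis using True by (simp del: divide_divide_eq_left)
      qed simp
    qed
    show "AE x in \<mu>. (\<lambda>n. indicator (K k) x * neglog (cmod (X (n + n0) - x) / T)) \<longlonglongrightarrow> indicator (K k) x * neglog (cmod (z - x) / T)"
    proof (intro AE_I2)
      fix x
      have "(\<lambda>n. cmod (X (n + n0) - x) / T) \<longlonglongrightarrow> cmod (z - x) / T"
        using T by (intro tendsto_intros LIMSEQ_ignore_initial_segment X) auto
      then have "(\<lambda>n. neglog (cmod (X (n + n0) - x) / T)) \<longlonglongrightarrow> neglog (cmod (z - x) / T)"
        by (intro continuous_on_tendsto_compose[OF continuous_neglog]) auto
      then show "(\<lambda>n. indicator (K k) x * neglog (cmod (X (n + n0) - x) / T)) \<longlonglongrightarrow> indicator (K k) x * neglog (cmod (z - x) / T)"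
        by (cases "x \<in> K k") auto
    qed
  qed measurable
  then show ?thesis by (rule LIMSEQ_offset)
qed

text \<open>Harmonicity off \<open>K k\<close>, with the radius below the distance to
  \<open>K k\<close>; \<open>T\<close> is large enough for the kernel to be exact on the
  circle.\<close>

lemma part_circle_mean:
  assumes far: "\<And>x. x \<in> K k \<Longrightarrow> r < cmod (z - x)" and r: "r > 0" and T: "cmod z + s + r \<le> T"
  shows "(\<integral>\<^sup>+\<theta>. part k T (z + complex_of_real r * cis \<theta>) \<partial>circ) = ennreal (2 * pi) * part k T z"
proof -
  interpret C: finite_measure circ by (rule finite_measure_circ)
  interpret P: pair_sigma_finite \<mu> circ ..
  have m2 [measurable]: "snd \<in> borel_measurable (\<mu> \<Otimes>\<^sub>M circ)"
    by (rule measurable_compose[OF measurable_snd]) (intro borel_measurable_circ, simp)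
  have m1 [measurable]: "fst \<in> borel_measurable (\<mu> \<Otimes>\<^sub>M circ)"
    using measurable_fst[of \<mu> circ] by (simp cong: measurable_cong_sets)
  have [measurable]: "(\<lambda>p. indicator (K k) (fst p) :: ennreal) \<in> borel_measurable (\<mu> \<Otimes>\<^sub>M circ)"
    by (rule measurable_compose[OF m1]) (rule borel_measurable_indicator, simp)
  have [measurable]: "(\<lambda>p. neglog (cmod ((z + complex_of_real r * cis (snd p)) - fst p) / T)) \<in> borel_measurable (\<mu> \<Otimes>\<^sub>M circ)"
    by measurable
  have "(\<integral>\<^sup>+\<theta>. part k T (z + complex_of_real r * cis \<theta>) \<partial>circ) =
     (\<integral>\<^sup>+x. (\<integral>\<^sup>+\<theta>. indicator (K k) x * neglog (cmod ((z + complex_of_real r * cis \<theta>) - x) / T) \<partial>circ) \<partial>\<mu>)"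
    unfolding part_def by (rule P.Fubini') (simp add: case_prod_beta)
  also have "\<dots> = (\<integral>\<^sup>+x. ennreal (2 * pi) * (indicator (K k) x * neglog (cmod (z - x) / T)) \<partial>\<mu>)"
  proof (rule nn_integral_cong_AE)
    show "AE x in \<mu>. (\<integral>\<^sup>+\<theta>. indicator (K k) x * neglog (cmod ((z + complex_of_real r * cis \<theta>) - x) / T) \<partial>circ) = ennreal (2 * pi) * (indicator (K k) x * neglog (cmod (z - x) / T))"
      using AE_supp
    proof eventually_elim
      case (elim x)
      show ?case
      proof (cases "x \<in> K k")
        case True
        have e: "(z + complex_of_real r * cis \<theta>) - x = (z - x) - (- complex_of_real r) * cis \<theta>" for \<theta> by simp
        have "cmod (z - x) \<le> cmod z + s" using elim norm_triangle_ineq4[of z x] by linarith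
        then have "(\<integral>\<^sup>+\<theta>. neglog (cmod ((z - x) - (- complex_of_real r) * cis \<theta>) / T) \<partial>circ) = ennreal (2 * pi) * neglog (cmod (z - x) / T)"
          using far[OF True] r T by (intro circ_neglog_outside) auto
        then show ?thesis using True unfolding e by simp
      qed simp
    qed
  qed
  also have "\<dots> = ennreal (2 * pi) * part k T z"
    unfolding part_def by (rule nn_integral_cmult) measurable
  finally show ?thesis .
qed

lemma part_eq_top: "z \<in> K k \<Longrightarrow> T \<ge> 2 * s \<Longrightarrow> part k T z = \<infinity>"
  unfolding part_def by (rule K_polar)

lemma part_lsc_closed:
  assumes "T \<ge> 2 * s" "c < \<infinity>"
  shows "closed {z. part k T z \<le> c}"
  unfolding closed_sequential_limits
proof (intro allI impI, elim conjE)
  fix X z assume X: "\<forall>n. X n \<in> {z. part k T z \<le> c}" "X \<longlonglongrightarrow> z"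
  have T: "T > 0" using assms radius_pos by linarith
  have "part k T z = (\<integral>\<^sup>+x. liminf (\<lambda>n. indicator (K k) x * neglog (cmod (X n - x) / T)) \<partial>\<mu>)"
    unfolding part_def
  proof (rule nn_integral_cong)
    fix x
    have "(\<lambda>n. cmod (X n - x) / T) \<longlonglongrightarrow> cmod (z - x) / T"
      using T by (intro tendsto_intros X) auto
    then have "(\<lambda>n. neglog (cmod (X n - x) / T)) \<longlonglongrightarrow> neglog (cmod (z - x) / T)"
      by (intro continuous_on_tendsto_compose[OF continuous_neglog]) auto
    then have "(\<lambda>n. indicator (K k) x * neglog (cmod (X n - x) / T)) \<longlonglongrightarrow> indicator (K k) x * neglog (cmod (z - x) / T)"
      by (cases "x \<in> K k") auto
    then show "indicator (K k) x * neglog (cmod (z - x) / T) = liminf (\<lambda>n. indicator (K k) x * neglog (cmod (X n - x) / T))"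
      by (intro lim_imp_Liminf[symmetric]) auto
  qed
  also have "\<dots> \<le> liminf (\<lambda>n. part k T (X n))"
    unfolding part_def by (rule nn_integral_liminf) measurable
  also have "\<dots> \<le> liminf (\<lambda>n. c)"
    using X(1) by (intro Liminf_mono always_eventually) auto
  finally show "z \<in> {z. part k T z \<le> c}" by (simp add: Liminf_const)
qed

end

section \<open>The maximum principle with a barrier\<close>

lemma usc_measurable:
  assumes "usc U" shows "U \<in> borel_measurable (borel :: complex measure)"
  using assms by (intro borel_measurableI_less) (auto simp: usc_def)

context polar_measure
begin

text \<open>
  \<open>part k T\<close> is continuous off \<open>K k\<close> and infinite on it, so \<open>U + l * part k T\<close> with \<open>l < m\<close> tends to
  \<open>-\<infinity>\<close> at \<open>K k\<close> and attains its maximum away from it.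
\<close>

lemma max_principle_part:
  assumes U: "subharmonic U" and R: "s < R" "2 * R \<le> T"
    and l: "0 < l" "l < m"
    and bd: "\<And>z. cmod z = R \<Longrightarrow> part k T z \<le> ennreal Q \<and> U z \<le> ereal (B - l * Q)" and Q: "Q \<ge> 0"
    and ub: "\<And>z. cmod z < R \<Longrightarrow> part k T z < \<infinity> \<Longrightarrow> U z \<le> ereal (A - m * enn2real (part k T z))"
    and z1: "cmod z1 < R" "part k T z1 < \<infinity>"
  shows "U z1 \<le> ereal (B - l * enn2real (part k T z1))"
proof (rule ccontr)
  define pr where "pr z = enn2real (part k T z)" for z
  have pr0: "pr z \<ge> 0" for z by (simp add: pr_def)
  have T: "T > 0" "T \<ge> 2 * s" using R radius_pos by auto
  have uscU: "usc U" and Ufin: "\<And>z. U z \<noteq> \<infinity>"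
    and Umean: "\<And>z r. r > 0 \<Longrightarrow> U z \<le> ereal_integral circ (\<lambda>\<theta>. U (z + complex_of_real r * cis \<theta>)) / ereal (2 * pi)"
    using U by (auto simp: subharmonic_def)
  assume "\<not> ?thesis"
  then have gt: "ereal (B - l * pr z1) < U z1" by (simp add: pr_def not_le)
  then obtain u1 where u1: "U z1 = ereal u1" using Ufin[of z1] by (cases "U z1") auto
  \<comment> \<open>The value of \<open>U + l * pr\<close> at \<open>z1\<close>. The negated claim
    says that it exceeds the boundary bound \<open>B\<close>.\<close>
  define \<beta>0 where "\<beta>0 = u1 + l * pr z1"
  have \<beta>0: "B < \<beta>0" using gt by (simp add: u1 \<beta>0_def)
  \<comment> \<open>Where \<open>U + l * pr\<close> is at least \<beta>0, the bound U \<le> A - m pr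
    forces (m - l) pr \<le> A - \<beta>0. The superlevel sets thus lie where the barrier is at most
    \<open>c\<close>, away from \<open>K k\<close>.\<close>
  define c where "c = (A - \<beta>0) / (m - l)"
  have inc: "part k T z \<le> ennreal c" if z: "cmod z < R" "part k T z < \<infinity>" and g: "ereal (\<beta> - l * pr z) \<le> U z" "\<beta>0 \<le> \<beta>" for z \<beta>
  proof -
    have "ereal (\<beta> - l * pr z) \<le> ereal (A - m * pr z)" using ub[OF z] g(1) by (simp add: pr_def) (metis order_trans ereal_less_eq(3))
    then have "(m - l) * pr z \<le> A - \<beta>0" using g(2) by (simp add: algebra_simps)
    then have "pr z \<le> c" using l by (simp add: c_def pos_le_divide_eq mult.commute)
    then show ?thesis using z(2) by (auto simp: pr_def less_top intro: ennreal_leI[of "enn2real _", simplified])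
      (metis ennreal_enn2real ennreal_leI less_top)
  qed
  define L where "L = cball 0 R \<inter> {z. part k T z \<le> ennreal c}"
  have compL: "compact L" unfolding L_def using T by (intro compact_Int_closed part_lsc_closed) auto
  have Lfin: "part k T z < \<infinity>" if "z \<in> L" for z using that by (auto simp: L_def le_less_trans)
  have LK: "z \<notin> K k" if "z \<in> L" for z using Lfin[OF that] part_eq_top[OF _ T(2), of z k] by auto
  define C where "C \<beta> = {z \<in> L. ereal (\<beta> - l * pr z) \<le> U z}" for \<beta>
  have compC: "compact (C \<beta>)" for \<beta>
  proof -
    have "closed (C \<beta>)" unfolding closed_sequential_limits
    proof (intro allI impI, elim conjE)
      fix X z assume X: "\<forall>n. X n \<in> C \<beta>" "X \<longlonglongrightarrow> z"
      have zL: "z \<in> L" using compact_imp_closed[OF compL] X unfolding closed_sequential_limits C_def by blast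
      have "(\<lambda>n. pr (X n)) \<longlonglongrightarrow> pr z" unfolding pr_def
        using part_continuous[OF LK[OF zL] X(2) T(1)] Lfin[OF zL] by (intro tendsto_enn2real) auto
      then have lim: "(\<lambda>n. ereal (\<beta> - l * pr (X n))) \<longlonglongrightarrow> ereal (\<beta> - l * pr z)"
        by (intro tendsto_intros) auto
      have "ereal (\<beta> - l * pr z) \<le> U z"
      proof (rule ccontr)
        assume "\<not> ?thesis"
        then obtain a where a: "U z < a" "a < ereal (\<beta> - l * pr z)" using dense not_le by metis
        have "\<forall>\<^sub>F n in sequentially. X n \<in> {x. U x < a}"
          using X(2) uscU a(1) by (intro topological_tendstoD) (auto simp: usc_def)
        moreover have "\<forall>\<^sub>F n in sequentially. a < ereal (\<beta> - l * pr (X n))"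
          using lim a(2) by (rule order_tendstoD(1))
        ultimately have "\<forall>\<^sub>F n in sequentially. False"
        proof eventually_elim
          case (elim n)
          then have "U (X n) < ereal (\<beta> - l * pr (X n))" by auto
          moreover have "ereal (\<beta> - l * pr (X n)) \<le> U (X n)" using X(1) by (auto simp: C_def)
          ultimately show False by simp
        qed
        then show False by simp
      qed
      then show "z \<in> C \<beta>" using zL by (simp add: C_def)
    qed
    then show ?thesis using compact_Int_closed[OF compL] by (simp add: C_def Int_def inf_commute) (metis (no_types, lifting) C_def Collect_cong compL compact_Int_closed inf_set_def mem_Collect_eq)
  qed
  have Cint: "cmod z < R \<and> \<beta> \<le> A" if z: "z \<in> C \<beta>" "\<beta>0 \<le> \<beta>" for z \<beta>
  proof -
    have zL: "z \<in> L" "ereal (\<beta> - l * pr z) \<le> U z" using z by (auto simp: C_def)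
    have "cmod z \<noteq> R"
    proof
      assume e: "cmod z = R"
      have "pr z \<le> Q" using bd[OF e] Q by (auto simp: pr_def intro: enn2real_leI)
      moreover have "\<beta> - l * pr z \<le> B - l * Q"
        using order_trans[OF zL(2), of "ereal (B - l * Q)"] bd[OF e] by simp
      ultimately have "\<beta> \<le> B" using l(1) mult_left_mono[of "pr z" Q l] by linarith
      then show False using \<beta>0 z(2) by linarith
    qed
    then have zR: "cmod z < R" using zL(1) by (auto simp: L_def)
    have "ereal (\<beta> - l * pr z) \<le> ereal (A - m * pr z)"
      using order_trans[OF zL(2) ub[OF zR Lfin[OF zL(1)]]] by (simp add: pr_def)
    then have "\<beta> \<le> A - (m - l) * pr z" by (simp add: algebra_simps)
    moreover have "(m - l) * pr z \<ge> 0" using l pr0 by simp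
    ultimately show ?thesis using zR by linarith
  qed
  have z1C: "z1 \<in> C \<beta>0"
    using z1 inc[OF z1, of \<beta>0] by (simp add: C_def L_def u1 \<beta>0_def)
  \<comment> \<open>The maximum of \<open>U + l * pr\<close>, described by its superlevel sets so
    that the value -\<infinity> of \<open>U\<close> causes no trouble. Being nested, compact and
    nonempty below the supremum, they have a common point.\<close>
  define M where "M = Sup {\<beta>. \<beta>0 \<le> \<beta> \<and> C \<beta> \<noteq> {}}"
  have bdd: "bdd_above {\<beta>. \<beta>0 \<le> \<beta> \<and> C \<beta> \<noteq> {}}"
    using Cint by (intro bdd_aboveI[of _ A]) blast
  have M0: "\<beta>0 \<le> M" unfolding M_def using z1C bdd by (intro cSup_upper) auto
  have anti: "C \<beta>' \<subseteq> C \<beta>" if "\<beta> \<le> \<beta>'" for \<beta> \<beta>'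
  proof
    fix z assume "z \<in> C \<beta>'"
    then have "z \<in> L" "ereal (\<beta>' - l * pr z) \<le> U z" by (auto simp: C_def)
    moreover have le: "ereal (\<beta> - l * pr z) \<le> ereal (\<beta>' - l * pr z)" using that by simp
    ultimately show "z \<in> C \<beta>" using order_trans[OF le, of "U z"] by (simp add: C_def)
  qed
  have ne: "C \<beta> \<noteq> {}" if "\<beta> < M" for \<beta>
  proof -
    have "{\<beta>. \<beta>0 \<le> \<beta> \<and> C \<beta> \<noteq> {}} \<noteq> {}" using z1C by blast
    with that[unfolded M_def] obtain \<beta>' where "\<beta>' \<in> {\<beta>. \<beta>0 \<le> \<beta> \<and> C \<beta> \<noteq> {}}" "\<beta> < \<beta>'"
      by (rule less_cSupE)
    then have "\<beta> < \<beta>'" "C \<beta>' \<noteq> {}" by auto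
    then show ?thesis using anti[of \<beta> \<beta>'] by auto
  qed
  define F where "F n = C (M - 1 / real (Suc n))" for n
  have "(\<Inter>n. F n) \<noteq> {}"
  proof (rule compact_nest)
    show "compact (F n)" "F n \<noteq> {}" for n unfolding F_def by (auto intro!: compC ne)
    show "F n \<subseteq> F m" if "m \<le> n" for m n
      unfolding F_def using that by (intro anti) (simp add: frac_le)
  qed
  then obtain zM where zM: "\<And>n. zM \<in> C (M - 1 / real (Suc n))" by (auto simp: F_def)
  have zMC: "zM \<in> C M"
  proof -
    have "(\<lambda>n. M - 1 / real (Suc n) - l * pr zM) \<longlonglongrightarrow> M - 0 - l * pr zM"
      using LIMSEQ_inverse_real_of_nat by (intro tendsto_intros) (simp add: inverse_eq_divide)
    then have "(\<lambda>n. ereal (M - 1 / real (Suc n) - l * pr zM)) \<longlonglongrightarrow> ereal (M - l * pr zM)" by simp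
    then have "ereal (M - l * pr zM) \<le> U zM"
      by (rule LIMSEQ_le_const2) (use zM in \<open>auto simp: C_def\<close>)
    then show ?thesis using zM[of 0] by (simp add: C_def)
  qed
  have "continuous_on (C M) Re" by (intro continuous_on_Re continuous_on_id)
  \<comment> \<open>Among the maximum points one with largest real part is taken: every point
    further to the right then has a strictly smaller value, and no connectedness argument is called
    for.\<close>
  then obtain z0 where z0: "z0 \<in> C M" "\<And>z. z \<in> C M \<Longrightarrow> Re z \<le> Re z0"
    using continuous_attains_sup[OF compC[of M], of Re] zMC by blast
  have z0L: "z0 \<in> L" "ereal (M - l * pr z0) \<le> U z0" using z0 by (auto simp: C_def)
  have z0R: "cmod z0 < R" using Cint[OF z0(1) M0] by simp
  have top: "U z \<le> ereal (M - l * pr z)" if z: "cmod z < R" "part k T z < \<infinity>" for z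
  proof (rule ccontr)
    assume n: "\<not> ?thesis"
    then obtain u where u: "U z = ereal u" using Ufin[of z] by (cases "U z") auto
    define \<beta> where "\<beta> = u + l * pr z"
    have b: "M < \<beta>" using n by (simp add: u \<beta>_def)
    have "z \<in> C \<beta>" using z inc[OF z, of \<beta>] b M0 by (simp add: C_def L_def u \<beta>_def)
    then have "\<beta> \<le> M" unfolding M_def using bdd b M0 by (intro cSup_upper) auto
    then show False using b by simp
  qed
  have toplt: "U z < ereal (M - l * pr z)" if z: "cmod z < R" "part k T z < \<infinity>" "Re z > Re z0" for z
  proof (rule ccontr)
    assume "\<not> ?thesis"
    then have g: "ereal (M - l * pr z) \<le> U z" by simp
    then have "z \<in> C M" using z inc[OF z(1,2) g M0] by (simp add: C_def L_def)
    then show False using z0(2)[of z] z(3) by simp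
  qed
  have "open (- K k)" using compact_K[of k] by (simp add: compact_imp_closed open_Compl)
  then obtain e where e: "e > 0" "ball z0 e \<subseteq> - K k" using LK[OF z0L(1)] by (meson ComplI openE)
  \<comment> \<open>The circle stays in |w| < R, and 2 r below the distance of \<open>z0\<close>
    from \<open>K k\<close> keeps its points at distance at least \<open>r\<close> from
    \<open>K k\<close>, which bounds the barrier on it.\<close>
  define r where "r = min (e / 2) ((R - cmod z0) / 2)"
  have r: "r > 0" "2 * r \<le> e" "cmod z0 + r < R" using e z0R by (auto simp: r_def min_def field_simps)
  have far: "2 * r \<le> cmod (z0 - x)" if "x \<in> K k" for x
    using e(2) that r(2) by (force simp: dist_norm subset_eq)
  define y where "y \<theta> = z0 + complex_of_real r * cis \<theta>" for \<theta>
  have yn: "cmod (y \<theta> - z0) = r" for \<theta> using r(1) by (simp add: y_def norm_mult)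
  have yR: "cmod (y \<theta>) < R" for \<theta> using norm_triangle_ineq[of z0 "y \<theta> - z0"] yn[of \<theta>] r(3) by simp
  have yfar: "r \<le> cmod (y \<theta> - x)" if "x \<in> K k" for x \<theta>
    using far[OF that] norm_triangle_ineq4[of "y \<theta> - x" "y \<theta> - z0"] yn[of \<theta>] by simp
  have rT: "r < T" using r(3) R radius_pos norm_ge_zero[of z0] by linarith
  have ybd: "part k T (y \<theta>) \<le> ennreal (- ln (r / T))" for \<theta>
    using part_bound[of k r "y \<theta>" T] yfar r(1) T(1) by (simp add: neglog_def not_le divide_le_0_iff)
  have yfin: "part k T (y \<theta>) < \<infinity>" for \<theta> using ybd[of \<theta>] by (auto intro: le_less_trans)
  interpret Ci: finite_measure circ by (rule finite_measure_circ)
  have [measurable]: "y \<in> borel_measurable circ" unfolding y_def by (intro borel_measurable_circ) measurable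
  have [measurable]: "U \<in> borel_measurable borel" by (rule usc_measurable[OF uscU])
  have [measurable]: "(\<lambda>\<theta>. pr (y \<theta>)) \<in> borel_measurable circ" unfolding pr_def by measurable
  have intpr: "integrable circ (\<lambda>\<theta>. pr (y \<theta>))"
  proof (rule Ci.integrable_const_bound[where B="- ln (r / T)"])
    have "0 \<le> - ln (r / T)" using rT r(1) T(1) by (simp add: ln_le_zero_iff)
    then show "AE \<theta> in circ. norm (pr (y \<theta>)) \<le> - ln (r / T)"
      using ybd by (intro AE_I2) (simp add: pr_def enn2real_leI)
  qed measurable
  have Ipr: "(\<integral>\<theta>. pr (y \<theta>) \<partial>circ) = 2 * pi * pr z0"
  proof -
    have "ennreal (\<integral>\<theta>. pr (y \<theta>) \<partial>circ) = (\<integral>\<^sup>+\<theta>. ennreal (pr (y \<theta>)) \<partial>circ)"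
      by (rule nn_integral_eq_integral[symmetric, OF intpr]) (simp add: pr0)
    also have "\<dots> = (\<integral>\<^sup>+\<theta>. part k T (y \<theta>) \<partial>circ)"
      using yfin by (intro nn_integral_cong) (simp add: pr_def)
    also have "\<dots> = ennreal (2 * pi) * part k T z0" unfolding y_def
      by (rule part_circle_mean) (use far r R in \<open>fastforce+\<close>)
    also have "\<dots> = ennreal (2 * pi * pr z0)"
      using Lfin[OF z0L(1)] by (simp add: pr_def ennreal_mult')
    finally show ?thesis using pr0 by (subst (asm) ennreal_inj) (auto intro!: integral_nonneg)
  qed
  define w where "w \<theta> = M - l * pr (y \<theta>)" for \<theta>
  \<comment> \<open>The nonnegative amount by which \<open>U\<close> stays below its maximal profile
    \<open>w\<close>. The submean inequality at the maximum point forces its integral to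
    vanish.\<close>
  define h where "h \<theta> = e2ennreal (ereal (w \<theta>) - U (y \<theta>))" for \<theta>
  have [measurable]: "h \<in> borel_measurable circ" unfolding h_def w_def by measurable
  have Uw: "U (y \<theta>) \<le> ereal (w \<theta>)" for \<theta> unfolding w_def by (rule top[OF yR yfin])
  have Uh: "U (y \<theta>) = ereal (w \<theta>) - enn2ereal (h \<theta>)" for \<theta>
    using Uw[of \<theta>] Ufin[of "y \<theta>"] unfolding h_def
    by (cases "U (y \<theta>)") (auto simp: enn2ereal_e2ennreal)
  have iw: "integrable circ w" unfolding w_def[abs_def] using intpr by simp
  have Iw: "(\<integral>\<theta>. w \<theta> \<partial>circ) = 2 * pi * (M - l * pr z0)"
    unfolding w_def using intpr Ipr emeasure_circ
    by (subst Bochner_Integration.integral_diff) (auto simp: measure_def right_diff_distrib)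
  define J where "J = (\<integral>\<^sup>+\<theta>. h \<theta> \<partial>circ)"
  have "ereal_integral circ (\<lambda>\<theta>. U (y \<theta>)) = ereal (2 * pi * (M - l * pr z0)) - enn2ereal J"
    unfolding J_def Iw[symmetric] by (rule ereal_integral_diff[OF iw]) (measurable, rule Uh)
  then have "ereal (M - l * pr z0) \<le> (ereal (2 * pi * (M - l * pr z0)) - enn2ereal J) / ereal (2 * pi)"
    using Umean[OF r(1), of z0] z0L(2) by (simp add: y_def)
  then have "J = 0"
    by (cases J) (auto simp: enn2ereal_ennreal field_simps)
  then have "AE \<theta> in circ. h \<theta> = 0" unfolding J_def by (subst (asm) nn_integral_0_iff_AE) auto
  then have AE0: "AE \<theta> in lborel. \<theta> \<in> {0..2*pi} \<longrightarrow> h \<theta> = 0"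
    by (subst (asm) AE_restrict_space_iff) auto
  \<comment> \<open>For angles in (0, 1) the cosine is positive, so the point of the circle lies to
    the right of \<open>z0\<close> and the deficit there is strictly positive.\<close>
  have "AE \<theta> in lborel. \<theta> \<notin> {0<..<1::real}"
    using AE0
  proof eventually_elim
    case (elim \<theta>)
    show ?case
    proof
      assume t: "\<theta> \<in> {0<..<1::real}"
      then have "\<theta> < pi / 2" "\<theta> < 2 * pi" using pi_gt3 by auto
      then have "cos \<theta> > 0" using t by (intro cos_gt_zero) auto
      then have "Re (y \<theta>) > Re z0" using r(1) by (simp add: y_def)
      then have "U (y \<theta>) < ereal (w \<theta>)" unfolding w_def by (rule toplt[OF yR yfin])
      moreover have "h \<theta> = 0" using elim t \<open>\<theta> < 2 * pi\<close> by auto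
      ultimately show False using Uh[of \<theta>] by (simp add: zero_ennreal.rep_eq)
    qed
  qed
  then have "emeasure lborel {0<..<1::real} = 0"
    by (subst (asm) AE_iff_measurable[of "{0<..<1}"]) auto
  then show False by simp
qed

text \<open>The constant \<open>A\<close> enters only the a priori bound and disappears from the
  conclusion. On |w| = R the full potential is ln T - ln R, so the right side of the conclusion
  extends the boundary bound inwards.\<close>

theorem domination:
  assumes U: "subharmonic U" and R: "s < R" "2 * R \<le> T" and m: "m > 0"
    and bd: "\<And>z. cmod z = R \<Longrightarrow> U z \<le> ereal (\<kappa> + m * ln R)"
    and ub: "\<And>z. cmod z < R \<Longrightarrow> U z \<le> ereal A - ereal m * enn2ereal (full T z)"
    and z: "cmod z < R"
  shows "U z \<le> ereal (\<kappa> + m * ln T) - ereal m * enn2ereal (full T z)"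
proof (cases "full T z")
  case top
  then show ?thesis using ub[OF z] m by (cases "U z") auto
next
  case (real f)
  have R0: "R > 0" "T > 0" using R radius_pos by auto
  show ?thesis
  proof (cases "U z")
    case (real u)
    have fullR: "full T x = ennreal (ln T - ln R)" if "cmod x = R" for x
    proof -
      have "full T x = neglog (cmod x / T)" unfolding full_def using that R by (intro mean_mu) auto
      then show ?thesis using that R0 by (simp add: neglog_def ln_div not_le divide_le_0_iff)
    qed
    have lRT: "ln R \<le> ln T" using R R0 by (intro ln_mono) auto
    \<comment> \<open>The maximum principle demands a slope l < m, here (1 - \<epsilon>) m. The
      limit in \<open>k\<close> replaces the partial potential by the full one; afterwards
      \<epsilon> tends to 0.\<close>
    have key: "u \<le> \<kappa> + m * ln R + (1 - \<epsilon>) * m * (ln T - ln R) - (1 - \<epsilon>) * m * f" if \<epsilon>: "0 < \<epsilon>" "\<epsilon> < 1" for \<epsilon>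
    proof -
      have k: "u \<le> \<kappa> + m * ln R + (1 - \<epsilon>) * m * (ln T - ln R) - (1 - \<epsilon>) * m * enn2real (part k T z)" for k
      proof -
        have "U z \<le> ereal (\<kappa> + m * ln R + (1 - \<epsilon>) * m * (ln T - ln R) - (1 - \<epsilon>) * m * enn2real (part k T z))"
        proof (rule max_principle_part[OF U R, where m=m and Q="ln T - ln R" and A=A])
          show "0 < (1 - \<epsilon>) * m" "(1 - \<epsilon>) * m < m" using \<epsilon> m by auto
          show "0 \<le> ln T - ln R" using lRT by simp
          show "part k T x \<le> ennreal (ln T - ln R) \<and> U x \<le> ereal (\<kappa> + m * ln R + (1 - \<epsilon>) * m * (ln T - ln R) - (1 - \<epsilon>) * m * (ln T - ln R))"
            if "cmod x = R" for x using fullR[OF that] part_le_full[of k T x] bd[OF that] by simp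
          show "U x \<le> ereal (A - m * enn2real (part k T x))" if "cmod x < R" "part k T x < \<infinity>" for x
          proof -
            have "enn2ereal (part k T x) \<le> enn2ereal (full T x)" using part_le_full[of k T x] by (simp add: less_eq_ennreal.rep_eq)
            then have "ereal A - ereal m * enn2ereal (full T x) \<le> ereal A - ereal m * enn2ereal (part k T x)"
              using m by (intro ereal_minus_mono ereal_mult_left_mono) auto
            also have "\<dots> = ereal (A - m * enn2real (part k T x))"
              using that(2) by (cases "part k T x") (auto simp: enn2ereal_ennreal)
            finally show ?thesis using ub[OF that(1)] by (rule order_trans[rotated])
          qed
          show "cmod z < R" by (rule z)
          have "part k T z \<le> full T z" by (rule part_le_full)
          then show "part k T z < \<infinity>" using \<open>full T z = ennreal f\<close> by (auto simp: le_less_trans)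
        qed
        then show ?thesis using real by simp
      qed
      have "(\<lambda>k. enn2real (part k T z)) \<longlonglongrightarrow> enn2real (full T z)"
        using part_tendsto_full[of T z] \<open>full T z = ennreal f\<close> by (intro tendsto_enn2real) auto
      then have "(\<lambda>k. enn2real (part k T z)) \<longlonglongrightarrow> f" using \<open>full T z = ennreal f\<close> \<open>0 \<le> f\<close> by simp
      then have "(\<lambda>k. \<kappa> + m * ln R + (1 - \<epsilon>) * m * (ln T - ln R) - (1 - \<epsilon>) * m * enn2real (part k T z)) \<longlonglongrightarrow>
        \<kappa> + m * ln R + (1 - \<epsilon>) * m * (ln T - ln R) - (1 - \<epsilon>) * m * f"
        by (rule tendsto_diff[OF tendsto_const tendsto_mult[OF tendsto_const]])
      then show ?thesis by (rule LIMSEQ_le_const) (use k in auto)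
    qed
    have "(\<lambda>n. 1 / real (n + 2)) \<longlonglongrightarrow> 0"
      using LIMSEQ_ignore_initial_segment[OF LIMSEQ_inverse_real_of_nat, of 1] by (simp add: inverse_eq_divide add.commute)
    then have "(\<lambda>n. \<kappa> + m * ln R + (1 - 1 / real (n + 2)) * m * (ln T - ln R) - (1 - 1 / real (n + 2)) * m * f) \<longlonglongrightarrow>
        \<kappa> + m * ln R + (1 - 0) * m * (ln T - ln R) - (1 - 0) * m * f"
      by (intro tendsto_intros)
    then have "u \<le> \<kappa> + m * ln R + (1 - 0) * m * (ln T - ln R) - (1 - 0) * m * f"
      by (rule LIMSEQ_le_const) (use key in auto)
    then have "u \<le> \<kappa> + m * ln T - m * f" by (simp add: algebra_simps)
    then show ?thesis using real \<open>full T z = ennreal f\<close> \<open>0 \<le> f\<close> by (simp add: enn2ereal_ennreal)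
  next
    case PInf
    then show ?thesis using U by (auto simp: subharmonic_def)
  next
    case MInf
    then show ?thesis by simp
  qed
qed

end

section \<open>Exponential integrability\<close>

definition eexp :: "ennreal \<Rightarrow> ennreal" where
  "eexp x = (if x = \<infinity> then \<infinity> else ennreal (exp (enn2real x)))"

lemma eexp_ennreal: "0 \<le> x \<Longrightarrow> eexp (ennreal x) = ennreal (exp x)"
  by (simp add: eexp_def)

lemma eexp_top [simp]: "eexp \<infinity> = \<infinity>" "eexp top = \<infinity>"
  by (simp_all add: eexp_def)

lemma eexp_measurable [measurable]: "eexp \<in> borel_measurable borel"
  unfolding eexp_def[abs_def] by measurable

lemma eexp_mono: "x \<le> y \<Longrightarrow> eexp x \<le> eexp y"
  by (cases x; cases y) (auto simp: eexp_ennreal top_unique intro: ennreal_leI)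

lemma eexp_add: "eexp (x + y) = eexp x * eexp y"
proof (cases "x = \<infinity> \<or> y = \<infinity>")
  case True
  have "eexp z \<noteq> 0" for z by (cases z) (auto simp: eexp_ennreal)
  with True show ?thesis by (auto simp: ennreal_mult_top ennreal_top_mult)
next
  case False
  then show ?thesis
    by (cases x; cases y) (auto simp: eexp_ennreal ennreal_plus[symmetric] exp_add ennreal_mult simp del: ennreal_plus)
qed

lemma self_le_eexp: "x \<le> eexp x"
proof (cases x)
  case (real r)
  have "r \<le> exp r" using exp_ge_add_one_self[of r] by linarith
  then show ?thesis using real by (simp add: eexp_ennreal ennreal_leI)
qed simp

lemma (in prob_space) eexp_jensen:
  assumes [measurable]: "g \<in> borel_measurable M"
  shows "eexp (\<integral>\<^sup>+x. g x \<partial>M) \<le> (\<integral>\<^sup>+x. eexp (g x) \<partial>M)"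
proof (cases "\<integral>\<^sup>+x. g x \<partial>M")
  case top
  have "(\<integral>\<^sup>+x. g x \<partial>M) \<le> (\<integral>\<^sup>+x. eexp (g x) \<partial>M)" by (intro nn_integral_mono self_le_eexp)
  then show ?thesis using top by (simp add: top_unique)
next
  case (real a)
  \<comment> \<open>the tangent line \<open>exp u \<ge> exp a * (1 + u - a)\<close>, rearranged so that no subtraction occurs\<close>
  have tangent: "ennreal (exp a) + ennreal (exp a) * u \<le> eexp u + ennreal (exp a * a)" for u
  proof (cases u)
    case u: (real u')
    have "1 + (u' - a) \<le> exp (u' - a)" by (rule exp_ge_add_one_self)
    then have "exp a * (1 + (u' - a)) \<le> exp a * exp (u' - a)" by (intro mult_left_mono) auto
    then have "exp a + exp a * u' \<le> exp u' + exp a * a" by (simp add: exp_diff algebra_simps)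
    then show ?thesis using u real(1)
      by (simp add: eexp_ennreal ennreal_mult[symmetric] ennreal_plus[symmetric] del: ennreal_plus)
  qed simp
  have "(\<integral>\<^sup>+x. ennreal (exp a) + ennreal (exp a) * g x \<partial>M) \<le> (\<integral>\<^sup>+x. eexp (g x) + ennreal (exp a * a) \<partial>M)"
    by (intro nn_integral_mono tangent)
  then have le: "ennreal (exp a) + ennreal (exp a) * ennreal a \<le> (\<integral>\<^sup>+x. eexp (g x) \<partial>M) + ennreal (exp a * a)"
    by (simp add: nn_integral_add nn_integral_cmult emeasure_space_1 real)
  show ?thesis
  proof (cases "\<integral>\<^sup>+x. eexp (g x) \<partial>M")
    case top then show ?thesis by simp
  next
    case J: (real j)
    then show ?thesis using le real
      by (simp add: eexp_ennreal ennreal_mult[symmetric] ennreal_plus[symmetric] del: ennreal_plus)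
  qed
qed

context polar_measure
begin

text \<open>Without atoms, a small disc around \<open>z0\<close> has mass \<open>b\<close> with
  \<gamma> b \<le> 1. The mass outside contributes a bounded amount near \<open>z0\<close>; for the
  mass inside, Jensen's inequality for the normalised measure moves the exponential onto a single
  kernel, where it becomes at most T/|z - x|, integrable uniformly in \<open>x\<close>.\<close>

lemma eexp_full_locally_integrable:
  assumes \<gamma>: "\<gamma> \<ge> 0" and T: "T > 0" and \<delta>: "\<delta> > 0"
  shows "\<exists>r. 0 < r \<and> r < \<delta> \<and> (\<integral>\<^sup>+z. eexp (ennreal \<gamma> * full T z) * indicator (ball z0 r) z \<partial>lborel) < \<infinity>"
proof -
  have "(\<lambda>n. emeasure \<mu> (cball z0 (1 / real (Suc n)))) \<longlonglongrightarrow> emeasure \<mu> (\<Inter>n. cball z0 (1 / real (Suc n)))"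
  proof (rule Lim_emeasure_decseq)
    show "decseq (\<lambda>n. cball z0 (1 / real (Suc n)))"
      unfolding decseq_def by (intro allI impI subset_cball frac_le) auto
  qed auto
  moreover have "(\<Inter>n. cball z0 (1 / real (Suc n))) = {z0}"
  proof safe
    fix x assume x: "x \<in> (\<Inter>n. cball z0 (1 / real (Suc n)))"
    show "x = z0"
    proof (rule ccontr)
      assume "x \<noteq> z0"
      then obtain n where "1 / real (Suc n) < dist z0 x" by (metis zero_less_dist_iff nat_approx_posE)
      moreover have "dist z0 x \<le> 1 / real (Suc n)" using x by auto
      ultimately show False by simp
    qed
  qed auto
  ultimately have lim: "(\<lambda>n. emeasure \<mu> (cball z0 (1 / real (Suc n)))) \<longlonglongrightarrow> 0"
    using atomless by simp
  have "\<forall>\<^sub>F n in sequentially. emeasure \<mu> (cball z0 (1 / real (Suc n))) < ennreal (1 / (\<gamma> + 1))"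
    using \<gamma> by (intro order_tendstoD(2)[OF lim]) auto
  then obtain n where n: "emeasure \<mu> (cball z0 (1 / real (Suc n))) < ennreal (1 / (\<gamma> + 1))"
    by (auto simp: eventually_sequentially)
  \<comment> \<open>The disc of radius 2 r must have the small mass, \<open>r\<close> must stay
    below \<delta>, and distances up to 3 r must not exceed \<open>T\<close>, so that
    \<open>neglog\<close> is exact for z within \<open>r\<close> and x within 2 r of
    \<open>z0\<close>.\<close>
  define r where "r = min (1 / real (Suc n) / 2) (min (\<delta> / 2) (T / 3))"
  have r: "0 < r" "2 * r \<le> 1 / real (Suc n)" "r < \<delta>" "3 * r \<le> T"
  proof -
    have le: "r \<le> 1 / real (Suc n) / 2" "r \<le> \<delta> / 2" "r \<le> T / 3"
      unfolding r_def by linarith+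
    have "2 * x \<le> d" if "x \<le> d / 2" for x d :: real using that by linarith
    then show "2 * r \<le> 1 / real (Suc n)" using le(1) .
    show "r < \<delta>" using le(2) \<delta> by linarith
    show "3 * r \<le> T" using le(3) by linarith
    show "0 < r" using \<delta> T by (simp add: r_def)
  qed
  define B where "B = ball z0 (2 * r)"
  have [measurable]: "B \<in> sets borel" by (simp add: B_def)
  define b where "b = prob B"
  have "emeasure \<mu> B \<le> emeasure \<mu> (cball z0 (1 / real (Suc n)))"
    using r(2) by (intro emeasure_mono) (auto simp: B_def)
  then have "emeasure \<mu> B < ennreal (1 / (\<gamma> + 1))" using n by (rule le_less_trans)
  then have "ennreal b < ennreal (1 / (\<gamma> + 1))" by (simp only: b_def emeasure_eq_measure)
  then have "b < 1 / (\<gamma> + 1)" by (simp add: b_def ennreal_less_iff)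
  then have "b * (\<gamma> + 1) < 1" using \<gamma> by (simp add: pos_less_divide_eq)
  moreover have b0: "0 \<le> b" by (simp add: b_def)
  ultimately have gb: "\<gamma> * b \<le> 1" by (simp add: algebra_simps)
  define N where "N = - ln (r / T)"
  have N: "neglog (r / T) = ennreal N" "N \<ge> 0"
    using r T by (auto simp: neglog_def N_def not_le divide_le_0_iff ln_le_zero_iff)
  define q where "q z = (\<integral>\<^sup>+x. indicator B x * neglog (cmod (z - x) / T) \<partial>\<mu>)" for z
  have [measurable]: "q \<in> borel_measurable borel" unfolding q_def[abs_def] by measurable
  have fq: "full T z \<le> q z + ennreal N" if z: "z \<in> ball z0 r" for z
  proof -
    have "full T z \<le> (\<integral>\<^sup>+x. indicator B x * neglog (cmod (z - x) / T) + ennreal N \<partial>\<mu>)"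
      unfolding full_def
    proof (rule nn_integral_mono)
      fix x
      show "neglog (cmod (z - x) / T) \<le> indicator B x * neglog (cmod (z - x) / T) + ennreal N"
      proof (cases "x \<in> B")
        case False
        have "r \<le> cmod (z - x)"
          using False z norm_triangle_ineq4[of "x - z" "z0 - z"] by (auto simp: B_def dist_norm norm_minus_commute)
        then have "neglog (cmod (z - x) / T) \<le> neglog (r / T)" using T by (intro antimono_neglog divide_right_mono) auto
        then show ?thesis using False N by simp
      qed simp
    qed
    also have "\<dots> = q z + ennreal N"
      unfolding q_def by (subst nn_integral_add) (auto simp: emeasure_space_1[simplified])
    finally show ?thesis .
  qed
  have main: "(\<integral>\<^sup>+z. eexp (ennreal \<gamma> * q z) * indicator (ball z0 r) z \<partial>lborel) < \<infinity>"
  \<comment> \<open>Jensen's inequality is applied to \<mu> conditioned on \<open>B\<close>, which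
    requires positive mass.\<close>
  proof (cases "b = 0")
    case True
    then have "emeasure \<mu> B = 0" by (simp add: b_def emeasure_eq_measure)
    then have "AE x in \<mu>. x \<notin> B" by (intro AE_not_in) (auto simp: null_sets_def)
    then have "q z = 0" for z unfolding q_def
      by (subst nn_integral_0_iff_AE) (measurable, auto elim!: eventually_mono)
    then have "(\<integral>\<^sup>+z. eexp (ennreal \<gamma> * q z) * indicator (ball z0 r) z \<partial>lborel) = emeasure lborel (ball z0 r)"
      by (simp add: eexp_def)
    also have "\<dots> < \<infinity>" by (rule emeasure_bounded_finite) simp
    finally show ?thesis .
  next
    case False
    then have bpos: "b > 0" using b0 by simp
    define P where "P = density \<mu> (\<lambda>x. ennreal (1 / b) * indicator B x)"
    have setsP [measurable_cong, simp]: "sets P = sets borel" by (simp add: P_def)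
    interpret P: prob_space P
    proof
      have "emeasure P (space P) = (\<integral>\<^sup>+x. ennreal (1 / b) * indicator B x \<partial>\<mu>)"
        unfolding P_def by (subst emeasure_density) (auto intro!: nn_integral_cong)
      also have "\<dots> = ennreal (1 / b) * ennreal b"
        by (subst nn_integral_cmult_indicator) (auto simp: b_def emeasure_eq_measure)
      also have "\<dots> = 1" using bpos by (simp add: ennreal_mult'[symmetric])
      finally show "emeasure P (space P) = 1" .
    qed
    have nnP: "(\<integral>\<^sup>+x. g x \<partial>P) = (\<integral>\<^sup>+x. ennreal (1 / b) * indicator B x * g x \<partial>\<mu>)" if [measurable]: "g \<in> borel_measurable borel" for g
      unfolding P_def by (subst nn_integral_density) auto
    define e where "e z x = eexp (neglog (cmod (z - x) / T))" for z x
    have e_meas [measurable]: "(\<lambda>p. e (fst p) (snd p)) \<in> borel_measurable (lborel \<Otimes>\<^sub>M P)"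
    proof -
      have [measurable]: "snd \<in> borel_measurable (lborel \<Otimes>\<^sub>M P)"
        using measurable_snd[of lborel P] by (simp cong: measurable_cong_sets)
      have [measurable]: "fst \<in> borel_measurable ((lborel :: complex measure) \<Otimes>\<^sub>M P)"
        using measurable_fst[of "lborel :: complex measure" P] by (simp cong: measurable_cong_sets)
      show ?thesis unfolding e_def by measurable
    qed
    have pt: "eexp (ennreal \<gamma> * q z) \<le> (\<integral>\<^sup>+x. e z x \<partial>P)" for z
    proof -
      have "ennreal \<gamma> * q z = (\<integral>\<^sup>+x. ennreal (\<gamma> * b) * neglog (cmod (z - x) / T) \<partial>P)"
      proof -
        have "(\<integral>\<^sup>+x. ennreal (\<gamma> * b) * neglog (cmod (z - x) / T) \<partial>P) =
           (\<integral>\<^sup>+x. ennreal \<gamma> * (indicator B x * neglog (cmod (z - x) / T)) \<partial>\<mu>)"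
        proof (subst nnP, measurable, rule nn_integral_cong)
          fix x
          have "ennreal (1 / b) * ennreal (\<gamma> * b) = ennreal \<gamma>"
            using bpos \<gamma> by (simp add: ennreal_mult'[symmetric])
          then show "ennreal (1 / b) * indicator B x * (ennreal (\<gamma> * b) * neglog (cmod (z - x) / T)) = ennreal \<gamma> * (indicator B x * neglog (cmod (z - x) / T))"
            by (cases "x \<in> B") (auto simp: mult.assoc[symmetric])
        qed
        also have "\<dots> = ennreal \<gamma> * q z" unfolding q_def by (rule nn_integral_cmult) measurable
        finally show ?thesis ..
      qed
      then have "eexp (ennreal \<gamma> * q z) = eexp (\<integral>\<^sup>+x. ennreal (\<gamma> * b) * neglog (cmod (z - x) / T) \<partial>P)" by simp
      also have "\<dots> \<le> (\<integral>\<^sup>+x. eexp (ennreal (\<gamma> * b) * neglog (cmod (z - x) / T)) \<partial>P)"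
        by (rule P.eexp_jensen) measurable
      also have "\<dots> \<le> (\<integral>\<^sup>+x. e z x \<partial>P)"
        unfolding e_def
      proof (intro nn_integral_mono eexp_mono)
        fix x
        have "ennreal (\<gamma> * b) * neglog (cmod (z - x) / T) \<le> 1 * neglog (cmod (z - x) / T)"
          using gb by (intro mult_right_mono) (auto intro: ennreal_le_1[THEN iffD2])
        then show "ennreal (\<gamma> * b) * neglog (cmod (z - x) / T) \<le> neglog (cmod (z - x) / T)" by simp
      qed
      finally show ?thesis .
    qed
    have inner: "(\<integral>\<^sup>+z. e z x * indicator (ball z0 r) z \<partial>lborel) \<le> ennreal (T * (2 * pi * (3 * r)))" if x: "x \<in> B" for x
    proof -
      have "(\<integral>\<^sup>+z. e z x * indicator (ball z0 r) z \<partial>lborel) \<le> (\<integral>\<^sup>+z. ennreal T * (ennreal (1 / cmod (z - x)) * indicator (cball x (3 * r)) z) \<partial>lborel)"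
      proof (rule nn_integral_mono_AE)
        show "AE z in lborel. e z x * indicator (ball z0 r) z \<le> ennreal T * (ennreal (1 / cmod (z - x)) * indicator (cball x (3 * r)) z)"
          using AE_lborel_singleton[of x]
        proof eventually_elim
          case (elim z)
          show ?case
          proof (cases "z \<in> ball z0 r")
            case True
            have d: "cmod (z - x) \<le> 3 * r"
              using True x norm_triangle_ineq4[of "z - z0" "x - z0"] by (auto simp: B_def dist_norm norm_minus_commute)
            have p: "cmod (z - x) > 0" using elim by simp
            have "e z x = ennreal (exp (- ln (cmod (z - x) / T)))"
            proof -
              have "0 \<le> - ln (cmod (z - x) / T)" using p d r T by (simp add: ln_le_zero_iff)
              then show ?thesis using p T by (simp add: e_def neglog_def eexp_ennreal not_le divide_le_0_iff)
            qed
            also have "exp (- ln (cmod (z - x) / T)) = T * (1 / cmod (z - x))"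
              using p T by (simp add: exp_minus)
            finally show ?thesis using True d T by (simp add: ennreal_mult'[symmetric] dist_norm norm_minus_commute)
          qed simp
        qed
      qed
      also have "\<dots> = ennreal T * (\<integral>\<^sup>+z. ennreal (1 / cmod (z - x)) * indicator (cball x (3 * r)) z \<partial>lborel)"
        by (rule nn_integral_cmult) measurable
      also have "\<dots> = ennreal T * ennreal (2 * pi * (3 * r))"
        using r by (subst nn_integral_inverse_dist) auto
      also have "\<dots> = ennreal (T * (2 * pi * (3 * r)))" using T by (simp add: ennreal_mult')
      finally show ?thesis .
    qed
    interpret PP: pair_sigma_finite "lborel :: complex measure" P ..
    have ind_meas [measurable]: "(\<lambda>p. indicator (ball z0 r) (fst p) :: ennreal) \<in> borel_measurable (lborel \<Otimes>\<^sub>M P)"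
      by (rule measurable_compose[OF measurable_fst]) simp
    have AEB: "AE x in P. x \<in> B"
      unfolding P_def by (subst AE_density) (auto simp: indicator_def)
    have "(\<integral>\<^sup>+z. eexp (ennreal \<gamma> * q z) * indicator (ball z0 r) z \<partial>lborel) \<le> (\<integral>\<^sup>+z. (\<integral>\<^sup>+x. e z x * indicator (ball z0 r) z \<partial>P) \<partial>lborel)"
    proof (rule nn_integral_mono)
      fix z
      show "eexp (ennreal \<gamma> * q z) * indicator (ball z0 r) z \<le> (\<integral>\<^sup>+x. e z x * indicator (ball z0 r) z \<partial>P)"
        using pt[of z] by (cases "z \<in> ball z0 r") auto
    qed
    also have "\<dots> = (\<integral>\<^sup>+x. (\<integral>\<^sup>+z. e z x * indicator (ball z0 r) z \<partial>lborel) \<partial>P)"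
      by (rule PP.Fubini'[symmetric]) (simp add: case_prod_beta)
    also have "\<dots> \<le> (\<integral>\<^sup>+x. ennreal (T * (2 * pi * (3 * r))) \<partial>P)"
      by (rule nn_integral_mono_AE) (use AEB inner in \<open>auto elim!: eventually_mono\<close>)
    also have "\<dots> < \<infinity>" by (simp add: P.emeasure_space_1)
    finally show ?thesis .
  qed
  have "(\<integral>\<^sup>+z. eexp (ennreal \<gamma> * full T z) * indicator (ball z0 r) z \<partial>lborel) \<le>
     (\<integral>\<^sup>+z. eexp (ennreal (\<gamma> * N)) * (eexp (ennreal \<gamma> * q z) * indicator (ball z0 r) z) \<partial>lborel)"
  proof (rule nn_integral_mono)
    fix z
    show "eexp (ennreal \<gamma> * full T z) * indicator (ball z0 r) z \<le> eexp (ennreal (\<gamma> * N)) * (eexp (ennreal \<gamma> * q z) * indicator (ball z0 r) z)"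
    proof (cases "z \<in> ball z0 r")
      case True
      have "ennreal \<gamma> * full T z \<le> ennreal \<gamma> * (q z + ennreal N)" using fq[OF True] by (rule mult_left_mono) simp
      also have "\<dots> = ennreal (\<gamma> * N) + ennreal \<gamma> * q z" using \<gamma> by (simp add: distrib_left ennreal_mult' add.commute)
      finally have "eexp (ennreal \<gamma> * full T z) \<le> eexp (ennreal (\<gamma> * N) + ennreal \<gamma> * q z)" by (rule eexp_mono)
      then show ?thesis using True by (simp add: eexp_add)
    qed simp
  qed
  also have "\<dots> = eexp (ennreal (\<gamma> * N)) * (\<integral>\<^sup>+z. eexp (ennreal \<gamma> * q z) * indicator (ball z0 r) z \<partial>lborel)"
    by (rule nn_integral_cmult) measurable
  also have "\<dots> < \<infinity>" using main \<gamma> N by (auto simp: ennreal_mult_less_top eexp_ennreal)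
  finally show ?thesis using r by blast
qed

end

section \<open>The potential of a Fubini--Study disk\<close>

lemma circ_mean_log_kernel:
  assumes ne: "cmod w \<noteq> cmod z"
  shows "(\<integral>\<^sup>+\<theta>. log_kernel (cis \<theta> * w) 1 z \<partial>circ) =
    ennreal (2 * pi * (fs_potential w + fs_potential z - ln (max (cmod w) (cmod z))))"
proof -
  interpret C: finite_measure circ by (rule finite_measure_circ)
  have nz: "z - w * cis \<theta> \<noteq> 0" for \<theta>
  proof
    assume "z - w * cis \<theta> = 0"
    then have "cmod z = cmod (w * cis \<theta>)" by simp
    then show False using ne by (simp add: norm_mult)
  qed
  define I where "I = 2 * pi * ln (max (cmod w) (cmod z))"
  have I: "integrable circ (\<lambda>\<theta>. ln (cmod (z - w * cis \<theta>)))" "(\<integral>\<theta>. ln (cmod (z - w * cis \<theta>)) \<partial>circ) = I"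
    using circ_mean_ln_outside[of w z] circ_mean_ln_inside[of z w] ne
    by (cases "cmod w < cmod z"; force simp: I_def max_def)+
  have k: "log_kernel (cis \<theta> * w) 1 z = ennreal (fs_potential w + fs_potential z - ln (cmod (z - w * cis \<theta>)))"
    "0 \<le> fs_potential w + fs_potential z - ln (cmod (z - w * cis \<theta>))" for \<theta>
  proof -
    have e: "cis \<theta> * w - 1 * z = - (z - w * cis \<theta>)" by simp
    have n: "cis \<theta> * w - 1 * z \<noteq> 0" unfolding e neg_equal_0_iff_equal by (rule nz)
    have t: "ln ((cmod (cis \<theta> * w))\<^sup>2 + (cmod 1)\<^sup>2) / 2 = fs_potential w"
      by (simp add: fs_potential_def norm_mult add.commute)
    have c: "cmod (cis \<theta> * w - 1 * z) = cmod (z - w * cis \<theta>)" unfolding e by (rule norm_minus_cancel)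
    show "log_kernel (cis \<theta> * w) 1 z = ennreal (fs_potential w + fs_potential z - ln (cmod (z - w * cis \<theta>)))"
      "0 \<le> fs_potential w + fs_potential z - ln (cmod (z - w * cis \<theta>))"
      using log_kernel_eq[OF n] unfolding t c by auto
  qed
  have "(\<integral>\<^sup>+\<theta>. log_kernel (cis \<theta> * w) 1 z \<partial>circ) = ennreal (\<integral>\<theta>. fs_potential w + fs_potential z - ln (cmod (z - w * cis \<theta>)) \<partial>circ)"
    unfolding k(1) using I(1) k(2) by (intro nn_integral_eq_integral) auto
  also have "(\<integral>\<theta>. fs_potential w + fs_potential z - ln (cmod (z - w * cis \<theta>)) \<partial>circ) = 2 * pi * (fs_potential w + fs_potential z) - I"
    using I emeasure_circ by (subst Bochner_Integration.integral_diff) (auto simp: measure_def)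
  finally show ?thesis by (simp add: I_def right_diff_distrib)
qed

lemma ln_norm_half: "z \<noteq> 0 \<Longrightarrow> ln (cmod z) = ln ((cmod z)\<^sup>2) / 2"
  by (simp add: ln_realpow)

text \<open>
  The circle mean of \<open>log_kernel\<close> times the radial density of \<open>\<omega>\<close>, with \<open>t = |w|\<^sup>2\<close> and \<open>a = |z|\<^sup>2\<close>.
\<close>

definition tail_fun :: "real \<Rightarrow> real \<Rightarrow> real" where
  "tail_fun a t = (ln (1 + t) + ln (1 + a) - ln (max t a)) / (2 * (1 + t)\<^sup>2)"

lemma tail_fun_nonneg:
  assumes "0 \<le> a" "0 < t" shows "0 \<le> tail_fun a t"
proof -
  have "ln (max t a) \<le> ln ((1 + t) * (1 + a))"
  proof (rule ln_mono)
    have "0 \<le> t * a" using assms by simp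
    then show "max t a \<le> (1 + t) * (1 + a)" using assms by (simp add: algebra_simps)
  qed (use assms in auto)
  also have "\<dots> = ln (1 + t) + ln (1 + a)" using assms by (intro ln_mult_pos) auto
  finally show ?thesis by (simp add: tail_fun_def)
qed

lemma nn_integral_outer_kernel:
  assumes b: "0 < b"
  shows "(\<integral>\<^sup>+w. ennreal (fs_density w) * indicator {w. b \<le> (cmod w)\<^sup>2} w * log_kernel w 1 z \<partial>lborel) =
    (\<integral>\<^sup>+t. ennreal (tail_fun ((cmod z)\<^sup>2) t) * indicator {b..} t \<partial>lborel)"
proof -
  let ?a = "(cmod z)\<^sup>2"
  let ?W = "\<lambda>w::complex. ennreal (fs_density w) * indicator {w. b \<le> (cmod w)\<^sup>2} w"
  have [measurable]: "fs_density \<in> borel_measurable borel" unfolding fs_density_eq[abs_def] by measurable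
  have [measurable]: "tail_fun a \<in> borel_measurable borel" for a unfolding tail_fun_def[abs_def] by measurable
  have "ennreal (2 * pi) * (\<integral>\<^sup>+w. ?W w * log_kernel w 1 z \<partial>lborel) = (\<integral>\<^sup>+w. (\<integral>\<^sup>+\<theta>. ?W (cis \<theta> * w) * log_kernel (cis \<theta> * w) 1 z \<partial>circ) \<partial>lborel)"
    by (rule nn_integral_rotate_mean) measurable
  also have "\<dots> = (\<integral>\<^sup>+w. ennreal (2 * pi) * ((\<lambda>t. ennreal (tail_fun ?a t / pi) * indicator {b..} t) ((cmod w)\<^sup>2)) \<partial>lborel)"
  proof (rule nn_integral_cong_AE)
    \<comment> \<open>The circle through \<open>z\<close> is excluded: the circle means were
      computed only for |w| different from |z|.\<close>
    have "negligible (sphere (0::complex) (cmod z))" by (rule negligible_sphere)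
    then have "sphere (0::complex) (cmod z) \<in> null_sets lborel"
      by (auto simp: negligible_iff_null_sets null_sets_completion_iff)
    then have "AE w in lborel. w \<notin> sphere (0::complex) (cmod z)" by (rule AE_not_in)
    then show "AE w in lborel. (\<integral>\<^sup>+\<theta>. ?W (cis \<theta> * w) * log_kernel (cis \<theta> * w) 1 z \<partial>circ) =
       ennreal (2 * pi) * ((\<lambda>t. ennreal (tail_fun ?a t / pi) * indicator {b..} t) ((cmod w)\<^sup>2))"
    proof eventually_elim
      case (elim w)
      then have ne: "cmod w \<noteq> cmod z" by simp
      have W: "?W (cis \<theta> * w) = ?W w" for \<theta> by (simp add: fs_density_eq norm_mult indicator_def)
      have "(\<integral>\<^sup>+\<theta>. ?W (cis \<theta> * w) * log_kernel (cis \<theta> * w) 1 z \<partial>circ) = ?W w * (\<integral>\<^sup>+\<theta>. log_kernel (cis \<theta> * w) 1 z \<partial>circ)"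
        unfolding W by (rule nn_integral_cmult) (intro borel_measurable_circ, measurable)
      also have "\<dots> = ennreal (2 * pi) * (ennreal (tail_fun ?a ((cmod w)\<^sup>2) / pi) * indicator {b..} ((cmod w)\<^sup>2))"
      proof (cases "b \<le> (cmod w)\<^sup>2")
        case True
        then have w0: "w \<noteq> 0" using b by auto
        define t where "t = (cmod w)\<^sup>2"
        have t0: "t > 0" using w0 by (simp add: t_def)
        have "ln (max (cmod w) (cmod z)) = ln (max t ?a) / 2"
        proof (cases "cmod w < cmod z")
          case True
          then have "t \<le> ?a" "z \<noteq> 0" unfolding t_def by (auto intro: power_mono)
          then show ?thesis using True ln_norm_half[of z] by (simp add: max_def)
        next
          case False
          then have "?a \<le> t" unfolding t_def by (auto intro: power_mono)
          then show ?thesis using False ln_norm_half[OF w0] by (simp add: max_def t_def)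
        qed
        then have "fs_potential w + fs_potential z - ln (max (cmod w) (cmod z)) = (ln (1 + t) + ln (1 + ?a) - ln (max t ?a)) / 2"
          by (simp add: fs_potential_def t_def)
        then have e: "fs_density w * (2 * pi * (fs_potential w + fs_potential z - ln (max (cmod w) (cmod z)))) = 2 * pi * (tail_fun ?a t / pi)"
          unfolding fs_density_eq t_def[symmetric] tail_fun_def by simp
          let ?X = "2 * pi * (fs_potential w + fs_potential z - ln (max (cmod w) (cmod z)))"
          have "ennreal (fs_density w) * ennreal ?X = ennreal (fs_density w * ?X)"
            by (rule ennreal_mult'[symmetric]) (simp add: fs_density_eq)
          also have "\<dots> = ennreal (2 * pi * (tail_fun ?a t / pi))" by (simp only: e)
          also have "\<dots> = ennreal (2 * pi) * ennreal (tail_fun ?a t / pi)" by (rule ennreal_mult') simp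
          finally have "ennreal (fs_density w) * ennreal ?X = ennreal (2 * pi) * ennreal (tail_fun ?a t / pi)" .
then show ?thesis using True by (simp add: circ_mean_log_kernel[OF ne] t_def)
      qed simp
      finally show ?case .
    qed
  qed
  also have "\<dots> = ennreal (2 * pi) * (\<integral>\<^sup>+w. (\<lambda>t. ennreal (tail_fun ?a t / pi) * indicator {b..} t) ((cmod w)\<^sup>2) \<partial>lborel)"
    by (rule nn_integral_cmult) measurable
  also have "(\<integral>\<^sup>+w. (\<lambda>t. ennreal (tail_fun ?a t / pi) * indicator {b..} t) ((cmod w)\<^sup>2) \<partial>lborel) =
     (\<integral>\<^sup>+t. ennreal pi * (ennreal (tail_fun ?a t / pi) * indicator {b..} t) * indicator {0..} t \<partial>lborel)"
    by (rule nn_integral_radial) measurable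
  also have "\<dots> = (\<integral>\<^sup>+t. ennreal (tail_fun ?a t) * indicator {b..} t \<partial>lborel)"
    using b by (intro nn_integral_cong) (auto simp: indicator_def ennreal_mult'[symmetric])
  finally show ?thesis by (subst (asm) ennreal_mult_cancel_left) auto
qed

text \<open>The antiderivative of \<open>tail_fun a\<close> on \<open>{max a b..}\<close>; it vanishes at infinity.\<close>

definition tail_anti :: "real \<Rightarrow> real \<Rightarrow> real" where
  "tail_anti a t = (ln (1 + t) - t * ln t / (1 + t) - (ln (1 + t) + 1 + ln (1 + a)) / (1 + t)) / 2"

lemma tail_anti_deriv:
  assumes "0 < t" "a \<le> t"
  shows "(tail_anti a has_real_derivative tail_fun a t) (at t)"
proof -
  have p: "1 + t \<noteq> 0" "t \<noteq> 0" using assms by auto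
  have "((\<lambda>t. (ln (1 + t) - t * ln t / (1 + t) - (ln (1 + t) + 1 + ln (1 + a)) / (1 + t)) / 2) has_real_derivative
     (1 / (1 + t) - ((ln t + t * (1 / t)) * (1 + t) - t * ln t) / ((1 + t) * (1 + t)) -
      ((1 / (1 + t)) * (1 + t) - (ln (1 + t) + 1 + ln (1 + a))) / ((1 + t) * (1 + t))) / 2) (at t)"
    using assms by (auto intro!: derivative_eq_intros simp: mult_ac)
  also have "(1 / (1 + t) - ((ln t + t * (1 / t)) * (1 + t) - t * ln t) / ((1 + t) * (1 + t)) -
      ((1 / (1 + t)) * (1 + t) - (ln (1 + t) + 1 + ln (1 + a))) / ((1 + t) * (1 + t))) / 2 = tail_fun a t"
  proof -
    have gen: "(1 / (1 + t) - ((x + t * (1 / t)) * (1 + t) - t * x) / ((1 + t) * (1 + t)) -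
        ((1 / (1 + t)) * (1 + t) - (y + 1 + w)) / ((1 + t) * (1 + t))) / 2 = (y + w - x) / (2 * (1 + t)\<^sup>2)" for x y w :: real
    proof -
      have 1: "1 / (1 + t) = (1 + t) / ((1 + t) * (1 + t))" "t * (1 / t) = 1" "(1 + t) / ((1 + t) * (1 + t)) * (1 + t) = 1"
        using p by simp_all
      have "1 / (1 + t) - ((x + t * (1 / t)) * (1 + t) - t * x) / ((1 + t) * (1 + t)) - ((1 / (1 + t)) * (1 + t) - (y + 1 + w)) / ((1 + t) * (1 + t)) =
          ((1 + t) - ((x + 1) * (1 + t) - t * x) - (1 - (y + 1 + w))) / ((1 + t) * (1 + t))"
        unfolding 1 by (simp only: diff_divide_distrib)
      also have "(1 + t) - ((x + 1) * (1 + t) - t * x) - (1 - (y + 1 + w)) = y + w - x" by algebra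
      finally show ?thesis by (simp only: power2_eq_square divide_divide_eq_left mult.commute)
    qed
    have "(ln (1 + t) + ln (1 + a) - ln t) / (2 * (1 + t)\<^sup>2) = tail_fun a t"
      using assms by (simp add: tail_fun_def max_def)
    with gen show ?thesis by (rule trans)
  qed
  finally show ?thesis unfolding tail_anti_def[abs_def] .
qed

lemma tail_anti_tendsto: "(tail_anti a \<longlongrightarrow> 0) at_top"
  unfolding tail_anti_def[abs_def] by real_asymp

text \<open>It increases on this range, having the nonnegative derivative \<open>tail_fun a\<close>,
  and tends to 0.\<close>

lemma tail_anti_nonpos:
  assumes "0 < b" "0 \<le> a" "a \<le> b"
  shows "tail_anti a b \<le> 0"
proof (rule tendsto_lowerbound[OF tail_anti_tendsto])
  show "\<forall>\<^sub>F t in at_top. tail_anti a b \<le> tail_anti a t"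
    using eventually_ge_at_top[of b]
  proof eventually_elim
    case (elim t)
    show ?case
    proof (rule DERIV_nonneg_imp_nondecreasing[OF elim])
      fix x assume "b \<le> x" "x \<le> t"
      then have "0 < x" "a \<le> x" using assms by auto
      then show "\<exists>y. (tail_anti a has_real_derivative y) (at x) \<and> 0 \<le> y"
        using tail_anti_deriv[of x a] tail_fun_nonneg[of a x] assms by blast
    qed
  qed
qed simp

lemma nn_integral_tail_fun:
  assumes "0 < b" "0 \<le> a" "a \<le> b"
  shows "(\<integral>\<^sup>+t. ennreal (tail_fun a t) * indicator {b..} t \<partial>lborel) = ennreal (- tail_anti a b)"
proof -
  have "(\<integral>\<^sup>+t. ennreal (tail_fun a t) * indicator {b..} t \<partial>lborel) = ennreal (0 - tail_anti a b)"
    using assms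
    by (intro nn_integral_FTC_atLeast tail_anti_deriv tail_anti_tendsto tail_fun_nonneg)
       (auto simp: tail_fun_def[abs_def])
  then show ?thesis by simp
qed

lemma nn_integral_tail_fun_far:
  assumes b: "0 < b" "b \<le> a"
  shows "(\<integral>\<^sup>+t. ennreal (tail_fun a t) * indicator {b..} t \<partial>lborel) =
    ennreal ((b / (1 + b) * (ln a - ln (1 + a)) + (1 + ln (1 + b)) / (1 + b)) / 2)"
proof -
  have [measurable]: "tail_fun a \<in> borel_measurable borel" unfolding tail_fun_def[abs_def] by measurable
  \<comment> \<open>On {b..a} the maximum of \<open>t\<close> and \<open>a\<close> is the constant
    \<open>a\<close>, so the integrand has a simpler antiderivative there; \<open>tail_anti\<close>
    takes over from \<open>a\<close> on.\<close>
  define G where "G t = - (ln (1 + t) + 1 + ln (1 + a) - ln a) / (1 + t) / 2" for t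
  have d: "(G has_real_derivative tail_fun a t) (at t)" if "b \<le> t" "t \<le> a" for t
  proof -
    have p: "1 + t > 0" "max t a = a" using that b by auto
    have "((\<lambda>t. - (ln (1 + t) + 1 + ln (1 + a) - ln a) / (1 + t)) has_real_derivative
       (- (1 / (1 + t)) * (1 + t) - (- (ln (1 + t) + 1 + ln (1 + a) - ln a)) * 1) / ((1 + t) * (1 + t))) (at t)"
      using p by (intro derivative_eq_intros) auto
    note DERIV_cdivide[OF this, of 2]
    also have "- (1 / (1 + t)) * (1 + t) - (- (ln (1 + t) + 1 + ln (1 + a) - ln a)) * 1 = ln (1 + t) + ln (1 + a) - ln a"
      using p by simp
    also have "(ln (1 + t) + ln (1 + a) - ln a) / ((1 + t) * (1 + t)) / 2 = tail_fun a t"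
      using p by (simp add: tail_fun_def power2_eq_square mult_ac)
    finally show ?thesis unfolding G_def[abs_def] .
  qed
  have "(\<integral>\<^sup>+t. ennreal (tail_fun a t) * indicator {b..} t \<partial>lborel) =
     (\<integral>\<^sup>+t. ennreal (tail_fun a t) * indicator {b..a} t + ennreal (tail_fun a t) * indicator {a..} t \<partial>lborel)"
  proof (rule nn_integral_cong_AE)
    show "AE t in lborel. ennreal (tail_fun a t) * indicator {b..} t = ennreal (tail_fun a t) * indicator {b..a} t + ennreal (tail_fun a t) * indicator {a..} t"
      using AE_lborel_singleton[of a] by eventually_elim (use b in \<open>auto simp: indicator_def\<close>)
  qed
  also have "\<dots> = (\<integral>\<^sup>+t. ennreal (tail_fun a t) * indicator {b..a} t \<partial>lborel) + (\<integral>\<^sup>+t. ennreal (tail_fun a t) * indicator {a..} t \<partial>lborel)"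
    by (rule nn_integral_add) measurable
  also have "(\<integral>\<^sup>+t. ennreal (tail_fun a t) * indicator {b..a} t \<partial>lborel) = ennreal (G a - G b)"
  proof (rule nn_integral_FTC_Icc)
    show "(G has_real_derivative tail_fun a t) (at t)" if "t \<in> {b..a}" for t
      using that by (intro d) auto
  qed (use b in \<open>auto intro!: tail_fun_nonneg\<close>)
  also have "(\<integral>\<^sup>+t. ennreal (tail_fun a t) * indicator {a..} t \<partial>lborel) = ennreal (- tail_anti a a)"
    using b by (intro nn_integral_tail_fun) auto
  also have "ennreal (G a - G b) + ennreal (- tail_anti a a) = ennreal ((G a - G b) + (- tail_anti a a))"
  proof (rule ennreal_plus[symmetric])
    have "\<exists>l \<ge> 0. G a - G b = l"
    proof -
      have "G b \<le> G a"
        by (rule DERIV_nonneg_imp_nondecreasing[OF b(2)]) (use d b tail_fun_nonneg[of a] in force)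
      then show ?thesis by simp
    qed
    then show "0 \<le> G a - G b" by auto
    show "0 \<le> - tail_anti a a" using tail_anti_nonpos[of a a] b by simp
  qed
  also have "(G a - G b) + (- tail_anti a a) = (b / (1 + b) * (ln a - ln (1 + a)) + (1 + ln (1 + b)) / (1 + b)) / 2"
  proof -
    have p: "1 + a \<noteq> 0" "1 + b \<noteq> 0" using b by auto
    have "G a = - (2 * ln (1 + a) + 1 - ln a) / (1 + a) / 2" by (simp add: G_def)
    moreover have "tail_anti a a = (ln (1 + a) - a * ln a / (1 + a) - (2 * ln (1 + a) + 1) / (1 + a)) / 2"
      by (simp add: tail_anti_def)
    moreover have "G b = - (ln (1 + b) + 1) / (1 + b) / 2 - (ln (1 + a) - ln a) / (1 + b) / 2"
      using p by (simp add: G_def diff_divide_distrib add_divide_distrib)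
    ultimately have e: "(G a - G b) + (- tail_anti a a) = (ln a / (1 + a) + a * ln a / (1 + a) - ln (1 + a) + (1 + ln (1 + b)) / (1 + b) + (ln (1 + a) - ln a) / (1 + b)) / 2"
      by (simp add: diff_divide_distrib add_divide_distrib)
    have "ln a / (1 + a) + a * ln a / (1 + a) = ln a" using p by (simp add: add_divide_distrib[symmetric] distrib_left[symmetric]) (simp add: field_simps)
    moreover have "(ln (1 + a) - ln a) / (1 + b) = (ln (1 + a) - ln a) - b / (1 + b) * (ln (1 + a) - ln a)"
      using p by (simp add: field_simps)
    moreover have "x = l \<Longrightarrow> w = (m - l) - c * (m - l) \<Longrightarrow> (x - m + q + w) / 2 = (c * (l - m) + q) / 2"
      for x l w m c q :: real by (rule arg_cong[where f = "\<lambda>x. x / 2"]) (simp add: algebra_simps)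
    ultimately show ?thesis unfolding e by blast
  qed
  finally show ?thesis .
qed

lemma nn_integral_outer_fs_potential:
  assumes b: "0 < b"
  shows "(\<integral>\<^sup>+w. ennreal (fs_density w) * indicator {w. b \<le> (cmod w)\<^sup>2} w * ennreal (fs_potential w) \<partial>lborel) =
    ennreal ((1 + ln (1 + b)) / (1 + b) / 2)"
proof -
  have [measurable]: "fs_density \<in> borel_measurable borel" unfolding fs_density_eq[abs_def] by measurable
  have "(\<integral>\<^sup>+w. ennreal (fs_density w) * indicator {w. b \<le> (cmod w)\<^sup>2} w * ennreal (fs_potential w) \<partial>lborel) =
     (\<integral>\<^sup>+w. (\<lambda>t. ennreal (ln (1 + t) / 2 / (1 + t)\<^sup>2 / pi) * indicator {b..} t) ((cmod w)\<^sup>2) \<partial>lborel)"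
    by (intro nn_integral_cong) (auto simp: indicator_def fs_density_eq fs_potential_def ennreal_mult'[symmetric] mult_ac)
  also have "\<dots> = (\<integral>\<^sup>+t. ennreal pi * (ennreal (ln (1 + t) / 2 / (1 + t)\<^sup>2 / pi) * indicator {b..} t) * indicator {0..} t \<partial>lborel)"
    by (rule nn_integral_radial) measurable
  also have "\<dots> = (\<integral>\<^sup>+t. ennreal (ln (1 + t) / 2 / (1 + t)\<^sup>2) * indicator {b..} t \<partial>lborel)"
    using b by (intro nn_integral_cong) (auto simp: indicator_def ennreal_mult'[symmetric])
  also have "\<dots> = ennreal (0 - (- (ln (1 + b) + 1) / (1 + b) / 2))"
  proof (rule nn_integral_FTC_atLeast)
    show "((\<lambda>t. - (ln (1 + t) + 1) / (1 + t) / 2) has_real_derivative ln (1 + t) / 2 / (1 + t)\<^sup>2) (at t)" if "b \<le> t" for t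
    proof -
      have p: "1 + t > 0" using that b by auto
      have "((\<lambda>t. - (ln (1 + t) + 1) / (1 + t) / 2) has_real_derivative
         (- (1 / (1 + t)) * (1 + t) - (- (ln (1 + t) + 1)) * 1) / ((1 + t) * (1 + t)) / 2) (at t)"
        using p by (intro derivative_eq_intros) auto
      also have "(- (1 / (1 + t)) * (1 + t) - (- (ln (1 + t) + 1)) * 1) / ((1 + t) * (1 + t)) / 2 = ln (1 + t) / 2 / (1 + t)\<^sup>2"
        using p by (simp add: power2_eq_square)
      finally show ?thesis .
    qed
    show "((\<lambda>t::real. - (ln (1 + t) + 1) / (1 + t) / 2) \<longlongrightarrow> 0) at_top" by real_asymp
  qed (use b in auto)
  also have "0 - (- (ln (1 + b) + 1) / (1 + b) / 2) = (1 + ln (1 + b)) / (1 + b) / 2"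
  proof -
    have "0 - (- (l + 1) / q / 2) = (1 + l) / q / 2" for l q :: real
      by (simp only: minus_divide_left[symmetric] diff_0 minus_minus add.commute)
    then show ?thesis .
  qed
  finally show ?thesis .
qed

text \<open>The Monge--Ampere measure is a mixture of the normalised measure on the disk and \<mu>.
  Realising it by a coin toss yields a probability measure, as the locale of logarithmic potentials
  requires.\<close>

lemma nn_integral_bernoulli_bind:
  assumes "prob_space N0" "prob_space N1" and s: "sets N0 = sets borel" "sets N1 = sets borel" and \<rho>: "0 \<le> \<rho>" "\<rho> \<le> 1"
  defines "M \<equiv> measure_pmf (bernoulli_pmf \<rho>) \<bind> (\<lambda>b. if b then N1 else N0)"
  shows "prob_space M" "sets M = sets (borel :: complex measure)"
    and "\<And>h. h \<in> borel_measurable borel \<Longrightarrow> (\<integral>\<^sup>+x. h x \<partial>M) = ennreal (1 - \<rho>) * (\<integral>\<^sup>+x. h x \<partial>N0) + ennreal \<rho> * (\<integral>\<^sup>+x. h x \<partial>N1)"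
proof -
  have m [measurable]: "(\<lambda>b. if b then N1 else N0) \<in> measure_pmf (bernoulli_pmf \<rho>) \<rightarrow>\<^sub>M subprob_algebra borel"
    using assms by (auto simp: space_subprob_algebra prob_space_imp_subprob_space)
  show "prob_space M" unfolding M_def
    by (rule prob_space.prob_space_bind[OF measure_pmf.prob_space_axioms _ m]) (use assms in auto)
  show "sets M = sets borel" unfolding M_def by (rule sets_bind[OF _ ]) (use s in auto)
  fix h :: "complex \<Rightarrow> ennreal" assume [measurable]: "h \<in> borel_measurable borel"
  have "(\<integral>\<^sup>+x. h x \<partial>M) = (\<integral>\<^sup>+b. (\<integral>\<^sup>+x. h x \<partial>(if b then N1 else N0)) \<partial>measure_pmf (bernoulli_pmf \<rho>))"
    unfolding M_def by (rule nn_integral_bind[OF _ m]) measurable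
  also have "\<dots> = ennreal (1 - \<rho>) * (\<integral>\<^sup>+x. h x \<partial>N0) + ennreal \<rho> * (\<integral>\<^sup>+x. h x \<partial>N1)"
    using \<rho> by (simp add: nn_integral_bernoulli_pmf mult.commute add.commute)
  finally show "(\<integral>\<^sup>+x. h x \<partial>M) = ennreal (1 - \<rho>) * (\<integral>\<^sup>+x. h x \<partial>N0) + ennreal \<rho> * (\<integral>\<^sup>+x. h x \<partial>N1)" .
qed

section \<open>The model potentials\<close>

text \<open>The passage from chordal to Euclidean distance, arranged so that it also holds at the
  pole, where both sides are infinite.\<close>

lemma log_kernel_neglog:
  assumes T: "1 \<le> T" "cmod (z - x) \<le> T"
  shows "log_kernel x 1 z + ennreal (ln T) = neglog (cmod (z - x) / T) + ennreal (fs_potential x + fs_potential z)"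
proof (cases "x = z")
  case True
  then show ?thesis by (simp add: log_kernel_eq_top neglog_def)
next
  case False
  then have nz: "x - 1 * z \<noteq> 0" "cmod (z - x) > 0" by auto
  have k: "log_kernel x 1 z = ennreal (fs_potential x + fs_potential z - ln (cmod (z - x)))"
    "0 \<le> fs_potential x + fs_potential z - ln (cmod (z - x))"
    using log_kernel_eq[OF nz(1)] by (simp_all add: fs_potential_def norm_minus_commute add.commute)
  have "neglog (cmod (z - x) / T) = ennreal (ln T - ln (cmod (z - x)))"
    using nz T by (simp add: neglog_def ln_div not_le)
  moreover have "ln (cmod (z - x)) \<le> ln T" using nz T by simp
  ultimately show ?thesis
    using k T fs_potential_nonneg[of x] fs_potential_nonneg[of z] by (simp add: ennreal_plus[symmetric] del: ennreal_plus)
qed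

text \<open>Chordal distance is invariant under w \<mapsto> 1/w.\<close>

lemma log_kernel_inverse:
  assumes "w \<noteq> 0"
  shows "log_kernel 1 x w = log_kernel x 1 (1 / w)"
proof -
  define p where "p = cmod w"
  have p: "p > 0" using assms by (simp add: p_def)
  have "x - 1 * (1 / w) = - (1 - x * w) / w" using assms by (simp add: field_simps)
  then have 1: "cmod (x - 1 * (1 / w)) = cmod (1 - x * w) / p" by (simp add: norm_divide p_def norm_minus_commute)
  have "1 + (cmod (1 / w))\<^sup>2 = (1 + p\<^sup>2) / p\<^sup>2" using p by (simp add: norm_divide p_def field_simps)
  then have 2: "sqrt (1 + (cmod (1 / w))\<^sup>2) = sqrt (1 + p\<^sup>2) / p" using p by (simp add: real_sqrt_divide)
  show ?thesis unfolding log_kernel_def 1 2 using p by (simp add: p_def[symmetric] add.commute)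
qed

lemma log_kernel_zero: "log_kernel 1 x 0 = ennreal (fs_potential x)"
  using log_kernel_eq(1)[of 1 x 0] by (simp add: fs_potential_def)

lemma ennreal_add_eq_imp:
  assumes "x + ennreal a = ennreal b" "0 \<le> a" "0 \<le> b"
  shows "x = ennreal (b - a) \<and> a \<le> b"
proof (cases x)
  case (real r)
  then have "ennreal (r + a) = ennreal b" using assms by simp
  then have "r + a = b" using real assms by (subst (asm) ennreal_inj) auto
  then show ?thesis using real by auto
qed (use assms in simp)

text \<open>The smallness condition is \<kappa> + \<rho> ln(2 s) < 0. For |w| \<le> s all points of
  the carrier are within 2 s, so \<phi> is at most this number there and hence negative.\<close>

locale polar_model = polar_measure +
  fixes R :: real
  assumes radius_less: "s < R"
    and radius_small: "ln (1 + R\<^sup>2) / 2 - R\<^sup>2 / (1 + R\<^sup>2) * ln R + R\<^sup>2 / (1 + R\<^sup>2) * ln (2 * s) < 0"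
begin

text \<open>
  \<open>\<kappa> + \<rho> * ln |w|\<close> is the value on \<open>s < |w| < R\<close> of \<open>\<phi>\<close> plus the local potential; \<open>c\<close> is the value
  at \<open>\<infinity>\<close> of the potential of \<open>M\<close>, and subtracting from it makes \<open>\<phi>\<close> vanish there.
\<close>

definition \<rho> :: real where "\<rho> = R\<^sup>2 / (1 + R\<^sup>2)"
definition \<kappa> :: real where "\<kappa> = ln (1 + R\<^sup>2) / 2 - \<rho> * ln R"
text \<open>At least 1, and larger than every distance between a point of |w| \<le> R and the
  carrier of \<mu>.\<close>

definition T :: real where "T = 2 * R + 1"
definition e :: real where "e = enn2real (\<integral>\<^sup>+x. ennreal (fs_potential x) \<partial>\<mu>)"
definition c :: real where "c = (1 + ln (1 + R\<^sup>2)) / (1 + R\<^sup>2) / 2 + \<rho> * e"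

lemma R_pos: "0 < R" and R2_pos: "0 < R\<^sup>2" using radius_less radius_pos by auto

lemma one_plus_R2 [simp]: "0 < 1 + R\<^sup>2" "1 + R\<^sup>2 \<noteq> 0"
  using R2_pos by linarith+

lemma rho_bounds: "0 < \<rho>" "\<rho> < 1" and one_minus_rho: "1 - \<rho> = 1 / (1 + R\<^sup>2)"
proof -
  show "0 < \<rho>" "\<rho> < 1" "1 - \<rho> = 1 / (1 + R\<^sup>2)"
    using R2_pos by (simp_all add: \<rho>_def divide_simps)
qed

lemma T_bounds: "1 \<le> T" "2 * R \<le> T" "2 * s \<le> T" "0 < T"
  using R_pos radius_less by (auto simp: T_def)

lemma e_nonneg: "0 \<le> e" by (simp add: e_def)

lemma c_nonneg: "0 \<le> c"
  using R2_pos rho_bounds e_nonneg by (simp add: c_def)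

lemma nn_integral_fs_potential: "(\<integral>\<^sup>+x. ennreal (fs_potential x) \<partial>\<mu>) = ennreal e"
proof -
  have "(\<integral>\<^sup>+x. ennreal (fs_potential x) \<partial>\<mu>) \<le> (\<integral>\<^sup>+x. ennreal (ln (1 + s\<^sup>2) / 2) \<partial>\<mu>)"
  proof (rule nn_integral_mono_AE)
    show "AE x in \<mu>. ennreal (fs_potential x) \<le> ennreal (ln (1 + s\<^sup>2) / 2)"
      using AE_supp
    proof eventually_elim
      case (elim x)
      then have "(cmod x)\<^sup>2 \<le> s\<^sup>2" by (intro power_mono) auto
      then show ?case unfolding fs_potential_def by (intro ennreal_leI divide_right_mono ln_mono) (auto simp: add_pos_nonneg)
    qed
  qed
  also have "\<dots> < \<infinity>" using emeasure_space_1 by (simp add: ennreal_mult_less_top less_top)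
  finally show ?thesis by (simp add: e_def less_top)
qed

text \<open>The Fubini--Study measure of |w| \<ge> R, normalised: its mass is 1/(1 + R^2). The
  squared form of the condition suits radial integration.\<close>

definition N :: "complex measure" where
  "N = density lborel (\<lambda>w. ennreal (fs_density w) * indicator {w. R\<^sup>2 \<le> (cmod w)\<^sup>2} w * ennreal (1 + R\<^sup>2))"

definition M :: "complex measure" where
  "M = measure_pmf (bernoulli_pmf \<rho>) \<bind> (\<lambda>b. if b then \<mu> else N)"

lemma fs_density_measurable [measurable]: "fs_density \<in> borel_measurable borel"
  unfolding fs_density_eq[abs_def] by measurable

lemma fs_potential_measurable [measurable]: "fs_potential \<in> borel_measurable borel"
  by (rule borel_measurable_continuous_onI[OF continuous_fs_potential])

lemma nn_integral_N:
  assumes [measurable]: "h \<in> borel_measurable borel"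
  shows "ennreal (1 - \<rho>) * (\<integral>\<^sup>+x. h x \<partial>N) = (\<integral>\<^sup>+w. ennreal (fs_density w) * indicator {w. R\<^sup>2 \<le> (cmod w)\<^sup>2} w * h w \<partial>lborel)"
proof -
  have "(\<integral>\<^sup>+x. h x \<partial>N) = (\<integral>\<^sup>+w. ennreal (1 + R\<^sup>2) * (ennreal (fs_density w) * indicator {w. R\<^sup>2 \<le> (cmod w)\<^sup>2} w * h w) \<partial>lborel)"
    unfolding N_def by (subst nn_integral_density) (auto intro!: nn_integral_cong simp: mult_ac)
  also have "\<dots> = ennreal (1 + R\<^sup>2) * (\<integral>\<^sup>+w. ennreal (fs_density w) * indicator {w. R\<^sup>2 \<le> (cmod w)\<^sup>2} w * h w \<partial>lborel)"
    by (rule nn_integral_cmult) measurable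
  also have "ennreal (1 - \<rho>) * \<dots> = ennreal ((1 - \<rho>) * (1 + R\<^sup>2)) * (\<integral>\<^sup>+w. ennreal (fs_density w) * indicator {w. R\<^sup>2 \<le> (cmod w)\<^sup>2} w * h w \<partial>lborel)"
    using rho_bounds by (subst ennreal_mult) (auto simp: mult.assoc)
  also have "(1 - \<rho>) * (1 + R\<^sup>2) = 1" unfolding one_minus_rho using R2_pos by simp
  finally show ?thesis by simp
qed

lemma nn_integral_fs_density_outer:
  "(\<integral>\<^sup>+w. ennreal (fs_density w) * indicator {w. R\<^sup>2 \<le> (cmod w)\<^sup>2} w \<partial>lborel) = ennreal (1 - \<rho>)"
proof -
  have "(\<integral>\<^sup>+w. ennreal (fs_density w) * indicator {w. R\<^sup>2 \<le> (cmod w)\<^sup>2} w \<partial>lborel) =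
     (\<integral>\<^sup>+w. ennreal (1 / pi) * (ennreal (1 / (1 + (cmod w)\<^sup>2)\<^sup>2) * indicator {w. R\<^sup>2 \<le> (cmod w)\<^sup>2} w) \<partial>lborel)"
    by (intro nn_integral_cong) (auto simp: fs_density_eq indicator_def ennreal_mult'[symmetric])
  also have "\<dots> = ennreal (1 / pi) * ennreal (pi / (1 + R\<^sup>2))"
    by (subst nn_integral_cmult) (auto simp: nn_integral_kernel_radial)
  also have "\<dots> = ennreal (1 - \<rho>)"
    unfolding one_minus_rho by (subst ennreal_mult'[symmetric]) auto
  finally show ?thesis .
qed

lemma prob_space_N: "prob_space N"
proof
  have "ennreal (1 - \<rho>) * emeasure N (space N) = ennreal (1 - \<rho>) * 1"
    using nn_integral_N[of "\<lambda>_. 1"] nn_integral_fs_density_outer by simp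
  then show "emeasure N (space N) = 1"
    using rho_bounds by (subst (asm) ennreal_mult_cancel_left) auto
qed

lemma sets_N: "sets N = sets borel" by (simp add: N_def)

lemma rho_bounds': "0 \<le> \<rho>" "\<rho> \<le> 1" using rho_bounds by auto

lemmas M_mixture = nn_integral_bernoulli_bind[OF prob_space_N prob_space_axioms sets_N sets_mu rho_bounds', folded M_def]

lemma sets_M [measurable_cong, simp]: "sets M = sets borel" by (rule M_mixture(2))

lemma space_M [simp]: "space M = UNIV" using sets_eq_imp_space_eq[OF sets_M] by simp

lemma nn_integral_M:
  assumes "h \<in> borel_measurable borel"
  shows "(\<integral>\<^sup>+x. h x \<partial>M) = (\<integral>\<^sup>+w. ennreal (fs_density w) * indicator {w. R\<^sup>2 \<le> (cmod w)\<^sup>2} w * h w \<partial>lborel) + ennreal \<rho> * (\<integral>\<^sup>+x. h x \<partial>\<mu>)"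
  unfolding M_mixture(3)[OF assms] nn_integral_N[OF assms] ..

sublocale L0: log_potential M "\<lambda>x. x" "\<lambda>_. 1" c
  by (intro log_potential.intro M_mixture(1) log_potential_axioms.intro) auto

sublocale L1: log_potential M "\<lambda>_. 1" "\<lambda>x. x" c
  by (intro log_potential.intro M_mixture(1) log_potential_axioms.intro) auto

lemma pot_inverse: "w \<noteq> 0 \<Longrightarrow> L1.pot w = L0.pot (1 / w)"
  unfolding L0.pot_def L1.pot_def by (intro nn_integral_cong log_kernel_inverse)

lemma pot_Infty: "L1.pot 0 = ennreal c"
proof -
  have "L1.pot 0 = (\<integral>\<^sup>+x. ennreal (fs_potential x) \<partial>M)" by (simp add: L1.pot_def log_kernel_zero)
  also have "\<dots> = ennreal ((1 + ln (1 + R\<^sup>2)) / (1 + R\<^sup>2) / 2) + ennreal \<rho> * ennreal e"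
    by (subst nn_integral_M) (simp_all only: nn_integral_outer_fs_potential[OF R2_pos] nn_integral_fs_potential, measurable)
  also have "\<dots> = ennreal c"
    unfolding c_def using R2_pos rho_bounds e_nonneg by (subst ennreal_plus) (auto simp: ennreal_mult')
  finally show ?thesis .
qed

lemma nn_integral_log_kernel_mu:
  assumes T': "1 \<le> T'" "cmod z + s \<le> T'"
  shows "(\<integral>\<^sup>+x. log_kernel x 1 z \<partial>\<mu>) + ennreal (ln T') = full T' z + ennreal (e + fs_potential z)"
proof -
  have "(\<integral>\<^sup>+x. log_kernel x 1 z \<partial>\<mu>) + ennreal (ln T') = (\<integral>\<^sup>+x. log_kernel x 1 z + ennreal (ln T') \<partial>\<mu>)"
    using T' by (subst nn_integral_add) (auto simp: emeasure_space_1[simplified])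
  also have "\<dots> = (\<integral>\<^sup>+x. neglog (cmod (z - x) / T') + (ennreal (fs_potential x) + ennreal (fs_potential z)) \<partial>\<mu>)"
  proof (rule nn_integral_cong_AE)
    show "AE x in \<mu>. log_kernel x 1 z + ennreal (ln T') = neglog (cmod (z - x) / T') + (ennreal (fs_potential x) + ennreal (fs_potential z))"
      using AE_supp
    proof eventually_elim
      case (elim x)
      then have "cmod (z - x) \<le> T'" using norm_triangle_ineq4[of z x] T' by linarith
      then show ?case
        using log_kernel_neglog[OF T'(1)] fs_potential_nonneg by (simp add: ennreal_plus)
    qed
  qed
  also have "\<dots> = full T' z + (ennreal e + ennreal (fs_potential z))"
    unfolding full_def by (subst nn_integral_add; simp add: nn_integral_add nn_integral_fs_potential emeasure_space_1[simplified])
  finally show ?thesis using e_nonneg fs_potential_nonneg by (simp add: ennreal_plus)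
qed

text \<open>Seen from here \<mu> is a point mass at 0, and its logarithm cancels that of the
  explicit outer part: the value is the one at infinity.\<close>

lemma pot_outside:
  assumes z: "R \<le> cmod z"
  shows "L0.pot z = ennreal c"
proof -
  define a where "a = (cmod z)\<^sup>2"
  define o1 where "o1 = (\<rho> * (ln a - ln (1 + a)) + (1 + ln (1 + R\<^sup>2)) / (1 + R\<^sup>2)) / 2"
  define I where "I = (\<integral>\<^sup>+x. log_kernel x 1 z \<partial>\<mu>)"
  have aR: "R\<^sup>2 \<le> a" unfolding a_def using z R_pos by (intro power_mono) auto
  then have a: "0 < a" using R2_pos by linarith
  have z0: "cmod z > 0" using z R_pos by linarith
  have lnz: "ln (cmod z) = ln a / 2" unfolding a_def using z0 by (intro ln_norm_half) auto
  \<comment> \<open>The closed form \<open>o1\<close> must be shown nonnegative, since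
    \<open>ennreal\<close> would otherwise truncate it; \<rho>/a \<le> \<rho>/R^2 = 1/(1 + R^2) is
    just enough.\<close>
  have "ln (1 + a) - ln a \<le> 1 / a"
  proof -
    have "ln (1 + a) - ln a = ln ((1 + a) / a)" using a by (simp add: ln_div)
    also have "(1 + a) / a = 1 + 1 / a" using a by (simp add: add_divide_distrib)
    also have "ln (1 + 1 / a) \<le> 1 / a" using a by (intro ln_add_one_self_le_self) auto
    finally show ?thesis .
  qed
  then have "\<rho> * (ln (1 + a) - ln a) \<le> \<rho> * (1 / a)" using rho_bounds by (intro mult_left_mono) auto
  also have "\<dots> \<le> \<rho> * (1 / R\<^sup>2)" using rho_bounds aR R2_pos a by (intro mult_left_mono divide_left_mono) auto
  also have "\<dots> = 1 / (1 + R\<^sup>2)" using R2_pos by (simp add: \<rho>_def)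
  also have "\<dots> \<le> (1 + ln (1 + R\<^sup>2)) / (1 + R\<^sup>2)" using R2_pos by (intro divide_right_mono) auto
  finally have o1: "0 \<le> o1" unfolding o1_def by (simp add: right_diff_distrib)
  \<comment> \<open>\<open>T\<close> is adapted to |z| \<le> R, whereas |z| is unbounded
    here.\<close>
  define T' where "T' = max 1 (cmod z + s)"
  have T': "1 \<le> T'" "cmod z + s \<le> T'" by (auto simp: T'_def)
  have "full T' z = neglog (cmod z / T')"
    unfolding full_def using z radius_less T' by (intro mean_mu) auto
  also have "\<dots> = ennreal (ln T' - ln (cmod z))" using z0 T' by (simp add: neglog_def ln_div not_le)
  finally have f: "full T' z = ennreal (ln T' - ln (cmod z))" .
  have le: "ln (cmod z) \<le> ln T'" using z0 T' radius_pos by (intro ln_mono) auto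
  have "I + ennreal (ln T') = ennreal (ln T' - ln (cmod z)) + ennreal (e + fs_potential z)"
    unfolding I_def nn_integral_log_kernel_mu[OF T'] f ..
  also have "\<dots> = ennreal (ln T' - ln (cmod z) + (e + fs_potential z))"
    using le e_nonneg fs_potential_nonneg[of z] by (intro ennreal_plus[symmetric]) auto
  finally have I: "I = ennreal (ln T' - ln (cmod z) + (e + fs_potential z) - ln T') \<and> ln T' \<le> ln T' - ln (cmod z) + (e + fs_potential z)"
    using le e_nonneg fs_potential_nonneg[of z] T' by (intro ennreal_add_eq_imp) auto
  define i where "i = e + fs_potential z - ln (cmod z)"
  have i: "I = ennreal i" "0 \<le> i" using I by (auto simp: i_def algebra_simps)
  have "L0.pot z = ennreal o1 + ennreal \<rho> * I"
    unfolding L0.pot_def I_def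
    by (subst nn_integral_M)
       (simp_all only: nn_integral_outer_kernel[OF R2_pos] nn_integral_tail_fun_far[OF R2_pos aR, unfolded a_def] o1_def a_def \<rho>_def, measurable)
  also have "\<dots> = ennreal (o1 + \<rho> * i)"
    using o1 i rho_bounds by (simp add: ennreal_mult' ennreal_plus)
  also have "o1 + \<rho> * i = c"
  proof -
    have "(r * (x - y) + q) / 2 + r * (d + y / 2 - x / 2) = q / 2 + r * d" for r x y q d :: real
      by (simp add: algebra_simps add_divide_distrib diff_divide_distrib)
    then show ?thesis unfolding o1_def i_def c_def lnz fs_potential_def a_def[symmetric] .
  qed
  finally show ?thesis .
qed

text \<open>The outer measure has no mass in |w| < R, so its contribution is the closed form
  \<open>tail_anti\<close>. What remains of \<mu> is \<open>full T\<close>, which brings the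
  potential into the shape that \<open>domination\<close> expects.\<close>

lemma pot_inside:
  assumes z: "cmod z < R"
  shows "ereal c - enn2ereal (L0.pot z) = ereal (\<kappa> - fs_potential z + \<rho> * ln T) - ereal \<rho> * enn2ereal (full T z)"
proof -
  define a where "a = (cmod z)\<^sup>2"
  define o1 where "o1 = - tail_anti a (R\<^sup>2)"
  define I where "I = (\<integral>\<^sup>+x. log_kernel x 1 z \<partial>\<mu>)"
  have a: "0 \<le> a" "a \<le> R\<^sup>2" unfolding a_def using z R_pos by (auto intro: power_mono)
  have o1: "0 \<le> o1" using tail_anti_nonpos[OF R2_pos a] by (simp add: o1_def)
  have p: "L0.pot z = ennreal o1 + ennreal \<rho> * I"
    unfolding L0.pot_def I_def
    by (subst nn_integral_M)
       (simp_all only: nn_integral_outer_kernel[OF R2_pos] nn_integral_tail_fun[OF R2_pos a, unfolded a_def] o1_def a_def, measurable)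
  have I: "I + ennreal (ln T) = full T z + ennreal (e + fs_potential z)"
    unfolding I_def using T_bounds z radius_less by (intro nn_integral_log_kernel_mu) (auto simp: T_def)
  show ?thesis
  proof (cases "full T z")
    case top
    then have "I = \<infinity>" using I by (cases I) (auto simp: ennreal_plus[symmetric] simp del: ennreal_plus)
    then show ?thesis using top rho_bounds unfolding p by (simp add: ennreal_mult_top)
  next
    case (real F)
    have "I + ennreal (ln T) = ennreal (F + (e + fs_potential z))"
      using I real e_nonneg fs_potential_nonneg[of z] by (simp add: ennreal_plus)
    then have "I = ennreal (F + (e + fs_potential z) - ln T) \<and> ln T \<le> F + (e + fs_potential z)"
      using real e_nonneg fs_potential_nonneg[of z] T_bounds by (intro ennreal_add_eq_imp) auto
    then have "L0.pot z = ennreal (o1 + \<rho> * (F + (e + fs_potential z) - ln T))" "0 \<le> o1 + \<rho> * (F + (e + fs_potential z) - ln T)"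
      unfolding p using o1 rho_bounds by (auto simp: ennreal_mult' ennreal_plus)
    then have 1: "ereal c - enn2ereal (L0.pot z) = ereal (c - (o1 + \<rho> * (F + (e + fs_potential z) - ln T)))"
      by (simp add: enn2ereal_ennreal)
    have 2: "ereal (\<kappa> - fs_potential z + \<rho> * ln T) - ereal \<rho> * enn2ereal (full T z) = ereal (\<kappa> - fs_potential z + \<rho> * ln T - \<rho> * F)"
      using real by (simp add: enn2ereal_ennreal)
    have R2: "ln (R\<^sup>2) = 2 * ln R" using R_pos by (simp add: ln_realpow)
    define q where "q = 1 + R\<^sup>2"
    have q: "q \<noteq> 0" "\<rho> = 1 - 1 / q" "R\<^sup>2 * ln (R\<^sup>2) / q = \<rho> * (2 * ln R)"
      using R2_pos one_minus_rho by (auto simp: q_def \<rho>_def R2)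
    have t: "tail_anti a (R\<^sup>2) = (ln q - \<rho> * (2 * ln R) - (ln q + 1 + ln (1 + a)) / q) / 2"
      unfolding tail_anti_def q_def[symmetric] q(3) ..
    have "c - o1 - \<rho> * e - \<rho> * fs_potential z = \<kappa> - fs_potential z"
    proof -
      have "((1 + L) / q / 2 + (1 - 1 / q) * d) - - ((L - (1 - 1 / q) * (2 * r) - (L + 1 + A) / q) / 2) - (1 - 1 / q) * d - (1 - 1 / q) * (A / 2) =
          L / 2 - (1 - 1 / q) * r - A / 2" for L d r A :: real
        by (simp add: algebra_simps add_divide_distrib diff_divide_distrib)
      then show ?thesis
        unfolding c_def o1_def t \<kappa>_def fs_potential_def a_def[symmetric] q_def[symmetric] q(2) .
    qed
    then show ?thesis unfolding 1 2 by (simp add: algebra_simps)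
  qed
qed

end

section \<open>The potential and its Monge--Ampere measure\<close>

lemma borel_singleton_cp1: "{x :: cp1} \<in> sets borel"
proof -
  have "\<exists>chart\<in>charts. x \<in> range chart"
    by (cases x) (auto simp: charts_def range_chart0 range_chart1)
  then obtain chart z where c: "chart \<in> charts" "x = chart z" by blast
  show ?thesis using chart_image_borel[OF c(1), of "{z}"] c by simp
qed

context polar_model
begin

definition phi :: "cp1 \<Rightarrow> ereal" where
  "phi p = (case p of Aff z \<Rightarrow> ereal c - enn2ereal (L0.pot z) | Infty \<Rightarrow> 0)"

definition disk :: "cp1 set" where
  "disk = insert Infty (Aff ` {w. R \<le> cmod w})"

lemma phi_chart0: "phi (chart0 w) = ereal c - enn2ereal (L0.pot w)"
  by (simp add: phi_def chart0_def)

lemma phi_chart1: "phi (chart1 w) = ereal c - enn2ereal (L1.pot w)"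
  using c_nonneg by (auto simp: phi_def chart1_def pot_Infty pot_inverse enn2ereal_ennreal zero_ereal_def)

lemma phi_chart_v:
  "phi (chart0 w) + ereal (fs_potential w) = L0.v w" "phi (chart1 w) + ereal (fs_potential w) = L1.v w"
proof -
  have "(ereal c - enn2ereal x) + ereal f = ereal (c + f) - enn2ereal x" for x f
    by (cases x) (auto simp: enn2ereal_ennreal)
  then show "phi (chart0 w) + ereal (fs_potential w) = L0.v w" "phi (chart1 w) + ereal (fs_potential w) = L1.v w"
    by (simp_all add: phi_chart0 phi_chart1 L0.v_def L1.v_def)
qed

lemma usc_phi: "usc phi"
  unfolding usc_def open_cp1_def charts_def
  using L0.usc_minus_pot[of "\<lambda>_. c"] L1.usc_minus_pot[of "\<lambda>_. c"]
  by (simp add: usc_def vimage_def phi_chart0 phi_chart1)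

lemma phi_measurable [measurable]: "phi \<in> borel_measurable borel"
  using usc_phi by (intro borel_measurableI_less) (auto simp: usc_def)

lemma phi_PSH: "phi \<in> PSH_FS"
proof -
  have "phi Infty \<noteq> - \<infinity>" by (simp add: phi_def)
  then show ?thesis
    unfolding PSH_FS_def charts_def using L0.subharmonic_v L1.subharmonic_v by (auto simp: phi_chart_v)
qed

lemma phi_Infty: "phi Infty = 0"
  by (simp add: phi_def)

lemma phi_outside: "R \<le> cmod z \<Longrightarrow> phi (Aff z) = 0"
  using c_nonneg by (simp add: phi_def pot_outside enn2ereal_ennreal)

lemma phi_inside: "cmod z < R \<Longrightarrow> phi (Aff z) = ereal (\<kappa> - fs_potential z + \<rho> * ln T) - ereal \<rho> * enn2ereal (full T z)"
  by (simp add: phi_def pot_inside)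

lemma full_annulus:
  assumes "s < cmod z" "cmod z < R"
  shows "full T z = ennreal (ln T - ln (cmod z))"
proof -
  have z: "0 < cmod z" using assms radius_pos by linarith
  have "full T z = neglog (cmod z / T)"
    unfolding full_def using assms radius_less by (intro mean_mu) (auto simp: T_def)
  then show ?thesis using z T_bounds assms by (simp add: neglog_def ln_div not_le)
qed

lemma full_ge:
  assumes "cmod z \<le> s"
  shows "ennreal (ln T - ln (2 * s)) \<le> full T z"
proof -
  have "ennreal (ln T - ln (2 * s)) = neglog (2 * s / T)"
    using radius_pos T_bounds by (simp add: neglog_def ln_div not_le)
  also have "\<dots> = (\<integral>\<^sup>+x. neglog (2 * s / T) \<partial>\<mu>)" by (simp add: emeasure_space_1[simplified])
  also have "\<dots> \<le> full T z" unfolding full_def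
  proof (rule nn_integral_mono_AE)
    show "AE x in \<mu>. neglog (2 * s / T) \<le> neglog (cmod (z - x) / T)"
      using AE_supp
    proof eventually_elim
      case (elim x)
      then have "cmod (z - x) \<le> 2 * s" using norm_triangle_ineq4[of z x] assms by linarith
      then show ?case using T_bounds by (intro antimono_neglog divide_right_mono) auto
    qed
  qed
  finally show ?thesis .
qed

lemma radial_neg: \<comment> \<open>strict concavity of the logarithm at \<open>(1 - \<rho>) * 1 + \<rho> * (a / R\<^sup>2) = (1 + a) / (1 + R\<^sup>2)\<close>\<close>
  assumes a: "0 < a" "a < R\<^sup>2"
  shows "\<rho> * (ln a - ln (R\<^sup>2)) < ln (1 + a) - ln (1 + R\<^sup>2)"
proof -
  define x where "x = a / R\<^sup>2"
  define y where "y = (1 + a) / (1 + R\<^sup>2)"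
  have x: "0 < x" and y: "0 < y" "y < 1" using a R2_pos by (auto simp: x_def y_def)
  have e: "y = (1 - \<rho>) + \<rho> * x"
    unfolding one_minus_rho unfolding x_def y_def \<rho>_def using R2_pos by (simp add: add_divide_distrib)
  have "ln (x / y) \<le> x / y - 1" using x y by (intro ln_le_minus_one) auto
  then have 1: "\<rho> * (ln x - ln y) \<le> \<rho> * (x / y - 1)"
    using x y rho_bounds by (intro mult_left_mono) (auto simp: ln_div)
  have "ln (1 / y) < 1 / y - 1"
    using ln_le_minus_one[of "1 / y"] ln_eq_minus_one[of "1 / y"] y by fastforce
  then have 2: "(1 - \<rho>) * (- ln y) < (1 - \<rho>) * (1 / y - 1)"
    using y rho_bounds by (intro mult_strict_left_mono) (auto simp: ln_div)
  have "\<rho> * (x / y - 1) + (1 - \<rho>) * (1 / y - 1) = ((1 - \<rho>) + \<rho> * x) / y - 1"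
    by (simp add: algebra_simps add_divide_distrib diff_divide_distrib)
  also have "\<dots> = 0" using y by (simp add: e[symmetric])
  finally have "\<rho> * (ln x - ln y) + (1 - \<rho>) * (- ln y) < 0" using 1 2 by linarith
  then have "\<rho> * ln x < ln y" by (simp add: algebra_simps)
  then show ?thesis using a R2_pos by (simp add: x_def y_def ln_div)
qed

text \<open>Negativity comes from the smallness of \<open>s\<close> on |w| \<le> s, and from strict
  concavity of the logarithm on the annulus, where \<phi> is explicit and radial.\<close>

lemma phi_neg:
  assumes z: "cmod z < R"
  shows "phi (Aff z) < 0"
proof -
  have conclude: "phi (Aff z) < 0" if f: "ennreal f \<le> full T z" "\<kappa> - fs_potential z + \<rho> * ln T - \<rho> * f < 0" for f
  proof (cases "full T z")
    case (real F)
    then have "f \<le> F" using f(1) by (cases "f \<le> 0") (auto simp: not_le)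
    then have "\<rho> * f \<le> \<rho> * F" using rho_bounds by (intro mult_left_mono) auto
    then show ?thesis using f(2) real by (simp add: phi_inside[OF z] enn2ereal_ennreal)
  qed (use rho_bounds in \<open>simp add: phi_inside[OF z]\<close>)
  show ?thesis
  proof (cases "cmod z \<le> s")
    case True
    show ?thesis
    proof (rule conclude[OF full_ge[OF True]])
      show "\<kappa> - fs_potential z + \<rho> * ln T - \<rho> * (ln T - ln (2 * s)) < 0"
        using radius_small fs_potential_nonneg[of z] by (simp add: \<kappa>_def \<rho>_def right_diff_distrib)
    qed
  next
    case False
    then have s: "s < cmod z" by simp
    then have z0: "0 < cmod z" using radius_pos by linarith
    show ?thesis
    proof (rule conclude)
      show "ennreal (ln T - ln (cmod z)) \<le> full T z" using full_annulus[OF s z] by simp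
      have "(cmod z)\<^sup>2 < R\<^sup>2" using z by (intro power_strict_mono) auto
      then have "\<rho> * (ln ((cmod z)\<^sup>2) - ln (R\<^sup>2)) < ln (1 + (cmod z)\<^sup>2) - ln (1 + R\<^sup>2)"
        using z0 by (intro radial_neg) auto
      then have "\<rho> * (2 * ln (cmod z) - 2 * ln R) < ln (1 + (cmod z)\<^sup>2) - ln (1 + R\<^sup>2)"
        using z0 R_pos by (simp add: ln_realpow)
      then show "\<kappa> - fs_potential z + \<rho> * ln T - \<rho> * (ln T - ln (cmod z)) < 0"
        by (simp add: \<kappa>_def fs_potential_def algebra_simps)
    qed
  qed
qed

lemma phi_eq_0_iff: "phi p = 0 \<longleftrightarrow> p \<in> disk"
proof (cases p)
  case (Aff z)
  then show ?thesis using phi_outside[of z] phi_neg[of z] by (cases "R \<le> cmod z") (auto simp: disk_def)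
qed (simp add: phi_Infty disk_def)

lemma phi_le_0: "phi p \<le> 0"
proof (cases p)
  case (Aff z)
  then show ?thesis using phi_outside[of z] phi_neg[of z] by (cases "R \<le> cmod z") auto
qed (simp add: phi_Infty)

lemma normalized_phi: "normalized phi"
  unfolding normalized_def
  by (rule antisym) (auto intro!: SUP_least phi_le_0 SUP_upper2[of Infty] simp: phi_Infty)

lemma ma_phi: "ma_measure phi = distr M borel chart0"
proof (rule ma_measure_eqI)
  have m0: "L0.mass = M" unfolding L0.mass_def
  proof (rule measure_eqI)
    fix A assume "A \<in> sets (distr (restrict_space M {x \<in> space M. (1::complex) \<noteq> 0}) borel (\<lambda>x. x / 1))"
    then have A: "A \<in> sets borel" by (simp only: sets_distr)
    have m: "(\<lambda>x. x / 1) \<in> borel_measurable (restrict_space M {x \<in> space M. (1::complex) \<noteq> 0})"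
      by (rule measurable_restrict_space1) (simp add: measurable_ident_sets)
    have "emeasure (distr (restrict_space M {x \<in> space M. (1::complex) \<noteq> 0}) borel (\<lambda>x. x / 1)) A =
        emeasure (restrict_space M {x \<in> space M. (1::complex) \<noteq> 0}) A"
      unfolding emeasure_distr[OF m A] by (simp add: space_restrict_space)
    also have "\<dots> = emeasure M A"
      by (rule emeasure_restrict_space) simp_all
    finally show "emeasure (distr (restrict_space M {x \<in> space M. (1::complex) \<noteq> 0}) borel (\<lambda>x. x / 1)) A = emeasure M A" .
  qed simp
  have m1: "L1.mass = pullback chart1 (distr M borel chart0)"
    unfolding L1.mass_def pullback_distr_chart0(2)[OF sets_M] ..
  fix chart assume "chart \<in> charts"
  then consider "chart = chart0" | "chart = chart1" by (auto simp: charts_def)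
  then show "is_ddc (\<lambda>w. phi (chart w) + ereal (fs_potential w)) (pullback chart (distr M borel chart0))"
  proof cases
    case 1
    \<comment> \<open>One finite value per chart is the hypothesis of \<open>is_ddc_v\<close>; the
      circle |w| = R provides it here, the point at infinity in the other chart.\<close>
    have "L0.pot (complex_of_real R) < \<infinity>" using R_pos by (simp add: pot_outside)
    then have "is_ddc L0.v M" using L0.is_ddc_v m0 by simp
    then show ?thesis unfolding 1 phi_chart_v pullback_distr_chart0(1)[OF sets_M] .
  next
    case 2
    have "L1.pot 0 < \<infinity>" by (simp add: pot_Infty)
    then have "is_ddc L1.v (pullback chart1 (distr M borel chart0))" using L1.is_ddc_v m1 by simp
    then show ?thesis unfolding 2 phi_chart_v .
  qed
qed simp

lemma lelong_phi: "lelong phi x = 0"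
proof -
  have fin: "emeasure M {z} = 0" for z
  proof -
    have "emeasure M {z} = (\<integral>\<^sup>+x. indicator {z} x \<partial>M)"
      by (rule nn_integral_indicator[symmetric]) simp
    also have "\<dots> = (\<integral>\<^sup>+w. ennreal (fs_density w) * indicator {w. R\<^sup>2 \<le> (cmod w)\<^sup>2} w * indicator {z} w \<partial>lborel) + ennreal \<rho> * (\<integral>\<^sup>+x. indicator {z} x \<partial>\<mu>)"
      by (rule nn_integral_M) simp
    also have "(\<integral>\<^sup>+w. ennreal (fs_density w) * indicator {w. R\<^sup>2 \<le> (cmod w)\<^sup>2} w * indicator {z} w \<partial>lborel) = (\<integral>\<^sup>+w. 0 \<partial>(lborel :: complex measure))"
    proof (rule nn_integral_cong_AE)
      show "AE w in lborel. ennreal (fs_density w) * indicator {w. R\<^sup>2 \<le> (cmod w)\<^sup>2} w * indicator {z} w = 0"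
        using AE_lborel_singleton[of z] by eventually_elim simp
    qed
    finally show ?thesis by (simp add: atomless)
  qed
  have s: "{x} \<in> sets borel" by (rule borel_singleton_cp1)
  show ?thesis
  proof (cases x)
    case (Aff z)
    then have "chart0 -` {x} = {z}" by (auto simp: chart0_def)
    then show ?thesis using s fin by (simp add: lelong_def ma_phi emeasure_distr)
  next
    case Infty
    then have "chart0 -` {x} = {}" by (auto simp: chart0_def)
    then show ?thesis using s by (simp add: lelong_def ma_phi emeasure_distr)
  qed
qed

lemma disk_eq: "disk = {x. phi x = 0}"
  using phi_eq_0_iff by auto

lemma disk_borel [measurable]: "disk \<in> sets borel"
  unfolding disk_eq by measurable

lemma AE_phi_pole: "AE x in \<mu>. phi (chart0 x) = - \<infinity>"
  using AE_supp AE_union_K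
proof eventually_elim
  case (elim x)
  then obtain k where k: "x \<in> K k" by blast
  have "full T x = \<infinity>"
    using part_eq_top[OF k T_bounds(3)] part_le_full[of k T x] by (simp add: top_unique)
  moreover have "cmod x < R" using elim radius_less by linarith
  ultimately show ?case using rho_bounds by (simp add: chart0_def phi_inside)
qed

lemma nn_integral_omega_FS:
  assumes "h \<in> borel_measurable borel"
  shows "(\<integral>\<^sup>+x. h x \<partial>omega_FS) = (\<integral>\<^sup>+w. ennreal (fs_density w) * h (chart0 w) \<partial>lborel)"
proof -
  have m: "(\<lambda>w. h (chart0 w)) \<in> borel_measurable borel" using assms chart_measurable(1) by simp
  have "(\<integral>\<^sup>+x. h x \<partial>omega_FS) = (\<integral>\<^sup>+w. h (chart0 w) \<partial>density lborel (\<lambda>w. ennreal (fs_density w)))"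
    unfolding omega_FS_def using assms chart_measurable(1) by (intro nn_integral_distr) auto
  also have "\<dots> = (\<integral>\<^sup>+w. ennreal (fs_density w) * h (chart0 w) \<partial>lborel)"
    using m by (intro nn_integral_density) auto
  finally show ?thesis .
qed

lemma indicator_disk_chart0: "indicator disk (chart0 w) = (indicator {w. R\<^sup>2 \<le> (cmod w)\<^sup>2} w :: ennreal)"
  using R_pos by (auto simp: disk_def chart0_def indicator_def image_iff)

lemma emeasure_disk:
  assumes [measurable]: "A \<in> sets borel"
  shows "emeasure (density omega_FS (indicator disk)) A =
    (\<integral>\<^sup>+w. ennreal (fs_density w) * indicator {w. R\<^sup>2 \<le> (cmod w)\<^sup>2} w * indicator A (chart0 w) \<partial>lborel)"
proof -
  have "emeasure (density omega_FS (indicator disk)) A = (\<integral>\<^sup>+x. indicator disk x * indicator A x \<partial>omega_FS)"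
    by (rule emeasure_density) (auto simp: omega_FS_def)
  also have "\<dots> = (\<integral>\<^sup>+w. ennreal (fs_density w) * (indicator disk (chart0 w) * indicator A (chart0 w)) \<partial>lborel)"
    by (rule nn_integral_omega_FS) measurable
  finally show ?thesis by (simp add: indicator_disk_chart0 mult.assoc)
qed

text \<open>The set of poles has full measure for \<mu>, while \<phi> vanishes on the disk and so
  leaves the other component of \<open>M\<close> untouched.\<close>

lemma np_ma_phi: "np_ma_measure phi = density omega_FS (indicator disk)"
proof (rule measure_eqI)
  show "sets (np_ma_measure phi) = sets (density omega_FS (indicator disk))"
    by (simp add: np_ma_measure_def ma_phi omega_FS_def)
  fix A assume "A \<in> sets (np_ma_measure phi)"
  then have A [measurable]: "A \<in> sets borel" by (simp add: np_ma_measure_def ma_phi)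
  define h where "h x = indicator {x. phi x \<noteq> - \<infinity>} x * (indicator A x :: ennreal)" for x
  have h [measurable]: "h \<in> borel_measurable borel" unfolding h_def[abs_def] by measurable
  have hc: "(\<lambda>w. h (chart0 w)) \<in> borel_measurable borel" using h chart_measurable(1) by simp
  have "emeasure (np_ma_measure phi) A = (\<integral>\<^sup>+x. h x \<partial>distr M borel chart0)"
    unfolding np_ma_measure_def ma_phi h_def by (rule emeasure_density) auto
  also have "\<dots> = (\<integral>\<^sup>+w. h (chart0 w) \<partial>M)"
    by (rule nn_integral_distr) auto
  also have "\<dots> = (\<integral>\<^sup>+w. ennreal (fs_density w) * indicator {w. R\<^sup>2 \<le> (cmod w)\<^sup>2} w * h (chart0 w) \<partial>lborel) + ennreal \<rho> * (\<integral>\<^sup>+w. h (chart0 w) \<partial>\<mu>)"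
    by (rule nn_integral_M[OF hc])
  also have "(\<integral>\<^sup>+w. h (chart0 w) \<partial>\<mu>) = (\<integral>\<^sup>+w. 0 \<partial>\<mu>)"
  proof (rule nn_integral_cong_AE)
    show "AE w in \<mu>. h (chart0 w) = 0" using AE_phi_pole by eventually_elim (simp add: h_def)
  qed
  also have "(\<integral>\<^sup>+w. ennreal (fs_density w) * indicator {w. R\<^sup>2 \<le> (cmod w)\<^sup>2} w * h (chart0 w) \<partial>lborel) =
      (\<integral>\<^sup>+w. ennreal (fs_density w) * indicator {w. R\<^sup>2 \<le> (cmod w)\<^sup>2} w * indicator A (chart0 w) \<partial>lborel)"
  proof (rule nn_integral_cong)
    fix w
    show "ennreal (fs_density w) * indicator {w. R\<^sup>2 \<le> (cmod w)\<^sup>2} w * h (chart0 w) = ennreal (fs_density w) * indicator {w. R\<^sup>2 \<le> (cmod w)\<^sup>2} w * indicator A (chart0 w)"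
    proof (cases "R \<le> cmod w")
      case True
      then have "phi (chart0 w) = 0" by (simp add: chart0_def phi_outside)
      then show ?thesis by (simp add: h_def)
    next
      case False
      then have "\<not> R\<^sup>2 \<le> (cmod w)\<^sup>2" using R_pos by simp
      then show ?thesis by simp
    qed
  qed
  finally show "emeasure (np_ma_measure phi) A = emeasure (density omega_FS (indicator disk)) A"
    by (simp add: emeasure_disk)
qed

lemma mass_disk: "emeasure (density omega_FS (indicator disk)) UNIV = ennreal (1 - \<rho>)"
  by (simp add: emeasure_disk nn_integral_fs_density_outer)

lemma positive_mass_phi: "positive_mass phi"
  using rho_bounds by (simp add: positive_mass_def np_ma_phi mass_disk)

end

section \<open>The envelope\<close>

lemma usc_reg_eq:
  assumes "usc f"
  shows "usc_reg f = f"
proof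
  fix x
  show "usc_reg f x = f x"
  proof (rule antisym)
    show "usc_reg f x \<le> f x"
    proof (rule dense_ge)
      fix a assume a: "f x < a"
      have "\<forall>\<^sub>F y in nhds x. y \<in> {y. f y < a}"
        using assms a by (intro eventually_nhds_in_open) (auto simp: usc_def)
      then show "usc_reg f x \<le> a"
        unfolding usc_reg_def by (intro Limsup_bounded) (auto elim: eventually_mono)
    qed
    show "f x \<le> usc_reg f x"
      unfolding usc_reg_def Limsup_def
      by (intro INF_greatest) (auto intro!: SUP_upper dest: eventually_nhds_x_imp_x)
  qed
qed

lemma exp_ereal_measurable [measurable]: "exp_ereal \<in> borel_measurable borel"
  unfolding exp_ereal_def[abs_def] by measurable

context polar_model
begin

lemma not_in_disk: "p \<notin> disk \<Longrightarrow> \<exists>z. p = Aff z \<and> cmod z < R"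
  by (cases p) (auto simp: disk_def image_iff not_le)

text \<open>On |w| = R the competitor is at most 0, so after adding the local potential it is at
  most \<kappa> + \<rho> ln R. The constant \<open>C\<close> only feeds the a priori bound, which
  \<open>domination\<close> discards.\<close>

lemma envelope_le_phi:
  assumes v: "v \<in> PSH_FS" and le: "\<And>y. v y \<le> min (phi y + ereal C) 0"
  shows "v y \<le> phi y"
proof (cases "y \<in> disk")
  case True
  then have "phi y = 0" by (simp add: phi_eq_0_iff)
  then show ?thesis using le[of y] by simp
next
  case False
  then obtain z where y: "y = Aff z" and z: "cmod z < R"
    using not_in_disk by blast
  define U where "U w = v (chart0 w) + ereal (fs_potential w)" for w
  have U: "subharmonic U"
    using v unfolding U_def[abs_def] by (auto simp: PSH_FS_def charts_def)
  have bd: "U w \<le> ereal (\<kappa> + \<rho> * ln R)" if "cmod w = R" for w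
  proof -
    have "U w \<le> 0 + ereal (fs_potential w)" unfolding U_def using le[of "chart0 w"] by (intro add_right_mono) simp
    then show ?thesis using that by (simp add: \<kappa>_def fs_potential_def)
  qed
  have sum: "phi (Aff w) + ereal (d + fs_potential w) = ereal (\<kappa> + \<rho> * ln T + d) - ereal \<rho> * enn2ereal (full T w)" if "cmod w < R" for w d
    unfolding phi_inside[OF that] using rho_bounds by (cases "full T w") (auto simp: enn2ereal_ennreal)
  have ub: "U w \<le> ereal (\<kappa> + \<rho> * ln T + C) - ereal \<rho> * enn2ereal (full T w)" if "cmod w < R" for w
  proof -
    have "U w \<le> (phi (Aff w) + ereal C) + ereal (fs_potential w)"
      unfolding U_def using le[of "chart0 w"] by (intro add_right_mono) (simp add: chart0_def)
    also have "\<dots> = phi (Aff w) + ereal (C + fs_potential w)" by (simp add: add.assoc)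
    finally show ?thesis unfolding sum[OF that] .
  qed
  have "U z \<le> ereal (\<kappa> + \<rho> * ln T) - ereal \<rho> * enn2ereal (full T z)"
    by (rule domination[OF U radius_less T_bounds(2) rho_bounds(1) bd ub z])
  also have "\<dots> = phi y + ereal (fs_potential z)" using sum[OF z, of 0] by (simp add: y)
  finally have "v y + ereal (fs_potential z) \<le> phi y + ereal (fs_potential z)"
    by (simp add: U_def y chart0_def)
  then show ?thesis by (cases "v y"; cases "phi y") auto
qed

text \<open>For nonnegative \<open>C\<close> the potential is itself a competitor. The envelopes
  therefore do not depend on \<open>C\<close>, and the limit defining the model envelope is
  eventually constant.\<close>

lemma P_env_phi:
  assumes "0 \<le> C"
  shows "P_env (\<lambda>y. min (phi y + ereal C) 0) = phi"
proof -
  have "phi y \<le> min (phi y + ereal C) 0" for y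
    using phi_le_0[of y] assms by (cases "phi y") auto
  then have "(SUP v\<in>{v \<in> PSH_FS. \<forall>y. v y \<le> min (phi y + ereal C) 0}. v x) = phi x" for x
    using phi_PSH envelope_le_phi[of _ C] by (intro antisym SUP_least SUP_upper2[of phi]) auto
  then show ?thesis by (simp add: P_env_def usc_reg_eq usc_phi)
qed

lemma P_model_phi: "P_model phi = phi"
proof -
  have "Lim at_top (\<lambda>C::real. P_env (\<lambda>y. min (phi y + ereal C) 0) x) = phi x" for x
  proof (rule tendsto_Lim)
    show "((\<lambda>C. P_env (\<lambda>y. min (phi y + ereal C) 0) x) \<longlongrightarrow> phi x) at_top"
      by (rule tendsto_eventually, rule eventually_mono[OF eventually_ge_at_top[of 0]]) (simp only: P_env_phi)
  qed simp
  then show ?thesis by (simp add: P_model_def usc_reg_eq usc_phi)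
qed

lemma model_phi: "model_potential phi"
  by (simp add: model_potential_def phi_PSH normalized_phi P_model_phi)

text \<open>In the coordinate at infinity the region |w| > s is a disc. It contains the disk and the
  annulus, where \<phi> is 0 or explicit, so \<phi> is bounded there.\<close>

lemma exp_phi_integrable_disk:
  assumes z: "cmod z < 1 / s" and a: "0 < a" and \<delta>: "0 < \<delta>"
  shows "\<exists>r. 0 < r \<and> r < \<delta> \<and> (\<integral>\<^sup>+y. exp_ereal (- (ereal a * phi y)) * indicator (chart1 ` ball z r) y \<partial>omega_FS) < \<infinity>"
proof -
  \<comment> \<open>On the annulus \<phi> is \<kappa> - \<open>fs_potential\<close> + \<rho> ln |w|,
    estimated with |w| \<le> R in the second term and |w| > s in the third; the absolute value
    covers the disk as well.\<close>
  define B where "B = \<bar>\<kappa> - ln (1 + R\<^sup>2) / 2 + \<rho> * ln s\<bar>"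
  define r where "r = min \<delta> (1 / s - cmod z) / 2"
  have r: "0 < r" "r < \<delta>" "cmod z + r < 1 / s" using z \<delta> by (auto simp: r_def min_def field_simps)
  have lower: "ereal (- B) \<le> phi (chart1 w)" if w: "cmod w < 1 / s" for w
  proof (cases "chart1 w \<in> disk")
    case True
    then show ?thesis by (simp add: phi_eq_0_iff[symmetric] B_def)
  next
    case False
    then obtain y where y: "chart1 w = Aff y" "cmod y < R"
      using not_in_disk by blast
    then have "w \<noteq> 0" "y = 1 / w" by (auto simp: chart1_def split: if_splits)
    then have sy: "s < cmod y" using w radius_pos by (simp add: norm_divide pos_less_divide_eq mult.commute)
    then have "(cmod y)\<^sup>2 \<le> R\<^sup>2" using y radius_pos by (intro power_mono) auto
    then have "ln (1 + (cmod y)\<^sup>2) \<le> ln (1 + R\<^sup>2)" by (intro ln_mono) (auto simp: add_pos_nonneg)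
    moreover have "\<rho> * ln s \<le> \<rho> * ln (cmod y)"
      using sy radius_pos rho_bounds by (intro mult_left_mono ln_mono) auto
    moreover have "ln (cmod y) \<le> ln T" using sy radius_pos y T_bounds R_pos by (intro ln_mono) auto
    ultimately show ?thesis using full_annulus[OF sy y(2)] unfolding y(1) phi_inside[OF y(2)]
      by (simp add: enn2ereal_ennreal B_def fs_potential_def right_diff_distrib)
  qed
  have "(\<integral>\<^sup>+y. exp_ereal (- (ereal a * phi y)) * indicator (chart1 ` ball z r) y \<partial>omega_FS) \<le> (\<integral>\<^sup>+y. ennreal (exp (a * B)) \<partial>omega_FS)"
  proof (rule nn_integral_mono)
    fix y
    show "exp_ereal (- (ereal a * phi y)) * indicator (chart1 ` ball z r) y \<le> ennreal (exp (a * B))"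
    proof (cases "y \<in> chart1 ` ball z r")
      case True
      then obtain w where w: "y = chart1 w" "w \<in> ball z r" by blast
      have "cmod w \<le> cmod z + cmod (z - w)" using norm_triangle_ineq4[of z "z - w"] by simp
      then have "ereal (- B) \<le> phi y" unfolding w(1) using w(2) r by (intro lower) (simp add: dist_norm)
      moreover have "phi y \<le> 0" by (rule phi_le_0)
      ultimately obtain t where t: "phi y = ereal t" "- B \<le> t" by (cases "phi y") auto
      have "- (a * t) \<le> a * B" using mult_left_mono[OF t(2), of a] a by simp
      then show ?thesis using t True by (simp add: exp_ereal_def ennreal_leI)
    qed simp
  qed
  also have "\<dots> = ennreal (exp (a * B)) * emeasure omega_FS (space omega_FS)" by simp
  also have "\<dots> < \<infinity>"
  proof -
    have "emeasure omega_FS (space omega_FS) = (\<integral>\<^sup>+w. ennreal (fs_density w) \<partial>lborel)"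
      using nn_integral_omega_FS[of "\<lambda>_. 1"] by simp
    also have "\<dots> = (\<integral>\<^sup>+w. ennreal (1 / pi) * (ennreal (1 / (1 + (cmod w)\<^sup>2)\<^sup>2) * indicator {w. 0 \<le> (cmod w)\<^sup>2} w) \<partial>lborel)"
      by (intro nn_integral_cong) (auto simp: fs_density_eq ennreal_mult'[symmetric])
    also have "\<dots> = ennreal (1 / pi) * ennreal (pi / (1 + 0))"
      by (subst nn_integral_cmult) (simp_all only: nn_integral_kernel_radial[OF order_refl], measurable)
    also have "\<dots> < \<infinity>" by (simp add: ennreal_mult_less_top)
    finally show ?thesis by (simp add: ennreal_mult_less_top)
  qed
  finally show ?thesis using r by blast
qed

lemma exp_phi_integrable_inside:
  assumes z: "cmod z < R" and a: "0 < a" and \<delta>: "0 < \<delta>"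
  shows "\<exists>r. 0 < r \<and> r < \<delta> \<and> (\<integral>\<^sup>+y. exp_ereal (- (ereal a * phi y)) * indicator (chart0 ` ball z r) y \<partial>omega_FS) < \<infinity>"
proof -
  obtain r where r: "0 < r" "r < min \<delta> (R - cmod z)" and fin: "(\<integral>\<^sup>+w. eexp (ennreal (a * \<rho>) * full T w) * indicator (ball z r) w \<partial>lborel) < \<infinity>"
    using eexp_full_locally_integrable[of "a * \<rho>" T "min \<delta> (R - cmod z)" z] T_bounds rho_bounds a z \<delta> by auto
  have [measurable]: "chart0 ` ball z r \<in> sets borel"
    by (rule chart_image_borel) (auto simp: charts_def)
  have "(\<integral>\<^sup>+y. exp_ereal (- (ereal a * phi y)) * indicator (chart0 ` ball z r) y \<partial>omega_FS) =
     (\<integral>\<^sup>+w. ennreal (fs_density w) * (exp_ereal (- (ereal a * phi (chart0 w))) * indicator (chart0 ` ball z r) (chart0 w)) \<partial>lborel)"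
    by (rule nn_integral_omega_FS) measurable
  also have "\<dots> \<le> (\<integral>\<^sup>+w. eexp (ennreal (a * \<rho>) * full T w) * indicator (ball z r) w \<partial>lborel)"
  proof (rule nn_integral_mono)
    fix w
    show "ennreal (fs_density w) * (exp_ereal (- (ereal a * phi (chart0 w))) * indicator (chart0 ` ball z r) (chart0 w)) \<le> eexp (ennreal (a * \<rho>) * full T w) * indicator (ball z r) w"
    proof (cases "w \<in> ball z r")
      case True
      have "cmod w \<le> cmod z + cmod (z - w)" using norm_triangle_ineq4[of z "z - w"] by simp
      then have w: "cmod w < R" using True r by (simp add: dist_norm)
      have "1 \<le> pi * (1 + (cmod w)\<^sup>2)\<^sup>2"
        using pi_ge_two mult_mono[of 1 pi 1 "(1 + (cmod w)\<^sup>2)\<^sup>2"] by simp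
      then have d: "ennreal (fs_density w) \<le> 1" by (simp add: fs_density_eq)
      have "exp_ereal (- (ereal a * phi (chart0 w))) \<le> eexp (ennreal (a * \<rho>) * full T w)"
      proof (cases "full T w")
        case top
        then show ?thesis using a rho_bounds by (simp add: ennreal_mult_top)
      next
        case (real F)
        have "(cmod w)\<^sup>2 \<le> R\<^sup>2" using w by (intro power_mono) auto
        then have "ln (1 + (cmod w)\<^sup>2) \<le> ln (1 + R\<^sup>2)" by (intro ln_mono) (auto simp: add_pos_nonneg)
        moreover have "\<rho> * ln R \<le> \<rho> * ln T" using R_pos T_bounds rho_bounds by (intro mult_left_mono ln_mono) auto
        \<comment> \<open>The summands of \<open>k\<close> other than - \<rho> F add up to something
          nonnegative, because |w| < R \<le> T. Hence exp(-a \<phi>) is at most the exponential of a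
          \<rho> \<open>full T\<close>.\<close>
        moreover define k where "k = \<kappa> - fs_potential w + \<rho> * ln T - \<rho> * F"
        ultimately have "- k \<le> \<rho> * F" by (simp add: \<kappa>_def fs_potential_def)
        from mult_left_mono[OF this, of a] have "- (a * k) \<le> a * (\<rho> * F)" using a by simp
        moreover have "phi (chart0 w) = ereal k"
          using real phi_inside[OF w] by (simp add: chart0_def enn2ereal_ennreal k_def)
        moreover have "ennreal (a * \<rho>) * full T w = ennreal (a * (\<rho> * F))"
          using real a rho_bounds by (simp add: ennreal_mult'[symmetric] mult.assoc)
        ultimately show ?thesis using real a rho_bounds
          by (simp add: exp_ereal_def eexp_ennreal ennreal_leI)
      qed
      then show ?thesis using True mult_mono[OF d] by (auto simp: indicator_def)
    next
      case False
      then have "chart0 w \<notin> chart0 ` ball z r" by (auto simp: chart0_def)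
      then show ?thesis by simp
    qed
  qed
  also have "\<dots> < \<infinity>" by (rule fin)
  finally show ?thesis using r by auto
qed

text \<open>Arbitrarily small radii are offered, so that the chart disc fits into a given open set
  and into a neighbourhood on which a given section is bounded.\<close>

lemma exp_phi_locally_integrable:
  assumes a: "0 < a"
  shows "\<exists>chart\<in>charts. \<exists>z. x = chart z \<and> (\<forall>\<delta>>0. \<exists>r. 0 < r \<and> r < \<delta> \<and>
    (\<integral>\<^sup>+y. exp_ereal (- (ereal a * phi y)) * indicator (chart ` ball z r) y \<partial>omega_FS) < \<infinity>)"
proof (cases "x \<in> disk")
  case True
  have "\<exists>z. x = chart1 z \<and> cmod z < 1 / s"
  proof (cases x)
    case (Aff y)
    then have "R \<le> cmod y" using True by (auto simp: disk_def)
    then have y: "s < cmod y" using radius_less by simp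
    then have "y \<noteq> 0" using radius_pos by auto
    then have "x = chart1 (1 / y)" using Aff by (simp add: chart1_def)
    moreover have "cmod (1 / y) < 1 / s" using y radius_pos by (simp add: norm_divide frac_less2)
    ultimately show ?thesis by blast
  next
    case Infty
    then have "x = chart1 0 \<and> cmod 0 < 1 / s" using radius_pos by (simp add: chart1_def)
    then show ?thesis by blast
  qed
  then show ?thesis
    using exp_phi_integrable_disk[OF _ a] by (auto simp: charts_def)
next
  case False
  then obtain z where "x = chart0 z" "cmod z < R" using not_in_disk unfolding chart0_def by blast
  then show ?thesis
    using exp_phi_integrable_inside[OF _ a] by (auto simp: charts_def)
qed

text \<open>A holomorphic section is locally bounded, so integrability of the weight alone puts it
  into the ideal.\<close>

lemma multiplier_phi:
  assumes a: "0 < a" and U: "open U"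
  shows "multiplier_ideal (\<lambda>x. ereal a * phi x) U = structure_sheaf U"
proof
  show "structure_sheaf U \<subseteq> multiplier_ideal (\<lambda>x. ereal a * phi x) U"
  proof
    fix f assume f: "f \<in> structure_sheaf U"
    have "\<exists>V. open V \<and> x \<in> V \<and> V \<subseteq> U \<and> (\<integral>\<^sup>+y\<in>V. ennreal ((cmod (f y))\<^sup>2) * exp_ereal (- (ereal a * phi y)) \<partial>omega_FS) < \<infinity>"
      if x: "x \<in> U" for x
    proof -
      obtain chart z where c: "chart \<in> charts" "x = chart z"
        and int: "\<forall>\<delta>>0. \<exists>r. 0 < r \<and> r < \<delta> \<and>
          (\<integral>\<^sup>+y. exp_ereal (- (ereal a * phi y)) * indicator (chart ` ball z r) y \<partial>omega_FS) < \<infinity>"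
        using exp_phi_locally_integrable[OF a, of x] by blast
      have o: "open (chart -` U)" using U c by (simp add: open_cp1_def)
      have "continuous_on (chart -` U) (f \<circ> chart)"
        by (rule holomorphic_on_imp_continuous_on) (use f c in \<open>auto simp: structure_sheaf_def\<close>)
      then have "isCont (f \<circ> chart) z"
        using o x c by (auto simp: continuous_on_eq_continuous_at o_def)
      then have "\<forall>\<^sub>F w in nhds z. dist ((f \<circ> chart) w) ((f \<circ> chart) z) < 1"
        by (intro tendstoD) (auto simp: isCont_def continuous_at tendsto_nhds_iff o_def)
      moreover have "\<forall>\<^sub>F w in nhds z. w \<in> chart -` U"
        using o x c by (intro eventually_nhds_in_open) auto
      ultimately have "\<forall>\<^sub>F w in nhds z. dist ((f \<circ> chart) w) ((f \<circ> chart) z) < 1 \<and> w \<in> chart -` U"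
        by (rule eventually_conj)
      then obtain \<delta> where \<delta>: "\<delta> > 0" "\<And>w. dist w z < \<delta> \<Longrightarrow> dist (f (chart w)) (f (chart z)) < 1 \<and> chart w \<in> U"
        unfolding eventually_nhds_metric by auto
      obtain r where r: "0 < r" "r < \<delta>"
        and fin: "(\<integral>\<^sup>+y. exp_ereal (- (ereal a * phi y)) * indicator (chart ` ball z r) y \<partial>omega_FS) < \<infinity>"
        using int \<delta>(1) by blast
      define V where "V = chart ` ball z r"
      define B where "B = cmod (f x) + 1"
      have V: "V \<subseteq> U" "\<And>y. y \<in> V \<Longrightarrow> cmod (f y) \<le> B"
      proof -
        have "cmod (f (chart w)) \<le> B \<and> chart w \<in> U" if "w \<in> ball z r" for w
          using \<delta>(2)[of w] that r c norm_triangle_sub[of "f (chart w)" "f x"]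
          by (auto simp: B_def dist_norm norm_minus_commute)
        then show "V \<subseteq> U" "\<And>y. y \<in> V \<Longrightarrow> cmod (f y) \<le> B" unfolding V_def by auto
      qed
      have [measurable]: "V \<in> sets borel" unfolding V_def using c by (intro chart_image_borel) auto
      have "(\<integral>\<^sup>+y\<in>V. ennreal ((cmod (f y))\<^sup>2) * exp_ereal (- (ereal a * phi y)) \<partial>omega_FS) \<le>
         (\<integral>\<^sup>+y. ennreal (B\<^sup>2) * (exp_ereal (- (ereal a * phi y)) * indicator V y) \<partial>omega_FS)"
      proof (rule nn_integral_mono)
        fix y
        show "ennreal ((cmod (f y))\<^sup>2) * exp_ereal (- (ereal a * phi y)) * indicator V y \<le> ennreal (B\<^sup>2) * (exp_ereal (- (ereal a * phi y)) * indicator V y)"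
        proof (cases "y \<in> V")
          case True
          then have "(cmod (f y))\<^sup>2 \<le> B\<^sup>2" using V(2) by (intro power_mono) auto
          then show ?thesis using True by (auto intro!: mult_right_mono ennreal_leI)
        qed simp
      qed
      also have "\<dots> = ennreal (B\<^sup>2) * (\<integral>\<^sup>+y. exp_ereal (- (ereal a * phi y)) * indicator V y \<partial>omega_FS)"
      proof (rule nn_integral_cmult)
        have "(\<lambda>y. exp_ereal (- (ereal a * phi y)) * indicator V y) \<in> borel_measurable borel" by measurable
        then show "(\<lambda>y. exp_ereal (- (ereal a * phi y)) * indicator V y) \<in> borel_measurable omega_FS"
          by (simp add: omega_FS_def)
      qed
      also have "\<dots> < \<infinity>" using fin by (simp add: V_def ennreal_mult_less_top)
      finally show ?thesis
        using V(1) r c by (intro exI[of _ V]) (auto simp: V_def intro!: open_chart_image)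
    qed
    then show "f \<in> multiplier_ideal (\<lambda>x. ereal a * phi x) U"
      using f by (simp add: multiplier_ideal_def)
  qed
qed (auto simp: multiplier_ideal_def)

end

text \<open>There is no atom at 0, so small discs around it have small mass. The radius found here
  becomes the size of a second carrier.\<close>

lemma (in polar_measure) small_ball:
  assumes "0 < s1"
  shows "\<exists>t. 0 < t \<and> t < s1 \<and> emeasure \<mu> (cball 0 t) < 1"
proof -
  have "(\<lambda>n. emeasure \<mu> (cball 0 (1 / real (Suc n)))) \<longlonglongrightarrow> emeasure \<mu> (\<Inter>n. cball 0 (1 / real (Suc n)))"
  proof (rule Lim_emeasure_decseq)
    show "decseq (\<lambda>n. cball (0::complex) (1 / real (Suc n)))"
      unfolding decseq_def by (intro allI impI subset_cball frac_le) auto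
  qed auto
  moreover have "(\<Inter>n. cball (0::complex) (1 / real (Suc n))) = {0}"
  proof safe
    fix x :: complex assume x: "x \<in> (\<Inter>n. cball 0 (1 / real (Suc n)))"
    have "(\<lambda>n. 1 / real (Suc n)) \<longlonglongrightarrow> 0" using LIMSEQ_inverse_real_of_nat by (simp add: inverse_eq_divide)
    then have "cmod x \<le> 0" using x by (intro LIMSEQ_le_const) auto
    then show "x = 0" by simp
  qed auto
  ultimately have "(\<lambda>n. emeasure \<mu> (cball 0 (1 / real (Suc n)))) \<longlonglongrightarrow> 0" by (simp add: atomless)
  then have "\<forall>\<^sub>F n in sequentially. emeasure \<mu> (cball 0 (1 / real (Suc n))) < 1"
    by (rule order_tendstoD(2)) simp
  moreover have "\<forall>\<^sub>F n in sequentially. 1 / real (Suc n) < s1"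
    using LIMSEQ_inverse_real_of_nat assms by (intro order_tendstoD(2)) (auto simp: inverse_eq_divide)
  ultimately have "\<forall>\<^sub>F n in sequentially. emeasure \<mu> (cball 0 (1 / real (Suc n))) < 1 \<and> 1 / real (Suc n) < s1"
    by (rule eventually_conj)
  then obtain n where "emeasure \<mu> (cball 0 (1 / real (Suc n))) < 1 \<and> 1 / real (Suc n) < s1"
    using eventually_happens by force
  then show ?thesis by (intro exI[of _ "1 / real (Suc n)"]) auto
qed

text \<open>Discs of radius below \<open>R\<close> miss the outer component, so the Monge--Ampere
  measure of the potential remembers \<mu> there.\<close>

lemma (in polar_model) emeasure_ma_ball:
  assumes "t < R"
  shows "emeasure (ma_measure phi) (chart0 ` cball 0 t) = ennreal \<rho> * emeasure \<mu> (cball 0 t)"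
proof -
  have s: "chart0 ` cball 0 t \<in> sets borel" by (rule chart_image_borel) (auto simp: charts_def)
  have "emeasure (ma_measure phi) (chart0 ` cball 0 t) = emeasure M (cball 0 t)"
    using s by (simp add: ma_phi emeasure_distr vimage_charts)
  also have "\<dots> = (\<integral>\<^sup>+x. indicator (cball 0 t) x \<partial>M)" by (rule nn_integral_indicator[symmetric]) simp
  also have "\<dots> = (\<integral>\<^sup>+w. ennreal (fs_density w) * indicator {w. R\<^sup>2 \<le> (cmod w)\<^sup>2} w * indicator (cball 0 t) w \<partial>lborel) + ennreal \<rho> * (\<integral>\<^sup>+x. indicator (cball 0 t) x \<partial>\<mu>)"
    by (rule nn_integral_M) simp
  also have "(\<integral>\<^sup>+w. ennreal (fs_density w) * indicator {w. R\<^sup>2 \<le> (cmod w)\<^sup>2} w * indicator (cball 0 t) w \<partial>lborel) = (\<integral>\<^sup>+w. 0 \<partial>(lborel :: complex measure))"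
    using assms R_pos by (intro nn_integral_cong) (auto simp: indicator_def)
  finally show ?thesis by simp
qed

lemma polar_model_exists:
  assumes R: "0 < R"
  shows "\<exists>s. 0 < s \<and> (\<forall>s'. 0 < s' \<and> s' \<le> s \<longrightarrow> (\<exists>\<mu> K. polar_model \<mu> K s' R))"
proof -
  define \<rho> where "\<rho> = R\<^sup>2 / (1 + R\<^sup>2)"
  have \<rho>: "0 < \<rho>" using R by (simp add: \<rho>_def add_pos_pos)
  define k where "k = ln (1 + R\<^sup>2) / 2 - \<rho> * ln R"
  \<comment> \<open>With 2 s' \<le> exp(-|k|/\<rho> - 1) one has k + \<rho> ln(2 s') \<le> k - |k| -
    \<rho> < 0. Both bounds persist for smaller radii, which leaves room for a second, smaller
    carrier.\<close>
  define s where "s = min (R / 2) (exp (- \<bar>k\<bar> / \<rho> - 1) / 2)"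
  have s: "0 < s" "s < R" using R by (auto simp: s_def min_def)
  have "\<exists>\<mu> K. polar_model \<mu> K s' R" if s': "0 < s'" "s' \<le> s" for s'
  proof -
    have "ln (2 * s') \<le> ln (exp (- \<bar>k\<bar> / \<rho> - 1))" using s' by (intro ln_mono) (auto simp: s_def)
    then have "\<rho> * ln (2 * s') \<le> \<rho> * (- \<bar>k\<bar> / \<rho> - 1)" using \<rho> by (intro mult_left_mono) auto
    also have "\<dots> = - \<bar>k\<bar> - \<rho>" using \<rho> by (simp add: right_diff_distrib)
    finally have "k + \<rho> * ln (2 * s') < 0" using \<rho> by linarith
    moreover obtain \<mu> K where "polar_measure \<mu> K s'" using polar_measure_ex[OF s'(1)] by blast
    ultimately have "polar_model \<mu> K s' R"
      using s s' by (intro polar_model.intro polar_model_axioms.intro) (auto simp: k_def \<rho>_def)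
    then show ?thesis by blast
  qed
  then show ?thesis using s by blast
qed

text \<open>The second carrier is scaled into a disc around 0 that does not have full mass for the
  first measure. Its own measure gives that disc mass 1, so the two measures differ while
  \<open>R\<close>, and with it the disk, is shared.\<close>

lemma polar_model_two:
  assumes R: "0 < R"
  shows "\<exists>\<mu>1 K1 s1 \<mu>2 K2 s2. polar_model \<mu>1 K1 s1 R \<and> polar_model \<mu>2 K2 s2 R \<and> s2 < R \<and>
    emeasure \<mu>1 (cball 0 s2) < 1 \<and> emeasure \<mu>2 (cball 0 s2) = 1"
proof -
  obtain s where s: "0 < s" and ex: "\<forall>s'. 0 < s' \<and> s' \<le> s \<longrightarrow> (\<exists>\<mu> K. polar_model \<mu> K s' R)"
    using polar_model_exists[OF R] by (elim exE conjE)
  have "\<exists>\<mu> K. polar_model \<mu> K s R" using ex s by simp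
  then obtain \<mu>1 K1 where 1: "polar_model \<mu>1 K1 s R" by (elim exE)
  interpret P1: polar_model \<mu>1 K1 s R by (rule 1)
  obtain s2 where s2: "0 < s2" "s2 < s" "emeasure \<mu>1 (cball 0 s2) < 1"
    using P1.small_ball[OF s] by (elim exE conjE)
  have "\<exists>\<mu> K. polar_model \<mu> K s2 R" using ex s2 by simp
  then obtain \<mu>2 K2 where 2: "polar_model \<mu>2 K2 s2 R" by (elim exE)
  interpret P2: polar_model \<mu>2 K2 s2 R by (rule 2)
  have "emeasure \<mu>2 (cball 0 s2) = 1"
    using P2.AE_supp by (intro P2.emeasure_eq_1_AE) auto
  moreover have "s2 < R" using s2 P1.radius_less by simp
  ultimately show ?thesis using 1 2 s2(3) by (intro exI conjI)
qed

theorem theoremA: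
  fixes \<rho> :: real
  assumes "0 < \<rho>" and "\<rho> < 1"
  shows "\<exists>(\<phi> :: cp1 \<Rightarrow> ereal) (\<psi> :: cp1 \<Rightarrow> ereal) (C :: cp1 set).
    \<phi> \<noteq> \<psi> \<and>
    model_potential \<phi> \<and> positive_mass \<phi> \<and>
    model_potential \<psi> \<and> positive_mass \<psi> \<and>
    closed_fs_disk C \<and>
    np_ma_measure \<phi> = density omega_FS (indicator C) \<and>
    np_ma_measure \<psi> = density omega_FS (indicator C) \<and>
    emeasure (density omega_FS (indicator C)) UNIV = ennreal (1 - \<rho>) \<and>
    (AE x in omega_FS. indicator {x. \<phi> x = 0} x = (indicator C x :: real)) \<and>
    (AE x in omega_FS. indicator {x. \<psi> x = 0} x = (indicator C x :: real)) \<and>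
    (\<forall>x. lelong \<phi> x = 0 \<and> lelong \<psi> x = 0) \<and>
    (\<forall>c::real. c > 0 \<longrightarrow> (\<forall>U. open U \<longrightarrow>
       multiplier_ideal (\<lambda>x. ereal c * \<phi> x) U = structure_sheaf U \<and>
       multiplier_ideal (\<lambda>x. ereal c * \<psi> x) U = structure_sheaf U))"
proof -
  \<comment> \<open>Then R^2/(1 + R^2) = \<rho>, so the disk |w| \<ge> R has mass 1 -
    \<rho>.\<close>
  define R where "R = sqrt (\<rho> / (1 - \<rho>))"
  have R: "0 < R" "R\<^sup>2 = \<rho> / (1 - \<rho>)" using assms by (auto simp: R_def)
  obtain \<mu>1 K1 s1 \<mu>2 K2 s2 where P: "polar_model \<mu>1 K1 s1 R" "polar_model \<mu>2 K2 s2 R" "s2 < R"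
    and d: "emeasure \<mu>1 (cball 0 s2) < 1" "emeasure \<mu>2 (cball 0 s2) = 1"
    using polar_model_two[OF R(1)] by (elim exE conjE)
  interpret P1: polar_model \<mu>1 K1 s1 R by (rule P(1))
  interpret P2: polar_model \<mu>2 K2 s2 R by (rule P(2))
  have "1 + R\<^sup>2 = 1 / (1 - \<rho>)" using assms R(2) by (simp add: field_simps)
  then have \<rho>: "P1.\<rho> = \<rho>" using assms by (simp add: P1.\<rho>_def R(2))
  have "P1.phi \<noteq> P2.phi"
  proof
    assume "P1.phi = P2.phi"
    \<comment> \<open>Equal potentials have the same Monge--Ampere measure, but the disc of radius
      \<open>s2\<close> tells the two measures apart.\<close>
    then have "ennreal \<rho> * emeasure \<mu>1 (cball 0 s2) = ennreal \<rho> * emeasure \<mu>2 (cball 0 s2)"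
      using P1.emeasure_ma_ball[OF P(3)] P2.emeasure_ma_ball[OF P(3)] \<rho> by simp
    then have "emeasure \<mu>1 (cball 0 s2) = emeasure \<mu>2 (cball 0 s2)"
      using assms by (subst (asm) ennreal_mult_cancel_left) auto
    then show False using d by simp
  qed
  moreover have "closed_fs_disk P1.disk"
    unfolding P1.disk_def by (rule closed_fs_disk_Infty[OF R(1)])
  ultimately show ?thesis
    using P1.model_phi P2.model_phi P1.positive_mass_phi P2.positive_mass_phi P1.np_ma_phi P2.np_ma_phi
      P1.mass_disk[unfolded \<rho>] P1.lelong_phi P2.lelong_phi P1.multiplier_phi P2.multiplier_phi
    by (intro exI[of _ P1.phi] exI[of _ P2.phi] exI[of _ P1.disk] conjI allI impI)
       (simp_all only: P1.disk_eq[symmetric] P2.disk_eq[symmetric] simp_thms eventually_True)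
qed

end
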